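(* Let $n\ge 2$ and let $\Sigma^n\subseteq\mathbb{R}^{n,1}$ be a smooth, compact, spacelike hypersurface (with boundary $\partial\Sigma$). Assume that $\Sigma$ is mean convex, and let $f$ be any smooth positive function on $\Sigma$. Then $$\int_\Sigma|\nabla f| + \int_{\partial\Sigma}f \;\geq\; C_{n,\tau}\left(\int_\Sigma f^{\frac{n}{n-1}}\right)^{\frac{n-1}{n}},$$ where $\tau=\tau(\Sigma)$ is the maximal slope of $\Sigma$ and $$C_{n,\tau} = n\,\omega_n^{\frac{1}{n}}(n+1)^{-\frac{1}{n}}\tau^{-\frac{1}{n}}\left(\tau+\sqrt{\tau^2-1}\right)^{-1}.$$
   Context: $\mathbb{R}^{n,1}$ is Minkowski space, i.e. $\mathbb{R}^{n+1}$ with coordinates $(x_0,\dots,x_n)$ and metric $\bar g=\langle\cdot,\cdot\rangle=-dx_0^2+dx_1^2+\cdots+dx_n^2$; write $|Y|^2=\langle Y,Y\rangle$. $\Sigma$ is spacelike if the induced metric $g$ is Riemannian; gradients, norms of tangent vectors, and integrals over $\Sigma$ and $\partial\Sigma$ are taken with respect to $g$ and the metric it induces on $\partial\Sigma$. $\bar\nabla$ and $\nabla$ are the Levi-Civita connections of $\bar g$ and $g$. The (normal-vector-valued) second fundamental form $h$ is defined by $\bar\nabla_Y Z=\nabla_Y Z-h(Y,Z)$ for tangent vector fields $Y,Z$, and the mean curvature vector is its trace $H=\operatorname{tr}_g h$. Since $\Sigma$ is a spacelike hypersurface, $H(x)$ is at each point either zero or timelike. $\Sigma$ is mean convex if $H$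 lies weakly on one side: either at every point $H$ is zero or timelike and past-pointing (negative $x_0$-component), or at every point $H$ is zero or timelike and future-pointing. The maximal slope is $\tau(\Sigma)=\sup\{|\nu_0(x)|: x\in\Sigma,\ \nu(x)\in T_x^\bot\Sigma,\ |\nu(x)|^2=-1\}$, where $\nu_0$ is the $x_0$-coordinate of $\nu$. $\omega_n$ is the volume of the unit ball in $\mathbb{R}^n$. *)

theory Defs
  imports "HOL-Analysis.Analysis"
begin

section \<open>Minkowski space\<close>

text \<open>
  Points of $\mathbb{R}^{n,1}$ are pairs $(x_0, (x_1,\dots,x_n))$, with $n$ the cardinality of
  the index type. The topology and differential calculus are the usual ones of
  $\mathbb{R}^{n+1}$.
\<close>

type_synonym 'n minkowski = "real \<times> (real ^ 'n)"

definition mink :: "'n::finite minkowski \<Rightarrow> 'n minkowski \<Rightarrow> real" where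
  "mink v w = snd v \<bullet> snd w - fst v * fst w"


section \<open>Smooth maps\<close>

primrec Ck_on :: "nat \<Rightarrow> 'a::euclidean_space set \<Rightarrow> ('a \<Rightarrow> 'b::euclidean_space) \<Rightarrow> bool" where
  "Ck_on 0 U f \<longleftrightarrow> continuous_on U f"
| "Ck_on (Suc k) U f \<longleftrightarrow>
     (\<forall>x\<in>U. f differentiable (at x)) \<and>
     (\<forall>v. Ck_on k U (\<lambda>x. frechet_derivative f (at x) v))"

definition smooth_on_open :: "'a::euclidean_space set \<Rightarrow> ('a \<Rightarrow> 'b::euclidean_space) \<Rightarrow> bool" where
  "smooth_on_open U f \<longleftrightarrow> open U \<and> (\<forall>k. Ck_on k U f)"

definition smooth_function_on :: "'a::euclidean_space set \<Rightarrow> ('a \<Rightarrow> 'b::euclidean_space) \<Rightarrow> bool" where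
  "smooth_function_on S f \<longleftrightarrow>
     (\<forall>p\<in>S. \<exists>U F. p \<in> U \<and> smooth_on_open U F \<and> (\<forall>q\<in>S \<inter> U. F q = f q))"

definition partial :: "'n::finite \<Rightarrow> (real ^ 'n \<Rightarrow> 'b::real_normed_vector) \<Rightarrow> real ^ 'n \<Rightarrow> 'b" where
  "partial j \<phi> y = frechet_derivative \<phi> (at y) (axis j 1)"


section \<open>Hypersurfaces with boundary\<close>

text \<open>
  A local parametrization of \<open>S\<close> is defined on a relatively open subset
  \<open>U \<inter> {y. 0 \<le> y $ i}\<close> of a closed coordinate half space, up to whose boundary it is smooth in
  the sense that it is the restriction of a smooth map on the open set \<open>U\<close>. Domains that do not
  meet the hyperplane \<open>{y. y $ i = 0}\<close> give the interior charts.
\<close>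

definition half_dom :: "'n::finite \<Rightarrow> (real ^ 'n) set \<Rightarrow> (real ^ 'n) set" where
  "half_dom i U = U \<inter> {y. 0 \<le> y $ i}"

definition bdry_dom :: "'n::finite \<Rightarrow> (real ^ 'n) set \<Rightarrow> (real ^ 'n) set" where
  "bdry_dom i U = U \<inter> {y. y $ i = 0}"

definition local_param ::
  "'n::finite minkowski set \<Rightarrow> 'n \<Rightarrow> (real ^ 'n) set \<Rightarrow> (real ^ 'n \<Rightarrow> 'n minkowski) \<Rightarrow> bool" where
  "local_param S i U \<phi> \<longleftrightarrow>
     smooth_on_open U \<phi> \<and>
     (\<forall>y\<in>half_dom i U. inj (frechet_derivative \<phi> (at y))) \<and>
     openin (top_of_set S) (\<phi> ` half_dom i U) \<and>
     (\<exists>\<psi>. homeomorphism (half_dom i U) (\<phi> ` half_dom i U) \<phi> \<psi>)"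

definition smooth_hypersurface :: "'n::finite minkowski set \<Rightarrow> bool" where
  "smooth_hypersurface S \<longleftrightarrow> (\<forall>p\<in>S. \<exists>i U \<phi>. local_param S i U \<phi> \<and> p \<in> \<phi> ` half_dom i U)"

definition hbdry :: "'n::finite minkowski set \<Rightarrow> 'n minkowski set" where
  "hbdry S = {p. \<exists>i U \<phi>. local_param S i U \<phi> \<and> p \<in> \<phi> ` bdry_dom i U}"

definition tangent_space :: "'n::finite minkowski set \<Rightarrow> 'n minkowski \<Rightarrow> 'n minkowski set" where
  "tangent_space S p =
     {v. \<exists>i U \<phi> y. local_param S i U \<phi> \<and> y \<in> half_dom i U \<and> \<phi> y = p \<and>
           v \<in> range (frechet_derivative \<phi> (at y))}"

definition normal_space :: "'n::finite minkowski set \<Rightarrow> 'n minkowski \<Rightarrow> 'n minkowski set" where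
  "normal_space S p = {v. \<forall>w\<in>tangent_space S p. mink v w = 0}"

definition spacelike :: "'n::finite minkowski set \<Rightarrow> bool" where
  "spacelike S \<longleftrightarrow> (\<forall>p\<in>S. \<forall>v\<in>tangent_space S p. v \<noteq> 0 \<longrightarrow> mink v v > 0)"

definition max_slope :: "'n::finite minkowski set \<Rightarrow> real" where
  "max_slope S = Sup {\<bar>fst \<nu>\<bar> | x \<nu>. x \<in> S \<and> \<nu> \<in> normal_space S x \<and> mink \<nu> \<nu> = -1}"


section \<open>Gradient\<close>

text \<open>
  The derivative \<open>f'\<close> of \<open>f\<close> at \<open>p\<close> within \<open>S\<close> is determined on the tangent space only, where it
  is the differential of \<open>f\<close>.
\<close>

definition gradient ::
  "'n::finite minkowski set \<Rightarrow> ('n minkowski \<Rightarrow> real) \<Rightarrow> 'n minkowski \<Rightarrow> 'n minkowski" where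
  "gradient S f p =
     (THE w. w \<in> tangent_space S p \<and>
        (\<exists>f'. (f has_derivative f') (at p within S) \<and>
              (\<forall>v\<in>tangent_space S p. mink w v = f' v)))"

definition tnorm :: "'n::finite minkowski \<Rightarrow> real" where
  "tnorm v = sqrt (mink v v)"


section \<open>Second fundamental form and mean curvature\<close>

definition metric_matrix :: "(real ^ 'n::finite \<Rightarrow> 'n minkowski) \<Rightarrow> real ^ 'n \<Rightarrow> real ^ 'n ^ 'n" where
  "metric_matrix \<phi> y = (\<chi> j k. mink (partial j \<phi> y) (partial k \<phi> y))"

definition christoffel ::
  "(real ^ 'n::finite \<Rightarrow> 'n minkowski) \<Rightarrow> real ^ 'n \<Rightarrow> 'n \<Rightarrow> 'n \<Rightarrow> 'n \<Rightarrow> real" where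
  "christoffel \<phi> y k i j =
     (\<Sum>l\<in>UNIV. matrix_inv (metric_matrix \<phi> y) $ k $ l *
        (partial i (\<lambda>z. metric_matrix \<phi> z $ j $ l) y +
         partial j (\<lambda>z. metric_matrix \<phi> z $ i $ l) y -
         partial l (\<lambda>z. metric_matrix \<phi> z $ i $ j) y)) / 2"

text \<open>
  Components of the second fundamental form in the coordinate frame $Y = \partial_i\varphi$,
  $Z = \partial_j\varphi$: the Levi-Civita connection of the induced metric gives
  $\nabla_Y Z = \sum_k \Gamma^k_{ij}\,\partial_k\varphi$, the flat ambient connection gives
  $\bar\nabla_Y Z = \partial_i\partial_j\varphi$, and the sign convention is
  $h(Y,Z) = \nabla_Y Z - \bar\nabla_Y Z$.
\<close>

definition second_ff ::
  "(real ^ 'n::finite \<Rightarrow> 'n minkowski) \<Rightarrow> real ^ 'n \<Rightarrow> 'n \<Rightarrow> 'n \<Rightarrow> 'n minkowski" where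
  "second_ff \<phi> y i j =
     (\<Sum>k\<in>UNIV. christoffel \<phi> y k i j *\<^sub>R partial k \<phi> y) - partial i (\<lambda>z. partial j \<phi> z) y"

definition mean_curvature_param ::
  "(real ^ 'n::finite \<Rightarrow> 'n minkowski) \<Rightarrow> real ^ 'n \<Rightarrow> 'n minkowski" where
  "mean_curvature_param \<phi> y =
     (\<Sum>i\<in>UNIV. \<Sum>j\<in>UNIV. matrix_inv (metric_matrix \<phi> y) $ i $ j *\<^sub>R second_ff \<phi> y i j)"

text \<open>The value does not depend on the parametrization.\<close>

definition mean_curvature :: "'n::finite minkowski set \<Rightarrow> 'n minkowski \<Rightarrow> 'n minkowski" where
  "mean_curvature S p =
     (SOME H. \<exists>i U \<phi> y. local_param S i U \<phi> \<and> y \<in> half_dom i U \<and> \<phi> y = p \<and>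
        H = mean_curvature_param \<phi> y)"

definition timelike :: "'n::finite minkowski \<Rightarrow> bool" where
  "timelike v \<longleftrightarrow> mink v v < 0"

definition mean_convex :: "'n::finite minkowski set \<Rightarrow> bool" where
  "mean_convex S \<longleftrightarrow>
     (\<forall>p\<in>S. mean_curvature S p = 0 \<or>
             timelike (mean_curvature S p) \<and> fst (mean_curvature S p) < 0) \<or>
     (\<forall>p\<in>S. mean_curvature S p = 0 \<or>
             timelike (mean_curvature S p) \<and> fst (mean_curvature S p) > 0)"


section \<open>Riemannian measures on the hypersurface and on its boundary\<close>

text \<open>
  \<open>coord_lebesgue J\<close> is Lebesgue measure of dimension \<open>card J\<close> on the coordinate subspace
  \<open>{y. \<forall>j. j \<notin> J \<longrightarrow> y $ j = 0}\<close>, regarded as a measure on the whole space.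
  \<open>volume_density J \<phi> y\<close> is the square root of the Gram determinant of the partial derivatives
  in the directions \<open>J\<close>; the determinant of this principal minor is computed by padding with the
  identity matrix.
\<close>

definition coord_lebesgue :: "'n::finite set \<Rightarrow> (real ^ 'n) measure" where
  "coord_lebesgue J =
     distr (\<Pi>\<^sub>M j\<in>J. lborel) borel (\<lambda>u. \<chi> j. if j \<in> J then u j else 0)"

definition volume_density ::
  "'n::finite set \<Rightarrow> (real ^ 'n \<Rightarrow> 'n minkowski) \<Rightarrow> real ^ 'n \<Rightarrow> real" where
  "volume_density J \<phi> y =
     sqrt (det (\<chi> j k. if j \<in> J \<and> k \<in> J then metric_matrix \<phi> y $ j $ k
                       else of_bool (j = k)))"

text \<open>
  Both measures are the unique Borel measures that in every parametrization are given by the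
  volume density of the induced metric. The boundary is parametrized by the restrictions of
  the parametrizations of \<open>S\<close> to the hyperplane \<open>{y. y $ i = 0}\<close>.
\<close>

definition is_hypersurface_measure :: "'n::finite minkowski set \<Rightarrow> 'n minkowski measure \<Rightarrow> bool" where
  "is_hypersurface_measure S M \<longleftrightarrow>
     space M = S \<and> sets M = sets (restrict_space borel S) \<and>
     (\<forall>i U \<phi>. local_param S i U \<phi> \<longrightarrow>
        (\<forall>B\<in>sets M. B \<subseteq> \<phi> ` half_dom i U \<longrightarrow>
           emeasure M B =
             (\<integral>\<^sup>+ y. ennreal (volume_density UNIV \<phi> y) * indicator (half_dom i U \<inter> \<phi> -` B) y
                \<partial>lborel)))"

definition is_boundary_measure :: "'n::finite minkowski set \<Rightarrow> 'n minkowski measure \<Rightarrow> bool" where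
  "is_boundary_measure S M \<longleftrightarrow>
     space M = hbdry S \<and> sets M = sets (restrict_space borel (hbdry S)) \<and>
     (\<forall>i U \<phi>. local_param S i U \<phi> \<longrightarrow>
        (\<forall>B\<in>sets M. B \<subseteq> \<phi> ` bdry_dom i U \<longrightarrow>
           emeasure M B =
             (\<integral>\<^sup>+ y. ennreal (volume_density (UNIV - {i}) \<phi> y) *
                     indicator (bdry_dom i U \<inter> \<phi> -` B) y
                \<partial>coord_lebesgue (UNIV - {i}))))"

definition hypersurface_measure :: "'n::finite minkowski set \<Rightarrow> 'n minkowski measure" where
  "hypersurface_measure S = (SOME M. is_hypersurface_measure S M)"

definition boundary_measure :: "'n::finite minkowski set \<Rightarrow> 'n minkowski measure" where
  "boundary_measure S = (SOME M. is_boundary_measure S M)"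


section \<open>The constant\<close>

definition isop_const :: "'n::finite itself \<Rightarrow> real \<Rightarrow> real" where
  "isop_const _ \<tau> =
     (let n = real CARD('n); \<omega> = measure lborel (ball (0 :: real ^ 'n) 1)
      in n * \<omega> powr (1 / n) * (n + 1) powr (- 1 / n) * \<tau> powr (- 1 / n) *
         inverse (\<tau> + sqrt (\<tau>\<^sup>2 - 1)))"

end

theory Submission
  imports Defs
begin

text \<open>
  The inequality follows from the sharp Sobolev inequality on $\mathbb{R}^n$ by orthogonal
  projection of the hypersurface $\Sigma$ to the horizontal hyperplane $x_0 = 0$. A tangent
  hyperplane of $\Sigma$ is spacelike, hence the graph of a linear functional of slope less than 1.
  So the projection is a local diffeomorphism, and its Jacobian with respect to the induced metric
  equals the height $|\nu_0|$ of the unit normal, which lies between 1 and $\tau$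
  (\<open>chart_densities\<close>).

  The projection need not be injective. The sum $F$ of $f$ over its fibres, that is
  \<open>push f\<close>, is a function of bounded variation on $\mathbb{R}^n$. Its distributional
  derivative consists of a part with a density, the fibre sum of the differential of $f$, and a part
  carried by the projection of $\partial\Sigma$. The first has total variation at most
  $\tau \int_\Sigma |\nabla f|$: the Jacobian is at most $\tau$, and the Euclidean length of the
  differential is at most $|\nabla f|$, because the induced metric is at most the Euclidean metric of
  the projection (\<open>norm_le_tnorm_gradient\<close>). The second has total variation at most
  $\tau \int_{\partial\Sigma} f$; this is the divergence theorem in the form of the inequality
  \<open>divergence\<close>, which rests on a comparison of Gram determinants (\<open>boundary_density\<close>). Thus
  \<open>BV_Sobolev\<close> gives
  $$n\,\omega_n^{1/n} \Bigl(\int_{\mathbb{R}^n} F^{\frac{n}{n-1}}\Bigr)^{\frac{n-1}{n}}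
    \le \tau \Bigl(\int_\Sigma |\nabla f| + \int_{\partial\Sigma} f\Bigr).$$
  The left hand side dominates the corresponding expression for $f$ on $\Sigma$, because the exponent
  is at least 1, so that the power of a sum of nonnegative numbers is at least the sum of their
  powers, and because the Jacobian is at least 1. This proves the inequality with the constant
  $n\,\omega_n^{1/n}/\tau$ (\<open>Sobolev_projection\<close>), which is at least $C_{n,\tau}$ since
  $\tau \ge 1$ (\<open>isop_const_le\<close>).

  The Sobolev inequality with its sharp constant comes from the Brunn-Minkowski inequality, applied
  to the level sets of a mollification of $F$ and to small balls (\<open>Sobolev_from_enlargement\<close>): the
  volume of thin enlargements of the level sets replaces their perimeter. The remaining part of the
  work concerns the measures on $\Sigma$ and $\partial\Sigma$: they are characterized by their
  values in charts, so their existence has to be shown by gluing the chart measures, which requires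
  the change of variables formula for transition maps and, for the boundary, a version of it on
  coordinate hyperplanes.
\<close>


section \<open>The Brunn-Minkowski inequality\<close>

definition msum :: "'a::real_normed_vector set \<Rightarrow> 'a set \<Rightarrow> 'a set" where
  "msum A B = (\<Union>x\<in>A. \<Union>y\<in>B. {x + y})"

lemma msum_iff: "z \<in> msum A B \<longleftrightarrow> (\<exists>x\<in>A. \<exists>y\<in>B. z = x + y)"
  by (auto simp: msum_def)

lemma msum_commute: "msum A B = msum B A"
  by (auto simp: msum_iff set_eq_iff) (metis add.commute)+

lemma msum_mono: "A \<subseteq> A' \<Longrightarrow> B \<subseteq> B' \<Longrightarrow> msum A B \<subseteq> msum A' B'"
  by (fastforce simp: msum_iff)

lemma open_msum: "open A \<Longrightarrow> open (msum A B)"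
  unfolding msum_def by (rule open_sums) simp

lemma bounded_msum: "bounded A \<Longrightarrow> bounded B \<Longrightarrow> bounded (msum A B)"
proof -
  have "msum A B = (\<lambda>(x,y). x + y) ` (A \<times> B)"
    by (auto simp: msum_def)
  then show "bounded A \<Longrightarrow> bounded B \<Longrightarrow> bounded (msum A B)"
    using bounded_plus[of A B] by (simp add: case_prod_unfold)
qed

lemma lmeasurable_msum:
  fixes A B :: "'a::euclidean_space set"
  shows "open A \<Longrightarrow> bounded A \<Longrightarrow> bounded B \<Longrightarrow> msum A B \<in> lmeasurable"
  by (intro lmeasurable_open open_msum bounded_msum)

lemma powr_inverse_power:
  fixes x :: real
  assumes "x \<ge> 0" "n > 0"
  shows "(x powr (1 / real n)) ^ n = x"
  using assms by (cases "x = 0") (auto simp: powr_powr simp flip: powr_realpow)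

definition nbox :: "'a::euclidean_space set \<Rightarrow> bool" where
  "nbox X \<longleftrightarrow> X \<noteq> {} \<and> (\<exists>l u. X = box l u)"

lemma nboxE:
  assumes "nbox X"
  obtains l u where "X = box l u" "\<And>b. b \<in> Basis \<Longrightarrow> l \<bullet> b < u \<bullet> b"
  using assms unfolding nbox_def by (metis box_ne_empty(2))

text \<open>
  For boxes with side lengths $a_b$ and $a'_b$ this is the inequality between the arithmetic and
  the geometric mean, applied to the ratios $a_b / (a_b + a'_b)$ and to their complements.
\<close>
lemma Brunn_Minkowski_box:
  fixes A B :: "'a::euclidean_space set"
  assumes "nbox A" "nbox B"
  shows "(measure lebesgue A powr (1/DIM('a)) + measure lebesgue B powr (1/DIM('a))) ^ DIM('a)
           \<le> measure lebesgue (msum A B)"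
proof -
  let ?n = "DIM('a)"
  obtain l u where A: "A = box l u" and lu: "\<And>b. b \<in> Basis \<Longrightarrow> l \<bullet> b < u \<bullet> b"
    using assms(1) by (auto elim: nboxE)
  obtain l' u' where B: "B = box l' u'" and lu': "\<And>b. b \<in> Basis \<Longrightarrow> l' \<bullet> b < u' \<bullet> b"
    using assms(2) by (auto elim: nboxE)
  have sub: "box (l + l') (u + u') \<subseteq> msum A B"
  proof
    fix x assume x: "x \<in> box (l + l') (u + u')"
    define t where "t = (\<lambda>b. ((x - l - l') \<bullet> b) / ((u + u' - l - l') \<bullet> b))"
    define y where "y = (\<Sum>b\<in>Basis. (l \<bullet> b + t b * ((u - l) \<bullet> b)) *\<^sub>R b)"
    have t: "0 < t b" "t b < 1" if "b \<in> Basis" for b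
      using x lu[OF that] lu'[OF that] that
      by (auto simp: t_def mem_box inner_diff_left inner_add_left field_simps)
    have yb: "y \<bullet> b = l \<bullet> b + t b * ((u - l) \<bullet> b)" if "b \<in> Basis" for b
      using that by (simp add: y_def)
    have "y \<in> A"
      unfolding A mem_box
    proof (intro ballI conjI)
      fix b :: 'a assume b: "b \<in> Basis"
      show "l \<bullet> b < y \<bullet> b"
        using yb[OF b] t[OF b] lu[OF b] by (simp add: inner_diff_left)
      have "t b * ((u - l) \<bullet> b) < 1 * ((u - l) \<bullet> b)"
        by (rule mult_strict_right_mono) (use t[OF b] lu[OF b] in \<open>auto simp: inner_diff_left\<close>)
      then show "y \<bullet> b < u \<bullet> b"
        using yb[OF b] by (simp add: inner_diff_left)
    qed
    moreover have "x - y \<in> B"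
      unfolding B mem_box
    proof (intro ballI conjI)
      fix b :: 'a assume b: "b \<in> Basis"
      have "t b * ((u + u' - l - l') \<bullet> b) = (x - l - l') \<bullet> b"
        using lu[OF b] lu'[OF b] by (simp add: t_def inner_diff_left inner_add_left)
      then have eq: "(x - y) \<bullet> b = l' \<bullet> b + t b * ((u' - l') \<bullet> b)"
        using yb[OF b] by (simp add: inner_diff_left inner_add_left algebra_simps)
      show "l' \<bullet> b < (x - y) \<bullet> b"
        using eq t[OF b] lu'[OF b] by (simp add: inner_diff_left)
      have "t b * ((u' - l') \<bullet> b) < 1 * ((u' - l') \<bullet> b)"
        by (rule mult_strict_right_mono) (use t[OF b] lu'[OF b] in \<open>auto simp: inner_diff_left\<close>)
      then show "(x - y) \<bullet> b < u' \<bullet> b"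
        using eq by (simp add: inner_diff_left)
    qed
    ultimately show "x \<in> msum A B"
      unfolding msum_iff by (metis add_diff_cancel_left' diff_add_cancel add.commute)
  qed
  define a where "a = (\<lambda>b. (u - l) \<bullet> b)"
  define a' where "a' = (\<lambda>b. (u' - l') \<bullet> b)"
  have pos: "0 < a b" "0 < a' b" if "b \<in> Basis" for b
    using lu[OF that] lu'[OF that] by (auto simp: a_def a'_def inner_diff_left)
  let ?pa = "\<Prod>b\<in>Basis. a b" and ?pb = "\<Prod>b\<in>Basis. a' b" and ?ps = "\<Prod>b\<in>Basis. a b + a' b"
  have mA: "measure lebesgue A = ?pa" "measure lebesgue B = ?pb"
    using lu lu' by (auto simp: A B a_def a'_def measure_completion measure_lborel_box_eq less_imp_le)
  have mS: "measure lebesgue (box (l + l') (u + u')) = ?ps"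
    using lu lu' by (auto simp: a_def a'_def measure_completion measure_lborel_box_eq less_imp_le
         inner_add_left inner_diff_left add_mono intro!: prod.cong)
  have ps: "0 < ?ps" "0 < ?pa" "0 < ?pb"
    by (auto intro!: prod_pos simp: pos add_pos_pos)
  have q: "(?pa / ?ps) powr (1/?n) + (?pb / ?ps) powr (1/?n) \<le> 1"
  proof -
    have "(?pa / ?ps) powr (1/?n) = (\<Prod>b\<in>Basis. a b / (a b + a' b)) powr (1/?n)"
      by (simp add: prod_dividef)
    also have "\<dots> \<le> (\<Sum>b\<in>Basis. a b / (a b + a' b)) / ?n"
      using arith_geom_mean[of "Basis::'a set" "\<lambda>b. a b / (a b + a' b)"] pos
      by (simp add: less_imp_le sum_divide_distrib)
    finally have 1: "(?pa / ?ps) powr (1/?n) \<le> (\<Sum>b\<in>Basis. a b / (a b + a' b)) / ?n" .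
    have "(?pb / ?ps) powr (1/?n) = (\<Prod>b\<in>Basis. a' b / (a b + a' b)) powr (1/?n)"
      by (simp add: prod_dividef)
    also have "\<dots> \<le> (\<Sum>b\<in>Basis. a' b / (a b + a' b)) / ?n"
      using arith_geom_mean[of "Basis::'a set" "\<lambda>b. a' b / (a b + a' b)"] pos
      by (simp add: less_imp_le sum_divide_distrib)
    finally have 2: "(?pb / ?ps) powr (1/?n) \<le> (\<Sum>b\<in>Basis. a' b / (a b + a' b)) / ?n" .
    have "(\<Sum>b\<in>Basis. a b / (a b + a' b)) + (\<Sum>b\<in>Basis. a' b / (a b + a' b))
        = (\<Sum>b\<in>(Basis::'a set). 1)"
      unfolding sum.distrib[symmetric]
      by (rule sum.cong) (use pos in \<open>auto simp: add_divide_distrib[symmetric] add_pos_pos less_imp_neq[THEN not_sym]\<close>)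
    then have "(\<Sum>b\<in>Basis. a b / (a b + a' b)) / ?n + (\<Sum>b\<in>Basis. a' b / (a b + a' b)) / ?n = 1"
      by (simp add: add_divide_distrib[symmetric])
    then show ?thesis using 1 2 by linarith
  qed
  have "?pa powr (1/?n) + ?pb powr (1/?n)
     = ?ps powr (1/?n) * ((?pa / ?ps) powr (1/?n) + (?pb / ?ps) powr (1/?n))"
    using ps(1) by (simp only: powr_divide distrib_left) (simp del: prod_zero_iff)
  also have "\<dots> \<le> ?ps powr (1/?n) * 1"
    using q by (intro mult_left_mono) auto
  finally have "(?pa powr (1/?n) + ?pb powr (1/?n)) ^ ?n \<le> (?ps powr (1/?n)) ^ ?n"
    by (intro power_mono) auto
  also have "\<dots> = ?ps"
    by (rule powr_inverse_power) (use ps(1) in \<open>auto simp del: prod_zero_iff intro: less_imp_le\<close>)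
  also have "\<dots> \<le> measure lebesgue (msum A B)"
    unfolding mS[symmetric]
    by (rule measure_mono_fmeasurable[OF sub])
       (auto intro!: lmeasurable_msum simp: A B bounded_box)
  finally show ?thesis
    by (simp add: mA)
qed

lemma box_halfspace:
  fixes l u :: "'a::euclidean_space"
  assumes k: "k \<in> Basis"
  shows "\<exists>l' u'. box l u \<inter> {x. x \<bullet> k < c} = box l' u'"
    and "\<exists>l' u'. box l u \<inter> {x. x \<bullet> k > c} = box l' u'"
proof -
  have "box l u \<inter> {x. x \<bullet> k < c} = box l (u + (min (u \<bullet> k) c - u \<bullet> k) *\<^sub>R k)"
    using k by (auto simp: mem_box inner_add_left inner_Basis if_distrib[of "(*) _"] cong: if_cong)
      (force split: if_splits)+
  then show "\<exists>l' u'. box l u \<inter> {x. x \<bullet> k < c} = box l' u'" by blast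
  have "box l u \<inter> {x. x \<bullet> k > c} = box (l + (max (l \<bullet> k) c - l \<bullet> k) *\<^sub>R k) u"
    using k by (auto simp: mem_box inner_add_left inner_Basis if_distrib[of "(*) _"] cong: if_cong)
      (force split: if_splits)+
  then show "\<exists>l' u'. box l u \<inter> {x. x \<bullet> k > c} = box l' u'" by blast
qed

text \<open>
  This estimate makes the volume that a moving coordinate hyperplane cuts off a Lipschitz
  function of the position of the hyperplane.
\<close>
lemma measure_slab_le:
  fixes B :: "'a::euclidean_space set"
  assumes k: "k \<in> Basis" and B: "B \<subseteq> cbox (-R *\<^sub>R One) (R *\<^sub>R One)" and R: "R > 0" and cd: "c \<le> d"
    and Bm: "B \<in> lmeasurable"
  shows "measure lebesgue (B \<inter> {x. c \<le> x \<bullet> k \<and> x \<bullet> k < d}) \<le> (2*R) ^ (DIM('a) - 1) * (d - c)"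
proof -
  define l0 u0 where lu0: "l0 = (-R) *\<^sub>R One + (c + R) *\<^sub>R k" "u0 = R *\<^sub>R One + (d - R) *\<^sub>R (k::'a)"
  let ?l = l0 and ?u = u0
  have bl: "?l \<bullet> b = (if b = k then c else -R)" "?u \<bullet> b = (if b = k then d else R)" if "b \<in> Basis" for b
    using k that by (auto simp: lu0 inner_add_left inner_diff_left inner_Basis)
  have "B \<inter> {x. c \<le> x \<bullet> k \<and> x \<bullet> k < d} \<subseteq> cbox ?l ?u"
  proof
    fix x assume "x \<in> B \<inter> {x. c \<le> x \<bullet> k \<and> x \<bullet> k < d}"
    then have "x \<in> cbox (-R *\<^sub>R One) (R *\<^sub>R One)" "c \<le> x \<bullet> k" "x \<bullet> k < d" using B by auto
    then show "x \<in> cbox ?l ?u"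
      unfolding mem_box by (auto simp: bl)
  qed
  moreover have "B \<inter> {x. c \<le> x \<bullet> k \<and> x \<bullet> k < d} \<in> lmeasurable"
  proof -
    have "{x. c \<le> x \<bullet> k \<and> x \<bullet> k < d} = {x. c \<le> x \<bullet> k} \<inter> {x. x \<bullet> k < d}" by auto
    moreover have "closed {x. c \<le> x \<bullet> k}" "open {x. x \<bullet> k < d}"
      by (auto intro!: closed_Collect_le open_Collect_less continuous_intros)
    ultimately have "{x. c \<le> x \<bullet> k \<and> x \<bullet> k < d} \<in> sets borel"
      by (simp add: borel_open borel_closed)
    then show ?thesis
      by (intro fmeasurable_Int_fmeasurable Bm) simp
  qed
  ultimately have "measure lebesgue (B \<inter> {x. c \<le> x \<bullet> k \<and> x \<bullet> k < d}) \<le> measure lebesgue (cbox ?l ?u)"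
    by (intro measure_mono_fmeasurable) auto
  also have "\<dots> = (\<Prod>b\<in>Basis. (?u - ?l) \<bullet> b)"
    using cd R by (subst measure_completion) (auto simp: measure_lborel_cbox_eq bl)
  also have "\<dots> = (\<Prod>b\<in>Basis. if b = k then d - c else 2 * R)"
    by (rule prod.cong) (simp_all add: inner_diff_left bl)
  also have "\<dots> = (d - c) * (\<Prod>b\<in>Basis - {k}. 2 * R)"
    using k by (simp add: prod.remove[of Basis k] if_distrib cong: if_cong)
  also have "\<dots> = (2*R) ^ (DIM('a) - 1) * (d - c)"
    using k by (simp add: card_Diff_singleton)
  finally show ?thesis .
qed

definition disjoint_boxes :: "'a::euclidean_space set set \<Rightarrow> bool" where
  "disjoint_boxes \<A> \<longleftrightarrow> finite \<A> \<and> \<A> \<noteq> {} \<and> (\<forall>X\<in>\<A>. nbox X) \<and> disjoint \<A>"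

lemma disjoint_boxes_open_bounded:
  assumes "disjoint_boxes \<A>"
  shows "open (\<Union>\<A>)" "bounded (\<Union>\<A>)" "\<Union>\<A> \<noteq> {}" "\<Union>\<A> \<in> lmeasurable" "0 < measure lebesgue (\<Union>\<A>)"
proof -
  have X: "open X" "bounded X" "X \<noteq> {}" if "X \<in> \<A>" for X
    using assms that by (auto simp: disjoint_boxes_def nbox_def)
  show 1: "open (\<Union>\<A>)" "bounded (\<Union>\<A>)" "\<Union>\<A> \<noteq> {}"
    using X assms by (auto simp: disjoint_boxes_def bounded_Union)
  then show 2: "\<Union>\<A> \<in> lmeasurable" by (intro lmeasurable_open)
  have "\<not> negligible (\<Union>\<A>)"
    using 1 open_not_negligible by blast
  then show "0 < measure lebesgue (\<Union>\<A>)"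
    using 2 negligible_iff_measure by (metis measure_nonneg order_le_less)
qed

text \<open>
  Empty pieces are dropped, so that cutting along a hyperplane that avoids one of the boxes lowers
  the number of boxes.
\<close>
definition cut :: "'a set \<Rightarrow> 'a set set \<Rightarrow> 'a set set" where
  "cut H \<A> = (\<lambda>X. X \<inter> H) ` \<A> - {{}}"

lemma Union_cut: "\<Union>(cut H \<A>) = \<Union>\<A> \<inter> H"
  by (auto simp: cut_def)

lemma card_cut_le: "finite \<A> \<Longrightarrow> card (cut H \<A>) \<le> card \<A>"
  unfolding cut_def by (meson card_Diff1_le card_image_le finite_imageI le_trans Diff_subset card_mono)

lemma card_cut_less:
  assumes "finite \<A>" "X \<in> \<A>" "X \<inter> H = {}"
  shows "card (cut H \<A>) < card \<A>"
proof -
  have "cut H \<A> \<subseteq> (\<lambda>X. X \<inter> H) ` (\<A> - {X})"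
    using assms(3) by (auto simp: cut_def)
  then have "card (cut H \<A>) \<le> card (\<A> - {X})"
    by (meson assms(1) card_image_le card_mono finite_Diff finite_imageI le_trans)
  also have "\<dots> < card \<A>"
    using assms by (meson card_Diff1_less)
  finally show ?thesis .
qed

lemma disjoint_boxes_cut:
  assumes "disjoint_boxes \<A>" "\<Union>\<A> \<inter> H \<noteq> {}" "k \<in> Basis" "H = {x. x \<bullet> k < c} \<or> H = {x. x \<bullet> k > c}"
  shows "disjoint_boxes (cut H \<A>)"
  unfolding disjoint_boxes_def
proof (intro conjI ballI)
  show "finite (cut H \<A>)" using assms by (auto simp: cut_def disjoint_boxes_def)
  show "cut H \<A> \<noteq> {}" using assms(2) by (metis Union_cut Union_empty)
  show "nbox X" if "X \<in> cut H \<A>" for X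
  proof -
    obtain Y where "Y \<in> \<A>" "X = Y \<inter> H" "X \<noteq> {}" using \<open>X \<in> cut H \<A>\<close> by (auto simp: cut_def)
    moreover obtain l u where "Y = box l u"
      using assms(1) \<open>Y \<in> \<A>\<close> unfolding disjoint_boxes_def nbox_def by blast
    ultimately show ?thesis
      using box_halfspace[OF assms(3)] assms(4) by (auto simp: nbox_def)
  qed
  show "disjoint (cut H \<A>)"
    using assms(1) unfolding disjoint_boxes_def cut_def disjoint_def by auto
qed

lemma separate_boxes:
  fixes X Y :: "'a::euclidean_space set"
  assumes "nbox X" "nbox Y" "X \<inter> Y = {}"
  obtains k c where "k \<in> Basis" "X \<subseteq> {x. x \<bullet> k < c} \<and> Y \<subseteq> {x. x \<bullet> k > c} \<or> Y \<subseteq> {x. x \<bullet> k < c} \<and> X \<subseteq> {x. x \<bullet> k > c}"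
proof -
  obtain l u where X: "X = box l u" and lu: "\<And>b. b \<in> Basis \<Longrightarrow> l \<bullet> b < u \<bullet> b"
    using assms(1) by (auto elim: nboxE)
  obtain l' u' where Y: "Y = box l' u'" and lu': "\<And>b. b \<in> Basis \<Longrightarrow> l' \<bullet> b < u' \<bullet> b"
    using assms(2) by (auto elim: nboxE)
  obtain k where k: "k \<in> Basis" and "u \<bullet> k \<le> l \<bullet> k \<or> u' \<bullet> k \<le> l' \<bullet> k \<or> u \<bullet> k \<le> l' \<bullet> k \<or> u' \<bullet> k \<le> l \<bullet> k"
    using assms(3) unfolding X Y disjoint_interval by blast
  then have "u \<bullet> k \<le> l' \<bullet> k \<or> u' \<bullet> k \<le> l \<bullet> k"
    using lu[OF k] lu'[OF k] by linarith
  then show ?thesis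
  proof
    assume "u \<bullet> k \<le> l' \<bullet> k"
    then have "X \<subseteq> {x. x \<bullet> k < u \<bullet> k} \<and> Y \<subseteq> {x. x \<bullet> k > u \<bullet> k}"
      using k by (force simp: X Y mem_box)
    then show ?thesis using k that by blast
  next
    assume "u' \<bullet> k \<le> l \<bullet> k"
    then have "Y \<subseteq> {x. x \<bullet> k < u' \<bullet> k} \<and> X \<subseteq> {x. x \<bullet> k > u' \<bullet> k}"
      using k by (force simp: X Y mem_box)
    then show ?thesis using k that by blast
  qed
qed

lemma lmeasurable_Int_halfspace:
  fixes S :: "'a::euclidean_space set"
  assumes "S \<in> lmeasurable"
  shows "S \<inter> {x. x \<bullet> k < c} \<in> lmeasurable" "S \<inter> {x. x \<bullet> k > c} \<in> lmeasurable"
proof -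
  have "open {x. x \<bullet> k < c}" "open {x. x \<bullet> k > c}"
    by (auto intro!: open_Collect_less continuous_intros)
  then show "S \<inter> {x. x \<bullet> k < c} \<in> lmeasurable" "S \<inter> {x. x \<bullet> k > c} \<in> lmeasurable"
    by (auto intro!: fmeasurable_Int_fmeasurable assms simp: borel_open)
qed

lemma measure_split_halfspace:
  fixes S :: "'a::euclidean_space set"
  assumes "S \<in> lmeasurable" "k \<in> Basis"
  shows "measure lebesgue (S \<inter> {x. x \<bullet> k < c}) + measure lebesgue (S \<inter> {x. x \<bullet> k > c}) = measure lebesgue S"
proof -
  let ?A = "S \<inter> {x. x \<bullet> k < c}" and ?B = "S \<inter> {x. x \<bullet> k > c}"
  have "measure lebesgue (?A \<union> ?B) = measure lebesgue ?A + measure lebesgue ?B"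
    by (rule measure_Un_AE) (use assms lmeasurable_Int_halfspace in auto)
  moreover have "measure lebesgue (?A \<union> ?B) = measure lebesgue S"
  proof (rule measure_negligible_symdiff[OF assms(1)])
    have "S - (?A \<union> ?B) \<union> (?A \<union> ?B - S) \<subseteq> {x. x \<bullet> k = c}" by auto
    then show "negligible (S - (?A \<union> ?B) \<union> (?A \<union> ?B - S))"
      using negligible_standard_hyperplane[OF assms(2)] negligible_subset by blast
  qed
  ultimately show ?thesis by simp
qed

text \<open>
  The volume cut off depends continuously on the hyperplane, so the intermediate value theorem
  applies.
\<close>
lemma halfspace_fraction:
  fixes B :: "'a::euclidean_space set"
  assumes k: "k \<in> Basis" and B: "B \<in> lmeasurable" "bounded B" and v: "0 \<le> v" "v \<le> measure lebesgue B"
  obtains d where "measure lebesgue (B \<inter> {x. x \<bullet> k < d}) = v"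
proof -
  define m where "m = (\<lambda>d. measure lebesgue (B \<inter> {x. x \<bullet> k < d}))"
  obtain R0 where "B \<subseteq> cbox (-R0) R0"
    using bounded_subset_cbox_symmetric[OF B(2)] by metis
  obtain R where R: "R > 0" and RB: "\<And>x. x \<in> B \<Longrightarrow> norm x \<le> R"
    using B(2) by (auto simp: bounded_pos)
  have RB': "\<bar>x \<bullet> b\<bar> \<le> R" if "x \<in> B" "b \<in> Basis" for x b
    using RB[OF that(1)] Basis_le_norm[OF that(2), of x] by linarith
  then have sub: "B \<subseteq> cbox (-R *\<^sub>R One) (R *\<^sub>R One)"
    by (auto simp: mem_box abs_le_iff) (smt (verit))+
  have lip: "m d - m c \<le> (2*R) ^ (DIM('a) - 1) * (d - c)" "m c \<le> m d" if "c \<le> d" for c d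
  proof -
    let ?s = "B \<inter> {x. c \<le> x \<bullet> k \<and> x \<bullet> k < d}"
    have eq: "B \<inter> {x. x \<bullet> k < d} = (B \<inter> {x. x \<bullet> k < c}) \<union> ?s"
      using that by auto
    have "?s = (B \<inter> {x. x \<bullet> k < d}) - (B \<inter> {x. x \<bullet> k < c})" by auto
    then have s: "?s \<in> lmeasurable"
      using lmeasurable_Int_halfspace[OF B(1)] by (simp add: fmeasurable_Diff fmeasurableD)
    have "m d = m c + measure lebesgue ?s"
      unfolding m_def eq by (rule measure_Un_AE) (use s lmeasurable_Int_halfspace[OF B(1)] in auto)
    then show "m d - m c \<le> (2*R) ^ (DIM('a) - 1) * (d - c)" "m c \<le> m d"
      using measure_slab_le[OF k sub R that B(1)] by auto
  qed
  have "continuous_on {-R - 1..R + 1} m"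
  proof (rule lipschitz_on_continuous_on[where L = "(2*R) ^ (DIM('a) - 1)"])
    show "((2*R) ^ (DIM('a) - 1))-lipschitz_on {-R - 1..R + 1} m"
    proof (rule lipschitz_onI)
      fix c d :: real
      show "dist (m c) (m d) \<le> (2*R) ^ (DIM('a) - 1) * dist c d"
        using lip[of c d] lip[of d c] by (cases "c \<le> d") (auto simp: dist_real_def)
    qed (use R in auto)
  qed
  moreover have "m (-R - 1) = 0"
  proof -
    have "B \<inter> {x. x \<bullet> k < -R - 1} = {}"
      using RB'[OF _ k] by fastforce
    then show ?thesis by (simp add: m_def)
  qed
  moreover have "m (R + 1) = measure lebesgue B"
  proof -
    have "B \<inter> {x. x \<bullet> k < R + 1} = B"
      using RB'[OF _ k] by fastforce
    then show ?thesis by (simp add: m_def)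
  qed
  ultimately obtain d where "m d = v"
    using IVT'[of m "-R - 1" v "R + 1"] v R by auto
  then show ?thesis using that by (simp add: m_def)
qed

text \<open>
  The argument of Hadwiger and Ohmann. A coordinate hyperplane that separates two boxes of the
  first family cuts it in some volume ratio $t : 1 - t$; a parallel hyperplane cuts the second
  family in the same ratio. Each half contains fewer boxes, the Minkowski sum of the lower halves
  is separated from that of the upper halves by the sum of the two hyperplanes, and by homogeneity
  the induction hypothesis bounds their volumes by $t$ and $1 - t$ times the desired quantity.
\<close>
lemma Brunn_Minkowski_step:
  fixes \<A> \<B> :: "'a::euclidean_space set set"
  assumes A: "disjoint_boxes \<A>" and B: "disjoint_boxes \<B>" and card: "card \<A> \<ge> 2"
    and IH: "\<And>\<A>' \<B>' :: 'a set set. disjoint_boxes \<A>' \<Longrightarrow> disjoint_boxes \<B>' \<Longrightarrow> card \<A>' + card \<B>' < card \<A> + card \<B> \<Longrightarrow>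
      (measure lebesgue (\<Union>\<A>') powr (1/DIM('a)) + measure lebesgue (\<Union>\<B>') powr (1/DIM('a))) ^ DIM('a)
           \<le> measure lebesgue (msum (\<Union>\<A>') (\<Union>\<B>'))"
  shows "(measure lebesgue (\<Union>\<A>) powr (1/DIM('a)) + measure lebesgue (\<Union>\<B>) powr (1/DIM('a))) ^ DIM('a)
           \<le> measure lebesgue (msum (\<Union>\<A>) (\<Union>\<B>))"
proof -
  let ?n = "DIM('a)" and ?A = "\<Union>\<A>" and ?B = "\<Union>\<B>"
  let ?m = "measure (lebesgue :: 'a measure)"
  have fin: "finite \<A>" "finite \<B>" using A B by (auto simp: disjoint_boxes_def)
  obtain X Y where "X \<in> \<A>" "Y \<in> \<A>" "X \<noteq> Y"
    using card card_le_Suc0_iff_eq[OF fin(1)] by force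
  then have "nbox X" "nbox Y" "X \<inter> Y = {}"
    using A by (auto simp: disjoint_boxes_def disjoint_def)
  then obtain k c X1 X2 where k: "k \<in> Basis" and X1: "X1 \<in> \<A>" "X1 \<subseteq> {x. x \<bullet> k < c}"
    and X2: "X2 \<in> \<A>" "X2 \<subseteq> {x. x \<bullet> k > c}"
    by (rule separate_boxes) (use \<open>X \<in> \<A>\<close> \<open>Y \<in> \<A>\<close> in blast)
  have ne: "X1 \<noteq> {}" "X2 \<noteq> {}" using A X1 X2 by (auto simp: disjoint_boxes_def nbox_def)
  let ?lo = "\<lambda>c. {x::'a. x \<bullet> k < c}" and ?hi = "\<lambda>c. {x::'a. x \<bullet> k > c}"
  have A1: "disjoint_boxes (cut (?lo c) \<A>)" and A2: "disjoint_boxes (cut (?hi c) \<A>)"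
    by (rule disjoint_boxes_cut[OF A _ k]; use X1 X2 ne in blast)+
  have cA1: "card (cut (?lo c) \<A>) < card \<A>" and cA2: "card (cut (?hi c) \<A>) < card \<A>"
    by (rule card_cut_less[OF fin(1) X2(1)], use X2 in force, rule card_cut_less[OF fin(1) X1(1)], use X1 in force)
  have mA: "?m ?A > 0" "?m (?A \<inter> ?lo c) > 0" "?m (?A \<inter> ?hi c) > 0"
    using disjoint_boxes_open_bounded(5)[OF A] disjoint_boxes_open_bounded(5)[OF A1]
      disjoint_boxes_open_bounded(5)[OF A2] by (auto simp: Union_cut)
  have mB: "?m ?B > 0" using disjoint_boxes_open_bounded(5)[OF B] .
  have splitA: "?m (?A \<inter> ?lo c) + ?m (?A \<inter> ?hi c) = ?m ?A"
    by (rule measure_split_halfspace[OF disjoint_boxes_open_bounded(4)[OF A] k])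
  define t where "t = ?m (?A \<inter> ?lo c) / ?m ?A"
  have t: "0 < t" "t < 1" using mA splitA by (auto simp: t_def)
  have At1: "?m (?A \<inter> ?lo c) = t * ?m ?A" using mA(1) by (simp add: t_def)
  have At: "?m (?A \<inter> ?lo c) = t * ?m ?A" "?m (?A \<inter> ?hi c) = (1 - t) * ?m ?A"
    using At1 splitA by (auto simp: left_diff_distrib)
  obtain d where d: "?m (?B \<inter> ?lo d) = t * ?m ?B"
    by (rule halfspace_fraction[OF k disjoint_boxes_open_bounded(4)[OF B] disjoint_boxes_open_bounded(2)[OF B], of "t * ?m ?B"])
       (use t mB in \<open>auto simp: mult_left_le_one_le\<close>)
  have d2: "?m (?B \<inter> ?hi d) = (1 - t) * ?m ?B"
    using measure_split_halfspace[OF disjoint_boxes_open_bounded(4)[OF B] k, of d] d by (simp add: algebra_simps)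
  have "?B \<inter> ?lo d \<noteq> {}" "?B \<inter> ?hi d \<noteq> {}"
    using d d2 t mB by (metis diff_gt_0_iff_gt less_irrefl measure_empty mult_pos_pos)+
  then have B1: "disjoint_boxes (cut (?lo d) \<B>)" and B2: "disjoint_boxes (cut (?hi d) \<B>)"
    by (auto intro!: disjoint_boxes_cut[OF B _ k])
  have powr_t: "((s * a) powr (1/?n) + (s * b) powr (1/?n)) ^ ?n = s * (a powr (1/?n) + b powr (1/?n)) ^ ?n"
    if "s > 0" "a > 0" "b > 0" for s a b :: real
  proof -
    have "(s * a) powr (1/?n) + (s * b) powr (1/?n) = s powr (1/?n) * (a powr (1/?n) + b powr (1/?n))"
      using that by (simp add: powr_mult distrib_left)
    moreover have "(s powr (1/?n)) ^ ?n = s"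
      by (rule powr_inverse_power) (use that in auto)
    ultimately show ?thesis by (simp add: power_mult_distrib)
  qed
  let ?r = "(?m ?A powr (1/?n) + ?m ?B powr (1/?n)) ^ ?n"
  have "t * ?r \<le> ?m (msum (?A \<inter> ?lo c) (?B \<inter> ?lo d))"
    using IH[OF A1 B1] cA1 card_cut_le[OF fin(2), of "?lo d"] powr_t[of t "?m ?A" "?m ?B"] t mA mB
    by (simp add: Union_cut At d)
  moreover have "(1 - t) * ?r \<le> ?m (msum (?A \<inter> ?hi c) (?B \<inter> ?hi d))"
    using IH[OF A2 B2] cA2 card_cut_le[OF fin(2), of "?hi d"] powr_t[of "1 - t" "?m ?A" "?m ?B"] t mA mB
    by (simp add: Union_cut At d2)
  moreover have "?m (msum (?A \<inter> ?lo c) (?B \<inter> ?lo d)) + ?m (msum (?A \<inter> ?hi c) (?B \<inter> ?hi d)) \<le> ?m (msum ?A ?B)"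
  proof -
    have meas: "msum (?A \<inter> ?lo c) (?B \<inter> ?lo d) \<in> lmeasurable" "msum (?A \<inter> ?hi c) (?B \<inter> ?hi d) \<in> lmeasurable" "msum ?A ?B \<in> lmeasurable"
      using disjoint_boxes_open_bounded[OF A1] disjoint_boxes_open_bounded[OF B1]
        disjoint_boxes_open_bounded[OF A2] disjoint_boxes_open_bounded[OF B2]
        disjoint_boxes_open_bounded[OF A] disjoint_boxes_open_bounded[OF B]
      unfolding Union_cut by (auto intro!: lmeasurable_msum)
    have "?m (msum (?A \<inter> ?lo c) (?B \<inter> ?lo d)) + ?m (msum (?A \<inter> ?hi c) (?B \<inter> ?hi d))
      = ?m (msum (?A \<inter> ?lo c) (?B \<inter> ?lo d) \<union> msum (?A \<inter> ?hi c) (?B \<inter> ?hi d))"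
    proof (rule measure_Un_AE[symmetric])
      show "AE x in lebesgue. x \<notin> msum (?A \<inter> ?lo c) (?B \<inter> ?lo d) \<or> x \<notin> msum (?A \<inter> ?hi c) (?B \<inter> ?hi d)"
      proof (rule AE_I2)
        fix x
        have "x \<bullet> k < c + d" if "x \<in> msum (?A \<inter> ?lo c) (?B \<inter> ?lo d)"
          using that by (auto simp: msum_iff inner_add_left)
        moreover have "x \<bullet> k > c + d" if "x \<in> msum (?A \<inter> ?hi c) (?B \<inter> ?hi d)"
          using that by (auto simp: msum_iff inner_add_left)
        ultimately show "x \<notin> msum (?A \<inter> ?lo c) (?B \<inter> ?lo d) \<or> x \<notin> msum (?A \<inter> ?hi c) (?B \<inter> ?hi d)"
          by fastforce
      qed
    qed (use meas in auto)
    also have "\<dots> \<le> ?m (msum ?A ?B)"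
      by (intro measure_mono_fmeasurable Un_least msum_mono sets.Un fmeasurableD meas) auto
    finally show ?thesis .
  qed
  ultimately show ?thesis by (simp add: algebra_simps)
qed

lemma Brunn_Minkowski_boxes:
  fixes \<A> \<B> :: "'a::euclidean_space set set"
  assumes "disjoint_boxes \<A>" "disjoint_boxes \<B>"
  shows "(measure lebesgue (\<Union>\<A>) powr (1/DIM('a)) + measure lebesgue (\<Union>\<B>) powr (1/DIM('a))) ^ DIM('a)
           \<le> measure lebesgue (msum (\<Union>\<A>) (\<Union>\<B>))"
  using assms
proof (induction "card \<A> + card \<B>" arbitrary: \<A> \<B> rule: less_induct)
  case less
  have "card \<A> \<noteq> 0" "card \<B> \<noteq> 0" using less.prems by (auto simp: disjoint_boxes_def)
  then consider "card \<A> \<ge> 2" | "card \<B> \<ge> 2" | "card \<A> = 1" "card \<B> = 1" by linarith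
  then show ?case
  proof cases
    case 1
    show ?thesis by (rule Brunn_Minkowski_step[OF less.prems 1]) (rule less.hyps)
  next
    case 2
    have "(measure lebesgue (\<Union>\<B>) powr (1/DIM('a)) + measure lebesgue (\<Union>\<A>) powr (1/DIM('a))) ^ DIM('a)
           \<le> measure lebesgue (msum (\<Union>\<B>) (\<Union>\<A>))"
    proof (rule Brunn_Minkowski_step[OF less.prems(2,1) 2])
      fix \<A>' \<B>' :: "'a set set"
      assume *: "disjoint_boxes \<A>'" "disjoint_boxes \<B>'" "card \<A>' + card \<B>' < card \<B> + card \<A>"
      show "(measure lebesgue (\<Union>\<A>') powr (1/DIM('a)) + measure lebesgue (\<Union>\<B>') powr (1/DIM('a))) ^ DIM('a)
           \<le> measure lebesgue (msum (\<Union>\<A>') (\<Union>\<B>'))"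
        using less.hyps[of \<A>' \<B>'] * by simp
    qed
    then show ?thesis by (simp add: msum_commute add.commute)
  next
    case 3
    then obtain X Y where "\<A> = {X}" "\<B> = {Y}" by (metis card_1_singletonE)
    then show ?thesis using Brunn_Minkowski_box[of X Y] less.prems by (simp add: disjoint_boxes_def)
  qed
qed

text \<open>
  An open set is a countable union of closed boxes; finitely many of them carry almost all of the
  volume, and a division of their union into boxes with disjoint interiors loses a null set only.
\<close>
lemma open_inner_boxes:
  fixes A :: "'a::euclidean_space set"
  assumes "open A" "bounded A" "A \<noteq> {}" "e > 0"
  obtains \<A> where "disjoint_boxes \<A>" "\<Union>\<A> \<subseteq> A" "measure lebesgue A - e < measure lebesgue (\<Union>\<A>)"
proof -
  have Am: "A \<in> lmeasurable" using assms by (simp add: lmeasurable_open)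
  have "\<not> negligible A" using assms open_not_negligible by blast
  then have mA: "0 < measure lebesgue A"
    using Am negligible_iff_measure by (metis measure_nonneg order_le_less)
  obtain \<D> where D: "countable \<D>" "\<D> \<subseteq> Pow A" "\<And>X. X \<in> \<D> \<Longrightarrow> \<exists>a b. X = cbox a b" "\<Union>\<D> = A"
    using open_countable_Union_open_cbox[OF assms(1)] by metis
  define e' where "e' = min e (measure lebesgue A)"
  have e': "e' > 0" "e' \<le> e" "e' \<le> measure lebesgue A" using mA assms by (auto simp: e'_def)
  obtain \<F> where F: "\<F> \<subseteq> \<D>" "finite \<F>" "measure lebesgue (\<Union>\<D>) - e' < measure lebesgue (\<Union>\<F>)"
  proof (rule measure_countable_Union_approachable[OF D(1) e'(1)])
    show "D \<in> lmeasurable" if "D \<in> \<D>" for D using D(3)[OF that] by auto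
    show "measure lebesgue (\<Union>D') \<le> measure lebesgue A" if "D' \<subseteq> \<D>" "finite D'" for D'
    proof (rule measure_mono_fmeasurable[OF _ _ Am])
      show "\<Union>D' \<subseteq> A" using that D by blast
      show "\<Union>D' \<in> sets lebesgue" using that D by (metis (no_types, lifting) borel_closed closed_Union closed_cbox sets_completionI_sets sets_lborel subsetD)
    qed
  qed auto
  have "\<And>s. s \<in> \<F> \<Longrightarrow> \<exists>a b. s = cbox a b" using F D by blast
  then obtain p where p: "p division_of (\<Union>\<F>)"
    using elementary_unions_intervals[OF F(2)] by metis
  define \<A> where "\<A> = interior ` p - {{}}"
  have p': "finite p" "\<Union>p = \<Union>\<F>" "\<And>K. K \<in> p \<Longrightarrow> \<exists>a b. K = cbox a b"
    "\<And>K L. K \<in> p \<Longrightarrow> L \<in> p \<Longrightarrow> K \<noteq> L \<Longrightarrow> interior K \<inter> interior L = {}"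
    using division_ofD[OF p] by auto
  have sub: "\<Union>\<A> \<subseteq> \<Union>\<F>" unfolding \<A>_def p'(2)[symmetric] using interior_subset by blast
  have neg: "negligible (\<Union>\<F> - \<Union>\<A>)"
  proof (rule negligible_subset)
    show "negligible (\<Union>K\<in>p. K - interior K)"
    proof (rule negligible_Union)
      fix T assume "T \<in> (\<lambda>K. K - interior K) ` p"
      then obtain K where "K \<in> p" and T: "T = K - interior K" by auto
      then obtain a b where "K = cbox a b" using p'(3) by blast
      then show "negligible T" using T negligible_frontier_interval[of a b] by (simp add: interior_cbox)
    qed (use p' in auto)
    show "\<Union>\<F> - \<Union>\<A> \<subseteq> (\<Union>K\<in>p. K - interior K)"
      unfolding \<A>_def p'(2)[symmetric] by blast
  qed
  have "\<Union>\<F> \<in> lmeasurable"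
    using F(2) D(3) F(1) by (intro fmeasurable.finite_Union) auto
  then have mF: "measure lebesgue (\<Union>\<A>) = measure lebesgue (\<Union>\<F>)"
    by (rule measure_negligible_symdiff) (use neg sub in \<open>simp add: Diff_eq_empty_iff[THEN iffD2]\<close>)
  have "0 < measure lebesgue (\<Union>\<A>)" using F(3) D(4) e' mF by simp
  then have "\<A> \<noteq> {}" by auto
  moreover have "nbox X" if XA: "X \<in> \<A>" for X
  proof -
    obtain K where "K \<in> p" "X = interior K" "X \<noteq> {}" using XA unfolding \<A>_def by blast
    then show ?thesis using p'(3)[of K] by (metis interior_cbox nbox_def)
  qed
  moreover have "disjoint \<A>"
    unfolding disjoint_def \<A>_def using p'(4) by (metis (no_types, lifting) DiffD1 imageE)
  ultimately have "disjoint_boxes \<A>"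
    using p'(1) by (auto simp: disjoint_boxes_def \<A>_def)
  moreover have "\<Union>\<A> \<subseteq> A" using sub F(1) D(2) by blast
  ultimately show ?thesis
    using that F(3) D(4) e' mF by force
qed

theorem Brunn_Minkowski_open:
  fixes A B :: "'a::euclidean_space set"
  assumes "open A" "bounded A" "A \<noteq> {}" "open B" "bounded B" "B \<noteq> {}"
  shows "(measure lebesgue A powr (1/DIM('a)) + measure lebesgue B powr (1/DIM('a))) ^ DIM('a)
           \<le> measure lebesgue (msum A B)"
proof -
  have Am: "A \<in> lmeasurable" "B \<in> lmeasurable" using assms by (auto simp: lmeasurable_open)
  have appr: "\<exists>a. (\<forall>i. disjoint_boxes (a i) \<and> \<Union>(a i) \<subseteq> S) \<and> (\<lambda>i. measure lebesgue (\<Union>(a i))) \<longlonglongrightarrow> measure lebesgue S"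
    if S: "open S" "bounded S" "S \<noteq> {}" for S :: "'a set"
  proof -
    have Sm: "S \<in> lmeasurable" using S by (simp add: lmeasurable_open)
    have "\<exists>\<A>. disjoint_boxes \<A> \<and> \<Union>\<A> \<subseteq> S \<and> measure lebesgue S - 1 / (real i + 1) < measure lebesgue (\<Union>\<A>)" for i :: nat
      by (rule open_inner_boxes[OF S, of "1 / (real i + 1)"]) auto
    then obtain a where a: "\<And>i. disjoint_boxes (a i) \<and> \<Union>(a i) \<subseteq> S \<and> measure lebesgue S - 1 / (real i + 1) < measure lebesgue (\<Union>(a i))"
      by metis
    have "(\<lambda>i. measure lebesgue (\<Union>(a i))) \<longlonglongrightarrow> measure lebesgue S"
    proof (rule tendsto_sandwich[of "\<lambda>i. measure lebesgue S - 1 / (real i + 1)" _ _ "\<lambda>i. measure lebesgue S"])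
      show "\<forall>\<^sub>F i in sequentially. measure lebesgue (\<Union>(a i)) \<le> measure lebesgue S"
        using a by (auto intro!: always_eventually measure_mono_fmeasurable[OF _ _ Sm] fmeasurableD disjoint_boxes_open_bounded(4))
      show "(\<lambda>i. measure lebesgue S - 1 / (real i + 1)) \<longlonglongrightarrow> measure lebesgue S"
        using tendsto_diff[OF tendsto_const LIMSEQ_inverse_real_of_nat, of "measure lebesgue S"]
        by (simp add: inverse_eq_divide add.commute)
    qed (use a in \<open>auto intro!: always_eventually less_imp_le\<close>)
    then show ?thesis using a by blast
  qed
  obtain a where a: "\<And>i. disjoint_boxes (a i)" "\<And>i. \<Union>(a i) \<subseteq> A" and la: "(\<lambda>i. measure lebesgue (\<Union>(a i))) \<longlonglongrightarrow> measure lebesgue A"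
    using appr[OF assms(1-3)] by blast
  obtain b where b: "\<And>i. disjoint_boxes (b i)" "\<And>i. \<Union>(b i) \<subseteq> B" and lb: "(\<lambda>i. measure lebesgue (\<Union>(b i))) \<longlonglongrightarrow> measure lebesgue B"
    using appr[OF assms(4-6)] by blast
  have "(measure lebesgue (\<Union>(a i)) powr (1/DIM('a)) + measure lebesgue (\<Union>(b i)) powr (1/DIM('a))) ^ DIM('a)
           \<le> measure lebesgue (msum A B)" for i
  proof -
    have "measure lebesgue (msum (\<Union>(a i)) (\<Union>(b i))) \<le> measure lebesgue (msum A B)"
      using a b assms
      by (intro measure_mono_fmeasurable msum_mono fmeasurableD lmeasurable_msum)
         (auto intro: disjoint_boxes_open_bounded)
    then show ?thesis
      using Brunn_Minkowski_boxes[OF a(1)[of i] b(1)[of i]] by linarith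
  qed
  moreover have "(\<lambda>i. (measure lebesgue (\<Union>(a i)) powr (1/DIM('a)) + measure lebesgue (\<Union>(b i)) powr (1/DIM('a))) ^ DIM('a))
      \<longlonglongrightarrow> (measure lebesgue A powr (1/DIM('a)) + measure lebesgue B powr (1/DIM('a))) ^ DIM('a)"
  proof -
    have "0 < measure lebesgue A" "0 < measure lebesgue B"
      using Am assms negligible_iff_measure open_not_negligible by (metis measure_nonneg order_le_less)+
    then show ?thesis by (intro tendsto_intros la lb) auto
  qed
  ultimately show ?thesis
    by (intro LIMSEQ_le_const2) auto
qed


section \<open>A Sobolev inequality from the enlargement of level sets\<close>

lemma emeasure_lborel_eq_measure:
  assumes "S \<in> lmeasurable" "S \<in> sets borel"
  shows "emeasure lborel S = ennreal (measure lebesgue S)"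
proof -
  have "emeasure lborel S = emeasure lebesgue S"
    using assms by simp
  then show ?thesis using assms(1) by (simp add: emeasure_eq_measure2)
qed

text \<open>
  Hoelder's inequality with an indicator function as one factor. Young's inequality is scaled
  so that its two terms integrate to quantities whose sum is the product on the right.
\<close>
lemma nn_integral_Holder_set:
  fixes g :: "'a \<Rightarrow> real" and n :: real
  assumes n: "n > 1" and g: "g \<in> borel_measurable M" "\<And>x. g x \<ge> 0" and A: "A \<in> sets M"
    and m: "emeasure M A = ennreal m" "m \<ge> 0" and i: "(\<integral>\<^sup>+x. ennreal (g x powr n) \<partial>M) = ennreal i" "i \<ge> 0"
  shows "(\<integral>\<^sup>+x. ennreal (g x) * indicator A x \<partial>M) \<le> ennreal (m powr ((n - 1) / n) * i powr (1 / n))"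
proof -
  consider "m = 0" | "i = 0" | "m > 0" "i > 0" using m i by linarith
  then show ?thesis
  proof cases
    case 1
    then have "(\<integral>\<^sup>+x. ennreal (g x) * indicator A x \<partial>M) = 0"
      using A m(1) by (intro nn_integral_null_set) (auto simp: null_sets_def)
    then show ?thesis by simp
  next
    case 2
    then have "(\<integral>\<^sup>+x. ennreal (g x powr n) \<partial>M) = 0" using i(1) by simp
    moreover have "(\<lambda>x. ennreal (g x powr n)) \<in> borel_measurable M" using g(1) by measurable
    ultimately have "AE x in M. ennreal (g x powr n) = 0"
      using nn_integral_0_iff_AE by blast
    then have "AE x in M. ennreal (g x) * indicator A x = 0"
    proof eventually_elim
      fix x assume "ennreal (g x powr n) = 0"
      then have "g x powr n = 0" by (simp add: ennreal_eq_0_iff order_antisym)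
      then show "ennreal (g x) * indicator A x = 0" by simp
    qed
    then have "(\<integral>\<^sup>+x. ennreal (g x) * indicator A x \<partial>M) = 0"
      by (subst nn_integral_cong_AE[where v = "\<lambda>_. 0"]) auto
    then show ?thesis by simp
  next
    case 3
    define q where "q = n / (n - 1)"
    define a where "a = i powr (1/n)"
    define b where "b = m powr ((n - 1) / n)"
    have q: "q > 1" "1/n + 1/q = 1" using n by (auto simp: q_def field_simps)
    have ab: "a > 0" "b > 0" using 3 by (auto simp: a_def b_def)
    have an: "a powr n = i" using 3 n by (simp add: a_def powr_powr)
    have bq: "b powr q = m" using 3 n by (simp add: b_def q_def powr_powr)
    have young: "g x \<le> a * b / (n * i) * g x powr n + a * b / (q * m)" for x
    proof -
      have "(g x / a) * (1 / b) \<le> (g x / a) powr n / n + (1 / b) powr q / q"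
        using Youngs_inequality[OF n q, of "g x / a" "1 / b"] ab g(2) by simp
      also have "\<dots> = g x powr n / (n * i) + 1 / (q * m)"
        using ab g(2)[of x] an bq by (simp add: powr_divide mult.commute)
      finally have "a * b * ((g x / a) * (1 / b)) \<le> a * b * (g x powr n / (n * i) + 1 / (q * m))"
        using ab by (intro mult_left_mono) auto
      then show ?thesis using ab by (simp add: field_simps)
    qed
    have "(\<integral>\<^sup>+x. ennreal (g x) * indicator A x \<partial>M)
       \<le> (\<integral>\<^sup>+x. ennreal (a * b / (n * i)) * ennreal (g x powr n) + ennreal (a * b / (q * m)) * indicator A x \<partial>M)"
    proof (rule nn_integral_mono)
      fix x
      have "ennreal (g x) \<le> ennreal (a * b / (n * i)) * ennreal (g x powr n) + ennreal (a * b / (q * m))"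
        using ab 3 n q young[of x]
        by (simp add: ennreal_mult[symmetric] ennreal_plus[symmetric] del: ennreal_plus)
      then show "ennreal (g x) * indicator A x \<le> ennreal (a * b / (n * i)) * ennreal (g x powr n) + ennreal (a * b / (q * m)) * indicator A x"
        by (auto simp: indicator_def)
    qed
    also have "\<dots> = ennreal (a * b / (n * i)) * ennreal i + ennreal (a * b / (q * m)) * ennreal m"
      using g A by (simp add: nn_integral_add nn_integral_cmult i m(1))
    also have "\<dots> = ennreal (a * b / n + a * b / q)"
      using ab 3 n q by (simp add: ennreal_mult[symmetric] ennreal_plus[symmetric] del: ennreal_plus)
    also have "a * b / n + a * b / q = a * b"
      using q(2) by (metis (no_types, opaque_lifting) distrib_left mult.right_neutral times_divide_eq_right)
    finally show ?thesis by (simp add: a_def b_def mult.commute)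
  qed
qed

lemma layer_cake:
  fixes F :: "'a \<Rightarrow> real" and g :: "'a \<Rightarrow> ennreal"
  assumes "sigma_finite_measure M" and F[measurable]: "F \<in> borel_measurable M" and g[measurable]: "g \<in> borel_measurable M"
  shows "(\<integral>\<^sup>+x. g x * ennreal (F x) \<partial>M) = (\<integral>\<^sup>+s. indicator {0<..} s * (\<integral>\<^sup>+x. g x * indicator {x. s < F x} x \<partial>M) \<partial>lborel)"
proof -
  interpret M: sigma_finite_measure M by fact
  interpret P: pair_sigma_finite M "lborel :: real measure"
    by (rule pair_sigma_finite.intro) (auto simp: assms lborel.sigma_finite_measure_axioms)
  have "(\<integral>\<^sup>+x. g x * ennreal (F x) \<partial>M) = (\<integral>\<^sup>+x. (\<integral>\<^sup>+s. g x * indicator {0<..<F x} s \<partial>lborel) \<partial>M)"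
  proof (rule nn_integral_cong)
    fix x
    have "emeasure lborel {0<..<F x} = ennreal (F x)"
      by (cases "0 \<le> F x") (auto simp: ennreal_neg)
    then show "g x * ennreal (F x) = (\<integral>\<^sup>+s. g x * indicator {0<..<F x} s \<partial>lborel)"
      by (simp add: nn_integral_cmult)
  qed
  also have "\<dots> = (\<integral>\<^sup>+x. (\<integral>\<^sup>+s. g x * (indicator {0<..} s * (if s < F x then 1 else 0)) \<partial>lborel) \<partial>M)"
    by (intro nn_integral_cong) (auto simp: indicator_def)
  also have "\<dots> = (\<integral>\<^sup>+s. (\<integral>\<^sup>+x. g x * (indicator {0<..} s * (if s < F x then 1 else 0)) \<partial>M) \<partial>lborel)"
    by (rule P.Fubini'[symmetric]) measurable
  also have "\<dots> = (\<integral>\<^sup>+s. indicator {0<..} s * (\<integral>\<^sup>+x. g x * indicator {x. s < F x} x \<partial>M) \<partial>lborel)"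
  proof (rule nn_integral_cong)
    fix s :: real
    show "(\<integral>\<^sup>+x. g x * (indicator {0<..} s * (if s < F x then 1 else 0)) \<partial>M) =
          indicator {0<..} s * (\<integral>\<^sup>+x. g x * indicator {x. s < F x} x \<partial>M)"
      by (cases "0 < s") (auto intro!: nn_integral_cong simp: indicator_def)
  qed
  finally show ?thesis .
qed

text \<open>
  The first two terms of the binomial expansion: the part of the Brunn-Minkowski inequality that
  survives when one of the two sets is a small ball.
\<close>
lemma power_add_ge:
  fixes x y :: real
  assumes "x \<ge> 0" "y \<ge> 0" "n \<ge> 1"
  shows "x ^ n + real n * x ^ (n - 1) * y \<le> (x + y) ^ n"
  using assms(3)
proof (induction n rule: dec_induct)
  case base
  then show ?case by simp
next
  case (step m)
  obtain k where m: "m = Suc k" using step.hyps by (cases m) auto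
  have "x ^ Suc m + real (Suc m) * x ^ m * y \<le> (x ^ m + real m * x ^ (m - 1) * y) * (x + y)"
    using assms by (simp add: m algebra_simps)
  also have "\<dots> \<le> (x + y) ^ m * (x + y)"
    by (rule mult_right_mono[OF step.IH]) (use assms in auto)
  finally show ?case by (simp add: mult.commute)
qed

text \<open>
  The function \<open>G\<close> plays the role of the length of the gradient of \<open>F\<close>, up to a quadratic error.
  If \<open>A\<close> is the level set \<open>{s < F}\<close>, then the enlargement of \<open>A\<close> by a ball of radius \<open>t\<close> lies in the
  level set of \<open>F + t * G + t\<^sup>2 * W\<close>, and the Brunn-Minkowski inequality bounds its volume below by
  $|A| + t\, N \omega^{1/N} |A|^{(N-1)/N}$. Integrating over the levels \<open>s\<close>, cancelling the integral
  of \<open>F\<close> and letting \<open>t\<close> tend to zero gives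
  $N \omega^{1/N} \int_0^\infty |\{s < F\}|^{(N-1)/N}\, ds \le J$. With $p = N/(N-1)$ the norm of
  \<open>F\<close> is recovered from
  $\int F^p = \int_0^\infty \int_{\{s < F\}} F^{p-1}\, ds$ by Hoelder's inequality on each level set.
\<close>
theorem Sobolev_from_enlargement:
  fixes F G W :: "'a::euclidean_space \<Rightarrow> real"
  assumes n: "DIM('a) \<ge> 2" and cF: "continuous_on UNIV F"
    and F0: "\<And>x. F x \<ge> 0" and FM: "\<And>x. F x \<le> M" and supp: "\<And>x. norm x > R \<Longrightarrow> F x = 0"
    and G[measurable]: "G \<in> borel_measurable borel" "\<And>x. G x \<ge> 0" and J: "(\<integral>\<^sup>+x. ennreal (G x) \<partial>lborel) = ennreal J" "J \<ge> 0"
    and W[measurable]: "W \<in> borel_measurable borel" "\<And>x. W x \<ge> 0" and K: "(\<integral>\<^sup>+x. ennreal (W x) \<partial>lborel) = ennreal K" "K \<ge> 0"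
    and est: "\<And>t x v. 0 < t \<Longrightarrow> t < 1 \<Longrightarrow> norm v < t \<Longrightarrow> F (x + v) \<le> F x + t * G x + t\<^sup>2 * W x"
  defines "N \<equiv> real DIM('a)"
  defines "\<omega> \<equiv> measure lebesgue (ball (0::'a) 1)"
  shows "(\<integral>\<^sup>+x. ennreal (F x powr (N / (N - 1))) \<partial>lborel) \<le> ennreal ((J / (N * \<omega> powr (1/N))) powr (N / (N - 1)))"
proof -
  let ?n = "DIM('a)"
  have N: "N \<ge> 2" using n by (simp add: N_def)
  have [measurable]: "F \<in> borel_measurable borel" using cF by (rule borel_measurable_continuous_onI)
  have \<omega>: "\<omega> > 0"
  proof -
    have "\<not> negligible (ball (0::'a) 1)" by (intro open_not_negligible) auto
    then show ?thesis unfolding \<omega>_def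
      by (metis lmeasurable_ball measure_nonneg negligible_iff_measure order_le_less)
  qed
  define A where "A = (\<lambda>s. {x. s < F x})"
  define m where "m = (\<lambda>s. measure lebesgue (A s))"
  have Aopen: "open (A s)" for s
    unfolding A_def by (intro open_Collect_less cF continuous_intros)
  have Ab: "A s \<subseteq> cball 0 R" if "s > 0" for s
  proof
    fix x assume "x \<in> A s"
    then have "F x \<noteq> 0" using that by (simp add: A_def)
    then show "x \<in> cball 0 R" using supp[of x] by (auto simp: not_le[symmetric])
  qed
  have Abdd: "bounded (A s)" if "s > 0" for s
    by (rule bounded_subset[OF bounded_cball Ab[OF that]])
  have Am: "A s \<in> lmeasurable" if "s > 0" for s
    using Aopen Abdd that by (intro lmeasurable_open)
  have em: "emeasure lborel (A s) = ennreal (m s)" if "s > 0" for s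
    unfolding m_def by (rule emeasure_lborel_eq_measure[OF Am[OF that] borel_open[OF Aopen]])
  \<comment> \<open>the Brunn-Minkowski inequality for a level set and a ball of radius t\<close>
  have key: "ennreal (m s) + ennreal (t * (N * \<omega> powr (1/N))) * ennreal (m s powr ((N - 1) / N))
       \<le> emeasure lborel {x. s < F x + t * G x + t\<^sup>2 * W x}"
    if s: "s > 0" and t: "0 < t" "t < 1" for s t
  proof (cases "A s = {}")
    case True
    then show ?thesis by (simp add: m_def)
  next
    case False
    let ?B = "ball (0::'a) t"
    have B: "measure lebesgue ?B = t ^ ?n * \<omega>"
      using content_ball_conv_unit_ball[of t "0::'a"] t by (simp add: \<omega>_def measure_completion)
    have ne: "?B \<noteq> {}" using t by simp
    have rtB: "measure lebesgue ?B powr (1/?n) = t * \<omega> powr (1/N)"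
    proof -
      have "(t ^ ?n) powr (1/N) = t"
        using t by (simp add: N_def powr_powr powr_realpow[symmetric])
      then show ?thesis using t \<omega> by (simp add: B N_def powr_mult)
    qed
    define r where "r = m s powr (1/?n)"
    have r: "r \<ge> 0" by (simp add: r_def)
    have m0: "m s \<ge> 0" by (simp add: m_def)
    have rn: "r ^ ?n = m s" using m0 by (simp add: r_def powr_inverse_power)
    have rn1: "r ^ (?n - 1) = m s powr ((N - 1) / N)"
      using m0 n by (cases "m s = 0") (auto simp: r_def powr_powr N_def of_nat_diff simp flip: powr_realpow)
    have "m s + t * (N * \<omega> powr (1/N)) * m s powr ((N - 1) / N) \<le> (r + t * \<omega> powr (1/N)) ^ ?n"
      using power_add_ge[of r "t * \<omega> powr (1/N)" ?n] r t n by (simp add: rn rn1[unfolded One_nat_def] N_def algebra_simps)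
    also have "\<dots> \<le> measure lebesgue (msum (A s) ?B)"
      using Brunn_Minkowski_open[OF Aopen Abdd[OF s] False open_ball bounded_ball ne] rtB
      by (simp add: r_def m_def)
    finally have le: "m s + t * (N * \<omega> powr (1/N)) * m s powr ((N - 1) / N) \<le> measure lebesgue (msum (A s) ?B)" .
    have ms: "msum (A s) ?B \<in> lmeasurable" by (intro lmeasurable_msum Aopen Abdd s bounded_ball)
    have "ennreal (m s + t * (N * \<omega> powr (1/N)) * m s powr ((N - 1) / N)) \<le> emeasure lborel (msum (A s) ?B)"
      using ennreal_leI[OF le] emeasure_lborel_eq_measure[OF ms borel_open[OF open_msum[OF Aopen]]] by simp
    also have "\<dots> \<le> emeasure lborel {x. s < F x + t * G x + t\<^sup>2 * W x}"
    proof (rule emeasure_mono)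
      show "msum (A s) ?B \<subseteq> {x. s < F x + t * G x + t\<^sup>2 * W x}"
      proof
        fix z assume "z \<in> msum (A s) ?B"
        then obtain x v where "s < F x" "norm v < t" "z = x + v" by (auto simp: msum_iff A_def)
        then show "z \<in> {x. s < F x + t * G x + t\<^sup>2 * W x}"
          using est[OF t, of "-v" z] by simp
      qed
    qed measurable
    finally show ?thesis
      using m0 t N \<omega> by (simp add: ennreal_mult ennreal_plus mult.assoc)
  qed
  define Q where "Q = (\<integral>\<^sup>+s. indicator {0<..} s * ennreal (m s powr ((N - 1) / N)) \<partial>lborel)"
  define I1 where "I1 = (\<integral>\<^sup>+x. ennreal (F x) \<partial>lborel)"
  have I1: "I1 < \<infinity>"
  proof -
    have "I1 \<le> (\<integral>\<^sup>+x. ennreal M * indicator (cball (0::'a) R) x \<partial>lborel)"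
      unfolding I1_def
    proof (rule nn_integral_mono)
      fix x show "ennreal (F x) \<le> ennreal M * indicator (cball (0::'a) R) x"
        using FM[of x] supp[of x] by (cases "norm x > R") (auto simp: ennreal_leI)
    qed
    also have "\<dots> < \<infinity>"
      using emeasure_bounded_finite[OF bounded_cball, of "0::'a" R]
      by (simp add: nn_integral_cmult_indicator ennreal_mult_eq_top_iff less_top[symmetric])
    finally show ?thesis .
  qed
  have I1_eq: "I1 = (\<integral>\<^sup>+s. indicator {0<..} s * ennreal (m s) \<partial>lborel)"
  proof -
    have "I1 = (\<integral>\<^sup>+x. 1 * ennreal (F x) \<partial>lborel)" by (simp add: I1_def)
    also have "\<dots> = (\<integral>\<^sup>+s. indicator {0<..} s * (\<integral>\<^sup>+x. 1 * indicator {x. s < F x} x \<partial>lborel) \<partial>lborel)"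
      by (rule layer_cake) (auto simp: lborel.sigma_finite_measure_axioms)
    also have "\<dots> = (\<integral>\<^sup>+s. indicator {0<..} s * ennreal (m s) \<partial>lborel)"
    proof (rule nn_integral_cong)
      fix s :: real
      have "(\<integral>\<^sup>+x. 1 * indicator {x. s < F x} x \<partial>lborel) = emeasure lborel (A s)"
        using borel_open[OF Aopen[of s]] by (simp add: A_def)
      then show "indicator {0<..} s * (\<integral>\<^sup>+x. 1 * indicator {x. s < F x} x \<partial>lborel) = indicator {0<..} s * ennreal (m s)"
        using em[of s] by (cases "s > 0") auto
    qed
    finally show ?thesis .
  qed
  have mm[measurable]: "m \<in> borel_measurable borel"
  proof -
    have "(\<lambda>s::real. \<integral>\<^sup>+x. indicator {x. s < F x} x \<partial>lborel) \<in> borel_measurable borel"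
      unfolding indicator_def by measurable
    moreover have "(\<integral>\<^sup>+x. indicator {x. s < F x} x \<partial>lborel) = emeasure lborel (A s)" for s
      using borel_open[OF Aopen[of s]] by (simp add: A_def)
    ultimately have "(\<lambda>s. emeasure lborel (A s)) \<in> borel_measurable borel" by simp
    then have "(\<lambda>s. enn2real (emeasure lborel (A s))) \<in> borel_measurable borel"
      by measurable
    moreover have "m = (\<lambda>s. enn2real (emeasure lborel (A s)))"
      by (auto simp: m_def measure_def[symmetric] measure_completion Aopen borel_open)
    ultimately show ?thesis by simp
  qed
  \<comment> \<open>both sides are integrated over the levels, divided by t, and t tends to zero\<close>
  have QJ: "ennreal (N * \<omega> powr (1/N)) * Q \<le> ennreal J"
  proof -
    have le: "ennreal (N * \<omega> powr (1/N)) * Q \<le> ennreal (J + t * K)" if t: "0 < t" "t < 1" for t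
    proof -
      have "I1 + ennreal t * (ennreal (N * \<omega> powr (1/N)) * Q)
          = (\<integral>\<^sup>+s. indicator {0<..} s * (ennreal (m s) + ennreal (t * (N * \<omega> powr (1/N))) * ennreal (m s powr ((N - 1) / N))) \<partial>lborel)"
        unfolding I1_eq Q_def using t N
        by (simp add: nn_integral_add[symmetric] nn_integral_cmult[symmetric] ennreal_mult distrib_left mult_ac)
      also have "\<dots> \<le> (\<integral>\<^sup>+s. indicator {0<..} s * (\<integral>\<^sup>+x. 1 * indicator {x. s < F x + t * G x + t\<^sup>2 * W x} x \<partial>lborel) \<partial>lborel)"
        using key[OF _ t] by (intro nn_integral_mono) (auto simp: indicator_def[of "{0<..}"])
      also have "\<dots> = (\<integral>\<^sup>+x. 1 * ennreal (F x + t * G x + t\<^sup>2 * W x) \<partial>lborel)"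
        by (rule layer_cake[symmetric]) (auto simp: lborel.sigma_finite_measure_axioms)
      also have "\<dots> = (\<integral>\<^sup>+x. ennreal (F x) + (ennreal t * ennreal (G x) + ennreal (t\<^sup>2) * ennreal (W x)) \<partial>lborel)"
        using t F0 G(2) W(2) by (intro nn_integral_cong) (simp add: ennreal_mult ennreal_plus add.assoc)
      also have "\<dots> = I1 + (ennreal t * ennreal J + ennreal (t\<^sup>2) * ennreal K)"
        by (simp add: nn_integral_add nn_integral_cmult I1_def J K)
      finally have "ennreal t * (ennreal (N * \<omega> powr (1/N)) * Q) \<le> ennreal t * ennreal J + ennreal (t\<^sup>2) * ennreal K"
        using I1 by (auto simp: ennreal_add_left_cancel_le)
      also have "\<dots> = ennreal t * ennreal (J + t * K)"
        using t J K by (simp add: ennreal_mult[symmetric] ennreal_plus[symmetric] power2_eq_square algebra_simps del: ennreal_plus)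
      finally show ?thesis
        using t by (simp add: ennreal_mult_le_mult_iff)
    qed
    show ?thesis
    proof (rule ennreal_le_epsilon)
      fix e :: real assume e: "e > 0"
      define t where "t = min (1/2) (e / (K + 1))"
      have t: "0 < t" "t < 1" using e K by (auto simp: t_def)
      have "t * K \<le> e / (K + 1) * K" using K by (intro mult_right_mono) (auto simp: t_def)
      also have "\<dots> \<le> e" using e K by (simp add: field_simps)
      finally have "ennreal (J + t * K) \<le> ennreal (J + e)" by (intro ennreal_leI) simp
      then show "ennreal (N * \<omega> powr (1/N)) * Q \<le> ennreal J + ennreal e"
        using le[OF t] J e by (simp add: ennreal_plus)
    qed
  qed
  define p where "p = N / (N - 1)"
  define I where "I = (\<integral>\<^sup>+x. ennreal (F x powr p) \<partial>lborel)"
  have p: "p > 1" "(p - 1) * N = p" using N by (auto simp: p_def field_simps)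
  have "I < \<infinity>"
  proof -
    have "I \<le> (\<integral>\<^sup>+x. ennreal (M powr p) * indicator (cball (0::'a) R) x \<partial>lborel)"
      unfolding I_def
    proof (rule nn_integral_mono)
      fix x show "ennreal (F x powr p) \<le> ennreal (M powr p) * indicator (cball (0::'a) R) x"
        using FM[of x] F0[of x] supp[of x] p by (cases "norm x > R") (auto intro!: ennreal_leI powr_mono2)
    qed
    also have "\<dots> < \<infinity>"
      using emeasure_bounded_finite[OF bounded_cball, of "0::'a" R]
      by (simp add: nn_integral_cmult_indicator ennreal_mult_eq_top_iff less_top[symmetric])
    finally show ?thesis .
  qed
  then obtain i where i: "I = ennreal i" "i \<ge> 0" by (cases I) auto
  have Qfin: "Q < \<infinity>"
  proof (rule ccontr)
    assume "\<not> Q < \<infinity>"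
    then have "Q = \<infinity>" using less_top[of Q] by simp
    then show False using QJ N \<omega> by (simp add: ennreal_mult_top top_unique)
  qed
  then obtain q where q: "Q = ennreal q" "q \<ge> 0" by (cases Q) auto
  have qJ: "q \<le> J / (N * \<omega> powr (1/N))"
    using QJ q N \<omega> J by (simp add: ennreal_mult[symmetric] field_simps)
  have "I = (\<integral>\<^sup>+x. ennreal (F x powr (p - 1)) * ennreal (F x) \<partial>lborel)"
    unfolding I_def
  proof (rule nn_integral_cong)
    fix x show "ennreal (F x powr p) = ennreal (F x powr (p - 1)) * ennreal (F x)"
      using F0[of x] p by (cases "F x = 0") (auto simp: ennreal_mult[symmetric] powr_diff)
  qed
  also have "\<dots> = (\<integral>\<^sup>+s. indicator {0<..} s * (\<integral>\<^sup>+x. ennreal (F x powr (p - 1)) * indicator {x. s < F x} x \<partial>lborel) \<partial>lborel)"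
    by (rule layer_cake) (auto simp: lborel.sigma_finite_measure_axioms)
  also have "\<dots> \<le> (\<integral>\<^sup>+s. ennreal (i powr (1/N)) * (indicator {0<..} s * ennreal (m s powr ((N - 1) / N))) \<partial>lborel)"
  proof (rule nn_integral_mono)
    fix s :: real
    show "indicator {0<..} s * (\<integral>\<^sup>+x. ennreal (F x powr (p - 1)) * indicator {x. s < F x} x \<partial>lborel)
        \<le> ennreal (i powr (1/N)) * (indicator {0<..} s * ennreal (m s powr ((N - 1) / N)))"
    proof (cases "s > 0")
      case True
      have "(\<integral>\<^sup>+x. ennreal (F x powr (p - 1)) * indicator (A s) x \<partial>lborel) \<le> ennreal (m s powr ((N - 1) / N) * i powr (1 / N))"
      proof (rule nn_integral_Holder_set)
        show "(\<integral>\<^sup>+x. ennreal ((F x powr (p - 1)) powr N) \<partial>lborel) = ennreal i"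
          unfolding powr_powr p(2) using i(1) by (simp add: I_def)
      qed (use True em[OF True] i N in \<open>auto simp: m_def Aopen borel_open\<close>)
      then show ?thesis using True by (simp add: A_def ennreal_mult mult.commute)
    qed auto
  qed
  also have "\<dots> = ennreal (i powr (1/N) * q)"
    using q by (simp add: nn_integral_cmult Q_def[symmetric] ennreal_mult)
  \<comment> \<open>the integral i of the power of F occurs on both sides, with exponent 1/N on the right\<close>
  finally have iq: "i \<le> i powr (1/N) * q" using i q by simp
  have "i \<le> q powr p"
  proof (cases "i = 0")
    case False
    then have i0: "i > 0" using i by simp
    have "i powr (1/N) * i powr (1 - 1/N) = i" using i0 by (simp flip: powr_add)
    then have "i powr (1/N) * i powr (1 - 1/N) \<le> i powr (1/N) * q" using iq by simp
    then have "i powr (1 - 1/N) \<le> q" using i0 by simp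
    then have "(i powr (1 - 1/N)) powr p \<le> q powr p" using p by (intro powr_mono2) auto
    moreover have "(1 - 1/N) * p = 1" using N by (simp add: p_def field_simps)
    ultimately show ?thesis using i0 by (simp add: powr_powr)
  qed auto
  also have "\<dots> \<le> (J / (N * \<omega> powr (1/N))) powr p"
    using p q qJ by (intro powr_mono2) auto
  finally show ?thesis using i(1) by (simp add: I_def p_def ennreal_leI)
qed


section \<open>The sharp Sobolev inequality for functions of bounded variation\<close>

lemma integrable_indicator_cball: "integrable lborel (indicator (cball a r) :: 'a::euclidean_space \<Rightarrow> real)"
  using emeasure_bounded_finite[OF bounded_cball, of a r] by (intro integrable_real_indicator) auto

lemma integrable_bounded_support:
  fixes f :: "'a::euclidean_space \<Rightarrow> real"
  assumes "f \<in> borel_measurable borel" "\<And>x. \<bar>f x\<bar> \<le> B" "\<And>x. x \<notin> cball a r \<Longrightarrow> f x = 0"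
  shows "integrable lborel f"
proof (rule Bochner_Integration.integrable_bound)
  show "integrable lborel (\<lambda>x. B * indicator (cball a r) x :: real)"
    by (intro integrable_mult_right integrable_indicator_cball)
  show "AE x in lborel. norm (f x) \<le> norm (B * indicator (cball a r) x :: real)"
  proof (rule AE_I2)
    fix x show "norm (f x) \<le> norm (B * indicator (cball a r) x :: real)"
      using assms(2)[of x] assms(3)[of x] by (cases "x \<in> cball a r") auto
  qed
qed (use assms(1) in simp)

text \<open>
  A mollifying kernel, not normalized. The square of the positive part of a polynomial is
  continuously differentiable, supported in the ball of radius \<open>\<epsilon>\<close>, and has an explicit quadratic
  Taylor bound.
\<close>
definition bump :: "real \<Rightarrow> 'a::euclidean_space \<Rightarrow> real" where
  "bump \<epsilon> z = (max 0 (\<epsilon>\<^sup>2 - z \<bullet> z))\<^sup>2"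

text \<open>
  The derivative of \<open>bump \<epsilon>\<close> at \<open>z\<close> in the direction \<open>v\<close>.
\<close>
definition dbump :: "real \<Rightarrow> 'a::euclidean_space \<Rightarrow> 'a \<Rightarrow> real" where
  "dbump \<epsilon> z v = - 4 * max 0 (\<epsilon>\<^sup>2 - z \<bullet> z) * (z \<bullet> v)"

lemma bump_nonneg: "bump \<epsilon> z \<ge> 0" by (simp add: bump_def)

lemma bump_outside:
  assumes "norm z \<ge> \<epsilon>" "\<epsilon> > 0" shows "bump \<epsilon> z = 0" "dbump \<epsilon> z v = 0"
proof -
  have "\<epsilon>\<^sup>2 \<le> z \<bullet> z"
    using assms by (simp add: power_mono flip: power2_norm_eq_inner)
  then show "bump \<epsilon> z = 0" "dbump \<epsilon> z v = 0" by (auto simp: bump_def dbump_def)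
qed

lemma bump_le: "bump \<epsilon> z \<le> (\<epsilon>\<^sup>2)\<^sup>2"
  unfolding bump_def by (rule power_mono) auto

lemma continuous_bump: "continuous_on UNIV (bump \<epsilon>)" "continuous_on UNIV (\<lambda>z. dbump \<epsilon> z v)"
  unfolding bump_def dbump_def by (intro continuous_intros)+

lemma borel_measurable_bump [measurable]:
  "bump \<epsilon> \<in> borel_measurable borel" "(\<lambda>z. dbump \<epsilon> z v) \<in> borel_measurable borel"
  by (intro borel_measurable_continuous_onI continuous_bump)+

text \<open>
  The remainder is the quadratic error term of \<open>Sobolev_from_enlargement\<close>; the radius 2 is chosen
  so that kernel and derivative vanish outside also after a translation by a vector of length at
  most 1.
\<close>
lemma bump_taylor:
  assumes e: "0 < \<epsilon>" "\<epsilon> \<le> 1" and v: "norm v \<le> 1"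
  shows "bump \<epsilon> (z + v) \<le> bump \<epsilon> z + dbump \<epsilon> z v + 25 * (norm v)\<^sup>2 * indicator (cball 0 2) z"
proof (cases "norm z \<le> 2")
  case False
  have "norm z \<le> norm (z + v) + norm v" by (metis add_diff_cancel norm_triangle_ineq4)
  then have "norm (z + v) \<ge> \<epsilon>" "norm z \<ge> \<epsilon>" using False e v by linarith+
  then have "bump \<epsilon> (z + v) = 0" "bump \<epsilon> z = 0" "dbump \<epsilon> z v = 0"
    by (auto intro: bump_outside[OF _ e(1)])
  then show ?thesis using False by simp
next
  case True
  define s where "s = \<epsilon>\<^sup>2 - z \<bullet> z"
  define h where "h = - 2 * (z \<bullet> v) - v \<bullet> v"
  have sh: "\<epsilon>\<^sup>2 - (z + v) \<bullet> (z + v) = s + h"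
    by (simp add: s_def h_def inner_add_left inner_add_right inner_commute)
  have gen: "(max 0 (s + h))\<^sup>2 \<le> (max 0 s)\<^sup>2 + 2 * max 0 s * h + h\<^sup>2"
  proof (cases "s \<ge> 0")
    case True
    have "(max 0 (s + h))\<^sup>2 \<le> (s + h)\<^sup>2" by (simp add: max_def)
    then show ?thesis using True by (simp add: power2_sum max_def)
  next
    case False
    have "(max 0 (s + h))\<^sup>2 \<le> h\<^sup>2"
      using False by (auto simp: max_def intro!: power_mono)
    then show ?thesis using False by (simp add: max_def)
  qed
  have "\<bar>h\<bar> \<le> 5 * norm v"
  proof -
    have "\<bar>h\<bar> \<le> 2 * \<bar>z \<bullet> v\<bar> + norm v * norm v" by (simp add: h_def power2_norm_eq_inner[symmetric] power2_eq_square abs_if)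
    also have "\<dots> \<le> 2 * (2 * norm v) + 1 * norm v"
    proof -
      have "\<bar>z \<bullet> v\<bar> \<le> norm z * norm v" by (rule Cauchy_Schwarz_ineq2)
      also have "\<dots> \<le> 2 * norm v" using True by (intro mult_right_mono) auto
      finally show ?thesis using mult_right_mono[OF v, of "norm v"] by auto
    qed
    finally show ?thesis by simp
  qed
  then have h2: "h\<^sup>2 \<le> (5 * norm v)\<^sup>2" by (metis abs_ge_zero power2_abs power_mono)
  have "2 * max 0 s * h \<le> dbump \<epsilon> z v"
    by (simp add: dbump_def s_def[symmetric] h_def right_diff_distrib algebra_simps)
  then show ?thesis
    using gen h2 True by (simp add: bump_def sh s_def[symmetric] power_mult_distrib)
qed

lemma integrable_bump:
  assumes "0 < \<epsilon>" shows "integrable lborel (bump \<epsilon> :: 'a::euclidean_space \<Rightarrow> real)"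
proof (rule integrable_bounded_support[of _ "(\<epsilon>\<^sup>2)\<^sup>2" 0 \<epsilon>])
  show "\<bar>bump \<epsilon> x\<bar> \<le> (\<epsilon>\<^sup>2)\<^sup>2" for x :: 'a
    using bump_le[of \<epsilon> x] bump_nonneg[of \<epsilon> x] by linarith
  show "bump \<epsilon> x = 0" if "x \<notin> cball 0 \<epsilon>" for x :: 'a
    by (rule bump_outside) (use that assms in auto)
qed simp

lemma bump_minus: "bump \<epsilon> (x - w) = bump \<epsilon> (w - x)"
  by (simp add: bump_def inner_diff_left inner_diff_right inner_commute)

lemma nn_integral_lborel_shift:
  fixes f :: "'a::euclidean_space \<Rightarrow> ennreal"
  assumes [measurable]: "f \<in> borel_measurable borel"
  shows "(\<integral>\<^sup>+x. f (x + c) \<partial>lborel) = (\<integral>\<^sup>+x. f x \<partial>lborel)"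
proof -
  have "(\<integral>\<^sup>+x. f x \<partial>lborel) = (\<integral>\<^sup>+x. f x \<partial>distr lborel borel ((+) c))"
    by (simp add: lborel_distr_plus)
  also have "\<dots> = (\<integral>\<^sup>+x. f (c + x) \<partial>lborel)"
    by (subst nn_integral_distr) auto
  finally show ?thesis by (simp add: add.commute)
qed

lemma integral_bump:
  fixes x :: "'a::euclidean_space"
  assumes "0 < \<epsilon>"
  shows "integral\<^sup>L lborel (bump \<epsilon> :: 'a \<Rightarrow> real) > 0"
    and "(\<integral>\<^sup>+w. ennreal (bump \<epsilon> (x - w)) \<partial>lborel) = ennreal (integral\<^sup>L lborel (bump \<epsilon> :: 'a \<Rightarrow> real))"
    and "(\<integral>\<^sup>+w. ennreal (bump \<epsilon> (w - x)) \<partial>lborel) = ennreal (integral\<^sup>L lborel (bump \<epsilon> :: 'a \<Rightarrow> real))"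
    and "integrable lborel (\<lambda>w. bump \<epsilon> (x - w))"
    and "(\<integral>w. bump \<epsilon> (x - w) \<partial>lborel) = integral\<^sup>L lborel (bump \<epsilon> :: 'a \<Rightarrow> real)"
proof -
  let ?k = "bump \<epsilon> :: 'a \<Rightarrow> real"
  have nn: "(\<integral>\<^sup>+w. ennreal (?k w) \<partial>lborel) = ennreal (integral\<^sup>L lborel ?k)"
    by (intro nn_integral_eq_integral integrable_bump assms) (simp add: bump_nonneg)
  have "(\<integral>\<^sup>+w. ennreal (?k (w + - x)) \<partial>lborel) = (\<integral>\<^sup>+w. ennreal (?k w) \<partial>lborel)"
    by (rule nn_integral_lborel_shift) simp
  then show 3: "(\<integral>\<^sup>+w. ennreal (?k (w - x)) \<partial>lborel) = ennreal (integral\<^sup>L lborel ?k)"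
    by (simp add: nn)
  then show 2: "(\<integral>\<^sup>+w. ennreal (?k (x - w)) \<partial>lborel) = ennreal (integral\<^sup>L lborel ?k)"
    by (subst bump_minus)
  show i: "integrable lborel (\<lambda>w. ?k (x - w))"
    by (rule integrableI_nonneg) (use 2 in \<open>auto simp: bump_nonneg\<close>)
  have "ennreal (\<integral>w. ?k (x - w) \<partial>lborel) = ennreal (integral\<^sup>L lborel ?k)"
    using nn_integral_eq_integral[OF i] 2 by (simp add: bump_nonneg)
  then show "(\<integral>w. ?k (x - w) \<partial>lborel) = integral\<^sup>L lborel ?k"
    by (simp add: bump_nonneg integral_nonneg_AE)
  have "integral\<^sup>L lborel ?k \<noteq> 0"
  proof
    assume "integral\<^sup>L lborel ?k = 0"
    then have "(\<integral>\<^sup>+w. ennreal (?k w) \<partial>lborel) = 0" using nn by simp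
    then have "AE w in lborel. ennreal (?k w) = 0" by (subst (asm) nn_integral_0_iff_AE) auto
    then have "AE w in lborel. w \<notin> ball (0::'a) \<epsilon>"
    proof eventually_elim
      fix w :: 'a assume "ennreal (bump \<epsilon> w) = 0"
      then have "bump \<epsilon> w = 0" using bump_nonneg[of \<epsilon> w] by (simp add: order_antisym_conv)
      then have "\<epsilon>\<^sup>2 \<le> w \<bullet> w" by (simp add: bump_def max_def split: if_splits)
      then have "\<epsilon> \<le> norm w" using assms by (simp add: norm_eq_sqrt_inner real_le_rsqrt)
      then show "w \<notin> ball 0 \<epsilon>" by simp
    qed
    then have "emeasure lborel (ball (0::'a) \<epsilon>) = 0"
      by (subst (asm) AE_iff_measurable[where N = "ball 0 \<epsilon>"]) auto
    then have "negligible (ball (0::'a) \<epsilon>)"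
      by (simp add: negligible_iff_emeasure0)
    then show False using assms open_not_negligible[of "ball (0::'a) \<epsilon>"] by simp
  qed
  moreover have "integral\<^sup>L lborel ?k \<ge> 0" by (simp add: bump_nonneg)
  ultimately show "integral\<^sup>L lborel ?k > 0" by linarith
qed

lemma nn_integral_mollified_measure:
  fixes M1 :: "'a::euclidean_space measure"
  assumes e: "\<epsilon> > 0" and M1: "finite_measure M1" "sets M1 = sets borel"
  shows "(\<integral>\<^sup>+x. (\<integral>\<^sup>+w. ennreal (bump \<epsilon> (x - w)) \<partial>M1) \<partial>lborel) = ennreal (integral\<^sup>L lborel (bump \<epsilon> :: 'a \<Rightarrow> real)) * emeasure M1 UNIV"
    and "(\<lambda>x. \<integral>\<^sup>+w. ennreal (bump \<epsilon> (x - w)) \<partial>M1) \<in> borel_measurable borel"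
    and "(\<integral>\<^sup>+w. ennreal (bump \<epsilon> (x - w)) \<partial>M1) < \<infinity>"
proof -
  interpret M1: finite_measure M1 by fact
  interpret P: pair_sigma_finite lborel M1
    by (rule pair_sigma_finite.intro) (auto simp: M1.sigma_finite_measure_axioms lborel.sigma_finite_measure_axioms)
  note [measurable_cong] = M1(2)
  have "(\<integral>\<^sup>+x. (\<integral>\<^sup>+w. ennreal (bump \<epsilon> (x - w)) \<partial>M1) \<partial>lborel) = (\<integral>\<^sup>+w. (\<integral>\<^sup>+x. ennreal (bump \<epsilon> (x - w)) \<partial>lborel) \<partial>M1)"
    by (rule P.Fubini'[symmetric]) measurable
  also have "\<dots> = (\<integral>\<^sup>+w. ennreal (integral\<^sup>L lborel (bump \<epsilon> :: 'a \<Rightarrow> real)) \<partial>M1)"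
    by (subst integral_bump(3)[OF e]) simp
  also have "\<dots> = ennreal (integral\<^sup>L lborel (bump \<epsilon> :: 'a \<Rightarrow> real)) * emeasure M1 UNIV"
    using sets_eq_imp_space_eq[OF M1(2)] by simp
  finally show "(\<integral>\<^sup>+x. (\<integral>\<^sup>+w. ennreal (bump \<epsilon> (x - w)) \<partial>M1) \<partial>lborel) = ennreal (integral\<^sup>L lborel (bump \<epsilon> :: 'a \<Rightarrow> real)) * emeasure M1 UNIV" .
  show "(\<lambda>x. \<integral>\<^sup>+w. ennreal (bump \<epsilon> (x - w)) \<partial>M1) \<in> borel_measurable borel" by measurable
  have "(\<integral>\<^sup>+w. ennreal (bump \<epsilon> (x - w)) \<partial>M1) \<le> (\<integral>\<^sup>+w. ennreal ((\<epsilon>\<^sup>2)\<^sup>2) \<partial>M1)"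
    by (intro nn_integral_mono ennreal_leI bump_le)
  also have "\<dots> < \<infinity>"
    by (simp add: ennreal_mult_eq_top_iff less_top[symmetric])
  finally show "(\<integral>\<^sup>+w. ennreal (bump \<epsilon> (x - w)) \<partial>M1) < \<infinity>" .
qed

text \<open>
  The sharp Sobolev inequality for functions of bounded variation. The hypothesis \<open>var\<close> says that
  the total variation of the distributional derivative of \<open>F\<close> is dominated by the measure
  \<open>M1 + M2\<close>, tested on the kernels \<open>bump\<close> only: the left hand side is the derivative in the
  direction \<open>v\<close> of the convolution of \<open>F\<close> with the kernel. Keeping two measures apart spares the
  formation of their sum; in the application one is absolutely continuous and the other is carried
  by a hypersurface. The convolutions satisfy \<open>Sobolev_from_enlargement\<close>, with \<open>G\<close> the mollified
  measure, and converge to \<open>F\<close> wherever \<open>F\<close> is continuous, so Fatou's lemma finishes the proof.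
\<close>
theorem BV_Sobolev:
  fixes F :: "'a::euclidean_space \<Rightarrow> real" and M1 M2 :: "'a measure"
  assumes n: "DIM('a) \<ge> 2" and F[measurable]: "F \<in> borel_measurable borel"
    and F0: "\<And>x. F x \<ge> 0" and FM: "\<And>x. F x \<le> M" and supp: "\<And>x. norm x > R \<Longrightarrow> F x = 0"
    and cont: "AE x in lborel. isCont F x"
    and M1: "finite_measure M1" "sets M1 = sets borel" and M2: "finite_measure M2" "sets M2 = sets borel"
    and J: "emeasure M1 UNIV + emeasure M2 UNIV = ennreal J" "J \<ge> 0"
    and var: "\<And>\<epsilon> x v. 0 < \<epsilon> \<Longrightarrow> \<epsilon> \<le> 1 \<Longrightarrow> ennreal (\<integral>w. F w * dbump \<epsilon> (x - w) v \<partial>lborel) \<le>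
        ennreal (norm v) * ((\<integral>\<^sup>+w. ennreal (bump \<epsilon> (x - w)) \<partial>M1) + (\<integral>\<^sup>+w. ennreal (bump \<epsilon> (x - w)) \<partial>M2))"
  defines "N \<equiv> real DIM('a)"
  defines "\<omega> \<equiv> measure lebesgue (ball (0::'a) 1)"
  shows "(\<integral>\<^sup>+x. ennreal (F x powr (N / (N - 1))) \<partial>lborel) \<le> ennreal ((J / (N * \<omega> powr (1/N))) powr (N / (N - 1)))"
proof -
  define k where "k = (\<lambda>\<epsilon>. integral\<^sup>L lborel (bump \<epsilon> :: 'a \<Rightarrow> real))"
  define Fe where "Fe = (\<lambda>\<epsilon> x. (\<integral>w. F w * bump \<epsilon> (x - w) \<partial>lborel) / k \<epsilon>)"
  have k: "k \<epsilon> > 0" if "\<epsilon> > 0" for \<epsilon> using integral_bump(1)[OF that] by (simp add: k_def)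
  have M0: "M \<ge> 0" using F0 FM order_trans by blast
  have Fout: "F w = 0" if "w \<notin> cball 0 R" for w using supp[of w] that by simp
  have bump_bdd: "\<bar>bump \<epsilon> z\<bar> \<le> (\<epsilon>\<^sup>2)\<^sup>2" for \<epsilon> and z :: 'a using bump_le[of \<epsilon> z] bump_nonneg[of \<epsilon> z] by simp
  have int1: "integrable lborel (\<lambda>w. F w * bump \<epsilon> (x - w))" for \<epsilon> x
    by (rule integrable_bounded_support[of _ "M * (\<epsilon>\<^sup>2)\<^sup>2" 0 R])
       (use F0 FM M0 bump_bdd Fout in \<open>auto simp: abs_mult abs_of_nonneg intro!: mult_mono\<close>)
  have dk_bdd: "\<bar>dbump \<epsilon> z v\<bar> \<le> 4 * \<epsilon>\<^sup>2 * (\<epsilon> * norm v)" if "\<epsilon> > 0" for \<epsilon> v and z :: 'a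
  proof (cases "norm z \<ge> \<epsilon>")
    case True then show ?thesis using that bump_outside(2)[OF True that] by simp
  next
    case False
    have "\<bar>z \<bullet> v\<bar> \<le> norm z * norm v" by (rule Cauchy_Schwarz_ineq2)
    also have "\<dots> \<le> \<epsilon> * norm v" using False by (intro mult_right_mono) auto
    finally have "4 * max 0 (\<epsilon>\<^sup>2 - z \<bullet> z) * \<bar>z \<bullet> v\<bar> \<le> 4 * \<epsilon>\<^sup>2 * (\<epsilon> * norm v)"
      by (intro mult_mono) auto
    then show ?thesis by (simp add: dbump_def abs_mult)
  qed
  have int2: "integrable lborel (\<lambda>w. F w * dbump \<epsilon> (x - w) v)" if "\<epsilon> > 0" for \<epsilon> x v
    by (rule integrable_bounded_support[of _ "M * (4 * \<epsilon>\<^sup>2 * (\<epsilon> * norm v))" 0 R])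
       (use F0 FM M0 dk_bdd[OF that] Fout in \<open>auto simp: abs_mult abs_of_nonneg intro!: mult_mono\<close>)
  have bound: "(\<integral>\<^sup>+x. ennreal (Fe \<epsilon> x powr (N / (N - 1))) \<partial>lborel) \<le> ennreal ((J / (N * \<omega> powr (1/N))) powr (N / (N - 1)))"
    if e: "0 < \<epsilon>" "\<epsilon> \<le> 1" for \<epsilon>
  proof -
    define G0 where "G0 = (\<lambda>x. (\<integral>\<^sup>+w. ennreal (bump \<epsilon> (x - w)) \<partial>M1) + (\<integral>\<^sup>+w. ennreal (bump \<epsilon> (x - w)) \<partial>M2))"
    define G where "G = (\<lambda>x. enn2real (G0 x) / k \<epsilon>)"
    define V where "V = measure lborel (cball (0::'a) R)"
    \<comment> \<open>W collects the quadratic remainders of the Taylor expansion of the kernel\<close>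
    define W where "W = (\<lambda>x. 25 * M * V / k \<epsilon> * indicator (cball (0::'a) (R + 2)) x)"
    have G0m[measurable]: "G0 \<in> borel_measurable borel"
      unfolding G0_def using nn_integral_mollified_measure(2)[OF e(1) M1] nn_integral_mollified_measure(2)[OF e(1) M2] by measurable
    have G0f: "G0 x < \<infinity>" for x
      unfolding G0_def using nn_integral_mollified_measure(3)[OF e(1) M1] nn_integral_mollified_measure(3)[OF e(1) M2] by simp
    have G: "ennreal (G x) = G0 x / ennreal (k \<epsilon>)" for x
    proof -
      have "ennreal (enn2real (G0 x)) = G0 x" using G0f[of x] by simp
      then show ?thesis using k[OF e(1)] by (simp add: G_def divide_ennreal[symmetric])
    qed
    have V0: "V \<ge> 0" by (simp add: V_def)
    show ?thesis unfolding N_def \<omega>_def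
    proof (rule Sobolev_from_enlargement[OF n, where G = G and W = W and M = M and R = "R + 1" and K = "enn2real (\<integral>\<^sup>+x. ennreal (W x) \<partial>lborel)"])
      show "continuous_on UNIV (Fe \<epsilon>)"
        unfolding continuous_on_eq_continuous_within
      proof (intro ballI, unfold continuous_within_sequentially o_def, intro allI impI, elim conjE)
        fix x and u :: "nat \<Rightarrow> 'a" assume u: "u \<longlonglongrightarrow> x"
        have "(\<lambda>i. \<integral>w. F w * bump \<epsilon> (u i - w) \<partial>lborel) \<longlonglongrightarrow> (\<integral>w. F w * bump \<epsilon> (x - w) \<partial>lborel)"
        proof (rule integral_dominated_convergence[where w = "\<lambda>w. M * (\<epsilon>\<^sup>2)\<^sup>2 * indicator (cball 0 R) w"])
          show "integrable lborel (\<lambda>w. M * (\<epsilon>\<^sup>2)\<^sup>2 * indicator (cball 0 R) w :: real)"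
            by (intro integrable_mult_right integrable_indicator_cball)
          show "AE w in lborel. (\<lambda>i. F w * bump \<epsilon> (u i - w)) \<longlonglongrightarrow> F w * bump \<epsilon> (x - w)"
          proof (intro AE_I2 tendsto_intros)
            fix w
            have "isCont (bump \<epsilon>) (x - w)" using continuous_bump(1)[where 'a='a, of \<epsilon>] by (simp add: continuous_on_eq_continuous_at)
            then show "(\<lambda>i. bump \<epsilon> (u i - w)) \<longlonglongrightarrow> bump \<epsilon> (x - w)"
              by (rule isCont_tendsto_compose) (intro tendsto_intros u)
          qed
          fix i show "AE w in lborel. norm (F w * bump \<epsilon> (u i - w)) \<le> M * (\<epsilon>\<^sup>2)\<^sup>2 * indicator (cball 0 R) w"
          proof (rule AE_I2)
            fix w show "norm (F w * bump \<epsilon> (u i - w)) \<le> M * (\<epsilon>\<^sup>2)\<^sup>2 * indicator (cball 0 R) w"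
              using Fout[of w] F0[of w] FM[of w] M0 bump_bdd[of \<epsilon> "u i - w"]
              by (cases "w \<in> cball 0 R") (auto simp: abs_mult intro!: mult_mono)
          qed
        qed auto
        then show "(\<lambda>i. Fe \<epsilon> (u i)) \<longlonglongrightarrow> Fe \<epsilon> x"
          unfolding Fe_def by (rule tendsto_divide) (use k[OF e(1)] in auto)
      qed
      show "Fe \<epsilon> x \<ge> 0" for x
        using k[OF e(1)] F0 by (auto simp: Fe_def bump_nonneg intro!: divide_nonneg_pos integral_nonneg_AE)
      show "Fe \<epsilon> x \<le> M" for x
      proof -
        have "(\<integral>w. F w * bump \<epsilon> (x - w) \<partial>lborel) \<le> (\<integral>w. M * bump \<epsilon> (x - w) \<partial>lborel)"
          by (intro integral_mono int1 integrable_mult_right integral_bump(4) e mult_right_mono FM bump_nonneg)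
        also have "\<dots> = M * k \<epsilon>" using integral_bump(5)[OF e(1), of x] by (simp add: k_def)
        finally show ?thesis using k[OF e(1)] by (simp add: Fe_def field_simps)
      qed
      show "Fe \<epsilon> x = 0" if "norm x > R + 1" for x
      proof -
        have "F w * bump \<epsilon> (x - w) = 0" for w
        proof (cases "norm w > R")
          case False
          have "norm x \<le> norm (x - w) + norm w" by (metis diff_add_cancel norm_triangle_ineq)
          then have "norm (x - w) \<ge> \<epsilon>" using that e False by linarith
          then show ?thesis using bump_outside(1)[of \<epsilon> "x - w"] e by simp
        qed (simp add: supp)
        then have "(\<lambda>w. F w * bump \<epsilon> (x - w)) = (\<lambda>_. 0)" by blast
        then show ?thesis by (simp add: Fe_def)
      qed
      show "G \<in> borel_measurable borel" unfolding G_def by measurable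
      show "G x \<ge> 0" for x using k[OF e(1)] by (simp add: G_def)
      show "(\<integral>\<^sup>+x. ennreal (G x) \<partial>lborel) = ennreal J"
      proof -
        have "(\<integral>\<^sup>+x. ennreal (G x) \<partial>lborel) = (\<integral>\<^sup>+x. G0 x \<partial>lborel) / ennreal (k \<epsilon>)"
          unfolding G by (rule nn_integral_divide) simp
        also have "(\<integral>\<^sup>+x. G0 x \<partial>lborel) = ennreal (k \<epsilon>) * emeasure M1 UNIV + ennreal (k \<epsilon>) * emeasure M2 UNIV"
          unfolding G0_def k_def
          using nn_integral_mollified_measure(1,2)[OF e(1) M1] nn_integral_mollified_measure(1,2)[OF e(1) M2]
          by (subst nn_integral_add) auto
        also have "\<dots> = ennreal (k \<epsilon>) * ennreal J" by (simp add: distrib_left[symmetric] J)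
        also have "\<dots> / ennreal (k \<epsilon>) = ennreal J"
          using k[OF e(1)] J(2) by (simp add: ennreal_mult[symmetric] divide_ennreal)
        finally show ?thesis .
      qed
      show "J \<ge> 0" by fact
      show "W \<in> borel_measurable borel" unfolding W_def
        by (intro borel_measurable_times borel_measurable_const borel_measurable_indicator) auto
      show "W x \<ge> 0" for x using k[OF e(1)] M0 V0 by (simp add: W_def)
      have "integrable lborel W" unfolding W_def
        by (intro integrable_mult_right integrable_indicator_cball)
      then have "(\<integral>\<^sup>+x. ennreal (W x) \<partial>lborel) = ennreal (integral\<^sup>L lborel W)"
        by (rule nn_integral_eq_integral) (use k[OF e(1)] M0 V0 in \<open>simp add: W_def\<close>)
      then show "(\<integral>\<^sup>+x. ennreal (W x) \<partial>lborel) = ennreal (enn2real (\<integral>\<^sup>+x. ennreal (W x) \<partial>lborel))" by simp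
      show "enn2real (\<integral>\<^sup>+x. ennreal (W x) \<partial>lborel) \<ge> 0" by simp
      show "Fe \<epsilon> (x + v) \<le> Fe \<epsilon> x + t * G x + t\<^sup>2 * W x" if t: "0 < t" "t < 1" and v: "norm v < t" for t x v
      proof -
        let ?i = "indicator (cball (0::'a) R) :: 'a \<Rightarrow> real" and ?j = "indicator (cball (0::'a) (R + 2)) x :: real"
        have pw: "F w * bump \<epsilon> (x + v - w) \<le> F w * bump \<epsilon> (x - w) + F w * dbump \<epsilon> (x - w) v + (25 * t\<^sup>2 * M * ?j) * ?i w" for w
        proof (cases "w \<in> cball 0 R")
          case False then show ?thesis using Fout by simp
        next
          case True
          have "bump \<epsilon> ((x - w) + v) \<le> bump \<epsilon> (x - w) + dbump \<epsilon> (x - w) v + 25 * (norm v)\<^sup>2 * indicator (cball 0 2) (x - w)"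
            by (rule bump_taylor[OF e]) (use t v in auto)
          also have "25 * (norm v)\<^sup>2 * indicator (cball 0 2) (x - w) \<le> 25 * t\<^sup>2 * ?j"
          proof (cases "x - w \<in> cball 0 2")
            case T2: True
            have "norm x \<le> norm (x - w) + norm w" by (metis diff_add_cancel norm_triangle_ineq)
            then have "x \<in> cball 0 (R + 2)" using T2 True by simp
            moreover have "(norm v)\<^sup>2 \<le> t\<^sup>2" using v by (intro power_mono) auto
            ultimately show ?thesis by (auto simp: indicator_def)
          qed auto
          finally have "F w * bump \<epsilon> ((x - w) + v) \<le> F w * (bump \<epsilon> (x - w) + dbump \<epsilon> (x - w) v + 25 * t\<^sup>2 * ?j)"
            using F0 by (intro mult_left_mono) auto
          moreover have "F w * (25 * t\<^sup>2 * ?j) \<le> M * (25 * t\<^sup>2 * ?j)"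
            using FM by (intro mult_right_mono) auto
          ultimately show ?thesis using True by (simp add: algebra_simps)
        qed
        have ii: "integrable lborel ?i"
          by (rule integrable_indicator_cball)
        have "(\<integral>w. F w * bump \<epsilon> (x + v - w) \<partial>lborel)
           \<le> (\<integral>w. F w * bump \<epsilon> (x - w) + F w * dbump \<epsilon> (x - w) v + (25 * t\<^sup>2 * M * ?j) * ?i w \<partial>lborel)"
          using ii by (intro integral_mono int1 int2 Bochner_Integration.integrable_add integrable_mult_right pw e(1))
        also have "\<dots> = (\<integral>w. F w * bump \<epsilon> (x - w) \<partial>lborel) + (\<integral>w. F w * dbump \<epsilon> (x - w) v \<partial>lborel) + (25 * t\<^sup>2 * M * ?j) * V"
          using ii int1 int2[OF e(1)] by (simp add: V_def)
        also have "(\<integral>w. F w * dbump \<epsilon> (x - w) v \<partial>lborel) \<le> t * enn2real (G0 x)"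
        proof -
          have "ennreal (\<integral>w. F w * dbump \<epsilon> (x - w) v \<partial>lborel) \<le> ennreal (norm v) * G0 x"
            using var[OF e, of x v] by (simp add: G0_def)
          also have "\<dots> = ennreal (norm v * enn2real (G0 x))"
            using G0f[of x] by (simp add: ennreal_mult)
          also have "\<dots> \<le> ennreal (t * enn2real (G0 x))"
            using v by (intro ennreal_leI mult_right_mono) auto
          finally show ?thesis using t by (subst (asm) ennreal_le_iff) auto
        qed
        finally have "(\<integral>w. F w * bump \<epsilon> (x + v - w) \<partial>lborel)
            \<le> (\<integral>w. F w * bump \<epsilon> (x - w) \<partial>lborel) + t * enn2real (G0 x) + (25 * t\<^sup>2 * M * ?j) * V" by simp
        then have "Fe \<epsilon> (x + v) \<le> ((\<integral>w. F w * bump \<epsilon> (x - w) \<partial>lborel) + t * enn2real (G0 x) + (25 * t\<^sup>2 * M * ?j) * V) / k \<epsilon>"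
          unfolding Fe_def by (rule divide_right_mono) (use k[OF e(1)] in simp)
        then show ?thesis
          by (simp add: Fe_def G_def W_def add_divide_distrib mult_ac)
      qed
    qed
  qed
  define es where "es = (\<lambda>i::nat. 1 / (real i + 1))"
  have es: "0 < es i" "es i \<le> 1" for i by (auto simp: es_def)
  have es0: "es \<longlonglongrightarrow> 0"
    unfolding es_def using LIMSEQ_inverse_real_of_nat by (simp add: inverse_eq_divide add.commute)
  have conv: "(\<lambda>i. Fe (es i) x) \<longlonglongrightarrow> F x" if x: "isCont F x" for x
  proof (rule LIMSEQ_I)
    fix r :: real assume r: "r > 0"
    obtain d where d: "d > 0" "\<And>w. dist w x < d \<Longrightarrow> dist (F w) (F x) < r / 2"
      using x r unfolding continuous_at_eps_delta by (metis half_gt_zero)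
    obtain n0 where n0: "\<And>i. i \<ge> n0 \<Longrightarrow> es i < d"
      using order_tendstoD(2)[OF es0 d(1)] by (auto simp: eventually_sequentially)
    show "\<exists>no. \<forall>n\<ge>no. norm (Fe (es n) x - F x) < r"
    proof (intro exI allI impI)
      fix i assume i: "i \<ge> n0"
      let ?e = "es i"
      have "Fe ?e x - F x = ((\<integral>w. F w * bump ?e (x - w) \<partial>lborel) - (\<integral>w. F x * bump ?e (x - w) \<partial>lborel)) / k ?e"
      proof -
        have "(\<integral>w. bump ?e (x - w) \<partial>lborel) = k ?e" using integral_bump(5)[OF es(1)[of i], of x] by (simp add: k_def)
        moreover have "k ?e \<noteq> 0" using k[OF es(1)[of i]] by simp
        ultimately show ?thesis by (simp add: Fe_def diff_divide_distrib)
      qed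
      also have "(\<integral>w. F w * bump ?e (x - w) \<partial>lborel) - (\<integral>w. F x * bump ?e (x - w) \<partial>lborel) = (\<integral>w. F w * bump ?e (x - w) - F x * bump ?e (x - w) \<partial>lborel)"
        by (rule Bochner_Integration.integral_diff[symmetric]) (intro int1 integrable_mult_right integral_bump(4) es)+
      finally have eq: "Fe ?e x - F x = (\<integral>w. F w * bump ?e (x - w) - F x * bump ?e (x - w) \<partial>lborel) / k ?e" .
      have "\<bar>\<integral>w. F w * bump ?e (x - w) - F x * bump ?e (x - w) \<partial>lborel\<bar> \<le> (\<integral>w. \<bar>F w * bump ?e (x - w) - F x * bump ?e (x - w)\<bar> \<partial>lborel)"
        by (rule integral_abs_bound)
      also have "\<dots> \<le> (\<integral>w. r / 2 * bump ?e (x - w) \<partial>lborel)"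
      proof (rule integral_mono)
        show "integrable lborel (\<lambda>w. \<bar>F w * bump ?e (x - w) - F x * bump ?e (x - w)\<bar>)"
          by (intro integrable_abs Bochner_Integration.integrable_diff int1 integrable_mult_right integral_bump(4) es)
        show "integrable lborel (\<lambda>w. r / 2 * bump ?e (x - w))"
          by (intro integrable_mult_right integral_bump(4) es)
        fix w
        show "\<bar>F w * bump ?e (x - w) - F x * bump ?e (x - w)\<bar> \<le> r / 2 * bump ?e (x - w)"
        proof (cases "norm (x - w) \<ge> ?e")
          case True then show ?thesis using bump_outside(1)[OF True es(1)] by simp
        next
          case False
          then have "dist w x < d" using n0[OF i] by (simp add: dist_norm norm_minus_commute)
          then have "\<bar>F w - F x\<bar> \<le> r / 2" using d(2)[of w] by (simp add: dist_real_def)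
          then have "\<bar>F w - F x\<bar> * bump ?e (x - w) \<le> r / 2 * bump ?e (x - w)"
            by (intro mult_right_mono bump_nonneg)
          then show ?thesis by (simp add: left_diff_distrib[symmetric] abs_mult bump_nonneg)
        qed
      qed
      also have "\<dots> = r / 2 * k ?e" using integral_bump(5)[OF es(1)[of i], of x] by (simp add: k_def)
      finally have "\<bar>Fe ?e x - F x\<bar> \<le> r / 2"
        unfolding eq using k[OF es(1)[of i]] by (simp add: field_simps)
      then show "norm (Fe ?e x - F x) < r" using r by simp
    qed
  qed
  have Fem[measurable]: "Fe \<epsilon> \<in> borel_measurable borel" for \<epsilon>
  proof -
    have "(\<lambda>x. \<integral>w. F w * bump \<epsilon> (x - w) \<partial>lborel) \<in> borel_measurable borel"
      by (rule lborel.borel_measurable_lebesgue_integral) measurable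
    then show ?thesis unfolding Fe_def by measurable
  qed
  have "(\<integral>\<^sup>+x. ennreal (F x powr (N / (N - 1))) \<partial>lborel) = (\<integral>\<^sup>+x. liminf (\<lambda>i. ennreal (Fe (es i) x powr (N / (N - 1)))) \<partial>lborel)"
  proof (rule nn_integral_cong_AE)
    show "AE x in lborel. ennreal (F x powr (N / (N - 1))) = liminf (\<lambda>i. ennreal (Fe (es i) x powr (N / (N - 1))))"
      using cont
    proof eventually_elim
      fix x assume "isCont F x"
      have p: "N / (N - 1) > 0" using n by (auto simp: N_def)
      have "(\<lambda>i. Fe (es i) x powr (N / (N - 1))) \<longlonglongrightarrow> F x powr (N / (N - 1))"
        using F0 k[OF es(1)] p
        by (intro tendsto_powr' conv \<open>isCont F x\<close> tendsto_const)
           (auto simp: Fe_def bump_nonneg intro!: always_eventually divide_nonneg_pos integral_nonneg_AE)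
      then have "(\<lambda>i. ennreal (Fe (es i) x powr (N / (N - 1)))) \<longlonglongrightarrow> ennreal (F x powr (N / (N - 1)))"
        by (rule tendsto_ennrealI)
      then show "ennreal (F x powr (N / (N - 1))) = liminf (\<lambda>i. ennreal (Fe (es i) x powr (N / (N - 1))))"
        by (metis lim_imp_Liminf trivial_limit_sequentially)
    qed
  qed
  also have "\<dots> \<le> liminf (\<lambda>i. \<integral>\<^sup>+x. ennreal (Fe (es i) x powr (N / (N - 1))) \<partial>lborel)"
    by (rule nn_integral_liminf) measurable
  also have "\<dots> \<le> ennreal ((J / (N * \<omega> powr (1/N))) powr (N / (N - 1)))"
    by (rule Liminf_le) (auto intro!: always_eventually bound es)
  finally show ?thesis .
qed


section \<open>Derivatives of compactly supported functions\<close>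

lemma DERIV_max0_square: "((\<lambda>t::real. (max 0 t)\<^sup>2) has_real_derivative 2 * max 0 t) (at t)"
proof -
  consider "t > 0" | "t < 0" | "t = 0" by linarith
  then show ?thesis
  proof cases
    case 1
    have "((\<lambda>t::real. t\<^sup>2) has_real_derivative 2 * t) (at t)" by (auto intro!: derivative_eq_intros)
    then have "((\<lambda>t::real. (max 0 t)\<^sup>2) has_real_derivative 2 * t) (at t)"
      by (rule DERIV_cong_ev[THEN iffD1, rotated -1, OF _ refl _ refl])
        (use 1 in \<open>auto intro!: eventually_mono[OF eventually_nhds_in_open[of "{0<..}" t]]\<close>)
    then show ?thesis using 1 by simp
  next
    case 2
    have "((\<lambda>t::real. 0::real) has_real_derivative 0) (at t)" by (auto intro!: derivative_eq_intros)
    then have "((\<lambda>t::real. (max 0 t)\<^sup>2) has_real_derivative 0) (at t)"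
      by (rule DERIV_cong_ev[THEN iffD1, rotated -1, OF _ refl _ refl])
        (use 2 in \<open>auto intro!: eventually_mono[OF eventually_nhds_in_open[of "{..<0}" t]]\<close>)
    then show ?thesis using 2 by simp
  next
    case 3
    have "((\<lambda>h::real. ((max 0 (0 + h))\<^sup>2 - (max 0 0)\<^sup>2) / h) \<longlongrightarrow> 0) (at 0)"
    proof (rule Lim_null_comparison)
      show "\<forall>\<^sub>F h in at 0. norm (((max 0 (0 + h))\<^sup>2 - (max 0 0)\<^sup>2) / h) \<le> \<bar>h\<bar>" for h :: real
        by (intro always_eventually allI) (auto simp: max_def power2_eq_square)
      show "((\<lambda>h::real. \<bar>h\<bar>) \<longlongrightarrow> 0) (at 0)" by (intro tendsto_eq_intros) auto
    qed
    then show ?thesis using 3 by (simp add: DERIV_def)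
  qed
qed

lemma has_derivative_bump: "(bump \<epsilon> has_derivative dbump \<epsilon> z) (at z)"
proof -
  have 1: "((\<lambda>z::'a. \<epsilon>\<^sup>2 - z \<bullet> z) has_derivative (\<lambda>v. - 2 * (z \<bullet> v))) (at z)"
    by (auto intro!: derivative_eq_intros simp: inner_commute)
  have "((\<lambda>t::real. (max 0 t)\<^sup>2) has_derivative (\<lambda>h. 2 * max 0 (\<epsilon>\<^sup>2 - z \<bullet> z) * h)) (at (\<epsilon>\<^sup>2 - z \<bullet> z))"
    using DERIV_max0_square by (simp add: has_field_derivative_def)
  from diff_chain_at[OF 1 this] show ?thesis
    by (simp add: o_def bump_def[abs_def] dbump_def[abs_def] mult.assoc algebra_simps)
qed

text \<open>
  A continuously differentiable function that increases from 0 to 1 on the unit interval.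
\<close>
definition ramp :: "real \<Rightarrow> real" where
  "ramp t = 2 * (max 0 t)\<^sup>2 - 4 * (max 0 (t - 1/2))\<^sup>2 + 2 * (max 0 (t - 1))\<^sup>2"

definition dramp :: "real \<Rightarrow> real" where
  "dramp t = 4 * max 0 t - 8 * max 0 (t - 1/2) + 4 * max 0 (t - 1)"

lemma DERIV_ramp: "(ramp has_real_derivative dramp t) (at t)"
proof -
  have s: "((\<lambda>t::real. (max 0 (t - c))\<^sup>2) has_real_derivative 2 * max 0 (t - c)) (at t)" for c
  proof -
    have "((\<lambda>t. t - c) has_real_derivative 1) (at t)" by (auto intro!: derivative_eq_intros)
    from DERIV_chain2[where f = "\<lambda>t. (max 0 t)\<^sup>2" and g = "\<lambda>t. t - c", OF DERIV_max0_square this] show ?thesis by simp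
  qed
  have "((\<lambda>t. 2 * (max 0 t)\<^sup>2 - 4 * (max 0 (t - 1/2))\<^sup>2 + 2 * (max 0 (t - 1))\<^sup>2) has_real_derivative
     2 * (2 * max 0 t) - 4 * (2 * max 0 (t - 1/2)) + 2 * (2 * max 0 (t - 1))) (at t)"
    by (intro DERIV_add DERIV_diff DERIV_cmult s DERIV_max0_square)
  then show ?thesis unfolding ramp_def[abs_def] dramp_def by simp
qed

lemma ramp_simps: "t \<le> 0 \<Longrightarrow> ramp t = 0" "t \<ge> 1 \<Longrightarrow> ramp t = 1" "t \<le> 0 \<Longrightarrow> dramp t = 0" "t \<ge> 1 \<Longrightarrow> dramp t = 0"
  "dramp t \<ge> 0" "dramp t \<le> 2"
  by (auto simp: ramp_def dramp_def max_def power2_eq_square algebra_simps split: if_splits)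

lemma ramp_bounds: "0 \<le> ramp t" "ramp t \<le> 1"
proof -
  have mono: "ramp s \<le> ramp t" if "s \<le> t" for s t
    by (rule DERIV_nonneg_imp_nondecreasing[OF that]) (use DERIV_ramp ramp_simps(5) in blast)
  show "0 \<le> ramp t" using mono[of "min t 0" t] ramp_simps(1)[of "min t 0"] by simp
  show "ramp t \<le> 1" using mono[of t "max t 1"] ramp_simps(2)[of "max t 1"] by simp
qed

lemma continuous_ramp: "continuous_on X ramp" "continuous_on X dramp"
  unfolding ramp_def dramp_def by (intro continuous_intros)+

lemma measurable_dramp [measurable]: "dramp \<in> borel_measurable borel"
  by (intro borel_measurable_continuous_onI continuous_ramp)

lemma nn_integral_dramp: "(\<integral>\<^sup>+t. ennreal (dramp t) \<partial>lborel) = 1"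
proof -
  have "(\<integral>\<^sup>+t. ennreal (dramp t) \<partial>lborel) = (\<integral>\<^sup>+t. ennreal (dramp t) * indicator {0..1} t \<partial>lborel)"
    by (intro nn_integral_cong) (auto simp: indicator_def ramp_simps)
  also have "\<dots> = ennreal (ramp 1 - ramp 0)"
    by (rule nn_integral_FTC_Icc) (auto simp: ramp_simps DERIV_ramp)
  finally show ?thesis by (simp add: ramp_simps)
qed

lemma integral_lborel_shift:
  fixes f :: "'a::euclidean_space \<Rightarrow> real"
  assumes [measurable]: "f \<in> borel_measurable borel"
  shows "(\<integral>x. f (x + c) \<partial>lborel) = (\<integral>x. f x \<partial>lborel)" "integrable lborel f \<Longrightarrow> integrable lborel (\<lambda>x. f (x + c))"
proof -
  have "(\<integral>x. f x \<partial>lborel) = (\<integral>x. f x \<partial>distr lborel borel ((+) c))"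
    by (simp add: lborel_distr_plus)
  also have "\<dots> = (\<integral>x. f (c + x) \<partial>lborel)"
    by (subst integral_distr) auto
  finally show "(\<integral>x. f (x + c) \<partial>lborel) = (\<integral>x. f x \<partial>lborel)" by (simp add: add.commute)
  assume "integrable lborel f"
  then have "integrable (distr lborel borel ((+) c)) f" by (simp add: lborel_distr_plus)
  then have "integrable lborel (\<lambda>x. f (c + x))" by (subst (asm) integrable_distr_eq) auto
  then show "integrable lborel (\<lambda>x. f (x + c))" by (simp add: add.commute)
qed

text \<open>
  By translation invariance the difference quotients of \<open>w\<close> have integral zero. By the mean value
  theorem they are bounded by the bound for the derivative, so dominated convergence applies; the
  derivative is measurable as a limit of difference quotients.
\<close>
theorem integral_directional_derivative_zero:
  fixes w :: "'a::euclidean_space \<Rightarrow> real"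
  assumes der: "\<And>y. (w has_derivative W y) (at y)" and bd: "\<And>y. \<bar>W y e\<bar> \<le> C"
    and supp: "\<And>y. y \<notin> cball 0 R \<Longrightarrow> w y = 0"
  shows "integrable lborel (\<lambda>y. W y e)" "(\<integral>y. W y e \<partial>lborel) = 0"
proof -
  have cw: "continuous_on UNIV w"
    by (rule has_derivative_continuous_on[of UNIV w W]) (rule der)
  have wm[measurable]: "w \<in> borel_measurable borel" by (rule borel_measurable_continuous_onI[OF cw])
  have "compact (w ` cball 0 R)" by (intro compact_continuous_image continuous_on_subset[OF cw]) auto
  then have "bounded (w ` cball 0 R)" by (rule compact_imp_bounded)
  then obtain B where B: "\<And>z. z \<in> w ` cball 0 R \<Longrightarrow> norm z \<le> B" unfolding bounded_iff by blast
  have "\<bar>w y\<bar> \<le> max B 0" for y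
    using B[of "w y"] supp[of y] by (cases "y \<in> cball 0 R") auto
  then have iw: "integrable lborel w" by (rule integrable_bounded_support[OF wm _ supp])
  define t where "t = (\<lambda>m::nat. 1 / (real m + 1))"
  have t: "t m > 0" "t m \<le> 1" for m by (auto simp: t_def)
  have t0: "t \<longlonglongrightarrow> 0"
    unfolding t_def using LIMSEQ_inverse_real_of_nat by (simp add: inverse_eq_divide add.commute)
  define q where "q = (\<lambda>m y. (w (y + t m *\<^sub>R e) - w y) / t m)"
  have line: "((\<lambda>s. w (y + s *\<^sub>R e)) has_real_derivative W (y + s *\<^sub>R e) e) (at s)" for y s
  proof -
    have "((\<lambda>s. y + s *\<^sub>R e) has_derivative (\<lambda>h. h *\<^sub>R e)) (at s)" by (auto intro!: derivative_eq_intros)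
    from diff_chain_at[OF this der[of "y + s *\<^sub>R e"]]
    have "((\<lambda>s. w (y + s *\<^sub>R e)) has_derivative (\<lambda>h. W (y + s *\<^sub>R e) (h *\<^sub>R e))) (at s)" by (simp add: o_def)
    moreover have "(\<lambda>h. W (y + s *\<^sub>R e) (h *\<^sub>R e)) = (\<lambda>h. W (y + s *\<^sub>R e) e * h)"
      using has_derivative_linear[OF der[of "y + s *\<^sub>R e"]] by (auto simp: linear_cmul)
    ultimately show ?thesis by (simp add: has_field_derivative_def)
  qed
  have lim: "(\<lambda>m. q m y) \<longlonglongrightarrow> W y e" for y
  proof -
    have "((\<lambda>h. (w (y + h *\<^sub>R e) - w y) / h) \<longlongrightarrow> W y e) (at 0)"
      using line[of y 0] by (simp add: DERIV_def)
    then show ?thesis unfolding q_def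
      by (rule filterlim_compose) (use t0 t(1) in \<open>auto simp: filterlim_at less_imp_neq[THEN not_sym]\<close>)
  qed
  have qb: "\<bar>q m y\<bar> \<le> C" for m y
  proof -
    obtain s where "w (y + t m *\<^sub>R e) - w (y + 0 *\<^sub>R e) = (t m - 0) * W (y + s *\<^sub>R e) e"
      using MVT2[OF t(1)[of m], of "\<lambda>s. w (y + s *\<^sub>R e)" "\<lambda>s. W (y + s *\<^sub>R e) e"] line by blast
    then have "q m y = W (y + s *\<^sub>R e) e" using t(1)[of m] by (simp add: q_def)
    then show ?thesis using bd by simp
  qed
  have qsupp: "q m y = 0" if "y \<notin> cball 0 (R + norm e)" for m y
  proof -
    have "norm y \<le> norm (y + t m *\<^sub>R e) + norm (t m *\<^sub>R e)" by (metis add_diff_cancel norm_triangle_ineq4)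
    moreover have "norm (t m *\<^sub>R e) \<le> norm e" using t[of m] by (simp add: mult_left_le_one_le)
    ultimately have "norm (y + t m *\<^sub>R e) > R" using that by simp
    moreover have "norm y > R" using that norm_ge_zero[of e] unfolding mem_cball_0 by linarith
    ultimately have "w (y + t m *\<^sub>R e) = 0" "w y = 0" by (auto intro: supp)
    then show ?thesis by (simp add: q_def)
  qed
  have qm[measurable]: "q m \<in> borel_measurable borel" for m unfolding q_def by measurable
  have Wm: "(\<lambda>y. W y e) \<in> borel_measurable lborel"
    by (rule borel_measurable_LIMSEQ_metric[of q]) (use qm lim in auto)
  have dom: "integrable lborel (\<lambda>y. C * indicator (cball 0 (R + norm e)) y :: real)"
    by (intro integrable_mult_right integrable_indicator_cball)
  have qdom: "norm (q m y) \<le> C * indicator (cball 0 (R + norm e)) y" for m y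
    using qb[of m y] qsupp[of y m] by (cases "y \<in> cball 0 (R + norm e)") auto
  show "integrable lborel (\<lambda>y. W y e)"
    by (rule integrable_dominated_convergence[where s = q and w = "\<lambda>y. C * indicator (cball 0 (R + norm e)) y"])
      (use Wm dom qm lim qdom in auto)
  have "(\<lambda>m. \<integral>y. q m y \<partial>lborel) \<longlonglongrightarrow> (\<integral>y. W y e \<partial>lborel)"
    by (rule integral_dominated_convergence[where w = "\<lambda>y. C * indicator (cball 0 (R + norm e)) y"])
      (use Wm dom qm lim qdom in auto)
  moreover have "(\<integral>y. q m y \<partial>lborel) = 0" for m
    unfolding q_def using iw integral_lborel_shift[OF wm, of "t m *\<^sub>R e"] by simp
  ultimately show "(\<integral>y. W y e \<partial>lborel) = 0" by (simp add: LIMSEQ_const_iff)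
qed


section \<open>Change of variables for nonnegative integrands\<close>

text \<open>
  A well-ordered copy of a finite index type. Renaming the coordinates transfers the change of
  variables formula for \<open>real ^ 'm\<close> with a well-ordered \<open>'m\<close> to every finite index type.
\<close>
typedef (overloaded) ('n::finite) idx = "{..<CARD('n)} :: nat set"
  by (rule exI[of _ 0]) simp

instantiation idx :: (finite) "{finite, wellorder}"
begin

definition "less_eq_idx (a :: 'a idx) (b :: 'a idx) \<longleftrightarrow> Rep_idx a \<le> Rep_idx b"
definition "less_idx (a :: 'a idx) (b :: 'a idx) \<longleftrightarrow> Rep_idx a < Rep_idx b"

instance
proof
  have "(UNIV :: 'a idx set) = Abs_idx ` {..<CARD('a)}"
    using type_definition.Abs_image[OF type_definition_idx] by metis
  then show "finite (UNIV :: 'a idx set)" by (metis finite_imageI finite_lessThan)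
  show "P a" if "\<And>x. (\<And>y. y < x \<Longrightarrow> P y) \<Longrightarrow> P x" for P and a :: "'a idx"
    by (rule measure_induct_rule[of Rep_idx]) (use that in \<open>auto simp: less_idx_def\<close>)
qed (auto simp: less_eq_idx_def less_idx_def Rep_idx_inject)

end

lemma card_idx: "CARD('n::finite idx) = CARD('n)"
  using type_definition.card[OF type_definition_idx] by simp

definition idx_of :: "'n::finite idx \<Rightarrow> 'n" where
  "idx_of = (SOME f. bij f)"

lemma bij_idx_of: "bij (idx_of :: 'n::finite idx \<Rightarrow> 'n)"
proof -
  have "\<exists>f. bij (f :: 'n idx \<Rightarrow> 'n)"
    using finite_same_card_bij[of "UNIV :: 'n idx set" "UNIV :: 'n set"] card_idx by auto
  then show ?thesis unfolding idx_of_def by (rule someI_ex)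
qed

lemma idx_of_inv [simp]:
  "inv idx_of (idx_of a) = a" "idx_of (inv idx_of b) = b" "inv idx_of b = a \<longleftrightarrow> b = idx_of a"
proof -
  show 1: "inv idx_of (idx_of a) = a" by (rule inv_f_f[OF bij_is_inj[OF bij_idx_of]])
  show 2: "idx_of (inv idx_of b) = b" by (rule surj_f_inv_f[OF bij_is_surj[OF bij_idx_of]])
  show "inv idx_of b = a \<longleftrightarrow> b = idx_of a" using 1 2 by metis
qed

text \<open>
  Conjugation by a bijection, possibly between different types, turns transpositions into
  transpositions and so preserves signs of permutations and determinants.
\<close>
lemma swapidseq_conj:
  assumes "swapidseq n p" "bij (\<pi> :: 'a \<Rightarrow> 'b)"
  shows "swapidseq n (\<pi> \<circ> p \<circ> inv \<pi>)"
  using assms(1)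
proof induction
  case id
  have "\<pi> \<circ> id \<circ> inv \<pi> = id" by (simp only: comp_id surj_iff[THEN iffD1, OF bij_is_surj[OF assms(2)]])
  then show ?case by (simp only: swapidseq.id)
next
  case (comp_Suc n p a b)
  have "\<pi> \<circ> (Transposition.transpose a b \<circ> p) \<circ> inv \<pi> = Transposition.transpose (\<pi> a) (\<pi> b) \<circ> (\<pi> \<circ> p \<circ> inv \<pi>)"
    using assms(2) by (auto simp: fun_eq_iff Transposition.transpose_def bij_is_inj inj_eq)
  moreover have "\<pi> a \<noteq> \<pi> b" using comp_Suc.hyps assms(2) by (auto simp: bij_is_inj inj_eq)
  ultimately show ?case using comp_Suc.IH swapidseq.comp_Suc by metis
qed

lemma sign_conj:
  assumes "p permutes (UNIV :: 'a::finite set)" "bij (\<pi> :: 'a \<Rightarrow> 'b)"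
  shows "sign (\<pi> \<circ> p \<circ> inv \<pi>) = sign p"
proof -
  have "permutation p" using assms(1) permutes_imp_permutation finite by blast
  then obtain n where n: "swapidseq n p" unfolding permutation_def by blast
  have "evenperm (\<pi> \<circ> p \<circ> inv \<pi>) = even n" "evenperm p = even n"
    using evenperm_unique[OF swapidseq_conj[OF n assms(2)]] evenperm_unique[OF n] by auto
  then show ?thesis by (simp add: sign_def)
qed

lemma det_reindex:
  fixes A :: "real ^ 'b::finite ^ 'b" and \<pi> :: "'a::finite \<Rightarrow> 'b"
  assumes \<pi>: "bij \<pi>"
  shows "det (\<chi> a b. A $ \<pi> a $ \<pi> b) = det A"
proof -
  have inv: "inv \<pi> (\<pi> a) = a" "\<pi> (inv \<pi> b) = b" for a b
    using \<pi> by (auto simp: bij_is_inj bij_is_surj surj_f_inv_f)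
  have bijs: "bij (inv \<pi>)" using \<pi> by (rule bij_imp_bij_inv)
  have "det (\<chi> a b. A $ \<pi> a $ \<pi> b) = (\<Sum>p | p permutes (UNIV::'a set). of_int (sign p) * (\<Prod>i\<in>UNIV. A $ \<pi> i $ \<pi> (p i)))"
    by (simp add: det_def)
  also have "\<dots> = (\<Sum>q | q permutes (UNIV::'b set). of_int (sign q) * (\<Prod>i\<in>UNIV. A $ i $ q i))"
  proof (rule sum.reindex_bij_witness[where i = "\<lambda>q. inv \<pi> \<circ> q \<circ> \<pi>" and j = "\<lambda>p. \<pi> \<circ> p \<circ> inv \<pi>"])
    fix p assume "p \<in> {p. p permutes (UNIV::'a set)}"
    then have p: "p permutes UNIV" by simp
    show "inv \<pi> \<circ> (\<pi> \<circ> p \<circ> inv \<pi>) \<circ> \<pi> = p" by (auto simp: fun_eq_iff inv)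
    show "\<pi> \<circ> p \<circ> inv \<pi> \<in> {q. q permutes UNIV}"
      by (auto intro!: bij_imp_permutes bij_comp permutes_bij[OF p] \<pi> bijs)
    have "(\<Prod>i\<in>UNIV. A $ i $ (\<pi> \<circ> p \<circ> inv \<pi>) i) = (\<Prod>i\<in>UNIV. A $ \<pi> i $ \<pi> (p i))"
      using prod.reindex_bij_betw[OF \<pi>, of "\<lambda>i. A $ i $ (\<pi> \<circ> p \<circ> inv \<pi>) i"] by (simp add: inv)
    then show "of_int (sign (\<pi> \<circ> p \<circ> inv \<pi>)) * (\<Prod>i\<in>UNIV. A $ i $ (\<pi> \<circ> p \<circ> inv \<pi>) i) = of_int (sign p) * (\<Prod>i\<in>UNIV. A $ \<pi> i $ \<pi> (p i))"
      by (simp add: sign_conj[OF p \<pi>])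
  next
    fix q assume "q \<in> {q. q permutes (UNIV::'b set)}"
    then have q: "q permutes UNIV" by simp
    show "\<pi> \<circ> (inv \<pi> \<circ> q \<circ> \<pi>) \<circ> inv \<pi> = q" by (auto simp: fun_eq_iff inv)
    show "inv \<pi> \<circ> q \<circ> \<pi> \<in> {p. p permutes UNIV}"
      by (auto intro!: bij_imp_permutes bij_comp permutes_bij[OF q] \<pi> bijs)
  qed
  also have "\<dots> = det A" by (simp add: det_def)
  finally show ?thesis .
qed

definition to_idx :: "real ^ 'n::finite \<Rightarrow> real ^ 'n idx" where
  "to_idx x = (\<chi> a. x $ idx_of a)"

definition from_idx :: "real ^ 'n idx \<Rightarrow> real ^ 'n::finite" where
  "from_idx y = (\<chi> i. y $ inv idx_of i)"

lemma idx_inverse [simp]: "from_idx (to_idx x) = x" "to_idx (from_idx y) = y"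
  by (simp_all add: to_idx_def from_idx_def vec_eq_iff)

lemma linear_to_idx: "linear to_idx"
  by (auto simp: linear_iff to_idx_def vec_eq_iff)

lemma linear_from_idx: "linear from_idx"
  by (auto simp: linear_iff from_idx_def vec_eq_iff)

lemma bl_idx: "bounded_linear to_idx" "bounded_linear from_idx"
  by (simp_all add: linear_conv_bounded_linear[symmetric] linear_to_idx linear_from_idx)

lemma measurable_idx [measurable]: "to_idx \<in> borel_measurable borel" "from_idx \<in> borel_measurable borel"
  by (auto intro!: borel_measurable_continuous_onI linear_continuous_on bl_idx)

lemma prod_Basis_cart: "(\<Prod>b\<in>Basis. z \<bullet> b) = (\<Prod>i\<in>UNIV. z $ i)" for z :: "real ^ 'm::finite"
  by (simp add: Basis_vec_def cart_eq_inner_axis axis_eq_axis prod.UNION_disjoint)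

lemma distr_to_idx: "distr lborel borel to_idx = (lborel :: (real ^ 'n::finite idx) measure)"
proof (rule lborel_eqI[symmetric])
  fix l u :: "real ^ 'n idx" assume lu: "\<And>b. b \<in> Basis \<Longrightarrow> l \<bullet> b \<le> u \<bullet> b"
  have vim: "to_idx -` box l u = box (from_idx l) (from_idx u)"
    unfolding box_def Basis_vec_def
    by (auto simp: to_idx_def from_idx_def inner_axis) (metis idx_of_inv(1,2))+
  have le: "l $ a \<le> u $ a" for a
    using lu[of "axis a 1"] by (simp add: inner_axis)
  have "emeasure (distr lborel borel to_idx) (box l u) = emeasure lborel (box (from_idx l) (from_idx u))"
    by (subst emeasure_distr) (auto simp: vim)
  also have "\<dots> = (\<Prod>b\<in>Basis. (from_idx u - from_idx l) \<bullet> b)"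
  proof (rule emeasure_lborel_box)
    fix b :: "real ^ 'n" assume "b \<in> Basis"
    then obtain i where "b = axis i 1" by (auto simp: Basis_vec_def)
    then show "from_idx l \<bullet> b \<le> from_idx u \<bullet> b" by (simp add: inner_axis from_idx_def le)
  qed
  also have "(\<Prod>b\<in>Basis. (from_idx u - from_idx l) \<bullet> b) = (\<Prod>i\<in>UNIV. (u - l) $ inv idx_of i)"
    by (simp add: prod_Basis_cart from_idx_def)
  also have "\<dots> = (\<Prod>a\<in>UNIV. (u - l) $ a)"
    using prod.reindex_bij_betw[OF bij_imp_bij_inv[OF bij_idx_of[where 'n='n]], of "\<lambda>a. (u - l) $ a"] by simp
  also have "\<dots> = (\<Prod>b\<in>Basis. (u - l) \<bullet> b)" by (simp add: prod_Basis_cart)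
  finally show "emeasure (distr lborel borel to_idx) (box l u) = (\<Prod>b\<in>Basis. (u - l) \<bullet> b)" .
qed simp

lemma nn_integral_idx:
  fixes f :: "real ^ 'n::finite idx \<Rightarrow> ennreal"
  assumes "f \<in> borel_measurable borel"
  shows "(\<integral>\<^sup>+y. f y \<partial>lborel) = (\<integral>\<^sup>+x. f (to_idx x) \<partial>lborel)"
  using assms by (subst distr_to_idx[symmetric]) (simp add: nn_integral_distr)

text \<open>
  If the integral of the Jacobian is finite, this is the change of variables theorem for gauge
  integrals. If it is infinite then the image cannot have finite measure, because the same theorem
  would make the Jacobian integrable.
\<close>
lemma emeasure_injective_image_wellorder:
  fixes g :: "real ^ 'm::{finite,wellorder} \<Rightarrow> real ^ 'm::_"
  assumes E: "E \<in> sets borel" and gE: "g ` E \<in> sets borel" and inj: "inj_on g E"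
    and der: "\<And>x. x \<in> E \<Longrightarrow> (g has_derivative g' x) (at x within E)"
    and h: "(\<lambda>x. indicator E x * \<bar>det (matrix (g' x))\<bar>) \<in> borel_measurable borel"
  shows "emeasure lborel (g ` E) = (\<integral>\<^sup>+x. ennreal (indicator E x * \<bar>det (matrix (g' x))\<bar>) \<partial>lborel)"
proof -
  let ?D = "\<lambda>x. \<bar>det (matrix (g' x))\<bar>" and ?h = "\<lambda>x. indicator E x * \<bar>det (matrix (g' x))\<bar>"
  have res: "(?h has_integral m) UNIV \<longleftrightarrow> (?D has_integral m) E" for m
  proof -
    have "?h = (\<lambda>x. if x \<in> E then ?D x else 0)" by (auto simp: indicator_def)
    then show ?thesis using has_integral_restrict_UNIV[of E ?D m] by simp
  qed
  have "E \<in> sets lebesgue" using E by simp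
  note base = has_measure_differentiable_image[OF this der inj]
  show ?thesis
  proof (cases "(\<integral>\<^sup>+x. ennreal (?h x) \<partial>lborel) = \<infinity>")
    case False
    then have int: "integrable lborel ?h"
      using h by (intro integrableI_nonneg) (auto simp: less_top)
    then have "(?h has_integral (integral\<^sup>L lborel ?h)) UNIV"
      by (rule has_integral_integral_lborel)
    then have "g ` E \<in> lmeasurable" "measure lebesgue (g ` E) = integral\<^sup>L lborel ?h"
      using base[of "integral\<^sup>L lborel ?h"] res by auto
    moreover have "emeasure lborel (g ` E) = emeasure lebesgue (g ` E)" using gE by simp
    ultimately have "emeasure lborel (g ` E) = ennreal (integral\<^sup>L lborel ?h)"
      by (simp add: emeasure_eq_measure2)
    then show ?thesis using nn_integral_eq_integral[OF int] by simp
  next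
    case True
    have "emeasure lborel (g ` E) = \<infinity>"
    proof (rule ccontr)
      assume a: "\<not> ?thesis"
      have "g ` E \<in> lmeasurable"
        using a gE by (intro fmeasurableI) (auto simp: less_top)
      then have "(?h has_integral (measure lebesgue (g ` E))) UNIV"
        using base[of "measure lebesgue (g ` E)"] res by auto
      then have "(\<integral>\<^sup>+x. ennreal (?h x) \<partial>lborel) = ennreal (measure lebesgue (g ` E))"
        by (intro nn_integral_has_integral_lborel h) auto
      then show False using True by simp
    qed
    then show ?thesis using True by simp
  qed
qed

lemma emeasure_injective_image:
  fixes g :: "real ^ 'n::finite \<Rightarrow> real ^ 'n"
  assumes E: "E \<in> sets borel" and gE: "g ` E \<in> sets borel" and inj: "inj_on g E"
    and der: "\<And>x. x \<in> E \<Longrightarrow> (g has_derivative g' x) (at x within E)"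
    and h: "(\<lambda>x. indicator E x * \<bar>det (matrix (g' x))\<bar>) \<in> borel_measurable borel"
  shows "emeasure lborel (g ` E) = (\<integral>\<^sup>+x. ennreal (indicator E x * \<bar>det (matrix (g' x))\<bar>) \<partial>lborel)"
proof -
  define G where "G = to_idx \<circ> g \<circ> from_idx"
  define G' where "G' = (\<lambda>y. to_idx \<circ> g' (from_idx y) \<circ> from_idx)"
  have vimE: "to_idx ` S = from_idx -` S" for S :: "(real ^ 'n) set"
    by (auto simp: image_iff) (metis idx_inverse(2))
  have to_idx_sets: "to_idx ` S \<in> sets borel" if "S \<in> sets borel" for S :: "(real ^ 'n) set"
    using measurable_sets[OF measurable_idx(2) that] by (simp add: vimE)
  have detG: "det (matrix (G' y)) = det (matrix (g' (from_idx y)))" for y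
  proof -
    have "matrix (G' y) = (\<chi> a b. matrix (g' (from_idx y)) $ idx_of a $ idx_of b)"
    proof -
      have fa: "from_idx (axis b 1) = axis (idx_of b) (1::real)" for b :: "'n idx"
        by (auto simp: from_idx_def axis_def vec_eq_iff)
      show ?thesis
        unfolding matrix_def G'_def to_idx_def o_def fa by simp
    qed
    then show ?thesis using det_reindex[OF bij_idx_of] by simp
  qed
  have ind: "indicator (to_idx ` E) y = (indicator E (from_idx y) :: real)" for y
    by (simp add: vimE indicator_def)
  have hG: "(\<lambda>y. indicator (to_idx ` E) y * \<bar>det (matrix (G' y))\<bar>) \<in> borel_measurable borel"
    unfolding ind detG using measurable_compose[OF measurable_idx(2) h] .
  have GE: "G ` to_idx ` E = to_idx ` g ` E" by (auto simp: G_def image_iff)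
  have "emeasure lborel (G ` to_idx ` E) = (\<integral>\<^sup>+y. ennreal (indicator (to_idx ` E) y * \<bar>det (matrix (G' y))\<bar>) \<partial>lborel)"
  proof (rule emeasure_injective_image_wellorder)
    show "to_idx ` E \<in> sets borel" by (rule to_idx_sets[OF E])
    show "G ` to_idx ` E \<in> sets borel" unfolding GE by (rule to_idx_sets[OF gE])
    show "inj_on G (to_idx ` E)"
      using inj unfolding inj_on_def G_def by auto (metis idx_inverse(1))
    show "(G has_derivative G' y) (at y within to_idx ` E)" if "y \<in> to_idx ` E" for y
    proof -
      have fy: "from_idx y \<in> E" using that by auto
      have im: "from_idx ` to_idx ` E = E" by (auto simp: image_iff)
      have 1: "(g \<circ> from_idx has_derivative g' (from_idx y) \<circ> from_idx) (at y within to_idx ` E)"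
        by (rule diff_chain_within) (use der[OF fy] im bounded_linear_imp_has_derivative[OF bl_idx(2)] in auto)
      have "(to_idx \<circ> (g \<circ> from_idx) has_derivative to_idx \<circ> (g' (from_idx y) \<circ> from_idx)) (at y within to_idx ` E)"
        by (rule diff_chain_within[OF 1]) (rule bounded_linear_imp_has_derivative[OF bl_idx(1)])
      then show ?thesis by (simp add: G_def G'_def o_assoc)
    qed
  qed (rule hG)
  also have "\<dots> = (\<integral>\<^sup>+x. ennreal (indicator E x * \<bar>det (matrix (g' x))\<bar>) \<partial>lborel)"
    using hG by (subst nn_integral_idx) (auto simp: ind detG)
  also have "emeasure lborel (G ` to_idx ` E) = emeasure lborel (g ` E)"
  proof -
    have "emeasure lborel (to_idx ` g ` E) = emeasure (distr lborel borel to_idx) (to_idx ` g ` E)"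
      by (simp add: distr_to_idx)
    also have "\<dots> = emeasure lborel (to_idx -` to_idx ` g ` E)"
      using to_idx_sets[OF gE] by (subst emeasure_distr) auto
    also have "to_idx -` to_idx ` g ` E = g ` E" by (auto simp: image_iff) (metis idx_inverse(1))
    finally show ?thesis by (simp add: GE)
  qed
  finally show ?thesis .
qed

text \<open>
  The formula for sets, applied to the parts of \<open>E\<close> that \<open>g\<close> maps into a given Borel set, identifies
  two measures; the integrals of \<open>F\<close> with respect to them agree. The function \<open>g\<close> is cut off
  outside \<open>E\<close> to make it Borel measurable on the whole space.
\<close>
theorem nn_integral_change_of_variables:
  fixes g :: "real ^ 'n::finite \<Rightarrow> real ^ 'n"
  assumes E: "E \<in> sets borel" and gE: "g ` E \<in> sets borel" and inj: "inj_on g E"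
    and der: "\<And>x. x \<in> E \<Longrightarrow> (g has_derivative g' x) (at x within E)"
    and h: "(\<lambda>x. indicator E x * \<bar>det (matrix (g' x))\<bar>) \<in> borel_measurable borel"
    and F[measurable]: "F \<in> borel_measurable borel"
  shows "(\<integral>\<^sup>+y. F y * indicator (g ` E) y \<partial>lborel) = (\<integral>\<^sup>+x. F (g x) * ennreal \<bar>det (matrix (g' x))\<bar> * indicator E x \<partial>lborel)"
proof -
  let ?h = "\<lambda>x. indicator E x * \<bar>det (matrix (g' x))\<bar>"
  have cont: "continuous_on E g"
    using der has_derivative_continuous_on by blast
  define g2 where "g2 = (\<lambda>x. indicator E x *\<^sub>R g x)"
  have [measurable]: "g2 \<in> borel_measurable borel" unfolding g2_def
    by (rule borel_measurable_continuous_on_indicator[OF E cont])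
  note [measurable] = h E gE
  have eq: "density lborel (indicator (g ` E)) = distr (density lborel (\<lambda>x. ennreal (?h x))) borel g2"
  proof (rule measure_eqI)
    fix B assume "B \<in> sets (density lborel (indicator (g ` E)))"
    then have B[measurable]: "B \<in> sets borel" by simp
    define EB where "EB = E \<inter> g2 -` B"
    have EB: "EB \<in> sets borel" unfolding EB_def
      using measurable_sets[of g2 borel borel B] E by (intro sets.Int) auto
    have gEB: "g ` EB = g ` E \<inter> B" by (auto simp: EB_def g2_def)
    have "emeasure (density lborel (indicator (g ` E))) B = emeasure lborel (g ` E \<inter> B)"
      by (simp add: emeasure_density indicator_inter_arith[symmetric])
    also have "\<dots> = emeasure lborel (g ` EB)" by (simp add: gEB)
    also have "\<dots> = (\<integral>\<^sup>+x. ennreal (indicator EB x * \<bar>det (matrix (g' x))\<bar>) \<partial>lborel)"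
    proof (rule emeasure_injective_image[OF EB])
      show "g ` EB \<in> sets borel" unfolding gEB by measurable
      show "inj_on g EB" using inj by (auto simp: EB_def intro: inj_on_subset)
      show "(g has_derivative g' x) (at x within EB)" if "x \<in> EB" for x
        using der[of x] that by (auto simp: EB_def intro: has_derivative_subset)
      have "(\<lambda>x. indicator EB x * \<bar>det (matrix (g' x))\<bar>) = (\<lambda>x. indicator EB x * ?h x)"
        by (auto simp: EB_def indicator_def)
      also have "\<dots> \<in> borel_measurable borel" using EB by measurable
      finally show "(\<lambda>x. indicator EB x * \<bar>det (matrix (g' x))\<bar>) \<in> borel_measurable borel" .
    qed
    also have "\<dots> = (\<integral>\<^sup>+x. ennreal (?h x) * indicator (g2 -` B) x \<partial>lborel)"
      by (intro nn_integral_cong) (auto simp: EB_def indicator_def)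
    also have "\<dots> = emeasure (distr (density lborel (\<lambda>x. ennreal (?h x))) borel g2) B"
      using measurable_sets[of g2 borel borel B]
      by (subst emeasure_distr) (auto simp: emeasure_density)
    finally show "emeasure (density lborel (indicator (g ` E))) B = emeasure (distr (density lborel (\<lambda>x. ennreal (?h x))) borel g2) B" .
  qed simp
  have "(\<integral>\<^sup>+y. F y * indicator (g ` E) y \<partial>lborel) = (\<integral>\<^sup>+y. F y \<partial>density lborel (indicator (g ` E)))"
    by (subst nn_integral_density) (auto simp: mult.commute)
  also have "\<dots> = (\<integral>\<^sup>+x. F (g2 x) \<partial>density lborel (\<lambda>x. ennreal (?h x)))"
    unfolding eq by (subst nn_integral_distr) auto
  also have "\<dots> = (\<integral>\<^sup>+x. ennreal (?h x) * F (g2 x) \<partial>lborel)"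
    by (subst nn_integral_density) auto
  also have "\<dots> = (\<integral>\<^sup>+x. F (g x) * ennreal \<bar>det (matrix (g' x))\<bar> * indicator E x \<partial>lborel)"
    by (intro nn_integral_cong) (auto simp: g2_def indicator_def mult.commute)
  finally show ?thesis .
qed


section \<open>Lebesgue measure on coordinate hyperplanes\<close>

lemma coord_embedding_measurable [measurable]:
  "(\<lambda>u. \<chi> j. if j \<in> J then u j else 0) \<in> (\<Pi>\<^sub>M j\<in>(J::'n::finite set). lborel) \<rightarrow>\<^sub>M (borel :: (real ^ 'n) measure)"
proof (subst borel_measurable_euclidean_space, rule ballI)
  fix b :: "real ^ 'n" assume "b \<in> Basis"
  then obtain k where b: "b = axis k 1" by (auto simp: Basis_vec_def)
  have "(\<lambda>u. (if k \<in> J then u k else 0)) \<in> (\<Pi>\<^sub>M j\<in>J. lborel) \<rightarrow>\<^sub>M (borel :: real measure)"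
    by (cases "k \<in> J") auto
  then show "(\<lambda>u. (\<chi> j. if j \<in> J then u j else 0) \<bullet> b) \<in> borel_measurable (\<Pi>\<^sub>M j\<in>J. lborel)"
    by (simp add: b inner_axis)
qed

lemma coord_lebesgue_UNIV: "coord_lebesgue UNIV = (lborel :: (real ^ 'n::finite) measure)"
proof (rule lborel_eqI[symmetric])
  interpret P: product_sigma_finite "\<lambda>_::'n. lborel :: real measure" ..
  fix l u :: "real ^ 'n" assume lu: "\<And>b. b \<in> Basis \<Longrightarrow> l \<bullet> b \<le> u \<bullet> b"
  have le: "l $ a \<le> u $ a" for a
    using lu[of "axis a 1"] by (simp add: inner_axis)
  have vim: "(\<lambda>v. \<chi> j. if j \<in> UNIV then v j else 0) -` box l u \<inter> space (\<Pi>\<^sub>M j\<in>(UNIV::'n set). lborel)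
      = (\<Pi>\<^sub>E j\<in>UNIV. {l $ j<..<u $ j})"
    by (auto simp: space_PiM PiE_def Pi_iff mem_box_cart)
  have "emeasure (coord_lebesgue UNIV) (box l u) = emeasure (\<Pi>\<^sub>M j\<in>(UNIV::'n set). lborel) (\<Pi>\<^sub>E j\<in>UNIV. {l $ j<..<u $ j})"
    unfolding coord_lebesgue_def by (subst emeasure_distr) (auto simp only: vim coord_embedding_measurable sets_lborel borel_open open_box)
  also have "\<dots> = (\<Prod>j\<in>UNIV. emeasure lborel {l $ j<..<u $ j})"
    by (rule P.emeasure_PiM) auto
  also have "\<dots> = ennreal (\<Prod>j\<in>UNIV. (u - l) $ j)"
    using le by (simp add: prod_ennreal)
  finally show "emeasure (coord_lebesgue UNIV) (box l u) = (\<Prod>b\<in>Basis. (u - l) \<bullet> b)"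
    by (simp add: prod_Basis_cart)
qed (simp add: coord_lebesgue_def)

lemma sets_coord_lebesgue [simp, measurable_cong]: "sets (coord_lebesgue J) = sets borel"
  by (simp add: coord_lebesgue_def)

lemma space_coord_lebesgue [simp]: "space (coord_lebesgue J) = UNIV"
  by (simp add: coord_lebesgue_def)

lemma AE_coord_lebesgue: "AE z in coord_lebesgue (UNIV - {i}). z $ i = (0::real)"
proof -
  have "{z::real ^ 'a. z $ i = 0} \<in> sets borel"
    by (intro borel_closed closed_Collect_eq continuous_intros)
  then show ?thesis
    unfolding coord_lebesgue_def by (subst AE_distr_iff[OF coord_embedding_measurable]) auto
qed

theorem nn_integral_lborel_coord:
  fixes F :: "real ^ 'n::finite \<Rightarrow> ennreal"
  assumes F[measurable]: "F \<in> borel_measurable borel"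
  shows "(\<integral>\<^sup>+z. F z \<partial>lborel) = (\<integral>\<^sup>+z. (\<integral>\<^sup>+t. F (z + t *\<^sub>R axis i 1) \<partial>lborel) \<partial>coord_lebesgue (UNIV - {i}))"
proof -
  interpret P: product_sigma_finite "\<lambda>_::'n. lborel :: real measure" ..
  let ?e = "\<lambda>J u. (\<chi> j. if j \<in> J then u j else 0) :: real ^ 'n"
  have ins: "insert i (UNIV - {i}) = (UNIV :: 'n set)" by auto
  have meas: "(\<lambda>u. F (?e UNIV u)) \<in> borel_measurable (\<Pi>\<^sub>M j\<in>UNIV. lborel)"
    using measurable_compose[OF coord_embedding_measurable F] .
  have "(\<integral>\<^sup>+z. F z \<partial>lborel) = (\<integral>\<^sup>+u. F (?e UNIV u) \<partial>(\<Pi>\<^sub>M j\<in>UNIV. lborel))"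
    unfolding coord_lebesgue_UNIV[symmetric] coord_lebesgue_def
    by (subst nn_integral_distr[OF coord_embedding_measurable]) (use F in simp_all)
  also have "\<dots> = (\<integral>\<^sup>+x. (\<integral>\<^sup>+t. F (?e UNIV (x(i := t))) \<partial>lborel) \<partial>(\<Pi>\<^sub>M j\<in>UNIV - {i}. lborel))"
    using P.product_nn_integral_insert[of "UNIV - {i}" i "\<lambda>u. F (?e UNIV u)"] meas by (simp add: ins)
  also have "\<dots> = (\<integral>\<^sup>+x. (\<integral>\<^sup>+t. F (?e (UNIV - {i}) x + t *\<^sub>R axis i 1) \<partial>lborel) \<partial>(\<Pi>\<^sub>M j\<in>UNIV - {i}. lborel))"
  proof -
    have "?e UNIV (x(i := t)) = ?e (UNIV - {i}) x + t *\<^sub>R axis i 1" for x t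
      by (auto simp: vec_eq_iff axis_def)
    then show ?thesis by simp
  qed
  also have "\<dots> = (\<integral>\<^sup>+z. (\<integral>\<^sup>+t. F (z + t *\<^sub>R axis i 1) \<partial>lborel) \<partial>coord_lebesgue (UNIV - {i}))"
    unfolding coord_lebesgue_def
    by (rule nn_integral_distr[symmetric, OF coord_embedding_measurable]) measurable
  finally show ?thesis .
qed

definition flatten :: "'n::finite \<Rightarrow> real ^ 'n \<Rightarrow> real ^ 'n" where
  "flatten i z = z - (z $ i) *\<^sub>R axis i 1"

lemma flatten_nth: "flatten i z $ j = (if j = i then 0 else z $ j)"
  by (simp add: flatten_def axis_def)

lemma linear_flatten: "linear (flatten i)"
  by (auto simp: linear_iff flatten_def algebra_simps)

lemma bounded_linear_flatten: "bounded_linear (flatten i)"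
  using linear_flatten by (simp add: linear_conv_bounded_linear)

lemma measurable_flatten [measurable]: "flatten i \<in> borel_measurable borel"
  by (intro borel_measurable_continuous_onI linear_continuous_on bounded_linear_flatten)

text \<open>
  Integration over a coordinate hyperplane is integration over a slab of thickness one. In this way
  the change of variables formula in full dimension also serves for the boundary.
\<close>
lemma nn_integral_coord_thicken:
  fixes F :: "real ^ 'n::finite \<Rightarrow> ennreal"
  assumes F[measurable]: "F \<in> borel_measurable borel"
  shows "(\<integral>\<^sup>+z. F z \<partial>coord_lebesgue (UNIV - {i})) = (\<integral>\<^sup>+z. F (flatten i z) * indicator {z. 0 < z $ i \<and> z $ i < 1} z \<partial>lborel)"
proof -
  let ?S = "{z::real ^ 'n. 0 < z $ i \<and> z $ i < 1}"
  have S: "?S \<in> sets borel"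
  proof -
    have "open {z::real ^ 'n. 0 < z $ i}" "open {z::real ^ 'n. z $ i < 1}"
      by (auto intro!: open_Collect_less continuous_intros)
    moreover have "?S = {z. 0 < z $ i} \<inter> {z. z $ i < 1}" by auto
    ultimately show ?thesis by (simp add: open_Int borel_open)
  qed
  have "(\<integral>\<^sup>+z. F (flatten i z) * indicator ?S z \<partial>lborel)
     = (\<integral>\<^sup>+z. (\<integral>\<^sup>+t. F (flatten i (z + t *\<^sub>R axis i 1)) * indicator ?S (z + t *\<^sub>R axis i 1) \<partial>lborel) \<partial>coord_lebesgue (UNIV - {i}))"
    by (rule nn_integral_lborel_coord) (use S in measurable)
  also have "\<dots> = (\<integral>\<^sup>+z. F z \<partial>coord_lebesgue (UNIV - {i}))"
  proof (rule nn_integral_cong_AE)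
    show "AE z in coord_lebesgue (UNIV - {i}). (\<integral>\<^sup>+t. F (flatten i (z + t *\<^sub>R axis i 1)) * indicator ?S (z + t *\<^sub>R axis i 1) \<partial>lborel) = F z"
      using AE_coord_lebesgue[of i]
    proof eventually_elim
      fix z :: "real ^ 'n" assume z: "z $ i = 0"
      have fz: "flatten i (z + t *\<^sub>R axis i 1) = z" for t
        using z by (auto simp: vec_eq_iff flatten_nth axis_def)
      have iz: "indicator ?S (z + t *\<^sub>R axis i 1) = (indicator {0<..<1} t :: ennreal)" for t
        using z by (auto simp: indicator_def axis_def)
      show "(\<integral>\<^sup>+t. F (flatten i (z + t *\<^sub>R axis i 1)) * indicator ?S (z + t *\<^sub>R axis i 1) \<partial>lborel) = F z"
        unfolding fz iz by (simp add: nn_integral_cmult_indicator)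
    qed
  qed
  finally show ?thesis by simp
qed

lemma emeasure_coord_lebesgue_bounded:
  fixes E :: "(real ^ 'n::finite) set"
  assumes "bounded E" "E \<in> sets borel"
  shows "emeasure (coord_lebesgue (UNIV - {i})) E < \<infinity>"
proof -
  obtain R where R: "\<And>x. x \<in> E \<Longrightarrow> norm x \<le> R" using assms(1) by (auto simp: bounded_iff)
  have "emeasure (coord_lebesgue (UNIV - {i})) E = (\<integral>\<^sup>+z. indicator E z \<partial>coord_lebesgue (UNIV - {i}))"
    using assms(2) by simp
  also have "\<dots> = (\<integral>\<^sup>+z. indicator E (flatten i z) * indicator {z. 0 < z $ i \<and> z $ i < 1} z \<partial>lborel)"
    by (rule nn_integral_coord_thicken) (use assms(2) in simp)
  also have "\<dots> \<le> (\<integral>\<^sup>+z. indicator (cball (0::real ^ 'n) (R + 1)) z \<partial>lborel)"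
  proof (rule nn_integral_mono)
    fix z :: "real ^ 'n"
    have "norm z \<le> R + 1" if "flatten i z \<in> E" "0 < z $ i" "z $ i < 1"
    proof -
      have "z = flatten i z + (z $ i) *\<^sub>R axis i 1" by (simp add: flatten_def)
      then have "norm z \<le> norm (flatten i z) + norm ((z $ i) *\<^sub>R axis i (1::real))"
        by (metis norm_triangle_ineq)
      then show ?thesis using R[OF that(1)] that by simp
    qed
    then show "indicator E (flatten i z) * indicator {z. 0 < z $ i \<and> z $ i < 1} z \<le> (indicator (cball (0::real ^ 'n) (R + 1)) z :: ennreal)"
      by (auto simp: indicator_def)
  qed
  also have "\<dots> < \<infinity>"
    using emeasure_bounded_finite[OF bounded_cball, of "0::real ^ 'n" "R + 1"] by simp
  finally show ?thesis .
qed

section \<open>Gram determinants of spacelike linear maps\<close>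

definition form_matrix :: "(real ^ 'n::finite \<Rightarrow> real ^ 'n \<Rightarrow> real) \<Rightarrow> real ^ 'n ^ 'n" where
  "form_matrix b = (\<chi> j k. b (axis j 1) (axis k 1))"

lemma bilinear_form_matrix:
  assumes "bilinear b"
  shows "b v w = v \<bullet> (form_matrix b *v w)"
proof -
  have v: "v = (\<Sum>j\<in>UNIV. v $ j *\<^sub>R axis j 1)" and w: "w = (\<Sum>j\<in>UNIV. w $ j *\<^sub>R axis j 1)"
    using basis_expansion[of v] basis_expansion[of w] by (simp_all add: scalar_mult_eq_scaleR)
  have "b v w = (\<Sum>(j,k)\<in>UNIV \<times> UNIV. b (v $ j *\<^sub>R axis j 1) (w $ k *\<^sub>R axis k 1))"
    by (subst v, subst w) (rule bilinear_sum[OF assms])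
  also have "\<dots> = (\<Sum>j\<in>UNIV. \<Sum>k\<in>UNIV. v $ j * (b (axis j 1) (axis k 1) * w $ k))"
    by (simp add: sum.cartesian_product bilinear_lmul[OF assms] bilinear_rmul[OF assms] mult_ac)
  also have "\<dots> = v \<bullet> (form_matrix b *v w)"
    by (simp add: inner_vec_def matrix_vector_mult_def form_matrix_def sum_distrib_left)
  finally show ?thesis .
qed

lemma inner_matrix_transpose: "(M *v v) \<bullet> y = v \<bullet> (transpose M *v y)" for M :: "real ^ 'n::finite ^ 'm::finite"
  by (metis dot_lmul_matrix inner_commute transpose_matrix_vector)

lemma det_form_compose:
  fixes L :: "real ^ 'n::finite \<Rightarrow> real ^ 'n"
  assumes b: "bilinear b" and L: "linear L"
  shows "det (form_matrix (\<lambda>v w. b (L v) (L w))) = (det (matrix L))\<^sup>2 * det (form_matrix b)"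
proof -
  have "form_matrix (\<lambda>v w. b (L v) (L w)) = transpose (matrix L) ** form_matrix b ** matrix L"
  proof -
    have "b (L v) (L w) = v \<bullet> ((transpose (matrix L) ** form_matrix b ** matrix L) *v w)" for v w
    proof -
      have Lmat: "L v = matrix L *v v" for v using L by (simp add: matrix_works)
      show ?thesis
        by (simp only: Lmat bilinear_form_matrix[OF b] inner_matrix_transpose matrix_vector_mul_assoc matrix_mul_assoc)
    qed
    then show ?thesis
      by (simp add: form_matrix_def vec_eq_iff inner_axis' matrix_vector_mult_basis column_def)
  qed
  then show ?thesis by (simp add: det_mul det_transpose power2_eq_square)
qed

lemma bilinear_mink_compose:
  assumes "linear D"
  shows "bilinear (\<lambda>v w. mink (D v) (D w))"
  using assms unfolding bilinear_def mink_def
  by (auto simp: linear_iff inner_add_left inner_add_right algebra_simps)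

text \<open>
  The Minkowski metric on a spacelike hyperplane, written in the projected coordinates: \<open>l\<close> is the
  linear functional whose graph is the hyperplane. A rotation takes \<open>l\<close> to a multiple of a
  coordinate vector, which makes the matrix diagonal.
\<close>
lemma det_one_minus_outer:
  fixes l :: "real ^ 'n::finite"
  shows "det (form_matrix (\<lambda>v w. v \<bullet> w - (l \<bullet> v) * (l \<bullet> w))) = 1 - l \<bullet> l"
proof -
  let ?b = "\<lambda>v w. v \<bullet> w - (l \<bullet> v) * (l \<bullet> w)"
  have b: "bilinear ?b"
    unfolding bilinear_def by (auto simp: linear_iff inner_add_left inner_add_right algebra_simps)
  fix k :: 'n
  define u where "u = (if l = 0 then axis k 1 else l /\<^sub>R norm l)"
  have u: "norm u = 1" "l = norm l *\<^sub>R u" by (auto simp: u_def)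
  obtain Q where Q: "orthogonal_matrix Q" "Q *v (axis k 1) = u"
    using orthogonal_matrix_exists_basis[OF u(1), of k] by metis
  have orth: "(Q *v v) \<bullet> (Q *v w) = v \<bullet> w" for v w
    using Q(1) by (simp add: orthogonal_matrix_def inner_matrix_transpose matrix_vector_mul_assoc)
  have lQ: "l \<bullet> (Q *v v) = norm l * v $ k" for v
    using orth[of "axis k 1" v] by (subst u(2)) (simp add: Q(2) inner_axis')
  have dQ: "(det Q)\<^sup>2 = 1" using det_orthogonal_matrix[OF Q(1)] by auto
  have "det (form_matrix ?b) = det (form_matrix (\<lambda>v w. ?b (Q *v v) (Q *v w)))"
    using det_form_compose[OF b matrix_vector_mul_linear[of Q]] by (simp add: dQ)
  also have "form_matrix (\<lambda>v w. ?b (Q *v v) (Q *v w)) = (\<chi> i j. if i = j then (if i = k then 1 - l \<bullet> l else 1) else 0)"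
    by (simp add: form_matrix_def vec_eq_iff orth lQ inner_axis_axis) (auto simp: axis_def power2_norm_eq_inner[symmetric] power2_eq_square)
  also have "det \<dots> = (\<Prod>i\<in>UNIV. (if i = k then 1 - l \<bullet> l else 1))"
    by (subst det_diagonal) auto
  also have "\<dots> = 1 - l \<bullet> l" by simp
  finally show ?thesis .
qed

text \<open>
  Cramer's rule for the \<open>i\<close>-th component of \<open>x\<close>. Replacing the \<open>i\<close>-th column by \<open>axis i 1\<close> has the same
  effect on the determinant as padding the minor with the identity matrix, which is the form of the
  Gram determinant in \<open>volume_density\<close>.
\<close>
lemma det_principal_minor:
  fixes G :: "real ^ 'n::finite ^ 'n"
  assumes "det G \<noteq> 0" "G *v x = axis i 1"
  shows "det (\<chi> j k. if j \<in> UNIV - {i} \<and> k \<in> UNIV - {i} then G $ j $ k else of_bool (j = k)) = x $ i * det G"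
proof -
  let ?C = "\<chi> j k. if k = i then axis i (1::real) $ j else G $ j $ k"
  have "x $ i = det ?C / det G"
    using cramer[OF assms(1), of x "axis i 1"] assms(2) by simp
  then have "det ?C = x $ i * det G" using assms(1) by simp
  moreover have "det (\<chi> j k. if j \<in> UNIV - {i} \<and> k \<in> UNIV - {i} then G $ j $ k else of_bool (j = k)) = det ?C"
    unfolding det_def
  proof (rule sum.cong[OF refl])
    fix p assume "p \<in> {p. p permutes (UNIV :: 'n set)}"
    then have p: "p permutes UNIV" by simp
    let ?M = "\<chi> j k. if j \<in> UNIV - {i} \<and> k \<in> UNIV - {i} then G $ j $ k else of_bool (j = k)"
    have "(\<Prod>j\<in>UNIV. ?M $ j $ p j) = (\<Prod>j\<in>UNIV. ?C $ j $ p j)"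
    proof (cases "p i = i")
      case True
      then have peq: "p j = i \<longleftrightarrow> j = i" for j using permutes_inj[OF p] by (metis injD)
      have "?M $ j $ p j = ?C $ j $ p j" for j
        using True peq[of j] by (cases "j = i") (auto simp: axis_def)
      then show ?thesis by simp
    next
      case False
      obtain j where j: "p j = i" using permutes_surj[OF p] by (metis surjD)
      then have "j \<noteq> i" using False by auto
      then have "?M $ j $ p j = 0" "?C $ j $ p j = 0" using j by (auto simp: axis_def)
      then show ?thesis by (metis (no_types, lifting) UNIV_I finite prod_zero)
    qed
    then show "of_int (sign p) * (\<Prod>j\<in>UNIV. ?M $ j $ p j) = of_int (sign p) * (\<Prod>j\<in>UNIV. ?C $ j $ p j)" by simp
  qed
  ultimately show ?thesis by simp
qed

text \<open>
  The differential of a chart of a spacelike hypersurface at a point.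
\<close>
locale spacelike_map =
  fixes D :: "real ^ 'n::finite \<Rightarrow> 'n minkowski"
  assumes lin: "linear D" and pos: "\<And>v. v \<noteq> 0 \<Longrightarrow> mink (D v) (D v) > 0"
begin

abbreviation "A \<equiv> matrix (snd \<circ> D)"
abbreviation "G \<equiv> form_matrix (\<lambda>v w. mink (D v) (D w))"

lemma lin_snd: "linear (snd \<circ> D)"
  using lin by (auto simp: linear_iff)

lemma inj_snd: "inj (snd \<circ> D)"
proof (subst linear_injective_0[OF lin_snd], intro allI impI)
  fix v assume "(snd \<circ> D) v = 0"
  then have "mink (D v) (D v) \<le> 0" by (simp add: mink_def)
  then show "v = 0" using pos[of v] by linarith
qed

lemma det_A: "det A \<noteq> 0"
  using inj_snd det_nz_iff_inj[OF lin_snd] by simp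

lemma ex_preimage: "\<exists>v. snd (D v) = w"
proof -
  have "surj (snd \<circ> D)" using linear_injective_imp_surjective[OF lin_snd inj_snd] by simp
  then show ?thesis by (metis comp_apply surjD)
qed

text \<open>
  The image of \<open>D\<close> is the graph of a linear functional over the horizontal hyperplane. Its slope is
  less than 1, as the tangent vector over \<open>l\<close> is spacelike.
\<close>
lemma ex_slope: "\<exists>l. norm l < 1 \<and> (\<forall>v. fst (D v) = l \<bullet> snd (D v))"
proof -
  obtain g where g: "linear g" "g \<circ> (snd \<circ> D) = id"
    using linear_injective_left_inverse[OF lin_snd inj_snd] by blast
  then have gv: "g (snd (D v)) = v" for v by (metis comp_apply id_apply)
  define l where "l = (\<chi> k. fst (D (g (axis k 1))))"
  have l: "fst (D (g w)) = l \<bullet> w" for w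
  proof -
    have lf: "linear (\<lambda>w. fst (D (g w)))" using g(1) lin by (auto simp: linear_iff)
    have "fst (D (g w)) = fst (D (g (\<Sum>k\<in>UNIV. w $ k *\<^sub>R axis k 1)))"
      using basis_expansion[of w] by (simp add: scalar_mult_eq_scaleR)
    also have "\<dots> = (\<Sum>k\<in>UNIV. w $ k * fst (D (g (axis k 1))))"
      by (simp add: linear_sum[OF lf] linear_cmul[OF lf])
    finally show ?thesis by (simp add: inner_vec_def l_def mult.commute)
  qed
  have "norm l < 1"
  proof (cases "l = 0")
    case False
    obtain v where v: "snd (D v) = l" using ex_preimage by blast
    then have "v \<noteq> 0" using False linear_0[OF lin] by auto
    moreover have "fst (D v) = l \<bullet> snd (D v)" using l[of "snd (D v)"] by (simp only: gv)
    ultimately have "l \<bullet> l - (l \<bullet> l) * (l \<bullet> l) > 0"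
      using pos[of v] by (simp add: mink_def v)
    then have "l \<bullet> l * (1 - l \<bullet> l) > 0" by (simp add: algebra_simps)
    then have "l \<bullet> l < 1" by (smt (verit) inner_ge_zero zero_less_mult_iff)
    then show ?thesis by (simp add: norm_eq_sqrt_inner)
  qed auto
  then show ?thesis using l gv by (metis)
qed

lemma det_G:
  assumes l: "\<And>v. fst (D v) = l \<bullet> snd (D v)"
  shows "det G = (det A)\<^sup>2 * (1 - l \<bullet> l)"
proof -
  let ?b = "\<lambda>v w. v \<bullet> w - (l \<bullet> v) * (l \<bullet> w)"
  have b: "bilinear ?b"
    unfolding bilinear_def by (auto simp: linear_iff inner_add_left inner_add_right algebra_simps)
  have "G = form_matrix (\<lambda>v w. ?b ((snd \<circ> D) v) ((snd \<circ> D) w))"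
    by (simp add: form_matrix_def mink_def l)
  then show ?thesis
    using det_form_compose[OF b lin_snd] by (simp only: det_one_minus_outer)
qed

text \<open>
  Up to sign, \<open>u $ i * det A\<close> is the flux of the horizontal vector \<open>snd (D u)\<close> through the projection
  of the facet of the coordinate cube that is orthogonal to \<open>axis i 1\<close>; the square root
  of the determinant on the right is the area of the facet in the induced metric. Let \<open>D x\<close> be dual
  to the \<open>i\<close>-th coordinate, that is \<open>G *v x = axis i 1\<close>. Then \<open>u $ i = mink (D u) (D x)\<close>, which by the Cauchy-Schwarz inequality is at
  most \<open>norm (snd (D u)) * sqrt (x $ i)\<close>, and \<open>x $ i * det G\<close> is the Gram determinant of the facet
  by \<open>det_principal_minor\<close>, where \<open>det G\<close> is given by \<open>det_G\<close>.
\<close>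
lemma boundary_density:
  assumes l: "\<And>v. fst (D v) = l \<bullet> snd (D v)" and l1: "norm l < 1"
  shows "\<bar>u $ i\<bar> * (\<bar>det A\<bar> * sqrt (1 - l \<bullet> l)) \<le>
     norm (snd (D u)) * sqrt (det (\<chi> j k. if j \<in> UNIV - {i} \<and> k \<in> UNIV - {i} then G $ j $ k else of_bool (j = k)))"
proof -
  have ll: "l \<bullet> l < 1" using l1 by (simp add: norm_eq_sqrt_inner)
  have dG: "det G > 0" using det_G[OF l] det_A ll by simp
  then have "invertible G" by (simp add: invertible_det_nz)
  then obtain G' where "G ** G' = mat 1" by (auto simp: invertible_def)
  then obtain x where x: "G *v x = axis i 1"
    by (metis matrix_vector_mul_assoc matrix_vector_mul_lid)
  note b = bilinear_form_matrix[OF bilinear_mink_compose[OF lin]]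
  let ?wu = "snd (D u)" and ?wx = "snd (D x)"
  have ui: "u $ i = ?wu \<bullet> (?wx - (l \<bullet> ?wx) *\<^sub>R l)"
    using b[of u x] x by (simp add: inner_axis mink_def l inner_diff_right inner_commute[of "snd (D u)" l] mult.commute)
  have xi: "x $ i = ?wx \<bullet> ?wx - (l \<bullet> ?wx)\<^sup>2"
    using b[of x x] x by (simp add: inner_axis mink_def l power2_eq_square)
  have "(norm (?wx - (l \<bullet> ?wx) *\<^sub>R l))\<^sup>2 = ?wx \<bullet> ?wx - 2 * (l \<bullet> ?wx)\<^sup>2 + (l \<bullet> l) * (l \<bullet> ?wx)\<^sup>2"
    unfolding power2_norm_eq_inner
    by (simp add: inner_diff_left inner_diff_right inner_commute[of "snd (D x)" l] power2_eq_square algebra_simps)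
  also have "\<dots> \<le> x $ i"
    using mult_right_mono[OF less_imp_le[OF ll], of "(l \<bullet> ?wx)\<^sup>2"] by (simp add: xi)
  finally have nx: "norm (?wx - (l \<bullet> ?wx) *\<^sub>R l) \<le> sqrt (x $ i)"
    by (simp add: real_le_rsqrt)
  have "\<bar>u $ i\<bar> \<le> norm ?wu * norm (?wx - (l \<bullet> ?wx) *\<^sub>R l)"
    unfolding ui by (rule Cauchy_Schwarz_ineq2)
  also have "\<dots> \<le> norm ?wu * sqrt (x $ i)"
    using nx by (intro mult_left_mono) auto
  finally have "\<bar>u $ i\<bar> * (\<bar>det A\<bar> * sqrt (1 - l \<bullet> l)) \<le> norm ?wu * sqrt (x $ i) * (\<bar>det A\<bar> * sqrt (1 - l \<bullet> l))"
    using ll by (intro mult_right_mono) auto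
  also have "\<dots> = norm ?wu * sqrt (x $ i * det G)"
    by (simp add: det_G[OF l] real_sqrt_mult)
  finally show ?thesis
    using det_principal_minor[OF _ x] dG by simp
qed

end


section \<open>Projected charts and transition maps\<close>

lemma Ck_on_subset: "Ck_on k U f \<Longrightarrow> W \<subseteq> U \<Longrightarrow> Ck_on k W f"
  by (induction k arbitrary: f) (auto intro: continuous_on_subset)

lemma isCont_nbhd:
  fixes f :: "'a::metric_space \<Rightarrow> 'b::topological_space"
  assumes "isCont f a" "open N" "f a \<in> N"
  obtains s where "s > 0" "\<And>x. dist x a < s \<Longrightarrow> f x \<in> N"
proof -
  have "(f \<longlongrightarrow> f a) (nhds a)"
    using assms(1) by (simp add: isCont_def tendsto_at_iff_tendsto_nhds)
  then have "\<forall>\<^sub>F x in nhds a. f x \<in> N" using assms(2,3) by (rule topological_tendstoD)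
  then show ?thesis using that unfolding eventually_nhds_metric by blast
qed

abbreviation dd :: "('a::real_normed_vector \<Rightarrow> 'b::real_normed_vector) \<Rightarrow> 'a \<Rightarrow> 'a \<Rightarrow> 'b" where
  "dd f y \<equiv> frechet_derivative f (at y)"

lemma smooth_on_openD:
  assumes "smooth_on_open U f"
  shows "open U" "continuous_on U f" "\<And>x. x \<in> U \<Longrightarrow> (f has_derivative dd f x) (at x)"
    "\<And>v. continuous_on U (\<lambda>x. dd f x v)"
proof -
  have k: "Ck_on k U f" for k using assms by (auto simp: smooth_on_open_def)
  show "open U" using assms by (simp add: smooth_on_open_def)
  show "continuous_on U f" using k[of 0] by simp
  show "(f has_derivative dd f x) (at x)" if "x \<in> U" for x
    using k[of "Suc 0"] that frechet_derivative_works by auto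
  show "continuous_on U (\<lambda>x. dd f x v)" for v using k[of "Suc 0"] by simp
qed

lemma half_dom_iff: "x \<in> half_dom i U \<longleftrightarrow> x \<in> U \<and> 0 \<le> x $ i"
  by (auto simp: half_dom_def)

lemma bdry_dom_iff: "x \<in> bdry_dom i U \<longleftrightarrow> x \<in> U \<and> x $ i = 0"
  by (auto simp: bdry_dom_def)

lemma borel_half_dom [measurable]: "open U \<Longrightarrow> half_dom i U \<in> sets borel" "open U \<Longrightarrow> bdry_dom i U \<in> sets borel"
proof -
  have "closed {y::real ^ 'a. 0 \<le> y $ i}" "closed {y::real ^ 'a. y $ i = 0}"
    by (auto intro!: closed_Collect_le closed_Collect_eq continuous_intros)
  then show "open U \<Longrightarrow> half_dom i U \<in> sets borel" "open U \<Longrightarrow> bdry_dom i U \<in> sets borel"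
    unfolding half_dom_def bdry_dom_def by (auto intro!: sets.Int simp: borel_open borel_closed)
qed

text \<open>
  At every point of a half space, small positive multiples of the basis vectors lead into the half
  space.
\<close>
lemma derivative_unique_half_dom:
  fixes f :: "real ^ 'n::finite \<Rightarrow> 'b::real_normed_vector"
  assumes "open U" "x \<in> half_dom i U"
    and "(f has_derivative f') (at x within half_dom i U)" "(f has_derivative f'') (at x within half_dom i U)"
  shows "f' = f''"
proof (rule frechet_derivative_unique_within[OF assms(3,4)])
  fix b :: "real ^ 'n" and e :: real assume b: "b \<in> Basis" and e: "e > 0"
  obtain d where d: "d > 0" "ball x d \<subseteq> U"
    using assms(1,2) by (auto simp: half_dom_iff open_contains_ball)
  let ?t = "min (e/2) (d/2)"
  have t: "?t > 0" "?t < e" "?t < d" using e d by auto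
  have "x + ?t *\<^sub>R b \<in> U"
    using d(2) t b by (auto simp: subset_eq dist_norm)
  moreover have "0 \<le> (x + ?t *\<^sub>R b) $ i"
  proof -
    have "0 \<le> b $ i" using b by (auto simp: Basis_vec_def axis_def)
    then show ?thesis using assms(2) t by (simp add: half_dom_iff)
  qed
  ultimately show "\<exists>d. 0 < \<bar>d\<bar> \<and> \<bar>d\<bar> < e \<and> x + d *\<^sub>R b \<in> half_dom i U"
    using t by (intro exI[of _ ?t]) (auto simp: half_dom_iff)
qed

lemma local_paramD:
  assumes "local_param S i U \<phi>"
  shows "open U" "continuous_on U \<phi>" "\<And>x. x \<in> U \<Longrightarrow> (\<phi> has_derivative dd \<phi> x) (at x)"
    "\<And>v. continuous_on U (\<lambda>x. dd \<phi> x v)"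
    "\<And>x. x \<in> half_dom i U \<Longrightarrow> inj (dd \<phi> x)"
    "openin (top_of_set S) (\<phi> ` half_dom i U)" "\<phi> ` half_dom i U \<subseteq> S"
    "inj_on \<phi> (half_dom i U)"
  using assms smooth_on_openD[of U \<phi>] unfolding local_param_def
  by (auto simp: openin_imp_subset homeomorphism_def inj_on_def intro: openin_imp_subset[THEN subsetD])
    (metis (no_types, lifting))+

lemma local_param_restrict:
  assumes "local_param S i U \<phi>" "open W" "W \<subseteq> U"
  shows "local_param S i W \<phi>"
proof -
  have sub: "half_dom i W \<subseteq> half_dom i U" using assms(3) by (auto simp: half_dom_def)
  have op: "openin (top_of_set (half_dom i U)) (half_dom i W)"
    unfolding openin_open using assms(2,3) by (intro exI[of _ W]) (auto simp: half_dom_def)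
  obtain \<psi> where h: "homeomorphism (half_dom i U) (\<phi> ` half_dom i U) \<phi> \<psi>"
    using assms(1) by (auto simp: local_param_def)
  have "openin (top_of_set (\<phi> ` half_dom i U)) (\<phi> ` half_dom i W)"
    by (rule homeomorphism_imp_open_map[OF h op])
  then have "openin (top_of_set S) (\<phi> ` half_dom i W)"
    using local_paramD(6)[OF assms(1)] openin_trans by blast
  moreover have "homeomorphism (half_dom i W) (\<phi> ` half_dom i W) \<phi> \<psi>"
    by (rule homeomorphism_of_subsets[OF h sub]) auto
  moreover have "smooth_on_open W \<phi>"
    using assms by (auto simp: smooth_on_open_def local_param_def intro: Ck_on_subset)
  ultimately show ?thesis
    using assms(1) sub unfolding local_param_def by blast
qed

locale spacelike_hypersurface =
  fixes S :: "'n::finite minkowski set"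
  assumes hyp: "smooth_hypersurface S" and comp: "compact S" and space: "spacelike S"
begin

lemma chart_spacelike:
  assumes "local_param S i U \<phi>" "y \<in> half_dom i U"
  shows "spacelike_map (dd \<phi> y)"
proof (rule spacelike_map.intro)
  have y: "y \<in> U" using assms by (simp add: half_dom_iff)
  show "linear (dd \<phi> y)" using local_paramD(3)[OF assms(1) y] by (rule has_derivative_linear)
  then have 0: "dd \<phi> y 0 = 0" by (rule linear_0)
  show "mink (dd \<phi> y v) (dd \<phi> y v) > 0" if "v \<noteq> 0" for v
  proof -
    have "dd \<phi> y v \<noteq> 0" using that local_paramD(5)[OF assms] 0 by (metis injD)
    moreover have "dd \<phi> y v \<in> tangent_space S (\<phi> y)"
      using assms unfolding tangent_space_def by blast
    moreover have "\<phi> y \<in> S" using assms local_paramD(7)[OF assms(1)] by blast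
    ultimately show ?thesis using space by (auto simp: spacelike_def)
  qed
qed

text \<open>
  The inverse function theorem for the projected chart \<open>snd \<circ> \<phi>\<close>, whose derivative is invertible
  because a spacelike hyperplane contains no vertical vector. It is applied to the smooth map on
  the whole open set \<open>U\<close>, so the inverse is defined beyond the boundary.
\<close>
lemma chart_inverse:
  assumes lp: "local_param S i U \<phi>" and a: "a \<in> half_dom i U"
  obtains W V g where "open W" "a \<in> W" "W \<subseteq> U" "open V" "homeomorphism W V (snd \<circ> \<phi>) g"
    "\<And>x. x \<in> W \<Longrightarrow> bij (snd \<circ> dd \<phi> x)"
    "\<And>x. x \<in> W \<Longrightarrow> (g has_derivative inv (snd \<circ> dd \<phi> x)) (at ((snd \<circ> \<phi>) x))"
proof -
  interpret spacelike_map "dd \<phi> a" by (rule chart_spacelike[OF lp a])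
  let ?f = "snd \<circ> \<phi>"
  define f' where "f' = (\<lambda>x. Blinfun (snd \<circ> dd \<phi> x))"
  have bl: "bounded_linear (snd \<circ> dd \<phi> x)" if "x \<in> U" for x
    using bounded_linear_compose[OF bounded_linear_snd has_derivative_bounded_linear[OF local_paramD(3)[OF lp that]]]
    by (simp add: o_def)
  have f': "blinfun_apply (f' x) = snd \<circ> dd \<phi> x" if "x \<in> U" for x
    unfolding f'_def by (rule bounded_linear_Blinfun_apply[OF bl[OF that]])
  have aU: "a \<in> U" using a by (simp add: half_dom_iff)
  have bij_a: "bij (snd \<circ> dd \<phi> a)"
    using inj_snd linear_injective_imp_surjective[OF lin_snd inj_snd] by (simp add: bij_def)
  define ig where "ig = Blinfun (inv (snd \<circ> dd \<phi> a))"
  have "linear (inv (snd \<circ> dd \<phi> a))"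
    by (rule inj_linear_imp_inv_linear[OF lin_snd inj_snd])
  then have "blinfun_apply ig = inv (snd \<circ> dd \<phi> a)"
    unfolding ig_def by (intro bounded_linear_Blinfun_apply) (simp add: linear_conv_bounded_linear)
  then have invf: "ig o\<^sub>L f' a = id_blinfun"
    by (intro blinfun_eqI) (use bij_a f'[OF aU] inv_f_f[OF bij_is_inj[OF bij_a]] in auto)
  have der: "(?f has_derivative blinfun_apply (f' x)) (at x)" if "x \<in> U" for x
    unfolding f'[OF that]
    using bounded_linear.has_derivative[OF bounded_linear_snd local_paramD(3)[OF lp that]] by (simp add: o_def)
  have cont: "continuous_on U f'"
  proof (rule continuous_on_blinfun_componentwise)
    fix b :: "real ^ 'n" assume "b \<in> Basis"
    have "continuous_on U (\<lambda>x. snd (dd \<phi> x b))"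
      by (intro continuous_intros local_paramD(4)[OF lp])
    then show "continuous_on U (\<lambda>x. blinfun_apply (f' x) b)"
      by (rule continuous_on_eq) (simp add: f')
  qed
  obtain W V g g' where "open W" and WU: "W \<subseteq> U" and "a \<in> W" "open V" "?f a \<in> V" and h: "homeomorphism W V ?f g"
    and g1: "\<And>y. y \<in> V \<Longrightarrow> (g has_derivative (g' y)) (at y)"
    and g2: "\<And>y. y \<in> V \<Longrightarrow> g' y = inv (blinfun_apply (f' (g y)))"
    and g3: "\<And>y. y \<in> V \<Longrightarrow> bij (blinfun_apply (f' (g y)))"
    using inverse_function_theorem[OF local_paramD(1)[OF lp] der cont aU invf] by blast
  have x: "?f x \<in> V" "g (?f x) = x" if "x \<in> W" for x
    using h that unfolding homeomorphism_def by auto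
  show ?thesis
  proof (rule that[OF \<open>open W\<close> \<open>a \<in> W\<close> WU \<open>open V\<close> h])
    fix y assume y: "y \<in> W"
    then have yU: "y \<in> U" using WU by auto
    show "bij (snd \<circ> dd \<phi> y)" using g3[OF x(1)[OF y]] unfolding x(2)[OF y] f'[OF yU] .
    show "(g has_derivative inv (snd \<circ> dd \<phi> y)) (at ((snd \<circ> \<phi>) y))"
      using g1[OF x(1)[OF y]] g2[OF x(1)[OF y]] unfolding x(2)[OF y] f'[OF yU] by simp
  qed
qed

text \<open>
  The projected chart is a diffeomorphism from the full ball onto an open set, with inverse \<open>g\<close>. The
  closed ball in the domain gives bounds on continuous quantities.
\<close>
definition flat_chart :: "'n \<Rightarrow> (real ^ 'n) set \<Rightarrow> (real ^ 'n \<Rightarrow> 'n minkowski) \<Rightarrow> real ^ 'n \<Rightarrow> real \<Rightarrow> (real ^ 'n \<Rightarrow> real ^ 'n) \<Rightarrow> bool" where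
  "flat_chart i U \<phi> a r g \<longleftrightarrow> local_param S i U \<phi> \<and> cball a r \<subseteq> U \<and> 0 \<le> a $ i \<and> r > 0 \<and>
     open ((snd \<circ> \<phi>) ` ball a r) \<and> homeomorphism (ball a r) ((snd \<circ> \<phi>) ` ball a r) (snd \<circ> \<phi>) g \<and>
     (\<forall>x\<in>ball a r. bij (snd \<circ> dd \<phi> x) \<and> (g has_derivative inv (snd \<circ> dd \<phi> x)) (at ((snd \<circ> \<phi>) x)))"

lemma flat_chartD:
  assumes "flat_chart i U \<phi> a r g"
  shows "local_param S i U \<phi>" "cball a r \<subseteq> U" "0 \<le> a $ i" "r > 0" "open ((snd \<circ> \<phi>) ` ball a r)"
    "homeomorphism (ball a r) ((snd \<circ> \<phi>) ` ball a r) (snd \<circ> \<phi>) g"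
    "\<And>x. x \<in> ball a r \<Longrightarrow> bij (snd \<circ> dd \<phi> x)"
    "\<And>x. x \<in> ball a r \<Longrightarrow> (g has_derivative inv (snd \<circ> dd \<phi> x)) (at (snd (\<phi> x)))"
    "local_param S i (ball a r) \<phi>"
    "a \<in> half_dom i (ball a r)"
    "\<And>x. x \<in> ball a r \<Longrightarrow> g (snd (\<phi> x)) = x"
    "inj_on (snd \<circ> \<phi>) (ball a r)"
proof -
  note d = assms[unfolded flat_chart_def]
  show lp: "local_param S i U \<phi>" and sub: "cball a r \<subseteq> U" and a: "0 \<le> a $ i" and r: "r > 0" and "open ((snd \<circ> \<phi>) ` ball a r)"
    and h: "homeomorphism (ball a r) ((snd \<circ> \<phi>) ` ball a r) (snd \<circ> \<phi>) g" using d by blast+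
  show "\<And>x. x \<in> ball a r \<Longrightarrow> bij (snd \<circ> dd \<phi> x)"
    "\<And>x. x \<in> ball a r \<Longrightarrow> (g has_derivative inv (snd \<circ> dd \<phi> x)) (at (snd (\<phi> x)))" using d by auto
  show "local_param S i (ball a r) \<phi>"
    by (rule local_param_restrict[OF lp]) (use sub ball_subset_cball in auto)
  show "a \<in> half_dom i (ball a r)" using a r by (simp add: half_dom_iff)
  show g: "\<And>x. x \<in> ball a r \<Longrightarrow> g (snd (\<phi> x)) = x" using h by (auto simp: homeomorphism_def)
  show "inj_on (snd \<circ> \<phi>) (ball a r)" by (rule inj_on_inverseI[of _ g]) (simp add: g)
qed

lemma flat_chart_exists:
  assumes lp: "local_param S i U \<phi>" and a: "a \<in> half_dom i U"
  obtains r0 g where "r0 > 0" "\<And>r. 0 < r \<Longrightarrow> r \<le> r0 \<Longrightarrow> flat_chart i U \<phi> a r g"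
proof -
  obtain W V g where W: "open W" "a \<in> W" "W \<subseteq> U" "open V" and h: "homeomorphism W V (snd \<circ> \<phi>) g"
    and b: "\<And>x. x \<in> W \<Longrightarrow> bij (snd \<circ> dd \<phi> x)"
    and g: "\<And>x. x \<in> W \<Longrightarrow> (g has_derivative inv (snd \<circ> dd \<phi> x)) (at ((snd \<circ> \<phi>) x))"
    using chart_inverse[OF lp a] by metis
  obtain r0 where r0: "r0 > 0" "cball a r0 \<subseteq> W" using W(1,2) by (meson open_contains_cball)
  have "flat_chart i U \<phi> a r g" if r: "0 < r" "r \<le> r0" for r
    unfolding flat_chart_def
  proof (intro conjI ballI)
    have sub: "cball a r \<subseteq> W" using r0 r subset_cball[OF r(2), of a] by blast
    have sub2: "ball a r \<subseteq> W" using sub ball_subset_cball by blast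
    show "cball a r \<subseteq> U" using sub W by blast
    show "0 \<le> a $ i" using a by (simp add: half_dom_iff)
    have "openin (top_of_set V) ((snd \<circ> \<phi>) ` ball a r)"
      by (rule homeomorphism_imp_open_map[OF h]) (use sub2 W(1) in \<open>simp add: openin_open_eq\<close>)
    then show "open ((snd \<circ> \<phi>) ` ball a r)" using W(4) openin_open_eq by blast
    show "homeomorphism (ball a r) ((snd \<circ> \<phi>) ` ball a r) (snd \<circ> \<phi>) g"
      by (rule homeomorphism_of_subsets[OF h sub2]) (use sub2 h in \<open>auto simp: homeomorphism_def\<close>)
    fix x assume "x \<in> ball a r"
    then have "x \<in> W" using sub2 by blast
    then show "bij (snd \<circ> dd \<phi> x)" "(g has_derivative inv (snd \<circ> dd \<phi> x)) (at ((snd \<circ> \<phi>) x))"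
      using b g by blast+
  qed (use lp r in auto)
  then show ?thesis using that r0(1) by blast
qed

lemma openin_SE:
  assumes "openin (top_of_set S) X"
  obtains N where "open N" "X = S \<inter> N"
  using assms by (auto simp: openin_open)

lemma snd_locally_inj:
  assumes "p \<in> S"
  obtains N where "open N" "p \<in> N" "inj_on snd (S \<inter> N)"
proof -
  obtain i U \<phi> a where lp: "local_param S i U \<phi>" and a: "a \<in> half_dom i U" "\<phi> a = p"
    using hyp assms unfolding smooth_hypersurface_def by (metis imageE)
  obtain r g where fc: "flat_chart i U \<phi> a r g"
    using flat_chart_exists[OF lp a(1)] by (metis order_refl)
  obtain N where N: "open N" "\<phi> ` half_dom i (ball a r) = S \<inter> N"
    using openin_SE[OF local_paramD(6)[OF flat_chartD(9)[OF fc]]] by metis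
  have "p \<in> N" using flat_chartD(10)[OF fc] a(2) N(2) by blast
  moreover have "inj_on snd (S \<inter> N)"
    using flat_chartD(12)[OF fc] unfolding N(2)[symmetric] inj_on_def half_dom_def by auto
  ultimately show ?thesis using N(1) that by blast
qed

text \<open>
  Near a point of \<open>S\<close> the projection is injective on \<open>S\<close>. Hence the transition map between two charts
  is the composition of one projected chart with the inverse of the other, and this composition
  extends the transition map differentiably across the boundary hyperplane.
\<close>
lemma transition:
  assumes c: "local_param S i U \<phi>" and d: "local_param S j V \<psi>"
    and a: "a \<in> half_dom i U" and b: "b \<in> half_dom j V" and ab: "\<phi> a = \<psi> b"
  obtains r T where "r > 0" "ball a r \<subseteq> U" "T ` ball a r \<subseteq> V" "T a = b"
    "\<And>W. open W \<Longrightarrow> W \<subseteq> ball a r \<Longrightarrow> open (T ` W)"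
    "\<And>x. x \<in> ball a r \<Longrightarrow> \<exists>T'. (T has_derivative T') (at x)"
    "\<And>x. x \<in> ball a r \<Longrightarrow> 0 \<le> x $ i \<Longrightarrow> T x \<in> half_dom j V \<and> \<psi> (T x) = \<phi> x"
proof -
  obtain r1 g1 where f1: "\<And>r. 0 < r \<Longrightarrow> r \<le> r1 \<Longrightarrow> flat_chart i U \<phi> a r g1" and r1: "r1 > 0"
    using flat_chart_exists[OF c a] by metis
  obtain r2 g2 where f2: "flat_chart j V \<psi> b r2 g2"
    using flat_chart_exists[OF d b] by (metis order_refl)
  let ?f = "snd \<circ> \<phi>" and ?h = "snd \<circ> \<psi>"
  have aU: "a \<in> U" using a by (simp add: half_dom_iff)
  obtain N where N: "open N" "\<psi> ` half_dom j (ball b r2) = S \<inter> N"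
    using openin_SE[OF local_paramD(6)[OF flat_chartD(9)[OF f2]]] by metis
  have pN: "\<phi> a \<in> N" using flat_chartD(10)[OF f2] N(2) ab by blast
  have "isCont \<phi> a" using local_paramD(3)[OF c aU] has_derivative_continuous by blast
  then have cf: "isCont ?f a" by (intro continuous_intros) (auto simp: o_def intro!: continuous_intros)
  have "?f a \<in> ?h ` ball b r2"
    using ab flat_chartD(4)[OF f2] by (auto simp: image_iff intro!: bexI[of _ b])
  then obtain s1 where s1: "s1 > 0" "\<And>x. dist x a < s1 \<Longrightarrow> ?f x \<in> ?h ` ball b r2"
    using isCont_nbhd[OF cf flat_chartD(5)[OF f2]] by blast
  obtain s2 where s2: "s2 > 0" "\<And>x. dist x a < s2 \<Longrightarrow> \<phi> x \<in> N"
    using isCont_nbhd[OF \<open>isCont \<phi> a\<close> N(1) pN] by blast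
  define r where "r = min r1 (min s1 s2)"
  have r: "r > 0" "r \<le> r1" "r \<le> s1" "r \<le> s2" using r1 s1 s2 by (auto simp: r_def)
  have fr: "flat_chart i U \<phi> a r g1" using f1 r by blast
  define T where "T = g2 \<circ> ?f"
  have img: "?f x \<in> ?h ` ball b r2" if "x \<in> ball a r" for x
    using s1(2)[of x] that r by (simp add: dist_commute)
  have Tin: "T x \<in> ball b r2" "snd (\<psi> (T x)) = snd (\<phi> x)" if x: "x \<in> ball a r" for x
  proof -
    obtain w where w: "w \<in> ball b r2" "snd (\<phi> x) = snd (\<psi> w)" using img[OF x] by auto
    then have "T x = w" using flat_chartD(11)[OF f2 w(1)] by (simp add: T_def)
    then show "T x \<in> ball b r2" "snd (\<psi> (T x)) = snd (\<phi> x)" using w by auto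
  qed
  have b2V: "ball b r2 \<subseteq> V" using flat_chartD(2)[OF f2] ball_subset_cball by blast
  show ?thesis
  proof (rule that[of r T])
    show "r > 0" by fact
    show "ball a r \<subseteq> U" using flat_chartD(2)[OF fr] ball_subset_cball by blast
    show "T ` ball a r \<subseteq> V" using Tin b2V by blast
    have "b \<in> ball b r2" using flat_chartD(4)[OF f2] by simp
    then show "T a = b" using flat_chartD(11)[OF f2, of b] ab by (simp add: T_def)
    show "open (T ` W)" if W: "open W" "W \<subseteq> ball a r" for W
    proof -
      have "openin (top_of_set (?f ` ball a r)) (?f ` W)"
        by (rule homeomorphism_imp_open_map[OF flat_chartD(6)[OF fr]]) (use W in \<open>simp add: openin_open_eq\<close>)
      then have o1: "open (?f ` W)" using flat_chartD(5)[OF fr] openin_open_eq by blast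
      have "openin (top_of_set (ball b r2)) (g2 ` (?f ` W))"
      proof (rule homeomorphism_imp_open_map)
        show "homeomorphism (?h ` ball b r2) (ball b r2) g2 ?h"
          using flat_chartD(6)[OF f2] homeomorphism_symD by blast
        have "?f ` W \<subseteq> ?h ` ball b r2" using img W(2) by blast
        then show "openin (top_of_set (?h ` ball b r2)) (?f ` W)"
          using o1 flat_chartD(5)[OF f2] by (simp add: openin_open_eq)
      qed
      then have "open (g2 ` (?f ` W))" using openin_open_eq[OF open_ball] by blast
      then show ?thesis by (simp only: T_def image_comp)
    qed
    show "\<exists>T'. (T has_derivative T') (at x)" if x: "x \<in> ball a r" for x
    proof -
      have xU: "x \<in> U" using x flat_chartD(2)[OF fr] ball_subset_cball by blast
      have "(?f has_derivative (\<lambda>v. snd (dd \<phi> x v))) (at x)"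
        using bounded_linear.has_derivative[OF bounded_linear_snd local_paramD(3)[OF c xU]] by (simp add: o_def)
      moreover have "(g2 has_derivative inv (snd \<circ> dd \<psi> (T x))) (at (?f x))"
        using flat_chartD(8)[OF f2 Tin(1)[OF x]] Tin(2)[OF x] by simp
      ultimately show ?thesis
        unfolding T_def using diff_chain_at by blast
    qed
    show "T x \<in> half_dom j V \<and> \<psi> (T x) = \<phi> x" if x: "x \<in> ball a r" "0 \<le> x $ i" for x
    proof -
      have "x \<in> half_dom i U" using x flat_chartD(2)[OF fr] ball_subset_cball by (auto simp: half_dom_iff)
      then have "\<phi> x \<in> S" using local_paramD(7)[OF c] by blast
      moreover have "\<phi> x \<in> N" using s2(2)[of x] x r by (simp add: dist_commute)
      ultimately obtain w where w: "w \<in> half_dom j (ball b r2)" "\<phi> x = \<psi> w" using N(2) by blast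
      then have "T x = w" using flat_chartD(11)[OF f2, of w] by (simp add: T_def half_dom_iff)
      then show ?thesis using w b2V by (auto simp: half_dom_iff)
    qed
  qed
qed

lemma transition_derivative:
  assumes "local_param S i U \<phi>" "local_param S j V \<psi>" "open W" "W \<subseteq> U" "x \<in> half_dom i W" "T ` W \<subseteq> V"
    and T': "(T has_derivative T') (at x)"
    and eq: "\<And>z. z \<in> W \<Longrightarrow> 0 \<le> z $ i \<Longrightarrow> \<psi> (T z) = \<phi> z"
  shows "dd \<phi> x = dd \<psi> (T x) \<circ> T'"
proof (rule derivative_unique_half_dom[OF assms(3,5)])
  have xW: "x \<in> W" using assms(5) by (simp add: half_dom_iff)
  have xU: "x \<in> U" "T x \<in> V" using assms(4,6) xW by auto
  show "(\<phi> has_derivative dd \<phi> x) (at x within half_dom i W)"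
    by (rule has_derivative_at_withinI[OF local_paramD(3)[OF assms(1) xU(1)]])
  have "(\<psi> \<circ> T has_derivative dd \<psi> (T x) \<circ> T') (at x)"
    by (rule diff_chain_at[OF T' local_paramD(3)[OF assms(2) xU(2)]])
  then have "(\<psi> \<circ> T has_derivative dd \<psi> (T x) \<circ> T') (at x within half_dom i W)"
    by (rule has_derivative_at_withinI)
  then show "(\<phi> has_derivative dd \<psi> (T x) \<circ> T') (at x within half_dom i W)"
    by (rule has_derivative_transform_within[OF _ zero_less_one assms(5)]) (use eq in \<open>auto simp: half_dom_iff\<close>)
qed

lemma tangent_space_chart:
  assumes "local_param S i U \<phi>" "a \<in> half_dom i U"
  shows "tangent_space S (\<phi> a) = range (dd \<phi> a)"
proof
  show "range (dd \<phi> a) \<subseteq> tangent_space S (\<phi> a)" using assms unfolding tangent_space_def by blast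
  show "tangent_space S (\<phi> a) \<subseteq> range (dd \<phi> a)"
  proof
    fix v assume "v \<in> tangent_space S (\<phi> a)"
    then obtain j V \<psi> b where d: "local_param S j V \<psi>" and b: "b \<in> half_dom j V" "\<psi> b = \<phi> a" and v: "v \<in> range (dd \<psi> b)"
      by (auto simp: tangent_space_def)
    obtain r T where T: "r > 0" "ball b r \<subseteq> V" "T ` ball b r \<subseteq> U" "T b = a"
      "\<And>x. x \<in> ball b r \<Longrightarrow> \<exists>T'. (T has_derivative T') (at x)"
      "\<And>x. x \<in> ball b r \<Longrightarrow> 0 \<le> x $ j \<Longrightarrow> T x \<in> half_dom i U \<and> \<phi> (T x) = \<psi> x"
      by (rule transition[OF d assms(1) b(1) assms(2) b(2)]) blast
    obtain T' where T': "(T has_derivative T') (at b)" using T(1,5) by (meson centre_in_ball)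
    have "dd \<psi> b = dd \<phi> (T b) \<circ> T'"
      by (rule transition_derivative[OF d assms(1) open_ball T(2) _ T(3) T']) (use T b(1) in \<open>auto simp: half_dom_iff\<close>)
    then show "v \<in> range (dd \<phi> a)" using v T(4) by auto
  qed
qed

text \<open>
  A transition map is open near an interior point, so it cannot map into a closed half space and
  attain its boundary there.
\<close>
lemma interior_point_transfer:
  assumes c: "local_param S i U \<phi>" and d: "local_param S j V \<psi>"
    and a: "a \<in> half_dom i U" and b: "b \<in> half_dom j V" and ab: "\<phi> a = \<psi> b" and pos: "a $ i > 0"
  shows "b $ j > 0"
proof (rule ccontr)
  assume "\<not> b $ j > 0"
  then have b0: "b $ j = 0" using b by (simp add: half_dom_iff)
  obtain r T where T: "r > 0" "T a = b" "\<And>W. open W \<Longrightarrow> W \<subseteq> ball a r \<Longrightarrow> open (T ` W)"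
      "\<And>x. x \<in> ball a r \<Longrightarrow> 0 \<le> x $ i \<Longrightarrow> T x \<in> half_dom j V \<and> \<psi> (T x) = \<phi> x"
    by (rule transition[OF c d a b ab]) blast
  let ?W = "ball a r \<inter> {x. 0 < x $ i}"
  have "open {x::real ^ 'n. 0 < x $ i}" by (intro open_Collect_less continuous_intros)
  then have "open (T ` ?W)" by (intro T(3) open_Int) auto
  moreover have "b \<in> T ` ?W"
    by (rule image_eqI[of _ _ a]) (use T(1,2) pos in auto)
  ultimately obtain e where e: "e > 0" "ball b e \<subseteq> T ` ?W" by (meson open_contains_ball)
  have "b - (e/2) *\<^sub>R axis j 1 \<in> ball b e" using e(1) by (simp add: dist_norm)
  then have "b - (e/2) *\<^sub>R axis j 1 \<in> T ` ?W" using e(2) by blast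
  then obtain x where "b - (e/2) *\<^sub>R axis j 1 = T x" "x \<in> ?W" by (rule imageE)
  then have "0 \<le> (b - (e/2) *\<^sub>R axis j 1) $ j" using T(4)[of x] by (auto simp only: half_dom_iff)
  then show False using b0 e(1) by (simp add: axis_def)
qed

lemma hbdry_chart:
  assumes c: "local_param S i U \<phi>" and a: "a \<in> half_dom i U"
  shows "\<phi> a \<in> hbdry S \<longleftrightarrow> a $ i = 0"
proof
  assume "\<phi> a \<in> hbdry S"
  then obtain j V \<psi> b where d: "local_param S j V \<psi>" "b \<in> bdry_dom j V" "\<phi> a = \<psi> b"
    unfolding hbdry_def by blast
  then have b: "b \<in> half_dom j V" "b $ j = 0" by (auto simp: half_dom_iff bdry_dom_iff)
  then show "a $ i = 0"
    using interior_point_transfer[OF c d(1) a b(1) d(3)] a by (force simp: half_dom_iff)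
next
  assume "a $ i = 0"
  then have "a \<in> bdry_dom i U" using a by (simp add: half_dom_iff bdry_dom_iff)
  then show "\<phi> a \<in> hbdry S" using c unfolding hbdry_def by blast
qed

end


section \<open>Volume densities and gluing of measures\<close>

lemma continuous_on_det:
  fixes M :: "'a::topological_space \<Rightarrow> real ^ 'n::finite ^ 'n"
  assumes "\<And>j k. continuous_on X (\<lambda>x. M x $ j $ k)"
  shows "continuous_on X (\<lambda>x. det (M x))"
  unfolding det_def by (intro continuous_intros assms)

lemma continuous_volume_density:
  assumes "local_param S i U \<phi>"
  shows "continuous_on U (volume_density J \<phi>)"
proof -
  have e: "continuous_on U (\<lambda>y. metric_matrix \<phi> y $ j $ k)" for j k
    unfolding metric_matrix_def partial_def mink_def
    by (simp, intro continuous_intros local_paramD(4)[OF assms])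
  have "continuous_on U (\<lambda>y. det (\<chi> j k. if j \<in> J \<and> k \<in> J then metric_matrix \<phi> y $ j $ k else of_bool (j = k)))"
  proof (rule continuous_on_det)
    fix j k
    show "continuous_on U (\<lambda>y. (\<chi> j k. if j \<in> J \<and> k \<in> J then metric_matrix \<phi> y $ j $ k else of_bool (j = k)) $ j $ k)"
      by (cases "j \<in> J \<and> k \<in> J") (auto intro: e)
  qed
  then show ?thesis unfolding volume_density_def by (intro continuous_intros)
qed

lemma metric_matrix_form: "metric_matrix \<phi> y = form_matrix (\<lambda>v w. mink (dd \<phi> y v) (dd \<phi> y w))"
  by (simp add: metric_matrix_def partial_def form_matrix_def)

lemma volume_density_UNIV: "volume_density UNIV \<phi> y = sqrt (det (form_matrix (\<lambda>v w. mink (dd \<phi> y v) (dd \<phi> y w))))"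
proof -
  have "(\<chi> j k. metric_matrix \<phi> y $ j $ k) = metric_matrix \<phi> y" by (simp add: vec_eq_iff)
  then show ?thesis by (simp add: volume_density_def metric_matrix_form)
qed

text \<open>
  Padding a principal minor with the identity amounts to making the omitted coordinate direction a
  unit vector that is orthogonal to the others.
\<close>
lemma volume_density_bdry:
  assumes "linear (dd \<phi> y)"
  shows "volume_density (UNIV - {i}) \<phi> y =
    sqrt (det (form_matrix (\<lambda>v w. mink (dd \<phi> y (flatten i v)) (dd \<phi> y (flatten i w)) + v $ i * w $ i)))"
proof -
  have fl: "flatten i (axis j (1::real)) = (if j = i then 0 else axis j 1)" for j
    by (auto simp: vec_eq_iff flatten_nth axis_def)
  have m0: "mink 0 w = 0" "mink w 0 = 0" for w :: "'a minkowski" by (auto simp: mink_def)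
  have ax: "axis j (1::real) $ i = (if j = i then 1 else 0)" for j by (auto simp: axis_def)
  have "(\<chi> j k. if j \<in> UNIV - {i} \<and> k \<in> UNIV - {i} then metric_matrix \<phi> y $ j $ k else of_bool (j = k)) =
    form_matrix (\<lambda>v w. mink (dd \<phi> y (flatten i v)) (dd \<phi> y (flatten i w)) + v $ i * w $ i)"
    by (auto simp: vec_eq_iff form_matrix_def metric_matrix_def partial_def fl ax linear_0[OF assms] m0)
  then show ?thesis by (simp add: volume_density_def)
qed

lemma borel_continuous_preimage:
  fixes f :: "'a::topological_space \<Rightarrow> 'b::real_normed_vector"
  assumes "D \<in> sets borel" "continuous_on D f" "B \<in> sets borel"
  shows "D \<inter> f -` B \<in> sets borel"
proof -
  have "(\<lambda>x. indicator D x *\<^sub>R f x) \<in> borel_measurable borel"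
    by (rule borel_measurable_continuous_on_indicator[OF assms(1,2)])
  from measurable_sets[OF this assms(3)]
  have "D \<inter> (\<lambda>x. indicator D x *\<^sub>R f x) -` B \<in> sets borel" using assms(1) by (intro sets.Int) auto
  moreover have "D \<inter> (\<lambda>x. indicator D x *\<^sub>R f x) -` B = D \<inter> f -` B" by auto
  ultimately show ?thesis by simp
qed

lemma sets_restrict_borel_iff: "B \<in> sets (restrict_space borel X) \<longleftrightarrow> (\<exists>B'\<in>sets borel. B = X \<inter> B')"
  by (auto simp: sets_restrict_space)

text \<open>
  The image under \<open>\<phi>\<close> of the measure with density \<open>w\<close> on the domain \<open>D\<close>; the target space \<open>X\<close> is \<open>S\<close> or
  its boundary.
\<close>
definition chart_measure :: "'a::topological_space set \<Rightarrow> 'b::topological_space measure \<Rightarrow> 'b set \<Rightarrow> ('b \<Rightarrow> real) \<Rightarrow> ('b \<Rightarrow> 'a) \<Rightarrow> 'a measure" where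
  "chart_measure X \<Lambda> D w \<phi> = distr (density (restrict_space \<Lambda> D) (\<lambda>y. ennreal (w y))) (restrict_space borel X) \<phi>"

lemma chart_measure:
  fixes \<phi> :: "'b::topological_space \<Rightarrow> 'a::real_normed_vector"
  assumes \<Lambda>: "sets \<Lambda> = sets borel" and D: "D \<in> sets borel" and w: "continuous_on D w" and \<phi>: "continuous_on D \<phi>" "\<phi> ` D \<subseteq> X"
  shows "sets (chart_measure X \<Lambda> D w \<phi>) = sets (restrict_space borel X)"
    and "q \<in> borel_measurable (restrict_space borel X) \<Longrightarrow>
      (\<integral>\<^sup>+p. q p \<partial>chart_measure X \<Lambda> D w \<phi>) = (\<integral>\<^sup>+y. ennreal (w y) * q (\<phi> y) * indicator D y \<partial>\<Lambda>)"
    and "B \<in> sets (restrict_space borel X) \<Longrightarrow>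
      emeasure (chart_measure X \<Lambda> D w \<phi>) B = (\<integral>\<^sup>+y. ennreal (w y) * indicator (D \<inter> \<phi> -` B) y \<partial>\<Lambda>)"
proof -
  have D': "D \<inter> space \<Lambda> \<in> sets \<Lambda>" using D \<Lambda> by (simp add: sets_eq_imp_space_eq[OF \<Lambda>])
  have rs: "sets (restrict_space \<Lambda> D) = sets (restrict_space borel D)"
    by (rule sets_restrict_space_cong[OF \<Lambda>])
  have wm: "(\<lambda>y. ennreal (w y)) \<in> borel_measurable (restrict_space \<Lambda> D)"
    using borel_measurable_continuous_on_restrict[OF w] measurable_cong_sets[OF rs refl]
    by (intro measurable_compose[OF _ measurable_ennreal]) blast
  have "\<phi> \<in> borel_measurable (restrict_space borel D)"
    by (rule borel_measurable_continuous_on_restrict[OF \<phi>(1)])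
  then have "\<phi> \<in> restrict_space borel D \<rightarrow>\<^sub>M restrict_space borel X"
    using \<phi>(2) by (intro measurable_restrict_space2) (auto simp: space_restrict_space)
  then have \<phi>m: "\<phi> \<in> restrict_space \<Lambda> D \<rightarrow>\<^sub>M restrict_space borel X"
    using measurable_cong_sets[OF rs refl] by blast
  then have \<phi>m': "\<phi> \<in> density (restrict_space \<Lambda> D) (\<lambda>y. ennreal (w y)) \<rightarrow>\<^sub>M restrict_space borel X"
    by simp
  show "sets (chart_measure X \<Lambda> D w \<phi>) = sets (restrict_space borel X)" by (simp add: chart_measure_def)
  show int: "(\<integral>\<^sup>+p. q p \<partial>chart_measure X \<Lambda> D w \<phi>) = (\<integral>\<^sup>+y. ennreal (w y) * q (\<phi> y) * indicator D y \<partial>\<Lambda>)"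
    if q: "q \<in> borel_measurable (restrict_space borel X)" for q
  proof -
    have qm: "(\<lambda>y. q (\<phi> y)) \<in> borel_measurable (restrict_space \<Lambda> D)" by (rule measurable_compose[OF \<phi>m q])
    have "(\<integral>\<^sup>+p. q p \<partial>chart_measure X \<Lambda> D w \<phi>) = (\<integral>\<^sup>+y. q (\<phi> y) \<partial>density (restrict_space \<Lambda> D) (\<lambda>y. ennreal (w y)))"
      unfolding chart_measure_def by (rule nn_integral_distr[OF \<phi>m']) (use q in simp)
    also have "\<dots> = (\<integral>\<^sup>+y. ennreal (w y) * q (\<phi> y) \<partial>restrict_space \<Lambda> D)"
      by (rule nn_integral_density[OF wm qm])
    also have "\<dots> = (\<integral>\<^sup>+y. ennreal (w y) * q (\<phi> y) * indicator D y \<partial>\<Lambda>)"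
      by (rule nn_integral_restrict_space[OF D'])
    finally show ?thesis .
  qed
  show "emeasure (chart_measure X \<Lambda> D w \<phi>) B = (\<integral>\<^sup>+y. ennreal (w y) * indicator (D \<inter> \<phi> -` B) y \<partial>\<Lambda>)"
    if B: "B \<in> sets (restrict_space borel X)"
  proof -
    have "emeasure (chart_measure X \<Lambda> D w \<phi>) B = (\<integral>\<^sup>+p. indicator B p \<partial>chart_measure X \<Lambda> D w \<phi>)"
      using B by (simp add: chart_measure_def)
    also have "\<dots> = (\<integral>\<^sup>+y. ennreal (w y) * indicator B (\<phi> y) * indicator D y \<partial>\<Lambda>)"
      by (rule int) (use B in simp)
    also have "\<dots> = (\<integral>\<^sup>+y. ennreal (w y) * indicator (D \<inter> \<phi> -` B) y \<partial>\<Lambda>)"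
      by (intro nn_integral_cong) (auto simp: indicator_def)
    finally show ?thesis .
  qed
qed

text \<open>
  Finitely many of the sets cover the space. Disjointifying them gives a partition, and the glued
  measure of a set is the sum of the given measures of its pieces. Agreement on overlaps makes the
  result correct on all the sets of the family.
\<close>
lemma glue_measures:
  fixes N :: "'c \<Rightarrow> 'a measure" and V :: "'c \<Rightarrow> 'a set"
  assumes sN: "\<And>c. c \<in> C \<Longrightarrow> sets (N c) = sets A" and K: "finite K" "K \<subseteq> C"
    and V: "\<And>c. c \<in> C \<Longrightarrow> V c \<in> sets A" and cover: "space A \<subseteq> (\<Union>k\<in>K. V k)"
    and agree: "\<And>c d B. c \<in> C \<Longrightarrow> d \<in> C \<Longrightarrow> B \<in> sets A \<Longrightarrow> B \<subseteq> V c \<Longrightarrow> B \<subseteq> V d \<Longrightarrow> emeasure (N c) B = emeasure (N d) B"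
  shows "\<exists>M. sets M = sets A \<and> (\<forall>c\<in>C. \<forall>B\<in>sets A. B \<subseteq> V c \<longrightarrow> emeasure M B = emeasure (N c) B)"
proof -
  obtain e where e: "bij_betw e {0..<card K} K"
    using ex_bij_betw_nat_finite[OF K(1)] by blast
  define n where "n = card K"
  have eK: "e i \<in> K" "e i \<in> C" if "i < n" for i
    using e that K(2) by (auto simp: bij_betw_def n_def)
  define P where "P = (\<lambda>i. V (e i) - (\<Union>j<i. V (e j)))"
  have P: "P i \<in> sets A" if "i < n" for i
    unfolding P_def using V eK that by (intro sets.Diff sets.finite_UN) auto
  have Pcov: "space A \<subseteq> (\<Union>i<n. P i)"
  proof
    fix x assume "x \<in> space A"
    then obtain k where "k \<in> K" "x \<in> V k" using cover by blast
    then have ex: "\<exists>i. i < n \<and> x \<in> V (e i)" using e by (force simp: bij_betw_def n_def)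
    define i where "i = (LEAST i. i < n \<and> x \<in> V (e i))"
    have i: "i < n \<and> x \<in> V (e i)" unfolding i_def by (rule LeastI_ex[OF ex])
    moreover have "x \<notin> V (e j)" if "j < i" for j
      using not_less_Least[of j "\<lambda>i. i < n \<and> x \<in> V (e i)"] that i by (auto simp: i_def)
    ultimately show "x \<in> (\<Union>i<n. P i)" by (auto simp: P_def)
  qed
  have Pdisj: "disjoint_family_on P {..<n}"
    unfolding disjoint_family_on_def
  proof (intro ballI impI)
    fix a b :: nat assume "a \<noteq> b"
    then consider "a < b" | "b < a" by linarith
    then show "P a \<inter> P b = {}" by cases (auto simp: P_def)
  qed
  define \<mu> where "\<mu> = (\<lambda>B. \<Sum>i<n. emeasure (N (e i)) (B \<inter> P i))"
  define M where "M = measure_of (space A) (sets A) \<mu>"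
  have sM: "sets M = sets A" unfolding M_def by (rule sets.sets_measure_of_eq)
  have emM: "emeasure M B = \<mu> B" if "B \<in> sets A" for B
  proof (rule emeasure_measure_of[OF M_def])
    show "sets A \<subseteq> Pow (space A)" by (rule sets.space_closed)
    show "B \<in> sets M" using that sM by simp
    show "positive (sets M) \<mu>" by (simp add: positive_def \<mu>_def)
    show "countably_additive (sets M) \<mu>"
      unfolding countably_additive_def
    proof (intro allI impI)
      fix F :: "nat \<Rightarrow> 'a set"
      assume F: "range F \<subseteq> sets M" "disjoint_family F" "\<Union> (range F) \<in> sets M"
      have "(\<Sum>m. \<mu> (F m)) = (\<Sum>i<n. \<Sum>m. emeasure (N (e i)) (F m \<inter> P i))"
        unfolding \<mu>_def by (rule suminf_sum) (rule summableI)
      also have "\<dots> = \<mu> (\<Union> (range F))"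
        unfolding \<mu>_def
      proof (rule sum.cong[OF refl])
        fix i assume "i \<in> {..<n}"
        then have i: "i < n" by simp
        have "(\<Sum>m. emeasure (N (e i)) (F m \<inter> P i)) = emeasure (N (e i)) (\<Union>m. F m \<inter> P i)"
        proof (rule suminf_emeasure)
          show "range (\<lambda>m. F m \<inter> P i) \<subseteq> sets (N (e i))"
            using F(1) P[OF i] sN[OF eK(2)[OF i]] sM by auto
          show "disjoint_family (\<lambda>m. F m \<inter> P i)"
            using F(2) by (auto simp: disjoint_family_on_def)
        qed
        also have "(\<Union>m. F m \<inter> P i) = \<Union> (range F) \<inter> P i" by auto
        finally show "(\<Sum>m. emeasure (N (e i)) (F m \<inter> P i)) = emeasure (N (e i)) (\<Union> (range F) \<inter> P i)" .
      qed
      finally show "(\<Sum>m. \<mu> (F m)) = \<mu> (\<Union> (range F))" .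
    qed
  qed
  have "emeasure M B = emeasure (N c) B" if c: "c \<in> C" and B: "B \<in> sets A" "B \<subseteq> V c" for c B
  proof -
    have "emeasure M B = (\<Sum>i<n. emeasure (N c) (B \<inter> P i))"
      unfolding emM[OF B(1)] \<mu>_def
    proof (rule sum.cong[OF refl])
      fix i assume "i \<in> {..<n}"
      then have i: "i < n" by simp
      show "emeasure (N (e i)) (B \<inter> P i) = emeasure (N c) (B \<inter> P i)"
        by (rule agree[OF eK(2)[OF i] c sets.Int[OF B(1) P[OF i]]]) (use B(2) in \<open>auto simp: P_def\<close>)
    qed
    also have "\<dots> = emeasure (N c) (\<Union>i<n. B \<inter> P i)"
    proof (rule sum_emeasure)
      show "(\<lambda>i. B \<inter> P i) ` {..<n} \<subseteq> sets (N c)" using B P sN[OF c] by auto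
      show "disjoint_family_on (\<lambda>i. B \<inter> P i) {..<n}"
        using Pdisj by (auto simp: disjoint_family_on_def)
    qed simp
    also have "(\<Union>i<n. B \<inter> P i) = B" using Pcov sets.sets_into_space[OF B(1)] by blast
    finally show ?thesis .
  qed
  then show ?thesis using sM by blast
qed

lemma nn_integral_eq_on:
  assumes s: "sets N = sets M" and V: "V \<in> sets M" and eq: "\<And>B. B \<in> sets M \<Longrightarrow> B \<subseteq> V \<Longrightarrow> emeasure M B = emeasure N B"
    and q: "q \<in> borel_measurable M" "\<And>x. x \<in> space M \<Longrightarrow> x \<notin> V \<Longrightarrow> q x = 0"
  shows "(\<integral>\<^sup>+x. q x \<partial>M) = (\<integral>\<^sup>+x. q x \<partial>N)"
proof -
  have sp: "space N = space M" using s by (rule sets_eq_imp_space_eq)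
  have qN: "q \<in> borel_measurable N" using q(1) measurable_cong_sets[OF s refl] by blast
  have VN: "V \<in> sets N" using V s by simp
  have d: "density M (indicator V) = density N (indicator V)"
  proof (rule measure_eqI)
    fix B assume "B \<in> sets (density M (indicator V))"
    then have B: "B \<in> sets M" by simp
    have "emeasure (density M (indicator V)) B = emeasure M (V \<inter> B)"
      using B V by (simp add: emeasure_density indicator_inter_arith[symmetric])
    also have "\<dots> = emeasure N (V \<inter> B)" using B V by (intro eq) auto
    also have "\<dots> = emeasure (density N (indicator V)) B"
      using B VN s by (simp add: emeasure_density indicator_inter_arith[symmetric])
    finally show "emeasure (density M (indicator V)) B = emeasure (density N (indicator V)) B" .
  qed (simp add: s)
  have "(\<integral>\<^sup>+x. q x \<partial>M) = (\<integral>\<^sup>+x. indicator V x * q x \<partial>M)"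
    by (intro nn_integral_cong) (auto simp: indicator_def q(2))
  also have "\<dots> = (\<integral>\<^sup>+x. q x \<partial>density M (indicator V))"
    by (rule nn_integral_density[symmetric]) (use V q in auto)
  also have "\<dots> = (\<integral>\<^sup>+x. indicator V x * q x \<partial>N)"
    unfolding d by (rule nn_integral_density) (use VN qN in auto)
  also have "\<dots> = (\<integral>\<^sup>+x. q x \<partial>N)"
    by (intro nn_integral_cong) (auto simp: indicator_def q(2) sp)
  finally show ?thesis .
qed

context spacelike_hypersurface
begin

lemma volume_density_pos:
  assumes "local_param S i U \<phi>" "x \<in> half_dom i U"
  shows "volume_density UNIV \<phi> x > 0" "volume_density (UNIV - {k}) \<phi> x > 0"
proof -
  interpret spacelike_map "dd \<phi> x" by (rule chart_spacelike[OF assms])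
  obtain l where l: "norm l < 1" "\<And>v. fst (dd \<phi> x v) = l \<bullet> snd (dd \<phi> x v)" using ex_slope by blast
  have ll: "l \<bullet> l < 1" using l(1) by (simp add: norm_eq_sqrt_inner)
  show "volume_density UNIV \<phi> x > 0"
    unfolding volume_density_UNIV using det_G[OF l(2)] det_A ll by simp
  have "0 < \<bar>axis k (1::real) $ k\<bar> * (\<bar>det A\<bar> * sqrt (1 - l \<bullet> l))" using det_A ll by simp
  also have "\<dots> \<le> norm (snd (dd \<phi> x (axis k 1))) * volume_density (UNIV - {k}) \<phi> x"
    using boundary_density[OF l(2,1), of "axis k 1" k] unfolding volume_density_def metric_matrix_form .
  finally show "volume_density (UNIV - {k}) \<phi> x > 0"
    by (metis norm_ge_zero zero_less_mult_pos mult_zero_left less_irrefl order_le_less)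
qed

text \<open>
  Transition maps are determined on the half spaces only, so they are differentiable within their
  domain \<open>E\<close>. The last property says that the derivative at a boundary point preserves the directions
  tangent to the boundary hyperplane, since boundary points correspond to boundary points.
\<close>
lemma chart_change:
  assumes c: "local_param S i U \<phi>" and d: "local_param S j V \<psi>"
  defines "E \<equiv> half_dom i U \<inter> \<phi> -` (\<psi> ` half_dom j V)"
  obtains T T' where "\<And>x. x \<in> E \<Longrightarrow> T x \<in> half_dom j V \<and> \<psi> (T x) = \<phi> x" "inj_on T E"
    "\<And>x. x \<in> E \<Longrightarrow> (T has_derivative T' x) (at x within E)"
    "\<And>x. x \<in> E \<Longrightarrow> dd \<phi> x = dd \<psi> (T x) \<circ> T' x"
    "\<And>x v. x \<in> E \<Longrightarrow> x $ i = 0 \<Longrightarrow> v $ i = 0 \<Longrightarrow> T' x v $ j = 0"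
proof -
  define T where "T = inv_into (half_dom j V) \<psi> \<circ> \<phi>"
  have T: "T x \<in> half_dom j V" "\<psi> (T x) = \<phi> x" if "x \<in> E" for x
    using that by (auto simp: T_def E_def intro: inv_into_into f_inv_into_f)
  have inj: "inj_on T E"
  proof (rule inj_onI)
    fix x y assume xy: "x \<in> E" "y \<in> E" "T x = T y"
    then have "\<phi> x = \<phi> y" using T(2) by metis
    then show "x = y" using xy local_paramD(8)[OF c] by (auto simp: E_def inj_on_def)
  qed
  have "\<exists>T'. (T has_derivative T') (at x within E) \<and> dd \<phi> x = dd \<psi> (T x) \<circ> T'" if x: "x \<in> E" for x
  proof -
    have xh: "x \<in> half_dom i U" using x by (simp add: E_def)
    obtain r R where R: "r > 0" "ball x r \<subseteq> U" "R ` ball x r \<subseteq> V" "R x = T x"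
      "\<And>x'. x' \<in> ball x r \<Longrightarrow> \<exists>T'. (R has_derivative T') (at x')"
      "\<And>x'. x' \<in> ball x r \<Longrightarrow> 0 \<le> x' $ i \<Longrightarrow> R x' \<in> half_dom j V \<and> \<psi> (R x') = \<phi> x'"
      by (rule transition[OF c d xh T(1)[OF x] T(2)[OF x, symmetric]]) blast
    obtain T' where T': "(R has_derivative T') (at x)" using R(1,5) by (meson centre_in_ball)
    have "dd \<phi> x = dd \<psi> (R x) \<circ> T'"
      by (rule transition_derivative[OF c d open_ball R(2) _ R(3) T']) (use R xh in \<open>auto simp: half_dom_iff\<close>)
    moreover have "(T has_derivative T') (at x within E)"
    proof (rule has_derivative_transform_within[OF has_derivative_at_withinI[OF T'] R(1) x])
      fix z assume z: "z \<in> E" "dist z x < r"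
      then have "R z \<in> half_dom j V \<and> \<psi> (R z) = \<phi> z"
        by (intro R(6)) (auto simp: dist_commute E_def half_dom_iff)
      then show "R z = T z"
        using T[OF z(1)] local_paramD(8)[OF d] by (metis inj_onD)
    qed
    ultimately show ?thesis using R(4) by auto
  qed
  then obtain T' where T': "\<And>x. x \<in> E \<Longrightarrow> (T has_derivative T' x) (at x within E)"
    "\<And>x. x \<in> E \<Longrightarrow> dd \<phi> x = dd \<psi> (T x) \<circ> T' x" by metis
  have "T' x v $ j = 0" if x: "x \<in> E" and xi: "x $ i = 0" and v: "v $ i = 0" for x v
  proof -
    have xU: "x \<in> U" and xp: "\<phi> x \<in> \<psi> ` half_dom j V" using x by (auto simp: E_def half_dom_iff)
    obtain N where N: "open N" "\<psi> ` half_dom j V = S \<inter> N"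
      using openin_SE[OF local_paramD(6)[OF d]] by metis
    have "open U" by (rule local_paramD(1)[OF c])
    have line: "isCont (\<lambda>s. x + s *\<^sub>R v) 0" by (intro continuous_intros)
    have "isCont \<phi> x" using local_paramD(3)[OF c xU] has_derivative_continuous by blast
    then have line2: "isCont (\<lambda>s. \<phi> (x + s *\<^sub>R v)) 0"
      by (intro isCont_o2[OF line]) simp
    obtain s1 where s1: "s1 > 0" "\<And>s. dist s 0 < s1 \<Longrightarrow> x + s *\<^sub>R v \<in> U"
      using isCont_nbhd[OF line \<open>open U\<close>] xU by auto
    obtain s2 where s2: "s2 > 0" "\<And>s. dist s 0 < s2 \<Longrightarrow> \<phi> (x + s *\<^sub>R v) \<in> N"
      using isCont_nbhd[OF line2 N(1)] xp N(2) by auto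
    define s0 where "s0 = min s1 s2"
    have s0: "s0 > 0" using s1 s2 by (simp add: s0_def)
    have inE: "x + s *\<^sub>R v \<in> E \<and> (x + s *\<^sub>R v) $ i = 0" if "s \<in> ball 0 s0" for s
    proof -
      have "x + s *\<^sub>R v \<in> U" "\<phi> (x + s *\<^sub>R v) \<in> N" using s1(2)[of s] s2(2)[of s] that by (auto simp: s0_def)
      moreover have "(x + s *\<^sub>R v) $ i = 0" using xi v by simp
      ultimately have "x + s *\<^sub>R v \<in> half_dom i U" by (simp add: half_dom_iff)
      moreover then have "\<phi> (x + s *\<^sub>R v) \<in> S" using local_paramD(7)[OF c] by blast
      ultimately show ?thesis using N(2) \<open>\<phi> (x + s *\<^sub>R v) \<in> N\<close> \<open>(x + s *\<^sub>R v) $ i = 0\<close> by (auto simp: E_def)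
    qed
    have zero: "T (x + s *\<^sub>R v) $ j = 0" if "s \<in> ball 0 s0" for s
    proof -
      note iE = inE[OF that]
      have "\<phi> (x + s *\<^sub>R v) \<in> hbdry S" using iE hbdry_chart[OF c] by (auto simp: E_def)
      then show ?thesis using hbdry_chart[OF d T(1)] T(2) iE by metis
    qed
    have d1: "((\<lambda>s. x + s *\<^sub>R v) has_derivative (\<lambda>s. s *\<^sub>R v)) (at 0 within ball 0 s0)"
      by (auto intro!: derivative_eq_intros)
    have "(T has_derivative T' x) (at (x + 0 *\<^sub>R v) within (\<lambda>s. x + s *\<^sub>R v) ` ball 0 s0)"
      using T'(1)[OF x] inE by (auto intro: has_derivative_subset)
    then have "(T \<circ> (\<lambda>s. x + s *\<^sub>R v) has_derivative T' x \<circ> (\<lambda>s. s *\<^sub>R v)) (at 0 within ball 0 s0)"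
      by (rule diff_chain_within[OF d1])
    then have "((\<lambda>s. T (x + s *\<^sub>R v) $ j) has_derivative (\<lambda>s. T' x (s *\<^sub>R v) $ j)) (at 0 within ball 0 s0)"
      using bounded_linear.has_derivative[OF bounded_linear_vec_nth] by (fastforce simp: o_def)
    then have "((\<lambda>s. T (x + s *\<^sub>R v) $ j) has_derivative (\<lambda>s. T' x (s *\<^sub>R v) $ j)) (at 0)"
      using s0 by (simp add: at_within_open[of 0 "ball 0 s0"])
    moreover have "((\<lambda>s. T (x + s *\<^sub>R v) $ j) has_derivative (\<lambda>s. 0)) (at 0)"
      by (rule has_derivative_transform_within_open[OF has_derivative_const[of 0] open_ball[of 0 s0]])
        (use s0 zero in auto)
    ultimately have "(\<lambda>s::real. T' x (s *\<^sub>R v) $ j) = (\<lambda>s. 0)" by (rule has_derivative_unique)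
    then show ?thesis by (metis scaleR_one)
  qed
  then show ?thesis using that[of T T'] T inj T' by blast
qed

end


section \<open>Independence of the chart measures from the chart\<close>

context spacelike_hypersurface
begin

lemma chart_linear:
  assumes "local_param S i U \<phi>" "x \<in> U" shows "linear (dd \<phi> x)"
  using local_paramD(3)[OF assms] by (rule has_derivative_linear)

lemma chart_image_sets:
  assumes "local_param S i U \<phi>"
  shows "\<phi> ` half_dom i U \<in> sets (restrict_space borel S)"
proof -
  obtain N where "open N" "\<phi> ` half_dom i U = S \<inter> N"
    using openin_SE[OF local_paramD(6)[OF assms]] by metis
  then show ?thesis unfolding sets_restrict_borel_iff by (intro bexI[of _ N]) auto
qed

lemma hbdry_subset: "hbdry S \<subseteq> S"
proof
  fix p assume "p \<in> hbdry S"
  then obtain i U \<phi> where "local_param S i U \<phi>" "p \<in> \<phi> ` bdry_dom i U" unfolding hbdry_def by blast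
  then show "p \<in> S" using local_paramD(7)[of S i U \<phi>] by (auto simp: bdry_dom_iff half_dom_iff)
qed

lemma chart_bdry_image:
  assumes "local_param S i U \<phi>"
  shows "\<phi> ` bdry_dom i U = hbdry S \<inter> \<phi> ` half_dom i U"
    and "\<phi> ` bdry_dom i U \<in> sets (restrict_space borel (hbdry S))"
proof -
  show eq: "\<phi> ` bdry_dom i U = hbdry S \<inter> \<phi> ` half_dom i U"
  proof (intro equalityI subsetI)
    fix p assume "p \<in> \<phi> ` bdry_dom i U"
    then show "p \<in> hbdry S \<inter> \<phi> ` half_dom i U"
      using assms unfolding hbdry_def by (auto simp: bdry_dom_iff half_dom_iff)
  next
    fix p assume "p \<in> hbdry S \<inter> \<phi> ` half_dom i U"
    then obtain x where "x \<in> half_dom i U" "p = \<phi> x" "\<phi> x \<in> hbdry S" by blast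
    then show "p \<in> \<phi> ` bdry_dom i U"
      using hbdry_chart[OF assms] by (auto simp: bdry_dom_iff half_dom_iff)
  qed
  obtain N where N: "open N" "\<phi> ` half_dom i U = S \<inter> N"
    using openin_SE[OF local_paramD(6)[OF assms]] by metis
  then have "\<phi> ` bdry_dom i U = hbdry S \<inter> N" using eq hbdry_subset by blast
  then show "\<phi> ` bdry_dom i U \<in> sets (restrict_space borel (hbdry S))"
    unfolding sets_restrict_borel_iff using N by (intro bexI[of _ N]) auto
qed

lemma finite_chart_cover:
  obtains K where "finite K" "\<And>i U \<phi>. (i, U, \<phi>) \<in> K \<Longrightarrow> local_param S i U \<phi>"
    "S \<subseteq> (\<Union>(i, U, \<phi>)\<in>K. \<phi> ` half_dom i U)"
proof -
  define Q where "Q = (\<lambda>p c N. (case c of (i, U, \<phi>) \<Rightarrow> local_param S i U \<phi> \<and> \<phi> ` half_dom i U = S \<inter> N) \<and> open N \<and> p \<in> N)"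
  have "\<exists>c N. Q p c N" if p: "p \<in> S" for p
  proof -
    obtain i U \<phi> where lp: "local_param S i U \<phi>" "p \<in> \<phi> ` half_dom i U"
      using hyp p unfolding smooth_hypersurface_def by blast
    obtain N where "open N" "\<phi> ` half_dom i U = S \<inter> N"
      using openin_SE[OF local_paramD(6)[OF lp(1)]] by metis
    then have "Q p (i, U, \<phi>) N" using lp by (auto simp: Q_def)
    then show ?thesis by blast
  qed
  then obtain c N where Q: "\<And>p. p \<in> S \<Longrightarrow> Q p (c p) (N p)"
    by metis
  have cN: "(case c p of (i, U, \<phi>) \<Rightarrow> local_param S i U \<phi> \<and> \<phi> ` half_dom i U = S \<inter> N p) \<and> open (N p) \<and> p \<in> N p"
    if "p \<in> S" for p using Q[OF that] by (simp add: Q_def)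
  have oN: "open (N p)" "p \<in> N p" if "p \<in> S" for p using cN[OF that] by auto
  obtain K where K: "K \<subseteq> S" "finite K" "S \<subseteq> (\<Union>p\<in>K. N p)"
    by (rule compactE_image[OF comp, of S N]) (use oN in auto)
  show ?thesis
  proof (rule that[of "c ` K"])
    show "finite (c ` K)" using K by simp
    show "local_param S i U \<phi>" if iU: "(i, U, \<phi>) \<in> c ` K" for i U \<phi>
    proof -
      obtain p where p: "(i, U, \<phi>) = c p" "p \<in> K" using iU by (rule imageE)
      then have "p \<in> S" using K(1) by blast
      from cN[OF this] show ?thesis unfolding p(1)[symmetric] by simp
    qed
    show "S \<subseteq> (\<Union>(i, U, \<phi>)\<in>c ` K. \<phi> ` half_dom i U)"
    proof
      fix x assume x: "x \<in> S"
      then obtain p where p: "p \<in> K" "x \<in> N p" using K by blast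
      obtain i U \<phi> where c: "c p = (i, U, \<phi>)" by (metis prod_cases3)
      then have "\<phi> ` half_dom i U = S \<inter> N p" using cN[of p] p K by auto
      then show "x \<in> (\<Union>(i, U, \<phi>)\<in>c ` K. \<phi> ` half_dom i U)"
        using c x p by (intro UN_I[of "c p"] imageI) auto
    qed
  qed
qed

lemma borel_chart_preimage:
  assumes "local_param S i U \<phi>" "D \<subseteq> half_dom i U" "D \<in> sets borel" "B \<in> sets (restrict_space borel X)" "\<phi> ` D \<subseteq> X"
  shows "D \<inter> \<phi> -` B \<in> sets borel"
proof -
  obtain B' where B': "B' \<in> sets borel" "B = X \<inter> B'" using assms(4) unfolding sets_restrict_borel_iff by blast
  have "D \<inter> \<phi> -` B' \<in> sets borel"
    using assms(2) by (intro borel_continuous_preimage assms(3) B'(1) continuous_on_subset[OF local_paramD(2)[OF assms(1)]])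
      (auto simp: half_dom_iff)
  moreover have "D \<inter> \<phi> -` B = D \<inter> \<phi> -` B'" using B'(2) assms(5) by auto
  ultimately show ?thesis by simp
qed

lemma volume_density_transform:
  assumes L: "linear L" and D: "linear (dd \<psi> y)" and eq: "dd \<phi> x = dd \<psi> y \<circ> L"
  shows "volume_density UNIV \<phi> x = volume_density UNIV \<psi> y * \<bar>det (matrix L)\<bar>"
proof -
  have "det (form_matrix (\<lambda>v w. mink (dd \<phi> x v) (dd \<phi> x w))) = (det (matrix L))\<^sup>2 * det (form_matrix (\<lambda>v w. mink (dd \<psi> y v) (dd \<psi> y w)))"
    using det_form_compose[OF bilinear_mink_compose[OF D] L] by (simp add: eq)
  then show ?thesis by (simp add: volume_density_UNIV real_sqrt_mult)
qed

text \<open>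
  The map \<open>M\<close> extends the derivative of the boundary transition map by the identity in the normal
  direction; its determinant is the Jacobian of the boundary transition map.
\<close>
lemma volume_density_bdry_transform:
  assumes L: "linear L" and D: "linear (dd \<psi> y)" and eq: "dd \<phi> x = dd \<psi> y \<circ> L" and D': "linear (dd \<phi> x)"
    and z: "\<And>v. v $ i = 0 \<Longrightarrow> L v $ j = 0"
  defines "M \<equiv> \<lambda>v. L (flatten i v) + v $ i *\<^sub>R axis j 1"
  shows "volume_density (UNIV - {i}) \<phi> x = volume_density (UNIV - {j}) \<psi> y * \<bar>det (matrix M)\<bar>"
proof -
  have M: "linear M"
    unfolding M_def using L linear_flatten[of i] by (auto simp: linear_iff algebra_simps)
  let ?b = "\<lambda>v w. mink (dd \<psi> y (flatten j v)) (dd \<psi> y (flatten j w)) + v $ j * w $ j"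
  have Dj: "linear (\<lambda>v. dd \<psi> y (flatten j v))"
    using D linear_flatten[of j] by (auto simp: linear_iff)
  have b: "bilinear ?b"
    using bilinear_mink_compose[OF Dj] unfolding bilinear_def by (auto simp: linear_iff algebra_simps)
  have zz: "L (flatten i v) $ j = 0" for v by (rule z) (simp add: flatten_nth)
  have Mj: "M v $ j = v $ i" "flatten j (M v) = L (flatten i v)" for v
    by (auto simp: M_def zz vec_eq_iff flatten_nth axis_def)
  have "det (form_matrix (\<lambda>v w. ?b (M v) (M w))) = (det (matrix M))\<^sup>2 * det (form_matrix ?b)"
    by (rule det_form_compose[OF b M])
  then show ?thesis
    by (simp add: volume_density_bdry[OF D] volume_density_bdry[OF D'] Mj eq real_sqrt_mult)
qed

lemma hypersurface_charts_agree:
  assumes c: "local_param S i U \<phi>" and d: "local_param S j V \<psi>"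
    and B: "B \<in> sets (restrict_space borel S)" "B \<subseteq> \<phi> ` half_dom i U" "B \<subseteq> \<psi> ` half_dom j V"
  shows "(\<integral>\<^sup>+y. ennreal (volume_density UNIV \<phi> y) * indicator (half_dom i U \<inter> \<phi> -` B) y \<partial>lborel)
       = (\<integral>\<^sup>+y. ennreal (volume_density UNIV \<psi> y) * indicator (half_dom j V \<inter> \<psi> -` B) y \<partial>lborel)"
proof -
  obtain T T' where T: "\<And>x. x \<in> half_dom i U \<inter> \<phi> -` (\<psi> ` half_dom j V) \<Longrightarrow> T x \<in> half_dom j V \<and> \<psi> (T x) = \<phi> x"
    and inj: "inj_on T (half_dom i U \<inter> \<phi> -` (\<psi> ` half_dom j V))"
    and der: "\<And>x. x \<in> half_dom i U \<inter> \<phi> -` (\<psi> ` half_dom j V) \<Longrightarrow> (T has_derivative T' x) (at x within half_dom i U \<inter> \<phi> -` (\<psi> ` half_dom j V))"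
    and dd: "\<And>x. x \<in> half_dom i U \<inter> \<phi> -` (\<psi> ` half_dom j V) \<Longrightarrow> dd \<phi> x = dd \<psi> (T x) \<circ> T' x"
    using chart_change[OF c d] by metis
  define E where "E = half_dom i U \<inter> \<phi> -` B"
  have E0: "E \<subseteq> half_dom i U \<inter> \<phi> -` (\<psi> ` half_dom j V)" using B(3) by (auto simp: E_def)
  have Em: "E \<in> sets borel" unfolding E_def
    by (rule borel_chart_preimage[OF c subset_refl _ B(1)]) (use local_paramD(1,7)[OF c] in \<open>auto intro: borel_half_dom\<close>)
  have Em2: "half_dom j V \<inter> \<psi> -` B \<in> sets borel"
    by (rule borel_chart_preimage[OF d subset_refl _ B(1)]) (use local_paramD(1,7)[OF d] in \<open>auto intro: borel_half_dom\<close>)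
  have TE: "T ` E = half_dom j V \<inter> \<psi> -` B"
  proof (intro equalityI subsetI)
    fix w assume "w \<in> T ` E"
    then obtain x where x: "x \<in> E" "w = T x" by blast
    then have "\<phi> x \<in> B" by (simp add: E_def)
    then show "w \<in> half_dom j V \<inter> \<psi> -` B" using T[OF subsetD[OF E0 x(1)]] x(2) by simp
  next
    fix w assume w: "w \<in> half_dom j V \<inter> \<psi> -` B"
    then obtain x where x: "x \<in> half_dom i U" "\<phi> x = \<psi> w" using B(2) by force
    then have xE: "x \<in> E" using w by (simp add: E_def)
    then have "T x = w" using T[of x] E0 w x(2) local_paramD(8)[OF d] by (metis IntD1 inj_onD subsetD)
    then show "w \<in> T ` E" using xE by blast
  qed
  have derE: "(T has_derivative T' x) (at x within E)" if "x \<in> E" for x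
    using der E0 that by (meson has_derivative_subset subsetD)
  have vd: "volume_density UNIV \<phi> x = volume_density UNIV \<psi> (T x) * \<bar>det (matrix (T' x))\<bar>" if "x \<in> E" for x
  proof (rule volume_density_transform)
    show "linear (T' x)" using derE[OF that] by (rule has_derivative_linear)
    have "T x \<in> half_dom j V" using T[OF subsetD[OF E0 that]] by simp
    then show "linear (dd \<psi> (T x))" by (intro chart_linear[OF d]) (simp add: half_dom_iff)
    show "dd \<phi> x = dd \<psi> (T x) \<circ> T' x" using dd E0 that by blast
  qed
  have pos: "volume_density UNIV \<psi> (T x) > 0" if "x \<in> E" for x
    using volume_density_pos(1)[OF d] T E0 that by blast
  have cT: "continuous_on E T" using derE has_derivative_continuous_on by blast
  have hm: "(\<lambda>x. indicator E x * \<bar>det (matrix (T' x))\<bar>) \<in> borel_measurable borel"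
  proof -
    have "continuous_on E (\<lambda>x. volume_density UNIV \<phi> x / volume_density UNIV \<psi> (T x))"
    proof (intro continuous_on_divide continuous_on_compose2[OF continuous_volume_density[OF d] cT])
      show "continuous_on E (volume_density UNIV \<phi>)"
        by (rule continuous_on_subset[OF continuous_volume_density[OF c]]) (auto simp: E_def half_dom_iff)
      show "T ` E \<subseteq> V" unfolding TE by (auto simp: half_dom_iff)
    qed (use pos in force)
    from borel_measurable_continuous_on_indicator[OF Em this]
    have "(\<lambda>x. indicator E x *\<^sub>R (volume_density UNIV \<phi> x / volume_density UNIV \<psi> (T x))) \<in> borel_measurable borel" .
    also have "(\<lambda>x. indicator E x *\<^sub>R (volume_density UNIV \<phi> x / volume_density UNIV \<psi> (T x))) = (\<lambda>x. indicator E x * \<bar>det (matrix (T' x))\<bar>)"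
    proof
      fix x show "indicator E x *\<^sub>R (volume_density UNIV \<phi> x / volume_density UNIV \<psi> (T x)) = indicator E x * \<bar>det (matrix (T' x))\<bar>"
        using vd[of x] pos[of x] by (cases "x \<in> E") auto
    qed
    finally show ?thesis .
  qed
  define F where "F = (\<lambda>w. ennreal (indicator (half_dom j V) w *\<^sub>R volume_density UNIV \<psi> w))"
  have Fm: "F \<in> borel_measurable borel"
  proof -
    have "(\<lambda>w. indicator (half_dom j V) w *\<^sub>R volume_density UNIV \<psi> w) \<in> borel_measurable borel"
      by (intro borel_measurable_continuous_on_indicator borel_half_dom local_paramD(1)[OF d]
          continuous_on_subset[OF continuous_volume_density[OF d]]) (auto simp: half_dom_iff)
    then show ?thesis unfolding F_def by measurable
  qed
  have "(\<integral>\<^sup>+y. F y * indicator (T ` E) y \<partial>lborel) = (\<integral>\<^sup>+x. F (T x) * ennreal \<bar>det (matrix (T' x))\<bar> * indicator E x \<partial>lborel)"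
    by (rule nn_integral_change_of_variables[OF Em _ inj_on_subset[OF inj E0] derE hm Fm])
      (use Em2 TE in auto)
  moreover have "(\<integral>\<^sup>+y. F y * indicator (T ` E) y \<partial>lborel) = (\<integral>\<^sup>+y. ennreal (volume_density UNIV \<psi> y) * indicator (half_dom j V \<inter> \<psi> -` B) y \<partial>lborel)"
    unfolding TE F_def by (intro nn_integral_cong) (auto simp: indicator_def)
  moreover have "(\<integral>\<^sup>+x. F (T x) * ennreal \<bar>det (matrix (T' x))\<bar> * indicator E x \<partial>lborel)
     = (\<integral>\<^sup>+y. ennreal (volume_density UNIV \<phi> y) * indicator (half_dom i U \<inter> \<phi> -` B) y \<partial>lborel)"
    unfolding E_def[symmetric]
  proof (rule nn_integral_cong)
    fix x
    show "F (T x) * ennreal \<bar>det (matrix (T' x))\<bar> * indicator E x = ennreal (volume_density UNIV \<phi> x) * indicator E x"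
    proof (cases "x \<in> E")
      case True
      then have "T x \<in> half_dom j V" using T E0 by blast
      then show ?thesis using True pos[OF True] vd[OF True] by (simp add: F_def ennreal_mult)
    qed auto
  qed
  ultimately show ?thesis by simp
qed

text \<open>
  Both sides are written as integrals over slabs of thickness one. The transition map between the
  slabs is the transition map of the boundary in the tangential directions and the identity in the
  normal direction.
\<close>
lemma boundary_charts_agree:
  assumes c: "local_param S i U \<phi>" and d: "local_param S j V \<psi>"
    and B: "B \<in> sets (restrict_space borel (hbdry S))" "B \<subseteq> \<phi> ` bdry_dom i U" "B \<subseteq> \<psi> ` bdry_dom j V"
  shows "(\<integral>\<^sup>+y. ennreal (volume_density (UNIV - {i}) \<phi> y) * indicator (bdry_dom i U \<inter> \<phi> -` B) y \<partial>coord_lebesgue (UNIV - {i}))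
       = (\<integral>\<^sup>+y. ennreal (volume_density (UNIV - {j}) \<psi> y) * indicator (bdry_dom j V \<inter> \<psi> -` B) y \<partial>coord_lebesgue (UNIV - {j}))"
proof -
  have bh: "bdry_dom k X \<subseteq> half_dom k X" for k :: 'n and X by (auto simp: bdry_dom_iff half_dom_iff)
  obtain T T' where T: "\<And>x. x \<in> half_dom i U \<inter> \<phi> -` (\<psi> ` half_dom j V) \<Longrightarrow> T x \<in> half_dom j V \<and> \<psi> (T x) = \<phi> x"
    and inj: "inj_on T (half_dom i U \<inter> \<phi> -` (\<psi> ` half_dom j V))"
    and der: "\<And>x. x \<in> half_dom i U \<inter> \<phi> -` (\<psi> ` half_dom j V) \<Longrightarrow> (T has_derivative T' x) (at x within half_dom i U \<inter> \<phi> -` (\<psi> ` half_dom j V))"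
    and dd: "\<And>x. x \<in> half_dom i U \<inter> \<phi> -` (\<psi> ` half_dom j V) \<Longrightarrow> dd \<phi> x = dd \<psi> (T x) \<circ> T' x"
    and T0: "\<And>x v. x \<in> half_dom i U \<inter> \<phi> -` (\<psi> ` half_dom j V) \<Longrightarrow> x $ i = 0 \<Longrightarrow> v $ i = 0 \<Longrightarrow> T' x v $ j = 0"
    by (rule chart_change[OF c d]) blast
  define E where "E = bdry_dom i U \<inter> \<phi> -` B"
  define E' where "E' = bdry_dom j V \<inter> \<psi> -` B"
  have E0: "E \<subseteq> half_dom i U \<inter> \<phi> -` (\<psi> ` half_dom j V)" using B(3) bh by (fastforce simp: E_def)
  have Ei: "x $ i = 0" if "x \<in> E" for x using that by (simp add: E_def bdry_dom_iff)
  have Em: "E \<in> sets borel" unfolding E_def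
    by (rule borel_chart_preimage[OF c bh _ B(1)])
       (use local_paramD(1)[OF c] chart_bdry_image(1)[OF c] in \<open>auto intro: borel_half_dom\<close>)
  have Em': "E' \<in> sets borel" unfolding E'_def
    by (rule borel_chart_preimage[OF d bh _ B(1)])
       (use local_paramD(1)[OF d] chart_bdry_image(1)[OF d] in \<open>auto intro: borel_half_dom\<close>)
  have TE: "T ` E = E'"
  proof (intro equalityI subsetI)
    fix w assume "w \<in> T ` E"
    then obtain x where x: "x \<in> E" "w = T x" by blast
    then have w: "w \<in> half_dom j V" "\<psi> w = \<phi> x" using T E0 by blast+
    then have "\<psi> w \<in> hbdry S" using x B(2) chart_bdry_image(1)[OF c] by (auto simp: E_def)
    then have "w $ j = 0" using hbdry_chart[OF d w(1)] by simp
    then show "w \<in> E'" using w x by (auto simp: E_def E'_def bdry_dom_iff half_dom_iff)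
  next
    fix w assume w: "w \<in> E'"
    then obtain x where x: "x \<in> bdry_dom i U" "\<phi> x = \<psi> w" using B(2) by (force simp: E'_def)
    then have xE: "x \<in> E" using w by (simp add: E_def E'_def)
    have "w \<in> half_dom j V" using w bh by (auto simp: E'_def)
    then have "T x = w" using T[of x] E0 xE x(2) local_paramD(8)[OF d] by (metis inj_onD subsetD)
    then show "w \<in> T ` E" using xE by blast
  qed
  have derE: "(T has_derivative T' x) (at x within E)" if "x \<in> E" for x
    using der E0 that by (meson has_derivative_subset subsetD)
  define H where "H = {z. flatten i z \<in> E \<and> 0 < z $ i \<and> z $ i < 1}"
  define H' where "H' = {z. flatten j z \<in> E' \<and> 0 < z $ j \<and> z $ j < 1}"
  define R where "R = (\<lambda>z. T (flatten i z) + z $ i *\<^sub>R axis j 1)"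
  define R' where "R' = (\<lambda>z v. T' (flatten i z) (flatten i v) + v $ i *\<^sub>R axis j 1)"
  have slab: "{z::real ^ 'n. 0 < z $ k \<and> z $ k < 1} \<in> sets borel" for k
  proof -
    have "open {z::real ^ 'n. 0 < z $ k}" "open {z::real ^ 'n. z $ k < 1}"
      by (auto intro!: open_Collect_less continuous_intros)
    moreover have "{z::real ^ 'n. 0 < z $ k \<and> z $ k < 1} = {z. 0 < z $ k} \<inter> {z. z $ k < 1}" by auto
    ultimately show ?thesis by (simp add: open_Int borel_open)
  qed
  have Hm: "H \<in> sets borel" "H' \<in> sets borel"
  proof -
    have "H = flatten i -` E \<inter> {z. 0 < z $ i \<and> z $ i < 1}" "H' = flatten j -` E' \<inter> {z. 0 < z $ j \<and> z $ j < 1}"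
      by (auto simp: H_def H'_def)
    then show "H \<in> sets borel" "H' \<in> sets borel"
      using measurable_sets[OF measurable_flatten Em, of i] measurable_sets[OF measurable_flatten Em', of j] slab
      by (auto intro!: sets.Int)
  qed
  have Tj: "T x $ j = 0" if "x \<in> E" for x using that TE by (auto simp: E'_def bdry_dom_iff)
  have Rf: "R z $ j = z $ i" "flatten j (R z) = T (flatten i z)" if "z \<in> H" for z
    using Tj[of "flatten i z"] that by (auto simp: H_def R_def vec_eq_iff flatten_nth axis_def)
  have RH: "R ` H = H'"
  proof (intro equalityI subsetI)
    fix w assume "w \<in> R ` H"
    then obtain z where z: "z \<in> H" "w = R z" by blast
    then have "T (flatten i z) \<in> E'" using TE by (auto simp: H_def)
    then show "w \<in> H'" using z Rf[OF z(1)] by (auto simp: H'_def H_def)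
  next
    fix w assume w: "w \<in> H'"
    then have "flatten j w \<in> T ` E" using TE by (simp add: H'_def)
    then obtain x where x: "x \<in> E" "T x = flatten j w" by (metis imageE)
    let ?z = "x + w $ j *\<^sub>R axis i 1"
    have fz: "flatten i ?z = x" "?z $ i = w $ j" using Ei[OF x(1)] by (auto simp: vec_eq_iff flatten_nth axis_def)
    then have "?z \<in> H" using x w by (simp add: H_def H'_def)
    moreover have "R ?z = w" unfolding R_def fz x(2) by (simp add: flatten_def)
    ultimately show "w \<in> R ` H" by (metis imageI)
  qed
  have injR: "inj_on R H"
  proof (rule inj_onI)
    fix y z assume yz: "y \<in> H" "z \<in> H" "R y = R z"
    then have "T (flatten i y) = T (flatten i z)" "y $ i = z $ i" using Rf by metis+
    then have "flatten i y = flatten i z"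
      using inj_on_subset[OF inj E0] yz by (auto simp: H_def inj_on_def)
    then show "y = z" using \<open>y $ i = z $ i\<close> by (simp add: flatten_def)
  qed
  have derR: "(R has_derivative R' z) (at z within H)" if z: "z \<in> H" for z
  proof -
    have fz: "flatten i z \<in> E" using z by (simp add: H_def)
    have im: "flatten i ` H \<subseteq> E" by (auto simp: H_def)
    have 1: "(flatten i has_derivative flatten i) (at z within H)"
      by (rule bounded_linear_imp_has_derivative[OF bounded_linear_flatten])
    have "(T has_derivative T' (flatten i z)) (at (flatten i z) within flatten i ` H)"
      using derE[OF fz] im by (rule has_derivative_subset)
    then have 2: "((\<lambda>z. T (flatten i z)) has_derivative (\<lambda>v. T' (flatten i z) (flatten i v))) (at z within H)"
      using diff_chain_within[OF 1] by (simp add: o_def)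
    have 3: "((\<lambda>z::real ^ 'n. z $ i *\<^sub>R axis j (1::real)) has_derivative (\<lambda>v. v $ i *\<^sub>R axis j 1)) (at z within H)"
      by (rule bounded_linear_imp_has_derivative)
         (intro bounded_linear_scaleR_const bounded_linear_vec_nth)
    show ?thesis unfolding R_def R'_def by (rule has_derivative_add[OF 2 3])
  qed
  have linT': "linear (T' x)" if "x \<in> E" for x using derE[OF that] by (rule has_derivative_linear)
  have inV: "T x \<in> half_dom j V" if "x \<in> E" for x using T E0 that by blast
  have vd: "volume_density (UNIV - {i}) \<phi> x = volume_density (UNIV - {j}) \<psi> (T x) * \<bar>det (matrix (\<lambda>v. T' x (flatten i v) + v $ i *\<^sub>R axis j 1))\<bar>"
    if x: "x \<in> E" for x
  proof (rule volume_density_bdry_transform)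
    show "linear (T' x)" by (rule linT'[OF x])
    show "linear (dd \<psi> (T x))" using inV[OF x] by (intro chart_linear[OF d]) (auto simp: half_dom_iff)
    show "linear (dd \<phi> x)" using E0 x by (intro chart_linear[OF c]) (auto simp: half_dom_iff)
    show "dd \<phi> x = dd \<psi> (T x) \<circ> T' x" using dd E0 x by blast
    show "T' x v $ j = 0" if "v $ i = 0" for v
      by (rule T0[OF subsetD[OF E0 x] Ei[OF x] that])
  qed
  have pos: "volume_density (UNIV - {j}) \<psi> (T x) > 0" if "x \<in> E" for x
    using volume_density_pos(2)[OF d inV[OF that]] .
  have cT: "continuous_on E T" using derE has_derivative_continuous_on by blast
  have hm: "(\<lambda>z. indicator H z * \<bar>det (matrix (R' z))\<bar>) \<in> borel_measurable borel"
  proof -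
    let ?q = "\<lambda>x. volume_density (UNIV - {i}) \<phi> x / volume_density (UNIV - {j}) \<psi> (T x)"
    have "continuous_on E ?q"
    proof (intro continuous_on_divide continuous_on_compose2[OF continuous_volume_density[OF d] cT])
      show "continuous_on E (volume_density (UNIV - {i}) \<phi>)"
        by (rule continuous_on_subset[OF continuous_volume_density[OF c]]) (auto simp: E_def bdry_dom_iff)
      show "T ` E \<subseteq> V" unfolding TE by (auto simp: E'_def bdry_dom_iff)
    qed (use pos in force)
    from borel_measurable_continuous_on_indicator[OF Em this]
    have m: "(\<lambda>x. indicator E x *\<^sub>R ?q x) \<in> borel_measurable borel" .
    have "(\<lambda>z. indicator H z * (indicator E (flatten i z) *\<^sub>R ?q (flatten i z))) \<in> borel_measurable borel"
      using measurable_compose[OF measurable_flatten m, of i] Hm(1) by measurable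
    also have "(\<lambda>z. indicator H z * (indicator E (flatten i z) *\<^sub>R ?q (flatten i z))) = (\<lambda>z. indicator H z * \<bar>det (matrix (R' z))\<bar>)"
    proof
      fix z show "indicator H z * (indicator E (flatten i z) *\<^sub>R ?q (flatten i z)) = indicator H z * \<bar>det (matrix (R' z))\<bar>"
      proof (cases "z \<in> H")
        case True
        then have fz: "flatten i z \<in> E" by (simp add: H_def)
        show ?thesis using vd[OF fz] pos[OF fz] fz True by (simp add: R'_def)
      qed auto
    qed
    finally show ?thesis .
  qed
  define F where "F = (\<lambda>w. ennreal (indicator (bdry_dom j V) w *\<^sub>R volume_density (UNIV - {j}) \<psi> w))"
  have Fm: "F \<in> borel_measurable borel"
  proof -
    have "(\<lambda>w. indicator (bdry_dom j V) w *\<^sub>R volume_density (UNIV - {j}) \<psi> w) \<in> borel_measurable borel"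
      by (intro borel_measurable_continuous_on_indicator borel_half_dom local_paramD(1)[OF d]
          continuous_on_subset[OF continuous_volume_density[OF d]]) (auto simp: bdry_dom_iff)
    then show ?thesis unfolding F_def by measurable
  qed
  define F1 where "F1 = (\<lambda>w. ennreal (indicator (bdry_dom i U) w *\<^sub>R volume_density (UNIV - {i}) \<phi> w))"
  have F1m: "F1 \<in> borel_measurable borel"
  proof -
    have "(\<lambda>w. indicator (bdry_dom i U) w *\<^sub>R volume_density (UNIV - {i}) \<phi> w) \<in> borel_measurable borel"
      by (intro borel_measurable_continuous_on_indicator borel_half_dom local_paramD(1)[OF c]
          continuous_on_subset[OF continuous_volume_density[OF c]]) (auto simp: bdry_dom_iff)
    then show ?thesis unfolding F1_def by measurable
  qed
  have "(\<integral>\<^sup>+y. ennreal (volume_density (UNIV - {j}) \<psi> y) * indicator E' y \<partial>coord_lebesgue (UNIV - {j}))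
      = (\<integral>\<^sup>+y. F y * indicator E' y \<partial>coord_lebesgue (UNIV - {j}))"
    unfolding F_def by (intro nn_integral_cong) (auto simp: indicator_def E'_def)
  also have "\<dots> = (\<integral>\<^sup>+z. (F (flatten j z) * indicator E' (flatten j z)) * indicator {z. 0 < z $ j \<and> z $ j < 1} z \<partial>lborel)"
    by (rule nn_integral_coord_thicken) (use Fm Em' in measurable)
  also have "\<dots> = (\<integral>\<^sup>+z. F (flatten j z) * indicator (R ` H) z \<partial>lborel)"
    unfolding RH by (intro nn_integral_cong) (auto simp: indicator_def H'_def)
  also have "\<dots> = (\<integral>\<^sup>+z. F (flatten j (R z)) * ennreal \<bar>det (matrix (R' z))\<bar> * indicator H z \<partial>lborel)"
    by (rule nn_integral_change_of_variables[OF Hm(1) _ injR derR hm])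
       (use Hm RH measurable_compose[OF measurable_flatten Fm, of j] in auto)
  also have "\<dots> = (\<integral>\<^sup>+z. (F1 (flatten i z) * indicator E (flatten i z)) * indicator {z. 0 < z $ i \<and> z $ i < 1} z \<partial>lborel)"
  proof (rule nn_integral_cong)
    fix z
    show "F (flatten j (R z)) * ennreal \<bar>det (matrix (R' z))\<bar> * indicator H z
        = (F1 (flatten i z) * indicator E (flatten i z)) * indicator {z. 0 < z $ i \<and> z $ i < 1} z"
    proof (cases "z \<in> H")
      case True
      then have fz: "flatten i z \<in> E" and s: "0 < z $ i \<and> z $ i < 1" by (auto simp: H_def)
      have "T (flatten i z) \<in> bdry_dom j V" using TE fz by (auto simp: E'_def)
      moreover have "flatten i z \<in> bdry_dom i U" using fz by (simp add: E_def)
      ultimately show ?thesis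
        using True fz s pos[OF fz] vd[OF fz] Rf(2)[OF True] by (simp add: F_def F1_def R'_def ennreal_mult)
    next
      case False
      then show ?thesis by (auto simp: H_def indicator_def)
    qed
  qed
  also have "\<dots> = (\<integral>\<^sup>+y. F1 y * indicator E y \<partial>coord_lebesgue (UNIV - {i}))"
    by (rule nn_integral_coord_thicken[symmetric]) (use F1m Em in measurable)
  also have "\<dots> = (\<integral>\<^sup>+y. ennreal (volume_density (UNIV - {i}) \<phi> y) * indicator E y \<partial>coord_lebesgue (UNIV - {i}))"
    unfolding F1_def by (intro nn_integral_cong) (auto simp: indicator_def E_def)
  finally show ?thesis by (simp add: E_def E'_def)
qed

end


section \<open>The induced measures\<close>

context spacelike_hypersurface
begin

lemma chart_density_measure:
  fixes J :: "'n set"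
  assumes c: "local_param S i U \<phi>" and \<Lambda>: "sets \<Lambda> = sets borel" and D: "D \<in> sets borel" "D \<subseteq> U" "\<phi> ` D \<subseteq> X"
  defines "N \<equiv> chart_measure X \<Lambda> D (volume_density J \<phi>) \<phi>"
  shows "sets N = sets (restrict_space borel X)"
    and "q \<in> borel_measurable (restrict_space borel X) \<Longrightarrow>
      (\<integral>\<^sup>+p. q p \<partial>N) = (\<integral>\<^sup>+y. ennreal (volume_density J \<phi> y) * q (\<phi> y) * indicator D y \<partial>\<Lambda>)"
    and "B \<in> sets (restrict_space borel X) \<Longrightarrow>
      emeasure N B = (\<integral>\<^sup>+y. ennreal (volume_density J \<phi> y) * indicator (D \<inter> \<phi> -` B) y \<partial>\<Lambda>)"
  unfolding N_def
  by (rule chart_measure[OF \<Lambda> D(1) continuous_on_subset[OF continuous_volume_density[OF c] D(2)]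
        continuous_on_subset[OF local_paramD(2)[OF c] D(2)] D(3)]; assumption)+

text \<open>
  Common to \<open>S\<close> and its boundary, for which \<open>dom\<close> is \<open>half_dom\<close> and \<open>bdry_dom\<close>: finitely many charts
  cover \<open>S\<close> by compactness, and the measures of any two charts agree on their overlap.
\<close>
lemma ex_chart_measure:
  fixes dom :: "'n \<Rightarrow> (real ^ 'n) set \<Rightarrow> (real ^ 'n) set" and J :: "'n \<Rightarrow> 'n set" and \<Lambda> :: "'n \<Rightarrow> (real ^ 'n) measure"
  defines "I \<equiv> \<lambda>i U \<phi> B. \<integral>\<^sup>+y. ennreal (volume_density (J i) \<phi> y) * indicator (dom i U \<inter> \<phi> -` B) y \<partial>\<Lambda> i"
  assumes X: "X \<subseteq> S" and \<Lambda>: "\<And>i. sets (\<Lambda> i) = sets borel" and dom: "\<And>i U. open U \<Longrightarrow> dom i U \<in> sets borel" "\<And>i U. dom i U \<subseteq> U"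
    and img: "\<And>i U \<phi>. local_param S i U \<phi> \<Longrightarrow> \<phi> ` dom i U = X \<inter> \<phi> ` half_dom i U"
      "\<And>i U \<phi>. local_param S i U \<phi> \<Longrightarrow> \<phi> ` dom i U \<in> sets (restrict_space borel X)"
    and agree: "\<And>i U \<phi> j V \<psi> B. local_param S i U \<phi> \<Longrightarrow> local_param S j V \<psi> \<Longrightarrow> B \<in> sets (restrict_space borel X) \<Longrightarrow>
      B \<subseteq> \<phi> ` dom i U \<Longrightarrow> B \<subseteq> \<psi> ` dom j V \<Longrightarrow> I i U \<phi> B = I j V \<psi> B"
  shows "\<exists>M. space M = X \<and> sets M = sets (restrict_space borel X) \<and>
    (\<forall>i U \<phi>. local_param S i U \<phi> \<longrightarrow> (\<forall>B\<in>sets M. B \<subseteq> \<phi> ` dom i U \<longrightarrow> emeasure M B = I i U \<phi> B))"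
proof -
  define C where "C = {(i, U, \<phi>). local_param S i U \<phi>}"
  define N where "N = (\<lambda>(i, U, \<phi>). chart_measure X (\<Lambda> i) (dom i U) (volume_density (J i) \<phi>) \<phi>)"
  define V where "V = (\<lambda>(i, U, \<phi>). \<phi> ` dom i U :: 'n minkowski set)"
  let ?A = "restrict_space borel X"
  have N: "sets (N (i, U, \<phi>)) = sets ?A" "B \<in> sets ?A \<Longrightarrow> emeasure (N (i, U, \<phi>)) B = I i U \<phi> B"
    if lp: "local_param S i U \<phi>" for i U \<phi> B
  proof -
    have "\<phi> ` dom i U \<subseteq> X" using img(1)[OF lp] by blast
    note cm = chart_density_measure[OF lp \<Lambda> dom(1)[OF local_paramD(1)[OF lp]] dom(2) this]
    show "sets (N (i, U, \<phi>)) = sets ?A" "B \<in> sets ?A \<Longrightarrow> emeasure (N (i, U, \<phi>)) B = I i U \<phi> B"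
      using cm(1,3) by (simp_all add: N_def I_def)
  qed
  obtain K where K: "finite K" "\<And>i U \<phi>. (i, U, \<phi>) \<in> K \<Longrightarrow> local_param S i U \<phi>" "S \<subseteq> (\<Union>(i, U, \<phi>)\<in>K. \<phi> ` half_dom i U)"
    by (rule finite_chart_cover) blast
  have "\<exists>M. sets M = sets ?A \<and> (\<forall>c\<in>C. \<forall>B\<in>sets ?A. B \<subseteq> V c \<longrightarrow> emeasure M B = emeasure (N c) B)"
  proof (rule glue_measures)
    show "sets (N c) = sets ?A" if "c \<in> C" for c using that N(1) by (auto simp: C_def)
    show "finite K" by fact
    show "K \<subseteq> C" using K(2) by (auto simp: C_def)
    show "V c \<in> sets ?A" if "c \<in> C" for c using that img(2) by (auto simp: C_def V_def)
    show "space ?A \<subseteq> (\<Union>k\<in>K. V k)"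
    proof
      fix p assume "p \<in> space ?A"
      then have p: "p \<in> X" by (simp add: space_restrict_space)
      then obtain i U \<phi> where k: "(i, U, \<phi>) \<in> K" "p \<in> \<phi> ` half_dom i U" using K(3) X by blast
      then have "p \<in> V (i, U, \<phi>)" using img(1)[OF K(2)[OF k(1)]] p by (simp add: V_def)
      then show "p \<in> (\<Union>k\<in>K. V k)" using k(1) by blast
    qed
    fix c d B assume "c \<in> C" "d \<in> C" and B: "B \<in> sets ?A" "B \<subseteq> V c" "B \<subseteq> V d"
    obtain i U \<phi> j W \<psi> where c: "c = (i, U, \<phi>)" and d: "d = (j, W, \<psi>)" by (metis prod_cases3)
    have lp: "local_param S i U \<phi>" "local_param S j W \<psi>" using \<open>c \<in> C\<close> \<open>d \<in> C\<close> by (auto simp: C_def c d)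
    show "emeasure (N c) B = emeasure (N d) B"
      unfolding c d N(2)[OF lp(1) B(1)] N(2)[OF lp(2) B(1)]
      by (rule agree[OF lp B(1)]) (use B(2,3) in \<open>simp_all add: c d V_def\<close>)
  qed
  then obtain M where M: "sets M = sets ?A" and Mc: "\<And>c B. c \<in> C \<Longrightarrow> B \<in> sets ?A \<Longrightarrow> B \<subseteq> V c \<Longrightarrow> emeasure M B = emeasure (N c) B"
    by blast
  have "space M = X" using sets_eq_imp_space_eq[OF M] by (simp add: space_restrict_space)
  moreover have "emeasure M B = I i U \<phi> B" if lp: "local_param S i U \<phi>" and B: "B \<in> sets M" "B \<subseteq> \<phi> ` dom i U" for i U \<phi> B
    using Mc[of "(i, U, \<phi>)" B] N(2)[OF lp, of B] lp B M by (simp add: C_def V_def)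
  ultimately show ?thesis using M by blast
qed

lemma is_hypersurface_measure: "is_hypersurface_measure S (hypersurface_measure S)"
proof -
  have "\<exists>M. is_hypersurface_measure S M"
    unfolding is_hypersurface_measure_def
  proof (rule ex_chart_measure[where \<Lambda> = "\<lambda>_. lborel" and dom = half_dom and J = "\<lambda>_. UNIV"])
    show "\<phi> ` half_dom i U = S \<inter> \<phi> ` half_dom i U" if "local_param S i U \<phi>" for i U \<phi>
      using local_paramD(7)[OF that] by blast
  qed (auto intro: borel_half_dom chart_image_sets hypersurface_charts_agree simp: half_dom_iff)
  then show ?thesis unfolding hypersurface_measure_def by (rule someI_ex)
qed

lemma is_boundary_measure: "is_boundary_measure S (boundary_measure S)"
proof -
  have "\<exists>M. is_boundary_measure S M"
    unfolding is_boundary_measure_def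
  proof (rule ex_chart_measure[where \<Lambda> = "\<lambda>i. coord_lebesgue (UNIV - {i})" and dom = bdry_dom and J = "\<lambda>i. UNIV - {i}", OF hbdry_subset])
    show "\<phi> ` bdry_dom i U = hbdry S \<inter> \<phi> ` half_dom i U" if "local_param S i U \<phi>" for i U \<phi>
      by (rule chart_bdry_image(1)[OF that])
  qed (auto intro: borel_half_dom chart_bdry_image(2) boundary_charts_agree simp: bdry_dom_iff)
  then show ?thesis unfolding boundary_measure_def by (rule someI_ex)
qed

abbreviation "\<mu> \<equiv> hypersurface_measure S"
abbreviation "\<sigma> \<equiv> boundary_measure S"

lemma mu: "space \<mu> = S" "sets \<mu> = sets (restrict_space borel S)"
  using is_hypersurface_measure by (auto simp: is_hypersurface_measure_def)

lemma sigma: "space \<sigma> = hbdry S" "sets \<sigma> = sets (restrict_space borel (hbdry S))"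
  using is_boundary_measure by (auto simp: is_boundary_measure_def)

lemma nn_integral_chart:
  fixes J :: "'n set"
  assumes c: "local_param S i U \<phi>" and \<Lambda>: "sets \<Lambda> = sets borel" and D: "D \<in> sets borel" "D \<subseteq> U"
    and M: "sets M = sets (restrict_space borel X)" "\<phi> ` D \<in> sets M"
      "\<And>B. B \<in> sets M \<Longrightarrow> B \<subseteq> \<phi> ` D \<Longrightarrow> emeasure M B = (\<integral>\<^sup>+y. ennreal (volume_density J \<phi> y) * indicator (D \<inter> \<phi> -` B) y \<partial>\<Lambda>)"
    and q: "q \<in> borel_measurable M" "\<And>p. p \<in> space M \<Longrightarrow> p \<notin> \<phi> ` D \<Longrightarrow> q p = 0"
  shows "(\<integral>\<^sup>+p. q p \<partial>M) = (\<integral>\<^sup>+y. ennreal (volume_density J \<phi> y) * q (\<phi> y) * indicator D y \<partial>\<Lambda>)"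
proof -
  have "\<phi> ` D \<subseteq> X" using sets.sets_into_space[OF M(2)] sets_eq_imp_space_eq[OF M(1)] by (auto simp: space_restrict_space)
  note cm = chart_density_measure[OF c \<Lambda> D this, where J = J]
  have "(\<integral>\<^sup>+p. q p \<partial>M) = (\<integral>\<^sup>+p. q p \<partial>chart_measure X \<Lambda> D (volume_density J \<phi>) \<phi>)"
    by (rule nn_integral_eq_on[where V = "\<phi> ` D"]) (use M q cm(1,3) in auto)
  also have "\<dots> = (\<integral>\<^sup>+y. ennreal (volume_density J \<phi> y) * q (\<phi> y) * indicator D y \<partial>\<Lambda>)"
    by (rule cm(2)) (use q(1) measurable_cong_sets[OF M(1) refl] in blast)
  finally show ?thesis .
qed

lemma nn_integral_mu_chart:
  assumes c: "local_param S i U \<phi>" and q: "q \<in> borel_measurable \<mu>" "\<And>p. p \<in> S \<Longrightarrow> p \<notin> \<phi> ` half_dom i U \<Longrightarrow> q p = 0"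
  shows "(\<integral>\<^sup>+p. q p \<partial>\<mu>) = (\<integral>\<^sup>+y. ennreal (volume_density UNIV \<phi> y) * q (\<phi> y) * indicator (half_dom i U) y \<partial>lborel)"
proof (rule nn_integral_chart[OF c _ _ _ mu(2) _ _ q(1)])
  show "half_dom i U \<in> sets borel" using local_paramD(1)[OF c] by (rule borel_half_dom)
  show "\<phi> ` half_dom i U \<in> sets \<mu>" using chart_image_sets[OF c] by (simp add: mu)
  show "emeasure \<mu> B = (\<integral>\<^sup>+y. ennreal (volume_density UNIV \<phi> y) * indicator (half_dom i U \<inter> \<phi> -` B) y \<partial>lborel)"
    if "B \<in> sets \<mu>" "B \<subseteq> \<phi> ` half_dom i U" for B
    using is_hypersurface_measure c that by (simp add: is_hypersurface_measure_def)
qed (use q(2) in \<open>auto simp: mu half_dom_iff\<close>)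

lemma nn_integral_sigma_chart:
  assumes c: "local_param S i U \<phi>" and q: "q \<in> borel_measurable \<sigma>" "\<And>p. p \<in> hbdry S \<Longrightarrow> p \<notin> \<phi> ` half_dom i U \<Longrightarrow> q p = 0"
  shows "(\<integral>\<^sup>+p. q p \<partial>\<sigma>) = (\<integral>\<^sup>+y. ennreal (volume_density (UNIV - {i}) \<phi> y) * q (\<phi> y) * indicator (bdry_dom i U) y \<partial>coord_lebesgue (UNIV - {i}))"
proof (rule nn_integral_chart[OF c _ _ _ sigma(2) _ _ q(1)])
  show "bdry_dom i U \<in> sets borel" using local_paramD(1)[OF c] by (rule borel_half_dom)
  show "\<phi> ` bdry_dom i U \<in> sets \<sigma>" using chart_bdry_image(2)[OF c] by (simp add: sigma)
  show "emeasure \<sigma> B = (\<integral>\<^sup>+y. ennreal (volume_density (UNIV - {i}) \<phi> y) * indicator (bdry_dom i U \<inter> \<phi> -` B) y \<partial>coord_lebesgue (UNIV - {i}))"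
    if "B \<in> sets \<sigma>" "B \<subseteq> \<phi> ` bdry_dom i U" for B
    using is_boundary_measure c that by (simp add: is_boundary_measure_def)
  show "q p = 0" if "p \<in> space \<sigma>" "p \<notin> \<phi> ` bdry_dom i U" for p
    using that q(2)[of p] chart_bdry_image(1)[OF c] by (auto simp: sigma)
qed (auto simp: bdry_dom_iff)

text \<open>
  Balls of the ambient space, rather than chart domains, index the partition of unity below: bump
  functions on them are restrictions of explicit functions.
\<close>
definition chart_ball :: "'n minkowski \<Rightarrow> real \<Rightarrow> bool" where
  "chart_ball p \<rho> \<longleftrightarrow> \<rho> > 0 \<and> (\<exists>i U \<phi> a r g. flat_chart i U \<phi> a r g \<and> S \<inter> cball p \<rho> \<subseteq> \<phi> ` half_dom i (ball a r))"

lemma atlas: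
  obtains K \<rho> where "finite K" "K \<subseteq> S" "\<And>p. p \<in> K \<Longrightarrow> chart_ball p (\<rho> p)" "S \<subseteq> (\<Union>p\<in>K. ball p (\<rho> p))"
proof -
  have "\<exists>\<rho>. chart_ball p \<rho>" if p: "p \<in> S" for p
  proof -
    obtain i U \<phi> where lp: "local_param S i U \<phi>" "p \<in> \<phi> ` half_dom i U"
      using hyp p unfolding smooth_hypersurface_def by blast
    then obtain a where a: "a \<in> half_dom i U" "p = \<phi> a" by blast
    obtain r g where fc: "flat_chart i U \<phi> a r g"
      using flat_chart_exists[OF lp(1) a(1)] by (metis order_refl)
    obtain N where N: "open N" "\<phi> ` half_dom i (ball a r) = S \<inter> N"
      using openin_SE[OF local_paramD(6)[OF flat_chartD(9)[OF fc]]] by metis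
    have "p \<in> N" using flat_chartD(10)[OF fc] a(2) N(2) by blast
    then obtain \<rho> where "\<rho> > 0" "cball p \<rho> \<subseteq> N" using N(1) by (meson open_contains_cball)
    then show ?thesis using fc N(2) unfolding chart_ball_def by blast
  qed
  then obtain \<rho> where \<rho>: "\<And>p. p \<in> S \<Longrightarrow> chart_ball p (\<rho> p)" by metis
  obtain K where "K \<subseteq> S" "finite K" "S \<subseteq> (\<Union>p\<in>K. ball p (\<rho> p))"
    by (rule compactE_image[OF comp, of S "\<lambda>p. ball p (\<rho> p)"]) (use \<rho> in \<open>auto simp: chart_ball_def\<close>)
  then show ?thesis using that \<rho> by blast
qed

lemma volume_density_bounded:
  assumes "flat_chart i U \<phi> a r g"
  obtains C where "\<And>y. y \<in> ball a r \<Longrightarrow> volume_density J \<phi> y \<le> C"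
proof -
  have "compact (volume_density J \<phi> ` cball a r)"
    by (intro compact_continuous_image continuous_on_subset[OF continuous_volume_density[OF flat_chartD(1)[OF assms]]]
        flat_chartD(2)[OF assms] compact_cball)
  then have "bounded (volume_density J \<phi> ` cball a r)" by (rule compact_imp_bounded)
  then obtain C where C: "\<And>z. z \<in> volume_density J \<phi> ` cball a r \<Longrightarrow> norm z \<le> C"
    unfolding bounded_iff by blast
  have "volume_density J \<phi> y \<le> C" if "y \<in> ball a r" for y
    using C[of "volume_density J \<phi> y"] that by force
  then show ?thesis using that by blast
qed

lemma chart_ball_finite:
  assumes "chart_ball p \<rho>"
  shows "emeasure \<mu> (S \<inter> cball p \<rho>) < \<infinity>" "emeasure \<sigma> (hbdry S \<inter> cball p \<rho>) < \<infinity>"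
proof -
  obtain i U \<phi> a r g where fc: "flat_chart i U \<phi> a r g" and sub: "S \<inter> cball p \<rho> \<subseteq> \<phi> ` half_dom i (ball a r)"
    using assms unfolding chart_ball_def by blast
  note lp = flat_chartD(9)[OF fc]
  obtain C where C: "\<And>y. y \<in> ball a r \<Longrightarrow> volume_density UNIV \<phi> y \<le> C" by (rule volume_density_bounded[OF fc]) blast
  obtain C' where C': "\<And>y. y \<in> ball a r \<Longrightarrow> volume_density (UNIV - {i}) \<phi> y \<le> C'" by (rule volume_density_bounded[OF fc]) blast
  have m1: "S \<inter> cball p \<rho> \<in> sets \<mu>" unfolding mu sets_restrict_borel_iff by (intro bexI[of _ "cball p \<rho>"]) auto
  have m2: "hbdry S \<inter> cball p \<rho> \<in> sets \<sigma>" unfolding sigma sets_restrict_borel_iff by (intro bexI[of _ "cball p \<rho>"]) auto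
  have "emeasure \<mu> (S \<inter> cball p \<rho>) = (\<integral>\<^sup>+p'. indicator (S \<inter> cball p \<rho>) p' \<partial>\<mu>)" using m1 by simp
  also have "\<dots> = (\<integral>\<^sup>+y. ennreal (volume_density UNIV \<phi> y) * indicator (S \<inter> cball p \<rho>) (\<phi> y) * indicator (half_dom i (ball a r)) y \<partial>lborel)"
    by (rule nn_integral_mu_chart[OF lp], use m1 in simp, use sub in \<open>auto simp: indicator_def\<close>)
  also have "\<dots> \<le> (\<integral>\<^sup>+y. ennreal C * indicator (ball a r) y \<partial>lborel)"
    by (intro nn_integral_mono) (auto simp: indicator_def half_dom_iff intro!: ennreal_leI C)
  also have "\<dots> < \<infinity>"
    using emeasure_bounded_finite[OF bounded_ball, of a r]
    by (simp add: nn_integral_cmult_indicator ennreal_mult_less_top)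
  finally show "emeasure \<mu> (S \<inter> cball p \<rho>) < \<infinity>" .
  have "emeasure \<sigma> (hbdry S \<inter> cball p \<rho>) = (\<integral>\<^sup>+p'. indicator (hbdry S \<inter> cball p \<rho>) p' \<partial>\<sigma>)" using m2 by simp
  also have "\<dots> = (\<integral>\<^sup>+y. ennreal (volume_density (UNIV - {i}) \<phi> y) * indicator (hbdry S \<inter> cball p \<rho>) (\<phi> y) * indicator (bdry_dom i (ball a r)) y \<partial>coord_lebesgue (UNIV - {i}))"
    by (rule nn_integral_sigma_chart[OF lp], use m2 in simp, use sub hbdry_subset in \<open>auto simp: indicator_def\<close>)
  also have "\<dots> \<le> (\<integral>\<^sup>+y. ennreal C' * indicator (ball a r) y \<partial>coord_lebesgue (UNIV - {i}))"
    by (intro nn_integral_mono) (auto simp: indicator_def bdry_dom_iff intro!: ennreal_leI C')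
  also have "\<dots> < \<infinity>"
    using emeasure_coord_lebesgue_bounded[OF bounded_ball, of a r i]
    by (simp add: nn_integral_cmult_indicator ennreal_mult_less_top)
  finally show "emeasure \<sigma> (hbdry S \<inter> cball p \<rho>) < \<infinity>" .
qed

lemma finite_measures: "finite_measure \<mu>" "finite_measure \<sigma>"
proof -
  obtain K \<rho> where K: "finite K" "K \<subseteq> S" "\<And>p. p \<in> K \<Longrightarrow> chart_ball p (\<rho> p)" "S \<subseteq> (\<Union>p\<in>K. ball p (\<rho> p))"
    by (rule atlas) blast
  have m1: "S \<inter> cball p \<rho> \<in> sets \<mu>" for p \<rho> unfolding mu sets_restrict_borel_iff by (intro bexI[of _ "cball p \<rho>"]) auto
  have m2: "hbdry S \<inter> cball p \<rho> \<in> sets \<sigma>" for p \<rho> unfolding sigma sets_restrict_borel_iff by (intro bexI[of _ "cball p \<rho>"]) auto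
  have "(\<Union>p\<in>K. ball p (\<rho> p)) \<subseteq> (\<Union>p\<in>K. cball p (\<rho> p))" by (rule UN_mono) auto
  then have S0: "S \<subseteq> (\<Union>p\<in>K. cball p (\<rho> p))" using K(4) by (rule subset_trans[rotated])
  have S1: "S = (\<Union>p\<in>K. S \<inter> cball p (\<rho> p))"
    unfolding Int_UN_distrib[symmetric] using S0 by (simp add: Int_absorb2)
  have S2: "hbdry S = (\<Union>p\<in>K. hbdry S \<inter> cball p (\<rho> p))" 
    unfolding Int_UN_distrib[symmetric] using subset_trans[OF hbdry_subset S0] by (simp add: Int_absorb2)
  have "emeasure \<mu> S \<le> (\<Sum>p\<in>K. emeasure \<mu> (S \<inter> cball p (\<rho> p)))"
    by (subst S1, rule emeasure_subadditive_finite[OF K(1)]) (use m1 in auto)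
  also have "\<dots> < \<infinity>" using chart_ball_finite(1)[OF K(3)] K(1) by (simp add: ennreal_sum_less_top)
  finally show "finite_measure \<mu>" by (intro finite_measureI) (simp add: mu)
  have "emeasure \<sigma> (hbdry S) \<le> (\<Sum>p\<in>K. emeasure \<sigma> (hbdry S \<inter> cball p (\<rho> p)))"
    by (subst S2, rule emeasure_subadditive_finite[OF K(1)]) (use m2 in auto)
  also have "\<dots> < \<infinity>" using chart_ball_finite(2)[OF K(3)] K(1) by (simp add: ennreal_sum_less_top)
  finally show "finite_measure \<sigma>" by (intro finite_measureI) (simp add: sigma)
qed

end


section \<open>The projection and its fibre sums\<close>

context spacelike_hypersurface
begin

lemma tangent_space_map:
  assumes "p \<in> S"
  obtains D where "spacelike_map D" "tangent_space S p = range D"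
proof -
  obtain i U \<phi> a where lp: "local_param S i U \<phi>" and a: "a \<in> half_dom i U" "p = \<phi> a"
    using hyp assms unfolding smooth_hypersurface_def by (metis imageE)
  show ?thesis
    using that[OF chart_spacelike[OF lp a(1)]] tangent_space_chart[OF lp a(1)] a(2) by simp
qed

text \<open>
  The tangent vector over a horizontal vector; the tangent space is a graph over the horizontal
  hyperplane.
\<close>
definition lift :: "'n minkowski \<Rightarrow> real ^ 'n \<Rightarrow> 'n minkowski" where
  "lift p e = (THE v. v \<in> tangent_space S p \<and> snd v = e)"

lemma lift_eq:
  assumes "p \<in> S" "v \<in> tangent_space S p"
  shows "lift p (snd v) = v"
proof -
  obtain D where D: "spacelike_map D" "tangent_space S p = range D" using tangent_space_map[OF assms(1)] .
  interpret spacelike_map D by fact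
  have "w = v" if w: "w \<in> tangent_space S p" "snd w = snd v" for w
  proof -
    obtain x y where "w = D x" "v = D y" using w assms(2) D(2) by auto
    then show ?thesis using inj_snd w(2) by (metis comp_apply injD)
  qed
  then show ?thesis unfolding lift_def using assms(2) by (intro the_equality) auto
qed

lemma lift_in:
  assumes "p \<in> S"
  shows "lift p e \<in> tangent_space S p" "snd (lift p e) = e"
proof -
  obtain D where D: "spacelike_map D" "tangent_space S p = range D" using tangent_space_map[OF assms(1)] .
  interpret spacelike_map D by fact
  obtain v where v: "snd (D v) = e" using ex_preimage by blast
  have "D v \<in> tangent_space S p" using D(2) by simp
  then have "lift p e = D v" using lift_eq[OF assms] v by metis
  then show "lift p e \<in> tangent_space S p" "snd (lift p e) = e" using v D(2) by auto
qed

lemma lift_chart: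
  assumes "local_param S i U \<phi>" "a \<in> half_dom i U"
  shows "lift (\<phi> a) (snd (dd \<phi> a u)) = dd \<phi> a u"
proof (rule lift_eq)
  show "\<phi> a \<in> S" using local_paramD(7)[OF assms(1)] assms(2) by blast
  show "dd \<phi> a u \<in> tangent_space S (\<phi> a)" by (simp add: tangent_space_chart[OF assms])
qed

lemma continuous_on_S_local:
  fixes f :: "'n minkowski \<Rightarrow> 'b::topological_space"
  assumes "\<And>p. p \<in> S \<Longrightarrow> \<exists>N. open N \<and> p \<in> N \<and> continuous_on (S \<inter> N) f"
  shows "continuous_on S f"
  unfolding continuous_on_eq_continuous_within
proof
  fix p assume p: "p \<in> S"
  obtain N where N: "open N" "p \<in> N" "continuous_on (S \<inter> N) f" using assms[OF p] by blast
  then have "continuous (at p within S \<inter> N) f" using p by (simp add: continuous_on_eq_continuous_within)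
  moreover have "at p within S \<inter> N = at p within S"
    by (rule at_within_nhd[OF N(2,1)]) auto
  ultimately show "continuous (at p within S) f" by simp
qed

text \<open>
  Cramer's rule expresses the inverse by determinants of continuous functions.
\<close>
lemma continuous_inv_derivative:
  assumes fc: "flat_chart i U \<phi> a r g"
  shows "continuous_on (ball a r) (\<lambda>y. inv (snd \<circ> dd \<phi> y) e)"
proof -
  have sub: "ball a r \<subseteq> U" using flat_chartD(2)[OF fc] ball_subset_cball by blast
  note lp = flat_chartD(1)[OF fc]
  define A where "A = (\<lambda>y. matrix (snd \<circ> dd \<phi> y))"
  have lin: "linear (snd \<circ> dd \<phi> y)" if "y \<in> ball a r" for y
    using chart_linear[OF lp, of y] that sub by (auto simp: linear_iff)
  have Aent: "A y $ k $ j = snd (dd \<phi> y (axis j 1)) $ k" for y k j by (simp add: A_def matrix_def)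
  have cA: "continuous_on (ball a r) (\<lambda>y. A y $ k $ j)" for k j
    unfolding Aent by (intro continuous_intros continuous_on_subset[OF local_paramD(4)[OF lp] sub])
  have d: "det (A y) \<noteq> 0" if "y \<in> ball a r" for y
    using det_nz_iff_inj[OF lin[OF that]] bij_is_inj[OF flat_chartD(7)[OF fc that]] by (simp add: A_def)
  have eq: "inv (snd \<circ> dd \<phi> y) e = (\<chi> k. det (\<chi> i j. if j = k then e $ i else A y $ i $ j) / det (A y))"
    if y: "y \<in> ball a r" for y
  proof -
    have "(snd \<circ> dd \<phi> y) (inv (snd \<circ> dd \<phi> y) e) = e"
      by (rule surj_f_inv_f[OF bij_is_surj[OF flat_chartD(7)[OF fc y]]])
    then have "A y *v inv (snd \<circ> dd \<phi> y) e = e"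
      using lin[OF y] by (simp add: A_def matrix_works)
    then show ?thesis using cramer[OF d[OF y]] by blast
  qed
  have "continuous_on (ball a r) (\<lambda>y. (\<chi> k. det (\<chi> i j. if j = k then e $ i else A y $ i $ j) / det (A y)))"
  proof (intro continuous_on_vec_lambda continuous_on_divide continuous_on_det)
    fix k i j
    show "continuous_on (ball a r) (\<lambda>x. (\<chi> i j. if j = k then e $ i else A x $ i $ j) $ i $ j)"
      by (cases "j = k") (auto intro: cA)
  qed (use d cA in auto)
  then show ?thesis by (rule continuous_on_eq) (simp add: eq)
qed

lemma continuous_g: "flat_chart i U \<phi> a r g \<Longrightarrow> continuous_on ((snd \<circ> \<phi>) ` ball a r) g"
  using flat_chartD(6) by (auto simp: homeomorphism_def)

lemma continuous_lift: "continuous_on S (\<lambda>p. lift p e)"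
proof (rule continuous_on_S_local)
  fix p assume p: "p \<in> S"
  obtain i U \<phi> b where lp: "local_param S i U \<phi>" and b: "b \<in> half_dom i U" "p = \<phi> b"
    using hyp p unfolding smooth_hypersurface_def by (metis imageE)
  obtain r g where fc: "flat_chart i U \<phi> b r g"
    using flat_chart_exists[OF lp b(1)] by (metis order_refl)
  obtain N where N: "open N" "\<phi> ` half_dom i (ball b r) = S \<inter> N"
    using openin_SE[OF local_paramD(6)[OF flat_chartD(9)[OF fc]]] by metis
  have pN: "p \<in> N" using flat_chartD(10)[OF fc] b(2) N(2) by blast
  have sub: "ball b r \<subseteq> U" using flat_chartD(2)[OF fc] ball_subset_cball by blast
  have eq: "lift q e = (\<Sum>k\<in>UNIV. inv (snd \<circ> dd \<phi> (g (snd q))) e $ k *\<^sub>R dd \<phi> (g (snd q)) (axis k 1))"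
    and gin: "g (snd q) \<in> ball b r" "snd q \<in> (snd \<circ> \<phi>) ` ball b r" if q: "q \<in> S \<inter> N" for q
  proof -
    obtain y where y: "y \<in> half_dom i (ball b r)" "q = \<phi> y" using q N(2) by blast
    then have yb: "y \<in> ball b r" by (simp add: half_dom_iff)
    have gy: "g (snd q) = y" using flat_chartD(11)[OF fc yb] y(2) by simp
    then show "g (snd q) \<in> ball b r" "snd q \<in> (snd \<circ> \<phi>) ` ball b r" using yb y(2) by auto
    have L: "linear (dd \<phi> y)" by (rule chart_linear[OF lp]) (use yb sub in blast)
    let ?v = "inv (snd \<circ> dd \<phi> y) e"
    have "(snd \<circ> dd \<phi> y) ?v = e"
      by (rule surj_f_inv_f[OF bij_is_surj[OF flat_chartD(7)[OF fc yb]]])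
    then have "lift q e = dd \<phi> y ?v" using lift_chart[OF flat_chartD(9)[OF fc] y(1), of ?v] y(2) by simp
    also have "\<dots> = dd \<phi> y (\<Sum>k\<in>UNIV. ?v $ k *\<^sub>R axis k 1)"
      using basis_expansion[of ?v] by (simp add: scalar_mult_eq_scaleR)
    also have "\<dots> = (\<Sum>k\<in>UNIV. ?v $ k *\<^sub>R dd \<phi> y (axis k 1))"
      by (simp add: linear_sum[OF L] linear_cmul[OF L])
    finally show "lift q e = (\<Sum>k\<in>UNIV. inv (snd \<circ> dd \<phi> (g (snd q))) e $ k *\<^sub>R dd \<phi> (g (snd q)) (axis k 1))"
      by (simp add: gy)
  qed
  have cg: "continuous_on (S \<inter> N) (\<lambda>q. g (snd q))"
    by (rule continuous_on_compose2[OF continuous_g[OF fc] continuous_on_snd[OF continuous_on_id]]) (use gin in auto)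
  have "continuous_on (S \<inter> N) (\<lambda>q. \<Sum>k\<in>UNIV. inv (snd \<circ> dd \<phi> (g (snd q))) e $ k *\<^sub>R dd \<phi> (g (snd q)) (axis k 1))"
    by (intro continuous_intros continuous_on_compose2[OF continuous_inv_derivative[OF fc] cg]
        continuous_on_compose2[OF local_paramD(4)[OF lp] cg]) (use gin sub in auto)
  then have "continuous_on (S \<inter> N) (\<lambda>q. lift q e)" by (rule continuous_on_eq) (simp add: eq)
  then show "\<exists>N. open N \<and> p \<in> N \<and> continuous_on (S \<inter> N) (\<lambda>q. lift q e)" using N(1) pN by blast
qed

text \<open>
  The tangent space at \<open>p\<close> is the graph of the linear functional that is the inner product with
  \<open>slope p\<close>.
\<close>
definition slope :: "'n minkowski \<Rightarrow> real ^ 'n" where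
  "slope p = (\<chi> k. fst (lift p (axis k 1)))"

lemma slope:
  assumes "p \<in> S"
  shows "norm (slope p) < 1" "\<And>v. v \<in> tangent_space S p \<Longrightarrow> fst v = slope p \<bullet> snd v"
proof -
  obtain D where D: "spacelike_map D" "tangent_space S p = range D" using tangent_space_map[OF assms(1)] .
  interpret spacelike_map D by fact
  obtain l where l: "norm l < 1" "\<And>v. fst (D v) = l \<bullet> snd (D v)" using ex_slope by blast
  have fl: "fst v = l \<bullet> snd v" if "v \<in> tangent_space S p" for v using l(2) that D(2) by auto
  have "slope p = l"
    unfolding slope_def vec_eq_iff using fl[OF lift_in(1)[OF assms]] lift_in(2)[OF assms] by (simp add: inner_axis)
  then show "norm (slope p) < 1" "\<And>v. v \<in> tangent_space S p \<Longrightarrow> fst v = slope p \<bullet> snd v" using l fl by auto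
qed

lemma continuous_slope: "continuous_on S slope"
  unfolding slope_def by (intro continuous_intros continuous_lift)

definition "\<tau> = max_slope S"

text \<open>
  The unit normals at \<open>p\<close> are the two vectors \<open>\<plusminus> (1, slope p) / sqrt (1 - slope p \<bullet> slope p)\<close>. By
  compactness the supremum that defines the maximal slope is finite, so it bounds each of these
  values.
\<close>
lemma max_slope_ge:
  assumes p: "p \<in> S"
  shows "1 \<le> \<tau> * sqrt (1 - slope p \<bullet> slope p)"
proof -
  let ?X = "{\<bar>fst \<nu>\<bar> | x \<nu>. x \<in> S \<and> \<nu> \<in> normal_space S x \<and> mink \<nu> \<nu> = -1}"
  have sq: "0 < 1 - slope x \<bullet> slope x" if "x \<in> S" for x
    using slope(1)[OF that] by (simp add: norm_eq_sqrt_inner)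
  have val: "\<bar>fst \<nu>\<bar> = 1 / sqrt (1 - slope x \<bullet> slope x)" if x: "x \<in> S" and \<nu>: "\<nu> \<in> normal_space S x" "mink \<nu> \<nu> = -1" for x \<nu>
  proof -
    have "snd \<nu> \<bullet> e = fst \<nu> * (slope x \<bullet> e)" for e
    proof -
      have "mink \<nu> (lift x e) = 0" using \<nu>(1) lift_in(1)[OF x] by (auto simp: normal_space_def)
      then show ?thesis using slope(2)[OF x lift_in(1)[OF x], of e] lift_in(2)[OF x, of e] by (simp add: mink_def)
    qed
    then have "\<forall>e. snd \<nu> \<bullet> e = (fst \<nu> *\<^sub>R slope x) \<bullet> e" by simp
    then have s: "snd \<nu> = fst \<nu> *\<^sub>R slope x" unfolding vector_eq_rdot .
    have "mink \<nu> \<nu> = - ((fst \<nu>)\<^sup>2 * (1 - slope x \<bullet> slope x))"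
      by (simp add: mink_def s power2_eq_square algebra_simps)
    then have "(fst \<nu>)\<^sup>2 * (1 - slope x \<bullet> slope x) = 1" using \<nu>(2) by simp
    then have "(fst \<nu>)\<^sup>2 = 1 / (1 - slope x \<bullet> slope x)" using sq[OF x] by (simp add: field_simps)
    then have "\<bar>fst \<nu>\<bar> = sqrt (1 / (1 - slope x \<bullet> slope x))" by (metis real_sqrt_abs)
    then show ?thesis by (simp add: real_sqrt_divide)
  qed
  have "continuous_on S (\<lambda>x. 1 / sqrt (1 - slope x \<bullet> slope x))"
    using sq by (intro continuous_intros continuous_slope) (auto dest: sq)
  then obtain x0 where x0: "x0 \<in> S" "\<And>x. x \<in> S \<Longrightarrow> 1 / sqrt (1 - slope x \<bullet> slope x) \<le> 1 / sqrt (1 - slope x0 \<bullet> slope x0)"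
    using continuous_attains_sup[OF comp, of "\<lambda>x. 1 / sqrt (1 - slope x \<bullet> slope x)"] p by blast
  have bdd: "bdd_above ?X"
    by (rule bdd_aboveI[of _ "1 / sqrt (1 - slope x0 \<bullet> slope x0)"]) (use val x0 in auto)
  define c where "c = 1 / sqrt (1 - slope p \<bullet> slope p)"
  have c: "c > 0" "c\<^sup>2 * (1 - slope p \<bullet> slope p) = 1" using sq[OF p] by (auto simp: c_def power_divide)
  define \<nu> where "\<nu> = c *\<^sub>R (1::real, slope p)"
  have "\<nu> \<in> normal_space S p"
    using slope(2)[OF p] by (auto simp: normal_space_def mink_def \<nu>_def)
  moreover have "mink \<nu> \<nu> = -1"
    using c(2) by (simp add: mink_def \<nu>_def power2_eq_square algebra_simps)
  moreover have "\<bar>fst \<nu>\<bar> = 1 / sqrt (1 - slope p \<bullet> slope p)" using c(1) by (simp add: \<nu>_def c_def[symmetric])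
  ultimately have "1 / sqrt (1 - slope p \<bullet> slope p) \<in> ?X"
    unfolding mem_Collect_eq using p by (intro exI[of _ p] exI[of _ \<nu>]) simp
  then have "1 / sqrt (1 - slope p \<bullet> slope p) \<le> \<tau>"
    unfolding \<tau>_def max_slope_def by (rule cSup_upper[OF _ bdd])
  then show ?thesis using sq[OF p] by (simp add: field_simps)
qed

lemma one_le_tau:
  assumes "p \<in> S" shows "1 \<le> \<tau>"
proof -
  have "sqrt (1 - slope p \<bullet> slope p) \<le> 1" "0 < sqrt (1 - slope p \<bullet> slope p)"
    using slope(1)[OF assms] by (auto simp: norm_eq_sqrt_inner)
  moreover have "1 \<le> \<tau> * sqrt (1 - slope p \<bullet> slope p)" by (rule max_slope_ge[OF assms])
  ultimately show ?thesis
    by (smt (verit) mult_le_cancel_left1 mult_less_0_iff mult_nonneg_nonneg zero_less_mult_iff mult_left_le)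
qed

text \<open>
  By \<open>det_G\<close> the Jacobian of the projection with respect to the induced metric is
  \<open>1 / sqrt (1 - slope p \<bullet> slope p)\<close>, the height of the unit normal, which lies between 1 and
  \<open>\<tau>\<close>. The last inequality bounds the flux of a constant vector through the projected boundary.
\<close>
lemma chart_densities:
  assumes lp: "local_param S i U \<phi>" and y: "y \<in> half_dom i U"
  defines "A \<equiv> matrix (snd \<circ> dd \<phi> y)"
  shows "det A \<noteq> 0" "volume_density UNIV \<phi> y \<le> \<bar>det A\<bar>" "\<bar>det A\<bar> \<le> \<tau> * volume_density UNIV \<phi> y"
    "\<bar>u $ i\<bar> * \<bar>det A\<bar> \<le> \<tau> * (norm (snd (dd \<phi> y u)) * volume_density (UNIV - {i}) \<phi> y)"
proof -
  interpret spacelike_map "dd \<phi> y" by (rule chart_spacelike[OF lp y])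
  have p: "\<phi> y \<in> S" using local_paramD(7)[OF lp] y by blast
  let ?l = "slope (\<phi> y)"
  have l: "fst (dd \<phi> y v) = ?l \<bullet> snd (dd \<phi> y v)" for v
    by (rule slope(2)[OF p]) (simp add: tangent_space_chart[OF lp y])
  have l1: "norm ?l < 1" by (rule slope(1)[OF p])
  have s: "0 < sqrt (1 - ?l \<bullet> ?l)" "sqrt (1 - ?l \<bullet> ?l) \<le> 1"
    using l1 by (auto simp: norm_eq_sqrt_inner)
  show "det A \<noteq> 0" using det_A by (simp add: A_def)
  have vd: "volume_density UNIV \<phi> y = \<bar>det A\<bar> * sqrt (1 - ?l \<bullet> ?l)"
    unfolding volume_density_UNIV using det_G[OF l] by (simp add: A_def real_sqrt_mult)
  show "volume_density UNIV \<phi> y \<le> \<bar>det A\<bar>"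
    unfolding vd using mult_left_mono[OF s(2), of "\<bar>det A\<bar>"] by simp
  note t = max_slope_ge[OF p]
  show "\<bar>det A\<bar> \<le> \<tau> * volume_density UNIV \<phi> y"
    unfolding vd using mult_left_mono[OF t, of "\<bar>det A\<bar>"] by (simp add: mult_ac)
  have "\<bar>u $ i\<bar> * (\<bar>det A\<bar> * sqrt (1 - ?l \<bullet> ?l)) \<le> norm (snd (dd \<phi> y u)) * volume_density (UNIV - {i}) \<phi> y"
    using boundary_density[OF l l1, of u i] unfolding volume_density_def metric_matrix_form A_def .
  then have "\<tau> * (\<bar>u $ i\<bar> * (\<bar>det A\<bar> * sqrt (1 - ?l \<bullet> ?l))) \<le> \<tau> * (norm (snd (dd \<phi> y u)) * volume_density (UNIV - {i}) \<phi> y)"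
    using one_le_tau[OF p] by (intro mult_left_mono) auto
  moreover have "\<bar>u $ i\<bar> * \<bar>det A\<bar> * 1 \<le> \<bar>u $ i\<bar> * \<bar>det A\<bar> * (\<tau> * sqrt (1 - ?l \<bullet> ?l))"
    by (rule mult_left_mono[OF t]) auto
  ultimately show "\<bar>u $ i\<bar> * \<bar>det A\<bar> \<le> \<tau> * (norm (snd (dd \<phi> y u)) * volume_density (UNIV - {i}) \<phi> y)"
    by (simp add: mult_ac)
qed

text \<open>
  The projection can map several points of \<open>S\<close> to the same point, so a function on \<open>S\<close> is
  transported to \<open>real ^ 'n\<close> by summation over the fibres.
\<close>
definition push :: "('n minkowski \<Rightarrow> 'b::comm_monoid_add) \<Rightarrow> real ^ 'n \<Rightarrow> 'b" where
  "push h y = (\<Sum>x\<in>{x\<in>S. snd x = y}. h x)"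

text \<open>
  A fibre is compact, and discrete since the projection is locally injective.
\<close>
lemma finite_fibre: "finite {x\<in>S. snd x = y}"
proof (rule ccontr)
  let ?T = "{x\<in>S. snd x = y}"
  assume "infinite ?T"
  then have "\<exists>p\<in>S. p islimpt ?T"
    using comp[unfolded compact_eq_Bolzano_Weierstrass, rule_format, of ?T] by blast
  then obtain p where p: "p \<in> S" "p islimpt ?T" by blast
  obtain N where N: "open N" "p \<in> N" "inj_on snd (S \<inter> N)" using snd_locally_inj[OF p(1)] .
  obtain x1 where x1: "x1 \<in> ?T" "x1 \<in> N" "x1 \<noteq> p" by (rule islimptE[OF p(2) N(2,1)])
  have "open (N - {x1})" using N(1) by (simp add: open_delete)
  moreover have "p \<in> N - {x1}" using N(2) x1(3) by simp
  ultimately have "\<exists>x2\<in>?T. x2 \<in> N - {x1}" using islimptE[OF p(2), of "N - {x1}"] by blast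
  then obtain x2 where x2: "x2 \<in> ?T" "x2 \<in> N - {x1}" by blast
  have "x1 = x2" by (rule inj_onD[OF N(3)]) (use x1 x2 in auto)
  then show False using x2 by simp
qed

text \<open>
  The projection is injective on one flat chart, so each fibre meets its image at most once.
\<close>
lemma push_chart:
  assumes fc: "flat_chart i U \<phi> a r g" and h: "\<And>x. x \<in> S \<Longrightarrow> x \<notin> \<phi> ` half_dom i (ball a r) \<Longrightarrow> h x = 0"
  shows "push h y = (if y \<in> (snd \<circ> \<phi>) ` half_dom i (ball a r) then h (\<phi> (g y)) else 0)"
proof (cases "y \<in> (snd \<circ> \<phi>) ` half_dom i (ball a r)")
  case True
  then obtain z where z: "z \<in> half_dom i (ball a r)" "y = snd (\<phi> z)" by auto
  then have zb: "z \<in> ball a r" by (simp add: half_dom_iff)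
  have gz: "g y = z" using flat_chartD(11)[OF fc zb] z(2) by simp
  have zS: "\<phi> z \<in> {x\<in>S. snd x = y}" using z local_paramD(7)[OF flat_chartD(9)[OF fc]] by blast
  have "push h y = (\<Sum>x\<in>{x\<in>S. snd x = y}. if x = \<phi> z then h (\<phi> z) else 0)"
    unfolding push_def
  proof (rule sum.cong[OF refl])
    fix x assume x: "x \<in> {x\<in>S. snd x = y}"
    show "h x = (if x = \<phi> z then h (\<phi> z) else 0)"
    proof (cases "x \<in> \<phi> ` half_dom i (ball a r)")
      case True
      then obtain w where w: "w \<in> half_dom i (ball a r)" "x = \<phi> w" by blast
      then have "w \<in> ball a r" by (simp add: half_dom_iff)
      then have "w = z" using flat_chartD(12)[OF fc] zb x w(2) z(2) by (auto simp: inj_on_def)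
      then show ?thesis using w by simp
    next
      case False
      then have "x \<noteq> \<phi> z" using z by blast
      then show ?thesis using h x False by auto
    qed
  qed
  also have "\<dots> = h (\<phi> z)" using finite_fibre zS by simp
  finally show ?thesis using True gz by simp
next
  case False
  have "h x = 0" if "x \<in> {x\<in>S. snd x = y}" for x
    using that False by (intro h) auto
  then show ?thesis using False by (simp add: push_def)
qed

lemma flat_image_borel:
  assumes fc: "flat_chart i U \<phi> a r g"
  shows "(snd \<circ> \<phi>) ` half_dom i (ball a r) \<in> sets borel" "(snd \<circ> \<phi>) ` bdry_dom i (ball a r) \<in> sets borel"
proof -
  let ?O = "(snd \<circ> \<phi>) ` ball a r"
  have cl: "closed {z::real ^ 'n. 0 \<le> z $ i}" "closed {z::real ^ 'n. z $ i = 0}"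
    by (auto intro!: closed_Collect_le closed_Collect_eq continuous_intros)
  have "(snd \<circ> \<phi>) ` half_dom i (ball a r) = ?O \<inter> g -` {z. 0 \<le> z $ i}"
    using flat_chartD(11)[OF fc] by (auto simp: half_dom_iff)
  then show "(snd \<circ> \<phi>) ` half_dom i (ball a r) \<in> sets borel"
    using borel_continuous_preimage[OF borel_open[OF flat_chartD(5)[OF fc]] continuous_g[OF fc] borel_closed[OF cl(1)]] by simp
  have "(snd \<circ> \<phi>) ` bdry_dom i (ball a r) = ?O \<inter> g -` {z. z $ i = 0}"
    using flat_chartD(11)[OF fc] by (auto simp: bdry_dom_iff)
  then show "(snd \<circ> \<phi>) ` bdry_dom i (ball a r) \<in> sets borel"
    using borel_continuous_preimage[OF borel_open[OF flat_chartD(5)[OF fc]] continuous_g[OF fc] borel_closed[OF cl(2)]] by simp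
qed

lemma continuous_det_chart:
  assumes "local_param S i U \<phi>"
  shows "continuous_on U (\<lambda>y. det (matrix (snd \<circ> dd \<phi> y)))"
proof (rule continuous_on_det)
  show "continuous_on U (\<lambda>x. matrix (snd \<circ> dd \<phi> x) $ j $ k)" for j k
    by (simp add: matrix_def) (intro continuous_intros local_paramD(4)[OF assms])
qed

lemma push_borel:
  fixes h :: "'n minkowski \<Rightarrow> real"
  assumes fc: "flat_chart i U \<phi> a r g" and h: "\<And>x. x \<in> S \<Longrightarrow> x \<notin> \<phi> ` half_dom i (ball a r) \<Longrightarrow> h x = 0"
    and ch: "continuous_on S h"
  shows "push h \<in> borel_measurable borel"
proof -
  let ?R = "(snd \<circ> \<phi>) ` half_dom i (ball a r)"
  have sub: "?R \<subseteq> (snd \<circ> \<phi>) ` ball a r" by (auto simp: half_dom_iff)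
  have gR: "g y \<in> half_dom i (ball a r)" if "y \<in> ?R" for y
    using that flat_chartD(11)[OF fc] by (auto simp: half_dom_iff)
  have "continuous_on ?R (\<lambda>y. h (\<phi> (g y)))"
  proof (rule continuous_on_compose2[OF ch continuous_on_compose2[OF _ continuous_on_subset[OF continuous_g[OF fc] sub]]])
    show "continuous_on (half_dom i (ball a r)) \<phi>"
      by (rule continuous_on_subset[OF local_paramD(2)[OF flat_chartD(9)[OF fc]]]) (auto simp: half_dom_iff)
    show "g ` ?R \<subseteq> half_dom i (ball a r)" using gR by blast
    show "(\<lambda>y. \<phi> (g y)) ` ?R \<subseteq> S" using gR local_paramD(7)[OF flat_chartD(9)[OF fc]] by blast
  qed
  from borel_measurable_continuous_on_indicator[OF flat_image_borel(1)[OF fc] this]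
  have "(\<lambda>y. indicator ?R y *\<^sub>R h (\<phi> (g y))) \<in> borel_measurable borel" .
  also have "(\<lambda>y. indicator ?R y *\<^sub>R h (\<phi> (g y))) = push h"
    by (auto simp: fun_eq_iff push_chart[OF fc h] indicator_def)
  finally show ?thesis .
qed

lemma nn_integral_flat_image:
  assumes fc: "flat_chart i U \<phi> a r g" and F: "F \<in> borel_measurable borel"
  shows "(\<integral>\<^sup>+y. F y * indicator ((snd \<circ> \<phi>) ` half_dom i (ball a r)) y \<partial>lborel)
    = (\<integral>\<^sup>+z. F (snd (\<phi> z)) * ennreal \<bar>det (matrix (snd \<circ> dd \<phi> z))\<bar> * indicator (half_dom i (ball a r)) z \<partial>lborel)"
proof -
  let ?H = "half_dom i (ball a r)"
  have sub: "ball a r \<subseteq> U" "?H \<subseteq> U" using flat_chartD(2)[OF fc] ball_subset_cball[of a r] by (auto simp: half_dom_iff)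
  have "(\<integral>\<^sup>+y. F y * indicator ((snd \<circ> \<phi>) ` ?H) y \<partial>lborel)
     = (\<integral>\<^sup>+z. F ((snd \<circ> \<phi>) z) * ennreal \<bar>det (matrix (snd \<circ> dd \<phi> z))\<bar> * indicator ?H z \<partial>lborel)"
  proof (rule nn_integral_change_of_variables[OF _ flat_image_borel(1)[OF fc] _ _ _ F])
    show H: "?H \<in> sets borel" by (simp add: borel_half_dom)
    show "inj_on (snd \<circ> \<phi>) ?H" by (rule inj_on_subset[OF flat_chartD(12)[OF fc]]) (auto simp: half_dom_iff)
    show "((snd \<circ> \<phi>) has_derivative (snd \<circ> dd \<phi> x)) (at x within ?H)" if "x \<in> ?H" for x
      using bounded_linear.has_derivative[OF bounded_linear_snd has_derivative_at_withinI[OF local_paramD(3)[OF flat_chartD(1)[OF fc]]], of x ?H] that sub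
      by (auto simp: o_def)
    have "continuous_on ?H (\<lambda>x. \<bar>det (matrix (snd \<circ> dd \<phi> x))\<bar>)"
      by (intro continuous_intros continuous_on_subset[OF continuous_det_chart[OF flat_chartD(1)[OF fc]] sub(2)])
    from borel_measurable_continuous_on_indicator[OF H this]
    show "(\<lambda>x. indicator ?H x * \<bar>det (matrix (snd \<circ> dd \<phi> x))\<bar>) \<in> borel_measurable borel" by simp
  qed
  then show ?thesis by simp
qed

lemma nn_integral_push_chart:
  fixes h :: "'n minkowski \<Rightarrow> real"
  assumes fc: "flat_chart i U \<phi> a r g" and h: "\<And>x. x \<in> S \<Longrightarrow> x \<notin> \<phi> ` half_dom i (ball a r) \<Longrightarrow> h x = 0"
    and ch: "continuous_on S h"
  shows "(\<integral>\<^sup>+y. ennreal (push h y) \<partial>lborel) = (\<integral>\<^sup>+z. ennreal (h (\<phi> z)) * ennreal \<bar>det (matrix (snd \<circ> dd \<phi> z))\<bar> * indicator (half_dom i (ball a r)) z \<partial>lborel)"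
proof -
  let ?R = "(snd \<circ> \<phi>) ` half_dom i (ball a r)"
  have pm: "(\<lambda>y. ennreal (push h y)) \<in> borel_measurable borel" using push_borel[OF fc h ch] by measurable
  have "(\<integral>\<^sup>+y. ennreal (push h y) \<partial>lborel) = (\<integral>\<^sup>+y. ennreal (push h y) * indicator ?R y \<partial>lborel)"
    by (intro nn_integral_cong) (auto simp: push_chart[OF fc h] indicator_def)
  also have "\<dots> = (\<integral>\<^sup>+z. ennreal (push h (snd (\<phi> z))) * ennreal \<bar>det (matrix (snd \<circ> dd \<phi> z))\<bar> * indicator (half_dom i (ball a r)) z \<partial>lborel)"
    by (rule nn_integral_flat_image[OF fc pm])
  also have "\<dots> = (\<integral>\<^sup>+z. ennreal (h (\<phi> z)) * ennreal \<bar>det (matrix (snd \<circ> dd \<phi> z))\<bar> * indicator (half_dom i (ball a r)) z \<partial>lborel)"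
  proof (rule nn_integral_cong)
    fix z
    have "push h (snd (\<phi> z)) = h (\<phi> z)" if "z \<in> half_dom i (ball a r)"
    proof -
      have "snd (\<phi> z) \<in> (snd \<circ> \<phi>) ` half_dom i (ball a r)" by (rule image_eqI[OF _ that]) simp
      moreover have "g (snd (\<phi> z)) = z" using that flat_chartD(11)[OF fc, of z] by (simp add: half_dom_iff)
      ultimately show ?thesis by (simp add: push_chart[OF fc h])
    qed
    then show "ennreal (push h (snd (\<phi> z))) * ennreal \<bar>det (matrix (snd \<circ> dd \<phi> z))\<bar> * indicator (half_dom i (ball a r)) z
       = ennreal (h (\<phi> z)) * ennreal \<bar>det (matrix (snd \<circ> dd \<phi> z))\<bar> * indicator (half_dom i (ball a r)) z"
      by (auto simp: indicator_def)
  qed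
  finally show ?thesis .
qed

lemma continuous_measurable_mu:
  fixes h :: "'n minkowski \<Rightarrow> real"
  assumes "continuous_on S h" shows "h \<in> borel_measurable \<mu>"
  using borel_measurable_continuous_on_restrict[OF assms] measurable_cong_sets[OF mu(2) refl] by blast

lemma continuous_measurable_sigma:
  fixes h :: "'n minkowski \<Rightarrow> real"
  assumes "continuous_on S h" shows "h \<in> borel_measurable \<sigma>"
  using borel_measurable_continuous_on_restrict[OF continuous_on_subset[OF assms hbdry_subset]] measurable_cong_sets[OF sigma(2) refl] by blast

text \<open>
  The Jacobian of the projection lies between 1 and \<open>\<tau>\<close>.
\<close>
lemma push_mu_compare_chart:
  fixes h :: "'n minkowski \<Rightarrow> real"
  assumes fc: "flat_chart i U \<phi> a r g" and h: "\<And>x. x \<in> S \<Longrightarrow> x \<notin> \<phi> ` half_dom i (ball a r) \<Longrightarrow> h x = 0"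
    and ch: "continuous_on S h" and h0: "\<And>x. x \<in> S \<Longrightarrow> h x \<ge> 0"
  shows "(\<integral>\<^sup>+p. ennreal (h p) \<partial>\<mu>) \<le> (\<integral>\<^sup>+y. ennreal (push h y) \<partial>lborel)"
    "(\<integral>\<^sup>+y. ennreal (push h y) \<partial>lborel) \<le> ennreal \<tau> * (\<integral>\<^sup>+p. ennreal (h p) \<partial>\<mu>)"
proof -
  note lp = flat_chartD(9)[OF fc]
  let ?H = "half_dom i (ball a r)"
  have hm: "(\<lambda>p. ennreal (h p)) \<in> borel_measurable \<mu>" using continuous_measurable_mu[OF ch] by measurable
  have imu: "(\<integral>\<^sup>+p. ennreal (h p) \<partial>\<mu>) = (\<integral>\<^sup>+y. ennreal (volume_density UNIV \<phi> y) * ennreal (h (\<phi> y)) * indicator ?H y \<partial>lborel)"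
    by (rule nn_integral_mu_chart[OF lp hm]) (simp add: h)
  have ipush: "(\<integral>\<^sup>+y. ennreal (push h y) \<partial>lborel) = (\<integral>\<^sup>+z. ennreal (h (\<phi> z)) * ennreal \<bar>det (matrix (snd \<circ> dd \<phi> z))\<bar> * indicator ?H z \<partial>lborel)"
    by (rule nn_integral_push_chart[OF fc h ch])
  have "(\<integral>\<^sup>+z. ennreal (volume_density UNIV \<phi> z) * ennreal (h (\<phi> z)) * indicator ?H z \<partial>lborel)
      \<le> (\<integral>\<^sup>+z. ennreal (h (\<phi> z)) * ennreal \<bar>det (matrix (snd \<circ> dd \<phi> z))\<bar> * indicator ?H z \<partial>lborel)"
  proof (rule nn_integral_mono)
    fix z :: "real ^ 'n"
    show "ennreal (volume_density UNIV \<phi> z) * ennreal (h (\<phi> z)) * indicator ?H z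
        \<le> ennreal (h (\<phi> z)) * ennreal \<bar>det (matrix (snd \<circ> dd \<phi> z))\<bar> * indicator ?H z"
    proof (cases "z \<in> ?H")
      case True
      then show ?thesis
        using chart_densities(2)[OF lp True] by (auto simp: mult.commute[of "ennreal (h _)"] intro!: mult_right_mono ennreal_leI)
    qed auto
  qed
  then show "(\<integral>\<^sup>+p. ennreal (h p) \<partial>\<mu>) \<le> (\<integral>\<^sup>+y. ennreal (push h y) \<partial>lborel)"
    by (simp only: imu ipush)
  have "(\<integral>\<^sup>+y. ennreal (push h y) \<partial>lborel) \<le> (\<integral>\<^sup>+y. ennreal \<tau> * (ennreal (volume_density UNIV \<phi> y) * ennreal (h (\<phi> y)) * indicator ?H y) \<partial>lborel)"
    unfolding ipush
  proof (rule nn_integral_mono)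
    fix z :: "real ^ 'n"
    show "ennreal (h (\<phi> z)) * ennreal \<bar>det (matrix (snd \<circ> dd \<phi> z))\<bar> * indicator ?H z
       \<le> ennreal \<tau> * (ennreal (volume_density UNIV \<phi> z) * ennreal (h (\<phi> z)) * indicator ?H z)"
    proof (cases "z \<in> ?H")
      case True
      have "\<phi> z \<in> S" using local_paramD(7)[OF lp] True by blast
      then have "0 \<le> \<tau>" using one_le_tau by fastforce
      then have "ennreal \<bar>det (matrix (snd \<circ> dd \<phi> z))\<bar> \<le> ennreal \<tau> * ennreal (volume_density UNIV \<phi> z)"
        using chart_densities(3)[OF lp True] volume_density_pos(1)[OF lp True] by (simp add: ennreal_mult[symmetric])
      then have "ennreal \<bar>det (matrix (snd \<circ> dd \<phi> z))\<bar> * ennreal (h (\<phi> z)) \<le> (ennreal \<tau> * ennreal (volume_density UNIV \<phi> z)) * ennreal (h (\<phi> z))"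
        by (rule mult_right_mono) simp
      then show ?thesis using True by (simp add: mult_ac)
    qed auto
  qed
  also have "\<dots> = ennreal \<tau> * (\<integral>\<^sup>+p. ennreal (h p) \<partial>\<mu>)"
  proof -
    have "(\<lambda>y. ennreal (indicator ?H y *\<^sub>R (volume_density UNIV \<phi> y * h (\<phi> y)))) \<in> borel_measurable borel"
    proof -
      have "continuous_on ?H (\<lambda>y. volume_density UNIV \<phi> y * h (\<phi> y))"
        by (intro continuous_intros continuous_on_compose2[OF ch] continuous_on_subset[OF continuous_volume_density[OF lp]]
            continuous_on_subset[OF local_paramD(2)[OF lp]]) (use local_paramD(7)[OF lp] in \<open>auto simp: half_dom_iff\<close>)
      then have "(\<lambda>y. indicator ?H y *\<^sub>R (volume_density UNIV \<phi> y * h (\<phi> y))) \<in> borel_measurable borel"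
        by (rule borel_measurable_continuous_on_indicator[rotated]) (simp add: borel_half_dom)
      then show ?thesis by measurable
    qed
    also have "(\<lambda>y. ennreal (indicator ?H y *\<^sub>R (volume_density UNIV \<phi> y * h (\<phi> y)))) = (\<lambda>y. ennreal (volume_density UNIV \<phi> y) * ennreal (h (\<phi> y)) * indicator ?H y)"
    proof
      fix y show "ennreal (indicator ?H y *\<^sub>R (volume_density UNIV \<phi> y * h (\<phi> y))) = ennreal (volume_density UNIV \<phi> y) * ennreal (h (\<phi> y)) * indicator ?H y"
      proof (cases "y \<in> ?H")
        case True
        then have "\<phi> y \<in> S" using local_paramD(7)[OF lp] by blast
        then show ?thesis using True volume_density_pos(1)[OF lp True] h0 by (simp add: ennreal_mult)
      qed auto
    qed
    finally show ?thesis unfolding imu by (simp add: nn_integral_cmult)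
  qed
  finally show "(\<integral>\<^sup>+y. ennreal (push h y) \<partial>lborel) \<le> ennreal \<tau> * (\<integral>\<^sup>+p. ennreal (h p) \<partial>\<mu>)" .
qed

end


section \<open>Differentials, partitions of unity and integrals of fibre sums\<close>

context spacelike_hypersurface
begin

lemma lift_linear:
  assumes p: "p \<in> S" shows "linear (lift p)"
proof -
  obtain D where D: "spacelike_map D" "tangent_space S p = range D" using tangent_space_map[OF p] .
  interpret spacelike_map D by fact
  have LD: "lift p (snd (D v)) = D v" for v by (rule lift_eq[OF p]) (simp add: D(2))
  show ?thesis
  proof (rule linearI)
    fix x y :: "real ^ 'n" and c :: real
    obtain v w where v: "snd (D v) = x" and w: "snd (D w) = y" using ex_preimage by metis
    have "snd (D (v + w)) = x + y" "snd (D (c *\<^sub>R v)) = c *\<^sub>R x"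
      using v w by (auto simp: linear_add[OF lin] linear_cmul[OF lin])
    then show "lift p (x + y) = lift p x + lift p y" "lift p (c *\<^sub>R x) = c *\<^sub>R lift p x"
      using LD[of v] LD[of w] LD[of "v + w"] LD[of "c *\<^sub>R v"] v w
      by (auto simp: linear_add[OF lin] linear_cmul[OF lin])
  qed
qed

text \<open>
  The differential of \<open>u\<close> in projected coordinates: the vector \<open>du p\<close> represents, with respect to the
  Euclidean inner product of the horizontal hyperplane, the linear functional that takes a
  horizontal vector \<open>e\<close> to the derivative of \<open>u\<close> along the tangent vector over \<open>e\<close>.
\<close>
definition has_diff :: "('n minkowski \<Rightarrow> real) \<Rightarrow> ('n minkowski \<Rightarrow> real ^ 'n) \<Rightarrow> bool" where
  "has_diff u du \<longleftrightarrow> (\<forall>p\<in>S. \<exists>u'. (u has_derivative u') (at p within S) \<and> (\<forall>e. u' (lift p e) = du p \<bullet> e)) \<and> continuous_on S du"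

lemma has_diffE:
  assumes "has_diff u du" "p \<in> S"
  obtains u' where "(u has_derivative u') (at p within S)" "\<And>e. u' (lift p e) = du p \<bullet> e"
  using assms unfolding has_diff_def by blast

lemma has_diff_I:
  assumes d: "\<And>p. p \<in> S \<Longrightarrow> (u has_derivative u' p) (at p within S)"
    and c: "\<And>e. continuous_on S (\<lambda>p. u' p (lift p e))"
  shows "has_diff u (\<lambda>p. \<chi> k. u' p (lift p (axis k 1)))"
  unfolding has_diff_def
proof (intro conjI ballI)
  fix p assume p: "p \<in> S"
  have "linear (\<lambda>e. u' p (lift p e))"
    using linear_compose[OF lift_linear[OF p] has_derivative_linear[OF d[OF p]]] by (simp add: o_def)
  note L = this
  have "u' p (lift p e) = (\<chi> k. u' p (lift p (axis k 1))) \<bullet> e" for e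
  proof -
    have "u' p (lift p e) = u' p (lift p (\<Sum>k\<in>UNIV. e $ k *\<^sub>R axis k 1))"
      using basis_expansion[of e] by (simp add: scalar_mult_eq_scaleR)
    also have "\<dots> = (\<Sum>k\<in>UNIV. e $ k * u' p (lift p (axis k 1)))"
      by (simp add: linear_sum[OF L] linear_cmul[OF L])
    finally show ?thesis by (simp add: inner_vec_def mult.commute)
  qed
  then show "\<exists>u''. (u has_derivative u'') (at p within S) \<and> (\<forall>e. u'' (lift p e) = (\<chi> k. u' p (lift p (axis k 1))) \<bullet> e)"
    using d[OF p] by blast
qed (intro continuous_on_vec_lambda c)

lemma has_diff_continuous: "has_diff u du \<Longrightarrow> continuous_on S u" "has_diff u du \<Longrightarrow> continuous_on S du"
  unfolding has_diff_def continuous_on_eq_continuous_within using has_derivative_continuous by blast+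

lemma has_diff_mult:
  assumes u: "has_diff u du" and v: "has_diff v dv"
  shows "has_diff (\<lambda>p. u p * v p) (\<lambda>p. u p *\<^sub>R dv p + v p *\<^sub>R du p)"
  unfolding has_diff_def
proof (intro conjI ballI)
  fix p assume p: "p \<in> S"
  obtain u' where u': "(u has_derivative u') (at p within S)" "\<And>e. u' (lift p e) = du p \<bullet> e" by (rule has_diffE[OF u p]) blast
  obtain v' where v': "(v has_derivative v') (at p within S)" "\<And>e. v' (lift p e) = dv p \<bullet> e" by (rule has_diffE[OF v p]) blast
  have "((\<lambda>p. u p * v p) has_derivative (\<lambda>h. u p * v' h + u' h * v p)) (at p within S)"
    by (rule has_derivative_mult[OF u'(1) v'(1)])
  then show "\<exists>w. ((\<lambda>p. u p * v p) has_derivative w) (at p within S) \<and> (\<forall>e. w (lift p e) = (u p *\<^sub>R dv p + v p *\<^sub>R du p) \<bullet> e)"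
    using u'(2) v'(2) by (intro exI[of _ "\<lambda>h. u p * v' h + u' h * v p"]) (auto simp: inner_add_left)
qed (intro continuous_intros has_diff_continuous[OF u] has_diff_continuous[OF v])

lemma has_diff_sum:
  assumes K: "finite K" and u: "\<And>k. k \<in> K \<Longrightarrow> has_diff (u k) (du k)"
  shows "has_diff (\<lambda>p. \<Sum>k\<in>K. u k p) (\<lambda>p. \<Sum>k\<in>K. du k p)"
  unfolding has_diff_def
proof (intro conjI ballI)
  fix p assume p: "p \<in> S"
  have "\<exists>u'. (u k has_derivative u') (at p within S) \<and> (\<forall>e. u' (lift p e) = du k p \<bullet> e)" if "k \<in> K" for k
    using u[OF that] p unfolding has_diff_def by blast
  then obtain u' where u': "\<And>k. k \<in> K \<Longrightarrow> (u k has_derivative u' k) (at p within S)" "\<And>k e. k \<in> K \<Longrightarrow> u' k (lift p e) = du k p \<bullet> e"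
    by metis
  have "((\<lambda>p. \<Sum>k\<in>K. u k p) has_derivative (\<lambda>h. \<Sum>k\<in>K. u' k h)) (at p within S)"
    by (rule has_derivative_sum[OF u'(1)])
  then show "\<exists>w. ((\<lambda>p. \<Sum>k\<in>K. u k p) has_derivative w) (at p within S) \<and> (\<forall>e. w (lift p e) = (\<Sum>k\<in>K. du k p) \<bullet> e)"
    using u'(2) by (intro exI[of _ "\<lambda>h. \<Sum>k\<in>K. u' k h"]) (auto simp: inner_sum_left)
qed (intro continuous_intros has_diff_continuous(2)[OF u])

lemma has_diff_inverse:
  assumes s: "has_diff s ds" and s0: "\<And>p. p \<in> S \<Longrightarrow> s p \<noteq> 0"
  shows "has_diff (\<lambda>p. inverse (s p)) (\<lambda>p. - (inverse (s p) * inverse (s p)) *\<^sub>R ds p)"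
  unfolding has_diff_def
proof (intro conjI ballI)
  fix p assume p: "p \<in> S"
  obtain s' where s': "(s has_derivative s') (at p within S)" "\<And>e. s' (lift p e) = ds p \<bullet> e" by (rule has_diffE[OF s p]) blast
  have "((\<lambda>p. inverse (s p)) has_derivative (\<lambda>h. - (inverse (s p) * s' h * inverse (s p)))) (at p within S)"
    by (rule Deriv.has_derivative_inverse[OF s0[OF p] s'(1)])
  then show "\<exists>w. ((\<lambda>p. inverse (s p)) has_derivative w) (at p within S) \<and> (\<forall>e. w (lift p e) = (- (inverse (s p) * inverse (s p)) *\<^sub>R ds p) \<bullet> e)"
    using s'(2) by (intro exI[of _ "\<lambda>h. - (inverse (s p) * s' h * inverse (s p))"]) (auto simp: mult_ac)
qed (intro continuous_intros has_diff_continuous[OF s] ballI s0)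

lemma has_diff_bump:
  "has_diff (\<lambda>x. bump \<epsilon> (x - p)) (\<lambda>x. \<chi> k. dbump \<epsilon> (x - p) (lift x (axis k 1)))"
proof (rule has_diff_I)
  fix x
  have "((\<lambda>x. x - p) has_derivative (\<lambda>v. v)) (at x within S)" by (auto intro!: derivative_eq_intros)
  from diff_chain_within[OF this has_derivative_at_withinI[OF has_derivative_bump]]
  show "((\<lambda>x. bump \<epsilon> (x - p)) has_derivative dbump \<epsilon> (x - p)) (at x within S)" by (simp add: o_def)
next
  show "continuous_on S (\<lambda>x. dbump \<epsilon> (x - p) (lift x e))" for e
    unfolding dbump_def by (intro continuous_intros continuous_lift)
qed

lemma has_diff_bump_snd:
  obtains dk where "has_diff (\<lambda>x. bump \<epsilon> (y - snd x)) dk" "\<And>x e. x \<in> S \<Longrightarrow> dk x \<bullet> e = - dbump \<epsilon> (y - snd x) e"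
proof -
  have C: "has_diff (\<lambda>x. bump \<epsilon> (y - snd x)) (\<lambda>x. \<chi> k. dbump \<epsilon> (y - snd x) (- snd (lift x (axis k 1))))"
  proof (rule has_diff_I)
    fix x
    have "((\<lambda>x. y - snd x) has_derivative (\<lambda>v. - snd v)) (at x within S)" by (auto intro!: derivative_eq_intros)
    from diff_chain_within[OF this has_derivative_at_withinI[OF has_derivative_bump]]
    show "((\<lambda>x. bump \<epsilon> (y - snd x)) has_derivative (\<lambda>v. dbump \<epsilon> (y - snd x) (- snd v))) (at x within S)" by (simp add: o_def)
  next
    show "continuous_on S (\<lambda>x. dbump \<epsilon> (y - snd x) (- snd (lift x e)))" for e
      unfolding dbump_def by (intro continuous_intros continuous_lift)
  qed
  have "(\<chi> k. dbump \<epsilon> (y - snd x) (- snd (lift x (axis k 1)))) \<bullet> e = - dbump \<epsilon> (y - snd x) e" if x: "x \<in> S" for x e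
  proof -
    have "(\<chi> k. dbump \<epsilon> (y - snd x) (- snd (lift x (axis k 1)))) = (4 * max 0 (\<epsilon>\<^sup>2 - (y - snd x) \<bullet> (y - snd x))) *\<^sub>R (y - snd x)"
      by (simp add: vec_eq_iff dbump_def lift_in(2)[OF x] inner_axis) (simp add: algebra_simps)
    then show ?thesis by (simp add: dbump_def)
  qed
  then show ?thesis using that[OF C] by blast
qed

text \<open>
  The bump functions of finitely many balls that cover \<open>S\<close>, divided by their sum, which is positive
  on \<open>S\<close>.
\<close>
lemma partition_of_unity:
  obtains K \<rho> \<zeta> d\<zeta> where "finite K" "\<And>k. k \<in> K \<Longrightarrow> chart_ball k (\<rho> k)" "\<And>k. k \<in> K \<Longrightarrow> has_diff (\<zeta> k) (d\<zeta> k)"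
    "\<And>k x. k \<in> K \<Longrightarrow> x \<in> S \<Longrightarrow> \<zeta> k x \<ge> 0"
    "\<And>k x. k \<in> K \<Longrightarrow> x \<in> S \<Longrightarrow> x \<notin> cball k (\<rho> k) \<Longrightarrow> \<zeta> k x = 0 \<and> d\<zeta> k x = 0"
    "\<And>x. x \<in> S \<Longrightarrow> (\<Sum>k\<in>K. \<zeta> k x) = 1" "\<And>x. x \<in> S \<Longrightarrow> (\<Sum>k\<in>K. d\<zeta> k x) = 0"
proof -
  obtain K \<rho> where K: "finite K" "K \<subseteq> S" "\<And>p. p \<in> K \<Longrightarrow> chart_ball p (\<rho> p)" "S \<subseteq> (\<Union>p\<in>K. ball p (\<rho> p))"
    by (rule atlas) blast
  have \<rho>: "\<rho> k > 0" if "k \<in> K" for k using K(3)[OF that] by (simp add: chart_ball_def)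
  define \<beta> where "\<beta> = (\<lambda>k x. bump (\<rho> k) (x - k))"
  define d\<beta> where "d\<beta> = (\<lambda>k x. \<chi> j. dbump (\<rho> k) (x - k) (lift x (axis j 1)))"
  define s where "s = (\<lambda>x. \<Sum>k\<in>K. \<beta> k x)"
  define ds where "ds = (\<lambda>x. \<Sum>k\<in>K. d\<beta> k x)"
  have \<beta>: "has_diff (\<beta> k) (d\<beta> k)" for k unfolding \<beta>_def d\<beta>_def by (rule has_diff_bump)
  have s: "has_diff s ds" unfolding s_def ds_def by (rule has_diff_sum[OF K(1) \<beta>])
  have spos: "s x > 0" if xS: "x \<in> S" for x
  proof -
    obtain k where k: "k \<in> K" "x \<in> ball k (\<rho> k)" using K(4) xS by blast
    have "norm (x - k) < \<rho> k" using k(2) by (simp add: dist_norm norm_minus_commute)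
    then have "(norm (x - k))\<^sup>2 < (\<rho> k)\<^sup>2" by (intro power_strict_mono) auto
    then have "\<beta> k x > 0" by (simp add: \<beta>_def bump_def power2_norm_eq_inner)
    then show ?thesis unfolding s_def
      by (intro sum_pos2[OF K(1) k(1)]) (auto simp: \<beta>_def bump_nonneg)
  qed
  define \<zeta> where "\<zeta> = (\<lambda>k x. \<beta> k x * inverse (s x))"
  define d\<zeta> where "d\<zeta> = (\<lambda>k x. \<beta> k x *\<^sub>R (- (inverse (s x) * inverse (s x)) *\<^sub>R ds x) + inverse (s x) *\<^sub>R d\<beta> k x)"
  have invs: "has_diff (\<lambda>p. inverse (s p)) (\<lambda>p. - (inverse (s p) * inverse (s p)) *\<^sub>R ds p)"
    by (rule has_diff_inverse[OF s]) (use spos in force)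
  show ?thesis
  proof (rule that[OF K(1) K(3)])
    show "has_diff (\<zeta> k) (d\<zeta> k)" for k unfolding \<zeta>_def d\<zeta>_def by (rule has_diff_mult[OF \<beta> invs])
    show "\<zeta> k x \<ge> 0" if "x \<in> S" for k x
      using spos[OF that] by (simp add: \<zeta>_def \<beta>_def bump_nonneg)
    show "\<zeta> k x = 0 \<and> d\<zeta> k x = 0" if "k \<in> K" "x \<in> S" "x \<notin> cball k (\<rho> k)" for k x
    proof -
      have "norm (x - k) \<ge> \<rho> k" using that(3) by (simp add: dist_norm norm_minus_commute)
      note o = bump_outside[OF this \<rho>[OF that(1)]]
      then have "\<beta> k x = 0" "d\<beta> k x = 0" by (auto simp: \<beta>_def d\<beta>_def vec_eq_iff)
      then show ?thesis by (simp add: \<zeta>_def d\<zeta>_def)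
    qed
    show "(\<Sum>k\<in>K. \<zeta> k x) = 1" if "x \<in> S" for x
    proof -
      have "(\<Sum>k\<in>K. \<zeta> k x) = s x * inverse (s x)" by (simp only: \<zeta>_def sum_distrib_right s_def)
      then show ?thesis using spos[OF that] by simp
    qed
    show "(\<Sum>k\<in>K. d\<zeta> k x) = 0" if "x \<in> S" for x
    proof -
      have "(\<Sum>k\<in>K. d\<zeta> k x) = s x *\<^sub>R (- (inverse (s x) * inverse (s x)) *\<^sub>R ds x) + inverse (s x) *\<^sub>R ds x"
        unfolding d\<zeta>_def sum.distrib scaleR_left.sum[symmetric] scaleR_right.sum[symmetric] by (simp add: s_def ds_def scaleR_sum_left scaleR_sum_right)
      also have "\<dots> = 0" using spos[OF that] by (simp add: field_simps)
      finally show ?thesis .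
    qed
  qed auto
qed

lemma push_sum:
  fixes h :: "'k \<Rightarrow> 'n minkowski \<Rightarrow> real"
  shows "push (\<lambda>x. \<Sum>k\<in>K. h k x) y = (\<Sum>k\<in>K. push (h k) y)"
  unfolding push_def by (rule sum.swap)

lemma push_cong: "(\<And>x. x \<in> S \<Longrightarrow> h x = h' x) \<Longrightarrow> push h y = push h' y"
  unfolding push_def by (rule sum.cong) auto

text \<open>
  A function of the projected point is constant on fibres.
\<close>
lemma push_snd_mult: "push (\<lambda>x. c (snd x) * h x) y = (c y :: real) * push h y"
  unfolding push_def sum_distrib_left by (rule sum.cong) auto

lemma push_chart_bounded:
  fixes h :: "'n minkowski \<Rightarrow> real"
  assumes fc: "flat_chart i U \<phi> a r g" and h: "\<And>x. x \<in> S \<Longrightarrow> x \<notin> \<phi> ` half_dom i (ball a r) \<Longrightarrow> h x = 0"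
    and B: "\<And>x. x \<in> S \<Longrightarrow> \<bar>h x\<bar> \<le> B"
  shows "\<bar>push h y\<bar> \<le> max B 0"
proof (cases "y \<in> (snd \<circ> \<phi>) ` half_dom i (ball a r)")
  case True
  then obtain z where z: "z \<in> half_dom i (ball a r)" "y = snd (\<phi> z)" by auto
  then have "g y = z" using flat_chartD(11)[OF fc, of z] by (simp add: half_dom_iff)
  moreover have "\<phi> z \<in> S" using z local_paramD(7)[OF flat_chartD(9)[OF fc]] by blast
  ultimately show ?thesis using True B[of "\<phi> z"] by (simp add: push_chart[OF fc h] le_max_iff_disj)
qed (simp add: push_chart[OF fc h])

lemma S_bounded:
  obtains R where "\<And>x. x \<in> S \<Longrightarrow> norm (snd x) \<le> R"
proof -
  have "bounded S" using comp by (rule compact_imp_bounded)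
  then obtain R where R: "\<And>x. x \<in> S \<Longrightarrow> norm x \<le> R" unfolding bounded_iff by blast
  have "norm (snd x) \<le> R" if "x \<in> S" for x
    using R[OF that] norm_snd_le[of "snd x" "fst x"] by simp
  then show ?thesis by (rule that)
qed

lemma continuous_S_bounded:
  fixes h :: "'n minkowski \<Rightarrow> real"
  assumes "continuous_on S h"
  obtains B where "B \<ge> 0" "\<And>x. x \<in> S \<Longrightarrow> \<bar>h x\<bar> \<le> B"
proof -
  have "bounded (h ` S)" by (intro compact_imp_bounded compact_continuous_image assms comp)
  then obtain B where "\<And>z. z \<in> h ` S \<Longrightarrow> norm z \<le> B" unfolding bounded_iff by blast
  then have "\<bar>h x\<bar> \<le> max B 0" if "x \<in> S" for x using that by (force simp: le_max_iff_disj)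
  then show ?thesis using that[of "max B 0"] by simp
qed

lemma push_outside: "y \<notin> snd ` S \<Longrightarrow> push h y = 0"
proof -
  assume "y \<notin> snd ` S"
  then have "{x\<in>S. snd x = y} = {}" by blast
  then show ?thesis unfolding push_def by (simp only: sum.empty)
qed

lemma push_continuous:
  fixes h :: "'n minkowski \<Rightarrow> real"
  assumes ch: "continuous_on S h"
  shows "push h \<in> borel_measurable borel" "integrable lborel (push h)" "\<exists>B\<ge>0. \<forall>y. \<bar>push h y\<bar> \<le> B"
proof -
  obtain K \<rho> \<zeta> d\<zeta> where K: "finite K" "\<And>k. k \<in> K \<Longrightarrow> chart_ball k (\<rho> k)" "\<And>k. k \<in> K \<Longrightarrow> has_diff (\<zeta> k) (d\<zeta> k)"
    "\<And>k x. k \<in> K \<Longrightarrow> x \<in> S \<Longrightarrow> x \<notin> cball k (\<rho> k) \<Longrightarrow> \<zeta> k x = 0 \<and> d\<zeta> k x = 0"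
    "\<And>x. x \<in> S \<Longrightarrow> (\<Sum>k\<in>K. \<zeta> k x) = 1"
    by (rule partition_of_unity) blast
  have eq: "push h y = (\<Sum>k\<in>K. push (\<lambda>x. \<zeta> k x * h x) y)" for y
    unfolding push_sum[symmetric] by (rule push_cong) (simp add: sum_distrib_right[symmetric] K(5))
  have ck: "continuous_on S (\<lambda>x. \<zeta> k x * h x)" if "k \<in> K" for k
    by (intro continuous_intros ch has_diff_continuous(1)[OF K(3)[OF that]])
  have m: "push (\<lambda>x. \<zeta> k x * h x) \<in> borel_measurable borel \<and> (\<exists>B\<ge>0. \<forall>y. \<bar>push (\<lambda>x. \<zeta> k x * h x) y\<bar> \<le> B)" if k: "k \<in> K" for k
  proof -
    obtain i U \<phi> a r g where fc: "flat_chart i U \<phi> a r g" and sub: "S \<inter> cball k (\<rho> k) \<subseteq> \<phi> ` half_dom i (ball a r)"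
      using K(2)[OF k] unfolding chart_ball_def by blast
    have z: "\<zeta> k x * h x = 0" if "x \<in> S" "x \<notin> \<phi> ` half_dom i (ball a r)" for x
    proof -
      have "x \<notin> cball k (\<rho> k)" using that sub by blast
      then show ?thesis using K(4)[OF k that(1)] by simp
    qed
    obtain B where B: "B \<ge> 0" "\<And>x. x \<in> S \<Longrightarrow> \<bar>\<zeta> k x * h x\<bar> \<le> B" by (rule continuous_S_bounded[OF ck[OF k]]) blast
    have "\<bar>push (\<lambda>x. \<zeta> k x * h x) y\<bar> \<le> max B 0" for y by (rule push_chart_bounded[OF fc z B(2)])
    moreover have "push (\<lambda>x. \<zeta> k x * h x) \<in> borel_measurable borel" by (rule push_borel[OF fc z ck[OF k]])
    ultimately show ?thesis by (intro conjI exI[of _ "max B 0"]) auto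
  qed
  show b: "push h \<in> borel_measurable borel"
    unfolding eq[abs_def] by (rule borel_measurable_sum) (use m in blast)
  have "\<exists>B. \<forall>k\<in>K. B k \<ge> 0 \<and> (\<forall>y. \<bar>push (\<lambda>x. \<zeta> k x * h x) y\<bar> \<le> B k)" using m by metis
  then obtain B where B: "\<And>k. k \<in> K \<Longrightarrow> B k \<ge> 0" "\<And>k y. k \<in> K \<Longrightarrow> \<bar>push (\<lambda>x. \<zeta> k x * h x) y\<bar> \<le> B k" by blast
  have bd: "\<bar>push h y\<bar> \<le> (\<Sum>k\<in>K. B k)" for y
    unfolding eq by (rule order_trans[OF sum_abs sum_mono]) (rule B(2))
  moreover have "(\<Sum>k\<in>K. B k) \<ge> 0" by (rule sum_nonneg) (rule B(1))
  ultimately show "\<exists>B\<ge>0. \<forall>y. \<bar>push h y\<bar> \<le> B" by blast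
  obtain R where R: "\<And>x. x \<in> S \<Longrightarrow> norm (snd x) \<le> R" by (rule S_bounded) blast
  show "integrable lborel (push h)"
  proof (rule integrable_bounded_support[OF b bd])
    show "push h y = 0" if "y \<notin> cball 0 R" for y
      by (rule push_outside) (use that R in auto)
  qed
qed

lemma push_mu_compare:
  fixes h :: "'n minkowski \<Rightarrow> real"
  assumes ch: "continuous_on S h" and h0: "\<And>x. x \<in> S \<Longrightarrow> h x \<ge> 0"
  shows "(\<integral>\<^sup>+p. ennreal (h p) \<partial>\<mu>) \<le> (\<integral>\<^sup>+y. ennreal (push h y) \<partial>lborel)"
    "(\<integral>\<^sup>+y. ennreal (push h y) \<partial>lborel) \<le> ennreal \<tau> * (\<integral>\<^sup>+p. ennreal (h p) \<partial>\<mu>)"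
proof -
  obtain K \<rho> \<zeta> d\<zeta> where K: "finite K" "\<And>k. k \<in> K \<Longrightarrow> chart_ball k (\<rho> k)" "\<And>k. k \<in> K \<Longrightarrow> has_diff (\<zeta> k) (d\<zeta> k)"
    "\<And>k x. k \<in> K \<Longrightarrow> x \<in> S \<Longrightarrow> \<zeta> k x \<ge> 0"
    "\<And>k x. k \<in> K \<Longrightarrow> x \<in> S \<Longrightarrow> x \<notin> cball k (\<rho> k) \<Longrightarrow> \<zeta> k x = 0 \<and> d\<zeta> k x = 0"
    "\<And>x. x \<in> S \<Longrightarrow> (\<Sum>k\<in>K. \<zeta> k x) = 1"
    by (rule partition_of_unity) blast
  let ?h = "\<lambda>k x. \<zeta> k x * h x"
  have eq: "push h y = (\<Sum>k\<in>K. push (?h k) y)" for y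
    unfolding push_sum[symmetric] by (rule push_cong) (simp add: sum_distrib_right[symmetric] K(6))
  have ck: "continuous_on S (?h k)" if "k \<in> K" for k
    by (intro continuous_intros ch has_diff_continuous(1)[OF K(3)[OF that]])
  have nn: "?h k x \<ge> 0" if "k \<in> K" "x \<in> S" for k x using K(4)[OF that] h0[OF that(2)] by simp
  have pnn: "push (?h k) y \<ge> 0" if "k \<in> K" for k y
    unfolding push_def by (rule sum_nonneg) (use nn[OF that] in auto)
  have c: "(\<integral>\<^sup>+p. ennreal (?h k p) \<partial>\<mu>) \<le> (\<integral>\<^sup>+y. ennreal (push (?h k) y) \<partial>lborel) \<and>
    (\<integral>\<^sup>+y. ennreal (push (?h k) y) \<partial>lborel) \<le> ennreal \<tau> * (\<integral>\<^sup>+p. ennreal (?h k p) \<partial>\<mu>)" if k: "k \<in> K" for k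
  proof -
    obtain i U \<phi> a r g where fc: "flat_chart i U \<phi> a r g" and sub: "S \<inter> cball k (\<rho> k) \<subseteq> \<phi> ` half_dom i (ball a r)"
      using K(2)[OF k] unfolding chart_ball_def by blast
    have z: "?h k x = 0" if "x \<in> S" "x \<notin> \<phi> ` half_dom i (ball a r)" for x
    proof -
      have "x \<notin> cball k (\<rho> k)" using that sub by blast
      then show ?thesis using K(5)[OF k that(1)] by simp
    qed
    show ?thesis using push_mu_compare_chart[OF fc z ck[OF k] nn[OF k]] by blast
  qed
  have i1: "(\<integral>\<^sup>+p. ennreal (h p) \<partial>\<mu>) = (\<Sum>k\<in>K. \<integral>\<^sup>+p. ennreal (?h k p) \<partial>\<mu>)"
  proof -
    have "(\<integral>\<^sup>+p. ennreal (h p) \<partial>\<mu>) = (\<integral>\<^sup>+p. (\<Sum>k\<in>K. ennreal (?h k p)) \<partial>\<mu>)"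
    proof (rule nn_integral_cong)
      fix p assume "p \<in> space \<mu>"
      then have p: "p \<in> S" by (simp add: mu)
      have "h p = (\<Sum>k\<in>K. ?h k p)" by (simp add: sum_distrib_right[symmetric] K(6)[OF p])
      then show "ennreal (h p) = (\<Sum>k\<in>K. ennreal (?h k p))" using nn p by simp
    qed
    also have "\<dots> = (\<Sum>k\<in>K. \<integral>\<^sup>+p. ennreal (?h k p) \<partial>\<mu>)"
      by (rule nn_integral_sum) (use continuous_measurable_mu[OF ck] in measurable)
    finally show ?thesis .
  qed
  have i2: "(\<integral>\<^sup>+y. ennreal (push h y) \<partial>lborel) = (\<Sum>k\<in>K. \<integral>\<^sup>+y. ennreal (push (?h k) y) \<partial>lborel)"
  proof -
    have "(\<integral>\<^sup>+y. ennreal (push h y) \<partial>lborel) = (\<integral>\<^sup>+y. (\<Sum>k\<in>K. ennreal (push (?h k) y)) \<partial>lborel)"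
      using pnn by (intro nn_integral_cong) (simp add: eq)
    also have "\<dots> = (\<Sum>k\<in>K. \<integral>\<^sup>+y. ennreal (push (?h k) y) \<partial>lborel)"
      by (rule nn_integral_sum) (use push_continuous(1)[OF ck] in measurable)
    finally show ?thesis .
  qed
  show "(\<integral>\<^sup>+p. ennreal (h p) \<partial>\<mu>) \<le> (\<integral>\<^sup>+y. ennreal (push h y) \<partial>lborel)"
    unfolding i1 i2 by (rule sum_mono) (use c in blast)
  show "(\<integral>\<^sup>+y. ennreal (push h y) \<partial>lborel) \<le> ennreal \<tau> * (\<integral>\<^sup>+p. ennreal (h p) \<partial>\<mu>)"
    unfolding i1 i2 sum_distrib_left by (rule sum_mono) (use c in blast)
qed

text \<open>
  The boundary hyperplane is a null set, and the projected chart is injective with a finite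
  Jacobian.
\<close>
lemma flat_bdry_null:
  assumes fc: "flat_chart i U \<phi> a r g"
  shows "AE y in lborel. y \<notin> (snd \<circ> \<phi>) ` bdry_dom i (ball a r)"
proof -
  let ?N = "(snd \<circ> \<phi>) ` bdry_dom i (ball a r)" and ?H = "half_dom i (ball a r)"
  have Nm: "?N \<in> sets borel" by (rule flat_image_borel(2)[OF fc])
  have hyp: "AE z in lborel. z $ i \<noteq> (0::real)"
  proof -
    have "negligible {z::real ^ 'n. z \<bullet> axis i 1 = 0}" by (rule negligible_standard_hyperplane) (auto simp: Basis_vec_def)
    then have "emeasure lebesgue {z::real ^ 'n. z $ i = 0} = 0"
      by (simp add: inner_axis negligible_iff_emeasure0 emeasure_eq_measure2)
    moreover have "{z::real ^ 'n. z $ i = 0} \<in> sets borel"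
      by (intro borel_closed closed_Collect_eq continuous_intros)
    ultimately have "emeasure lborel {z::real ^ 'n. z $ i = 0} = 0" by simp
    then show ?thesis
      by (subst AE_iff_measurable[OF _ refl]) (use \<open>{z::real ^ 'n. z $ i = 0} \<in> sets borel\<close> in auto)
  qed
  have "emeasure lborel ?N = (\<integral>\<^sup>+y. indicator ?N y * indicator ((snd \<circ> \<phi>) ` ?H) y \<partial>lborel)"
  proof -
    have "indicator ?N y * indicator ((snd \<circ> \<phi>) ` ?H) y = (indicator ?N y :: ennreal)" for y
      by (auto simp: indicator_def bdry_dom_iff half_dom_iff)
    then show ?thesis using Nm by simp
  qed
  also have "\<dots> = (\<integral>\<^sup>+z. indicator ?N (snd (\<phi> z)) * ennreal \<bar>det (matrix (snd \<circ> dd \<phi> z))\<bar> * indicator ?H z \<partial>lborel)"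
    by (rule nn_integral_flat_image[OF fc]) (use Nm in simp)
  also have "\<dots> = (\<integral>\<^sup>+z. 0 \<partial>(lborel :: (real ^ 'n) measure))"
  proof (rule nn_integral_cong_AE)
    show "AE z in lborel. indicator ?N (snd (\<phi> z)) * ennreal \<bar>det (matrix (snd \<circ> dd \<phi> z))\<bar> * indicator ?H z = 0"
      using hyp
    proof eventually_elim
      fix z :: "real ^ 'n" assume z: "z $ i \<noteq> 0"
      have "snd (\<phi> z) \<notin> ?N" if "z \<in> ?H"
      proof
        assume "snd (\<phi> z) \<in> ?N"
        then obtain w where "w \<in> bdry_dom i (ball a r)" "snd (\<phi> z) = snd (\<phi> w)" by auto
        then have "z = w" using flat_chartD(12)[OF fc] \<open>z \<in> ?H\<close> by (auto simp: inj_on_def bdry_dom_iff half_dom_iff)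
        then show False using z \<open>w \<in> _\<close> by (simp add: bdry_dom_iff)
      qed
      then show "indicator ?N (snd (\<phi> z)) * ennreal \<bar>det (matrix (snd \<circ> dd \<phi> z))\<bar> * indicator ?H z = 0"
        by (auto simp: indicator_def)
    qed
  qed
  finally have "emeasure lborel ?N = 0" by simp
  then show ?thesis by (subst AE_iff_measurable[where N = ?N]) (use Nm in auto)
qed

end


section \<open>The divergence theorem for the projected hypersurface\<close>

context spacelike_hypersurface
begin

text \<open>
  In the flat picture \<open>u\<close> becomes a function on the image of a half ball that vanishes near the
  spherical part of the boundary. It is multiplied by a cut-off that vanishes in a layer of width
  \<open>ep m\<close> along the flat part and is 1 outside a layer of width \<open>2 * ep m\<close>. The product is
  differentiable on the whole space with compact support, so the integral of its derivative in the
  direction \<open>e\<close> is zero. The derivative of \<open>u\<close> contributes, in the limit, the integral on the left;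
  the derivative of the cut-off contributes an integral over the layer, which
  \<open>chart_densities\<close> bounds by an average over parallel copies of the boundary of \<open>\<tau> * norm e\<close> times
  the integrand \<open>u\<close>, and this average converges to the boundary integral by continuity.
\<close>
lemma divergence_chart:
  assumes fc: "flat_chart i U \<phi> a r g" and sub\<rho>: "S \<inter> cball p \<rho> \<subseteq> \<phi> ` half_dom i (ball a r)"
    and u: "has_diff u du" and u0: "\<And>x. x \<in> S \<Longrightarrow> u x \<ge> 0"
    and supp: "\<And>x. x \<in> S \<Longrightarrow> x \<notin> cball p \<rho> \<Longrightarrow> u x = 0 \<and> du x = 0"
  shows "ennreal (\<integral>y. push (\<lambda>x. du x \<bullet> e) y \<partial>lborel) \<le> ennreal (\<tau> * norm e) * (\<integral>\<^sup>+x. ennreal (u x) \<partial>\<sigma>)"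
proof -
  note lpU = flat_chartD(1)[OF fc] and lp = flat_chartD(9)[OF fc]
  define H where "H = half_dom i (ball a r)"
  define \<theta> where "\<theta> = snd \<circ> \<phi>"
  define Op where "Op = ball a r \<inter> {z. 0 < z $ i}"
  define Om where "Om = \<theta> ` Op"
  define iv where "iv = (\<lambda>z. inv (snd \<circ> dd \<phi> z))"
  define vd where "vd = volume_density (UNIV - {i}) \<phi>"
  have HS: "\<phi> z \<in> S" if "z \<in> H" for z using that local_paramD(7)[OF lp] by (auto simp: H_def)
  have Hb: "z \<in> ball a r" "0 \<le> z $ i" if "z \<in> H" for z using that by (auto simp: H_def half_dom_iff)
  have OpH: "Op \<subseteq> H" by (auto simp: Op_def H_def half_dom_iff)
  have aS: "\<phi> a \<in> S" using HS flat_chartD(10)[OF fc] by (simp add: H_def)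
  have \<tau>1: "\<tau> \<ge> 1" by (rule one_le_tau[OF aS])
  have oOp: "open Op" unfolding Op_def by (intro open_Int open_ball open_Collect_less continuous_intros)
  have g\<theta>: "g (\<theta> z) = z" if "z \<in> ball a r" for z using flat_chartD(11)[OF fc that] by (simp add: \<theta>_def)
  have hom: "homeomorphism (ball a r) (\<theta> ` ball a r) \<theta> g" using flat_chartD(6)[OF fc] by (simp add: \<theta>_def)
  have oOm: "open Om"
  proof -
    have "openin (top_of_set (\<theta> ` ball a r)) (\<theta> ` Op)"
      by (rule homeomorphism_imp_open_map[OF hom]) (use oOp in \<open>auto simp: openin_open_eq Op_def\<close>)
    then show ?thesis using flat_chartD(5)[OF fc] openin_open_eq unfolding Om_def \<theta>_def by blast
  qed
  have gOm: "g y \<in> Op" "\<theta> (g y) = y" if y: "y \<in> Om" for y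
  proof -
    obtain z where "z \<in> Op" "y = \<theta> z" using y unfolding Om_def by blast
    then show "g y \<in> Op" "\<theta> (g y) = y" using g\<theta>[of z] by (auto simp: Op_def)
  qed
  have ivp: "snd (dd \<phi> z (iv z v)) = v" if "z \<in> ball a r" for z v
    using surj_f_inv_f[OF bij_is_surj[OF flat_chartD(7)[OF fc that]], of v] by (simp add: iv_def)
  have derg: "(g has_derivative iv z) (at (\<theta> z))" if "z \<in> ball a r" for z
    using flat_chartD(8)[OF fc that] by (simp add: iv_def \<theta>_def)
  have c\<theta>: "continuous_on (ball a r) \<theta>" using hom by (auto simp: homeomorphism_def)
  have cg: "continuous_on (\<theta> ` ball a r) g" using hom by (auto simp: homeomorphism_def)
  have c\<phi>: "continuous_on (ball a r) \<phi>" by (rule local_paramD(2)[OF lp])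
  have civ: "continuous_on (ball a r) (\<lambda>z. iv z v)" for v unfolding iv_def by (rule continuous_inv_derivative[OF fc])
  have cu: "continuous_on S u" and cdu: "continuous_on S du" using has_diff_continuous[OF u] by auto
  \<comment> \<open>compactness of the support keeps the cut-off functions away from the sphere\<close>
  define K where "K = (\<lambda>x. g (snd x)) ` (S \<inter> cball p \<rho>)"
  have gs: "snd x \<in> \<theta> ` ball a r \<and> g (snd x) \<in> H \<and> \<phi> (g (snd x)) = x" if x: "x \<in> S \<inter> cball p \<rho>" for x
  proof -
    obtain z where z: "z \<in> H" "x = \<phi> z" using x sub\<rho> unfolding H_def by blast
    then show ?thesis using g\<theta>[OF Hb(1)[OF z(1)]] Hb(1)[OF z(1)] by (auto simp: \<theta>_def)
  qed
  have Kc: "compact K" unfolding K_def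
  proof (rule compact_continuous_image)
    show "continuous_on (S \<inter> cball p \<rho>) (\<lambda>x. g (snd x))"
      by (rule continuous_on_compose2[OF cg continuous_on_snd[OF continuous_on_id]]) (use gs in blast)
    show "compact (S \<inter> cball p \<rho>)" using comp by (simp add: compact_Int)
  qed
  have KH: "K \<subseteq> H" unfolding K_def using gs by blast
  have Kb: "K \<subseteq> ball a r" using KH Hb by blast
  have offK: "u (\<phi> z) = 0 \<and> du (\<phi> z) = 0" if z: "z \<in> H" "z \<notin> K" for z
  proof (rule supp[OF HS[OF z(1)]])
    show "\<phi> z \<notin> cball p \<rho>"
    proof
      assume "\<phi> z \<in> cball p \<rho>"
      then have "g (snd (\<phi> z)) \<in> K" unfolding K_def using HS[OF z(1)] by blast
      then show False using g\<theta>[OF Hb(1)[OF z(1)]] z(2) by (simp add: \<theta>_def)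
    qed
  qed
  obtain Bu where Bu: "Bu \<ge> 0" "\<And>x. x \<in> S \<Longrightarrow> \<bar>u x\<bar> \<le> Bu" by (rule continuous_S_bounded[OF cu]) blast
  have cdue: "continuous_on S (\<lambda>x. du x \<bullet> e)" by (intro continuous_intros cdu)
  obtain Bd where Bd: "Bd \<ge> 0" "\<And>x. x \<in> S \<Longrightarrow> \<bar>du x \<bullet> e\<bar> \<le> Bd" by (rule continuous_S_bounded[OF cdue]) blast
  obtain Bi where Bi: "Bi \<ge> 0" "\<And>z. z \<in> K \<Longrightarrow> \<bar>iv z e $ i\<bar> \<le> Bi"
  proof -
    have "bounded ((\<lambda>z. iv z e $ i) ` K)"
      by (intro compact_imp_bounded compact_continuous_image Kc continuous_intros continuous_on_subset[OF civ Kb])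
    then obtain B where B: "\<And>z. z \<in> (\<lambda>z. iv z e $ i) ` K \<Longrightarrow> norm z \<le> B" unfolding bounded_iff by blast
    have "\<bar>iv z e $ i\<bar> \<le> max B 0" if "z \<in> K" for z using B[of "iv z e $ i"] that by (simp add: le_max_iff_disj)
    then show ?thesis using that[of "max B 0"] by simp
  qed
  \<comment> \<open>at interior points, g is differentiable and \<open>dd \<phi> z \<circ> iv z\<close> is the lift\<close>
  have deru: "((\<lambda>y. u (\<phi> (g y))) has_derivative (\<lambda>v. du (\<phi> (g y)) \<bullet> v)) (at y)" if y: "y \<in> Om" for y
  proof -
    define z where "z = g y"
    have z: "z \<in> Op" "\<theta> z = y" using gOm[OF y] by (auto simp: z_def)
    have zb: "z \<in> ball a r" and zH: "z \<in> H" using z(1) OpH by (auto simp: Op_def)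
    obtain u' where u': "(u has_derivative u') (at (\<phi> z) within S)" "\<And>e. u' (lift (\<phi> z) e) = du (\<phi> z) \<bullet> e"
      by (rule has_diffE[OF u HS[OF zH]]) blast
    have "(\<phi> has_derivative dd \<phi> z) (at z within Op)"
      by (rule has_derivative_at_withinI[OF local_paramD(3)[OF lp zb]])
    moreover have "(u has_derivative u') (at (\<phi> z) within \<phi> ` Op)"
      by (rule has_derivative_subset[OF u'(1)]) (use HS OpH in blast)
    ultimately have "(u \<circ> \<phi> has_derivative u' \<circ> dd \<phi> z) (at z within Op)"
      by (rule diff_chain_within)
    then have 1: "(u \<circ> \<phi> has_derivative u' \<circ> dd \<phi> z) (at z)"
      by (simp only: at_within_open[OF z(1) oOp])
    have "(g has_derivative iv z) (at y)" using derg[OF zb] z(2) by simp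
    from diff_chain_at[OF this, of "u \<circ> \<phi>"] 1
    have 2: "((u \<circ> \<phi>) \<circ> g has_derivative (u' \<circ> dd \<phi> z) \<circ> iv z) (at y)" by (simp add: z_def)
    have "(u' \<circ> dd \<phi> z) (iv z v) = du (\<phi> z) \<bullet> v" for v
    proof -
      have "dd \<phi> z (iv z v) = lift (\<phi> z) v"
        using lift_chart[OF lp, of z "iv z v"] zH ivp[OF zb, of v] by (simp add: H_def)
      then show ?thesis using u'(2) by simp
    qed
    then have "(u' \<circ> dd \<phi> z) \<circ> iv z = (\<lambda>v. du (\<phi> z) \<bullet> v)" by (simp add: fun_eq_iff)
    then show ?thesis using 2 by (simp add: o_def z_def)
  qed
  define ep where "ep = (\<lambda>m::nat. 1 / (real m + 1))"
  have ep: "ep m > 0" "ep m \<le> 1" for m by (auto simp: ep_def)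
  have ep0: "ep \<longlonglongrightarrow> 0"
    unfolding ep_def using LIMSEQ_inverse_real_of_nat by (simp add: inverse_eq_divide add.commute)
  define w where "w = (\<lambda>m y. if y \<in> Om then u (\<phi> (g y)) * ramp (g y $ i / ep m - 1) else 0)"
  define W where "W = (\<lambda>m y v. if y \<in> Om then (du (\<phi> (g y)) \<bullet> v) * ramp (g y $ i / ep m - 1)
      + u (\<phi> (g y)) * (dramp (g y $ i / ep m - 1) * (iv (g y) v $ i / ep m)) else 0)"
  define X where "X = (\<lambda>m y. if y \<in> Om then (du (\<phi> (g y)) \<bullet> e) * ramp (g y $ i / ep m - 1) else 0)"
  have derw: "(w m has_derivative W m y) (at y)" for m y
  proof (cases "y \<in> Om")
    case True
    have zb: "g y \<in> ball a r" using gOm[OF True] by (simp add: Op_def)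
    have dg: "(g has_derivative iv (g y)) (at y)" using derg[OF zb] gOm(2)[OF True] by simp
    have d1: "((\<lambda>y. g y $ i / ep m - 1) has_derivative (\<lambda>v. iv (g y) v $ i / ep m)) (at y)"
      using bounded_linear.has_derivative[OF bounded_linear_vec_nth dg, of i] ep(1)[of m]
      by (auto intro!: derivative_eq_intros)
    have d2: "(ramp has_derivative (\<lambda>h. dramp (g y $ i / ep m - 1) * h)) (at (g y $ i / ep m - 1))"
      using DERIV_ramp by (simp add: has_field_derivative_def)
    have dc: "((\<lambda>y. ramp (g y $ i / ep m - 1)) has_derivative (\<lambda>v. dramp (g y $ i / ep m - 1) * (iv (g y) v $ i / ep m))) (at y)"
      using diff_chain_at[OF d1 d2] by (simp only: o_def)
    have "((\<lambda>y. u (\<phi> (g y)) * ramp (g y $ i / ep m - 1)) has_derivative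
      (\<lambda>v. u (\<phi> (g y)) * (dramp (g y $ i / ep m - 1) * (iv (g y) v $ i / ep m)) + (du (\<phi> (g y)) \<bullet> v) * ramp (g y $ i / ep m - 1))) (at y)"
      by (rule has_derivative_mult[OF deru[OF True] dc])
    then have "(w m has_derivative
      (\<lambda>v. u (\<phi> (g y)) * (dramp (g y $ i / ep m - 1) * (iv (g y) v $ i / ep m)) + (du (\<phi> (g y)) \<bullet> v) * ramp (g y $ i / ep m - 1))) (at y)"
      by (rule has_derivative_transform_within_open[OF _ oOm True]) (simp add: w_def)
    moreover have "W m y = (\<lambda>v. u (\<phi> (g y)) * (dramp (g y $ i / ep m - 1) * (iv (g y) v $ i / ep m)) + (du (\<phi> (g y)) \<bullet> v) * ramp (g y $ i / ep m - 1))"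
      using True by (simp add: W_def fun_eq_iff)
    ultimately show ?thesis by simp
  next
    case False
    let ?Ke = "K \<inter> {z. ep m \<le> z $ i}"
    have "closed {z::real ^ 'n. ep m \<le> z $ i}" by (intro closed_Collect_le continuous_intros)
    then have "compact ?Ke" by (intro compact_Int_closed Kc)
    then have "compact (\<theta> ` ?Ke)"
      by (intro compact_continuous_image continuous_on_subset[OF c\<theta>]) (use Kb in auto)
    then have op: "open (- \<theta> ` ?Ke)" using compact_imp_closed open_Compl by blast
    have KeOm: "\<theta> ` ?Ke \<subseteq> Om"
      unfolding Om_def Op_def using Kb ep(1)[of m] by (intro image_mono) force
    have yc: "y \<in> - \<theta> ` ?Ke" using False KeOm by blast
    have "w m y' = 0" if y': "y' \<in> - \<theta> ` ?Ke" for y'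
    proof (cases "y' \<in> Om")
      case True
      have gy: "g y' \<in> H" "\<theta> (g y') = y'" using gOm[OF True] OpH by auto
      then have "g y' \<notin> ?Ke" using y' by force
      then show ?thesis
      proof (cases "g y' \<in> K")
        case True
        then have "g y' $ i / ep m - 1 \<le> 0" using \<open>g y' \<notin> ?Ke\<close> ep(1)[of m] by (simp add: field_simps)
        then show ?thesis by (simp add: w_def ramp_simps)
      next
        case False
        then show ?thesis using offK[OF gy(1)] by (simp add: w_def)
      qed
    qed (simp add: w_def)
    then have "(w m has_derivative (\<lambda>v. 0)) (at y)"
      by (intro has_derivative_transform_within_open[OF has_derivative_const[of 0] op yc]) simp
    moreover have "W m y = (\<lambda>v. 0)" using False by (simp add: W_def fun_eq_iff)
    ultimately show ?thesis by simp
  qed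
  have Wb: "\<bar>W m y e\<bar> \<le> Bd + Bu * (2 * (Bi / ep m))" for m y
  proof (cases "y \<in> Om")
    case True
    have gH: "g y \<in> H" using gOm[OF True] OpH by auto
    show ?thesis
    proof (cases "g y \<in> K")
      case gK: True
      have "\<bar>(du (\<phi> (g y)) \<bullet> e) * ramp (g y $ i / ep m - 1)\<bar> \<le> Bd * 1"
        unfolding abs_mult using Bd(2)[OF HS[OF gH]] Bd(1) ramp_bounds by (intro mult_mono) auto
      moreover have "\<bar>u (\<phi> (g y)) * (dramp (g y $ i / ep m - 1) * (iv (g y) e $ i / ep m))\<bar> \<le> Bu * (2 * (Bi / ep m))"
      proof -
        have "\<bar>iv (g y) e $ i / ep m\<bar> \<le> Bi / ep m"
          using Bi(2)[OF gK] ep(1)[of m] by (simp add: abs_divide divide_right_mono)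
        moreover have "\<bar>dramp (g y $ i / ep m - 1)\<bar> \<le> 2" using ramp_simps(5,6)[of "g y $ i / ep m - 1"] by simp
        ultimately show ?thesis
          unfolding abs_mult using Bu(2)[OF HS[OF gH]] Bu(1) Bi(1) by (intro mult_mono) auto
      qed
      moreover have "W m y e = (du (\<phi> (g y)) \<bullet> e) * ramp (g y $ i / ep m - 1)
          + u (\<phi> (g y)) * (dramp (g y $ i / ep m - 1) * (iv (g y) e $ i / ep m))"
        using True by (simp add: W_def)
      ultimately show ?thesis by linarith
    next
      case False
      then show ?thesis using offK[OF gH] True Bd(1) Bu(1) Bi(1) ep(1)[of m] by (simp add: W_def)
    qed
  qed (use Bd(1) Bu(1) Bi(1) ep(1)[of m] in \<open>simp add: W_def\<close>)
  obtain R where R: "\<And>x. x \<in> S \<Longrightarrow> norm (snd x) \<le> R" by (rule S_bounded) blast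
  have wsupp: "w m y = 0" if y: "y \<notin> cball 0 R" for m y
  proof -
    have "y \<notin> Om"
    proof
      assume "y \<in> Om"
      then have "y = snd (\<phi> (g y))" "\<phi> (g y) \<in> S" using gOm OpH HS by (auto simp: \<theta>_def)
      then show False using R[of "\<phi> (g y)"] y by simp
    qed
    then show ?thesis by (simp add: w_def)
  qed
  have Wint: "integrable lborel (\<lambda>y. W m y e)" "(\<integral>y. W m y e \<partial>lborel) = 0" for m
    using integral_directional_derivative_zero[of "w m" "W m" e, OF derw Wb wsupp] by auto
  \<comment> \<open>the term X in which u is differentiated; it converges off the projected boundary\<close>
  define P where "P = push (\<lambda>x. du x \<bullet> e)"
  have Poff: "du x \<bullet> e = 0" if "x \<in> S" "x \<notin> \<phi> ` half_dom i (ball a r)" for x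
  proof -
    have "x \<notin> cball p \<rho>" using that sub\<rho> by blast
    then show ?thesis using supp[OF that(1)] by simp
  qed
  have Pch: "P y = (if y \<in> \<theta> ` H then du (\<phi> (g y)) \<bullet> e else 0)" for y
    unfolding P_def H_def \<theta>_def by (rule push_chart[OF fc Poff])
  have Pm: "P \<in> borel_measurable borel" "integrable lborel P"
    unfolding P_def using push_continuous(1,2)[OF cdue] by auto
  have OmH: "y \<in> \<theta> ` H" if "y \<in> Om" for y using that OpH unfolding Om_def by blast
  have XP: "X m y = (if y \<in> Om then P y * ramp (g y $ i / ep m - 1) else 0)" for m y
    by (simp add: X_def Pch OmH)
  have Xm: "X m \<in> borel_measurable borel" for m
  proof -
    have "continuous_on Om (\<lambda>y. ramp (g y $ i / ep m - 1))"
    proof (rule continuous_on_compose2[OF continuous_ramp(1)[of UNIV]])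
      show "continuous_on Om (\<lambda>y. g y $ i / ep m - 1)"
        using ep(1)[of m] by (intro continuous_intros continuous_on_subset[OF cg]) (auto simp: Om_def Op_def)
    qed auto
    from borel_measurable_continuous_on_indicator[OF borel_open[OF oOm] this] Pm(1)
    have "(\<lambda>y. P y * (indicator Om y *\<^sub>R ramp (g y $ i / ep m - 1))) \<in> borel_measurable borel" by measurable
    also have "(\<lambda>y. P y * (indicator Om y *\<^sub>R ramp (g y $ i / ep m - 1))) = X m"
      by (auto simp: XP fun_eq_iff indicator_def)
    finally show ?thesis .
  qed
  have Xle: "norm (X m y) \<le> \<bar>P y\<bar>" for m y
    using ramp_bounds[of "g y $ i / ep m - 1"] by (auto simp: XP abs_mult intro!: mult_left_le)
  have Xlim: "AE y in lborel. (\<lambda>m. X m y) \<longlonglongrightarrow> P y"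
    using flat_bdry_null[OF fc]
  proof eventually_elim
    fix y assume y: "y \<notin> (snd \<circ> \<phi>) ` bdry_dom i (ball a r)"
    show "(\<lambda>m. X m y) \<longlonglongrightarrow> P y"
    proof (cases "y \<in> Om")
      case True
      have pos: "g y $ i > 0" using gOm[OF True] by (simp add: Op_def)
      have "\<forall>\<^sub>F m in sequentially. ep m < g y $ i / 2"
        by (rule order_tendstoD(2)[OF ep0]) (use pos in simp)
      then have "\<forall>\<^sub>F m in sequentially. X m y = P y"
      proof eventually_elim
        fix m assume "ep m < g y $ i / 2"
        then have "g y $ i / ep m - 1 \<ge> 1" using ep(1)[of m] by (simp add: field_simps)
        then show "X m y = P y" using True by (simp add: XP ramp_simps)
      qed
      then show ?thesis by (rule tendsto_eventually)
    next
      case False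
      have "y \<notin> \<theta> ` H"
      proof
        assume "y \<in> \<theta> ` H"
        then obtain z where z: "z \<in> H" "y = \<theta> z" by blast
        show False
        proof (cases "z $ i = 0")
          case True
          then have "z \<in> bdry_dom i (ball a r)" using Hb[OF z(1)] by (simp add: bdry_dom_iff)
          then show False using y z(2) by (auto simp: \<theta>_def)
        next
          case F2: False
          then have "z \<in> Op" using Hb[OF z(1)] by (simp add: Op_def)
          then show False using False z(2) by (simp add: Om_def)
        qed
      qed
      then show ?thesis using False by (simp add: XP Pch)
    qed
  qed
  have Xint: "integrable lborel (X m)" for m
    by (rule Bochner_Integration.integrable_bound[OF integrable_abs[OF Pm(2)]]) (use Xm Xle in auto)
  have limX: "(\<lambda>m. \<integral>y. X m y \<partial>lborel) \<longlonglongrightarrow> (\<integral>y. P y \<partial>lborel)"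
    by (rule integral_dominated_convergence[where w = "\<lambda>y. \<bar>P y\<bar>"]) (use Pm Xm Xle Xlim in auto)
  \<comment> \<open>the term Y in which the cut-off is differentiated, with integral opposite to that of X\<close>
  define Y where "Y = (\<lambda>m y. W m y e - X m y)"
  have Yint: "integrable lborel (Y m)" for m unfolding Y_def using Wint(1) Xint by auto
  have Yeq: "Y m y = (if y \<in> Om then u (\<phi> (g y)) * (dramp (g y $ i / ep m - 1) * (iv (g y) e $ i / ep m)) else 0)" for m y
    by (simp add: Y_def W_def X_def)
  have XY: "ennreal (\<integral>y. X m y \<partial>lborel) \<le> (\<integral>\<^sup>+y. ennreal \<bar>Y m y\<bar> \<partial>lborel)" for m
  proof -
    have "(\<integral>y. Y m y \<partial>lborel) = - (\<integral>y. X m y \<partial>lborel)"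
      unfolding Y_def using Wint[of m] Xint[of m] by simp
    then have "(\<integral>y. X m y \<partial>lborel) \<le> \<bar>\<integral>y. Y m y \<partial>lborel\<bar>" by simp
    also have "\<dots> \<le> (\<integral>y. \<bar>Y m y\<bar> \<partial>lborel)" by (rule integral_abs_bound)
    finally have "ennreal (\<integral>y. X m y \<partial>lborel) \<le> ennreal (\<integral>y. \<bar>Y m y\<bar> \<partial>lborel)" by (rule ennreal_leI)
    also have "\<dots> = (\<integral>\<^sup>+y. ennreal \<bar>Y m y\<bar> \<partial>lborel)"
      by (rule nn_integral_eq_integral[symmetric]) (use integrable_abs[OF Yint] in auto)
    finally show ?thesis .
  qed
  define k where "k = (\<lambda>z. indicator H z *\<^sub>R (u (\<phi> z) * vd z))"
  have Hm: "H \<in> sets borel" unfolding H_def by (simp add: borel_half_dom)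
  have cH: "continuous_on H (\<lambda>z. u (\<phi> z) * vd z)"
    unfolding vd_def
    by (intro continuous_intros continuous_on_compose2[OF cu continuous_on_subset[OF c\<phi>]]
        continuous_on_subset[OF continuous_volume_density[OF lp]]) (use Hb HS in auto)
  have km[measurable]: "k \<in> borel_measurable borel"
    unfolding k_def by (rule borel_measurable_continuous_on_indicator[OF Hm cH])
  have vd0: "vd z > 0" if "z \<in> H" for z
    using volume_density_pos(2)[OF lp] that by (simp add: vd_def H_def)
  have k0: "k z \<ge> 0" for z
    using vd0[of z] u0[OF HS[of z]] by (cases "z \<in> H") (auto simp: k_def)
  obtain Bv where Bv: "\<And>y. y \<in> ball a r \<Longrightarrow> vd y \<le> Bv" unfolding vd_def by (rule volume_density_bounded[OF fc]) blast
  define Bk where "Bk = Bu * max Bv 0"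
  have Bk0: "Bk \<ge> 0" using Bu(1) by (simp add: Bk_def)
  have kB: "k z \<le> Bk" for z
  proof (cases "z \<in> H")
    case True
    then have "u (\<phi> z) * vd z \<le> Bu * max Bv 0"
      using Bu(2)[OF HS[OF True]] Bu(1) Bv[OF Hb(1)[OF True]] vd0[OF True] by (intro mult_mono) (auto simp: le_max_iff_disj)
    then show ?thesis using True by (simp add: k_def Bk_def)
  qed (use Bk0 in \<open>simp add: k_def\<close>)
  \<comment> \<open>the substitution t = ep m * (1 + s) blows the boundary layer up to unit width\<close>
  define J where "J = (\<lambda>m. \<integral>\<^sup>+z. (\<integral>\<^sup>+s. ennreal (k (z + (ep m * (1 + s)) *\<^sub>R axis i 1)) * ennreal (dramp s) \<partial>lborel) \<partial>coord_lebesgue (UNIV - {i}))"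
  have YJ: "(\<integral>\<^sup>+y. ennreal \<bar>Y m y\<bar> \<partial>lborel) \<le> ennreal (\<tau> * norm e) * J m" for m
  proof -
    have Ym: "(\<lambda>y. ennreal \<bar>Y m y\<bar>) \<in> borel_measurable borel" using borel_measurable_integrable[OF Yint[of m]] by measurable
    have "(\<integral>\<^sup>+y. ennreal \<bar>Y m y\<bar> \<partial>lborel) = (\<integral>\<^sup>+y. ennreal \<bar>Y m y\<bar> * indicator ((snd \<circ> \<phi>) ` half_dom i (ball a r)) y \<partial>lborel)"
    proof (rule nn_integral_cong)
      fix y show "ennreal \<bar>Y m y\<bar> = ennreal \<bar>Y m y\<bar> * indicator ((snd \<circ> \<phi>) ` half_dom i (ball a r)) y"
        using OmH[of y] by (cases "y \<in> Om") (auto simp: Yeq \<theta>_def H_def)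
    qed
    also have "\<dots> = (\<integral>\<^sup>+z. ennreal \<bar>Y m (snd (\<phi> z))\<bar> * ennreal \<bar>det (matrix (snd \<circ> dd \<phi> z))\<bar> * indicator (half_dom i (ball a r)) z \<partial>lborel)"
      by (rule nn_integral_flat_image[OF fc Ym])
    also have "\<dots> \<le> (\<integral>\<^sup>+z. ennreal (\<tau> * norm e) * (ennreal (k z) * ennreal (dramp (z $ i / ep m - 1) / ep m)) \<partial>lborel)"
    proof (rule nn_integral_mono)
      fix z :: "real ^ 'n"
      show "ennreal \<bar>Y m (snd (\<phi> z))\<bar> * ennreal \<bar>det (matrix (snd \<circ> dd \<phi> z))\<bar> * indicator (half_dom i (ball a r)) z
          \<le> ennreal (\<tau> * norm e) * (ennreal (k z) * ennreal (dramp (z $ i / ep m - 1) / ep m))"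
      proof (cases "z \<in> Op")
        case True
        then have zH: "z \<in> H" and zb: "z \<in> ball a r" using OpH by (auto simp: Op_def)
        have "\<theta> z \<in> Om" using True by (simp add: Om_def)
        then have "Y m (snd (\<phi> z)) = u (\<phi> z) * (dramp (z $ i / ep m - 1) * (iv z e $ i / ep m))"
          using g\<theta>[OF zb] by (simp add: Yeq \<theta>_def)
        then have "\<bar>Y m (snd (\<phi> z))\<bar> * \<bar>det (matrix (snd \<circ> dd \<phi> z))\<bar>
           = u (\<phi> z) * (dramp (z $ i / ep m - 1) / ep m) * (\<bar>iv z e $ i\<bar> * \<bar>det (matrix (snd \<circ> dd \<phi> z))\<bar>)"
          using u0[OF HS[OF zH]] ramp_simps(5) ep(1)[of m] by (simp add: abs_mult)
        also have "\<dots> \<le> u (\<phi> z) * (dramp (z $ i / ep m - 1) / ep m) * (\<tau> * (norm e * vd z))"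
        proof (rule mult_left_mono)
          show "\<bar>iv z e $ i\<bar> * \<bar>det (matrix (snd \<circ> dd \<phi> z))\<bar> \<le> \<tau> * (norm e * vd z)"
            using chart_densities(4)[OF lp, of z "iv z e"] zH ivp[OF zb, of e] by (simp add: H_def vd_def)
          show "0 \<le> u (\<phi> z) * (dramp (z $ i / ep m - 1) / ep m)"
            using u0[OF HS[OF zH]] ramp_simps(5) ep(1)[of m] by (simp add: less_imp_le)
        qed
        also have "\<dots> = \<tau> * norm e * (k z * (dramp (z $ i / ep m - 1) / ep m))"
          using zH by (simp add: k_def)
        finally have "ennreal (\<bar>Y m (snd (\<phi> z))\<bar> * \<bar>det (matrix (snd \<circ> dd \<phi> z))\<bar>) \<le> ennreal (\<tau> * norm e * (k z * (dramp (z $ i / ep m - 1) / ep m)))"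
          by (rule ennreal_leI)
        moreover have "0 \<le> dramp (z $ i / ep m - 1) / ep m" using ramp_simps(5) ep(1)[of m] by (simp add: less_imp_le)
        moreover have "0 \<le> \<tau> * norm e" using \<tau>1 by simp
        moreover have "indicator (half_dom i (ball a r)) z = (1::ennreal)" using zH by (simp add: H_def)
        ultimately show ?thesis using k0[of z] by (simp only: ennreal_mult mult_nonneg_nonneg abs_ge_zero mult_1_right)
      next
        case False
        have "Y m (snd (\<phi> z)) = 0" if zH: "z \<in> H"
        proof -
          have "\<theta> z \<notin> Om"
          proof
            assume "\<theta> z \<in> Om"
            then have "z \<in> Op" using gOm(1)[of "\<theta> z"] g\<theta>[OF Hb(1)[OF zH]] by simp
            then show False using False by simp
          qed
          then show ?thesis by (simp add: Yeq \<theta>_def)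
        qed
        then show ?thesis by (auto simp: indicator_def H_def)
      qed
    qed
    also have "\<dots> = ennreal (\<tau> * norm e) * (\<integral>\<^sup>+z. ennreal (k z) * ennreal (dramp (z $ i / ep m - 1) / ep m) \<partial>lborel)"
      by (rule nn_integral_cmult) measurable
    also have "(\<integral>\<^sup>+z. ennreal (k z) * ennreal (dramp (z $ i / ep m - 1) / ep m) \<partial>lborel) = J m"
    proof -
      have "(\<integral>\<^sup>+z. ennreal (k z) * ennreal (dramp (z $ i / ep m - 1) / ep m) \<partial>lborel)
        = (\<integral>\<^sup>+z. (\<integral>\<^sup>+t. ennreal (k (z + t *\<^sub>R axis i 1)) * ennreal (dramp ((z + t *\<^sub>R axis i 1) $ i / ep m - 1) / ep m) \<partial>lborel) \<partial>coord_lebesgue (UNIV - {i}))"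
        by (rule nn_integral_lborel_coord) measurable
      also have "\<dots> = J m"
        unfolding J_def
      proof (rule nn_integral_cong_AE)
        show "AE z in coord_lebesgue (UNIV - {i}). (\<integral>\<^sup>+t. ennreal (k (z + t *\<^sub>R axis i 1)) * ennreal (dramp ((z + t *\<^sub>R axis i 1) $ i / ep m - 1) / ep m) \<partial>lborel)
          = (\<integral>\<^sup>+s. ennreal (k (z + (ep m * (1 + s)) *\<^sub>R axis i 1)) * ennreal (dramp s) \<partial>lborel)"
          using AE_coord_lebesgue[of i]
        proof eventually_elim
          fix z :: "real ^ 'n" assume z: "z $ i = 0"
          have "(\<integral>\<^sup>+t. ennreal (k (z + t *\<^sub>R axis i 1)) * ennreal (dramp ((z + t *\<^sub>R axis i 1) $ i / ep m - 1) / ep m) \<partial>lborel)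
            = (\<integral>\<^sup>+t. ennreal (k (z + t *\<^sub>R axis i 1)) * ennreal (dramp (t / ep m - 1) / ep m) \<partial>lborel)"
            using z by (simp add: axis_def)
          also have "\<dots> = ennreal \<bar>ep m\<bar> * (\<integral>\<^sup>+s. ennreal (k (z + (ep m + ep m * s) *\<^sub>R axis i 1)) * ennreal (dramp ((ep m + ep m * s) / ep m - 1) / ep m) \<partial>lborel)"
            by (rule nn_integral_real_affine) (use ep(1)[of m] in auto)
          also have "\<dots> = (\<integral>\<^sup>+s. ennreal \<bar>ep m\<bar> * (ennreal (k (z + (ep m + ep m * s) *\<^sub>R axis i 1)) * ennreal (dramp ((ep m + ep m * s) / ep m - 1) / ep m)) \<partial>lborel)"
            by (rule nn_integral_cmult[symmetric]) measurable
          also have "\<dots> = (\<integral>\<^sup>+s. ennreal (k (z + (ep m * (1 + s)) *\<^sub>R axis i 1)) * ennreal (dramp s) \<partial>lborel)"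
          proof (rule nn_integral_cong)
            fix s :: real
            have 1: "(ep m + ep m * s) / ep m - 1 = s" using ep(1)[of m] by (simp add: field_simps)
            have 2: "ep m + ep m * s = ep m * (1 + s)" by (simp add: algebra_simps)
            have 3: "ennreal (ep m) * ennreal (dramp s / ep m) = ennreal (dramp s)"
              using ep(1)[of m] ramp_simps(5)[of s] by (simp add: ennreal_mult[symmetric] less_imp_le)
            show "ennreal \<bar>ep m\<bar> * (ennreal (k (z + (ep m + ep m * s) *\<^sub>R axis i 1)) * ennreal (dramp ((ep m + ep m * s) / ep m - 1) / ep m))
              = ennreal (k (z + (ep m * (1 + s)) *\<^sub>R axis i 1)) * ennreal (dramp s)"
              unfolding 1 2 mult.left_commute[of "ennreal \<bar>ep m\<bar>"] using ep(1)[of m] 3 by simp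
          qed
          finally show "(\<integral>\<^sup>+t. ennreal (k (z + t *\<^sub>R axis i 1)) * ennreal (dramp ((z + t *\<^sub>R axis i 1) $ i / ep m - 1) / ep m) \<partial>lborel)
            = (\<integral>\<^sup>+s. ennreal (k (z + (ep m * (1 + s)) *\<^sub>R axis i 1)) * ennreal (dramp s) \<partial>lborel)" .
        qed
      qed
      finally show ?thesis .
    qed
    finally show ?thesis .
  qed
  have klim: "(\<lambda>m. k (z + (ep m * (1 + s)) *\<^sub>R axis i 1)) \<longlonglongrightarrow> k z" if z: "z $ i = 0" and s: "s \<ge> 0" for z s
  proof -
    let ?q = "\<lambda>m. z + (ep m * (1 + s)) *\<^sub>R axis i (1::real)"
    have "(\<lambda>m. z + (ep m * (1 + s)) *\<^sub>R axis i (1::real)) \<longlonglongrightarrow> z + (0 * (1 + s)) *\<^sub>R axis i 1"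
      by (intro tendsto_intros ep0)
    then have q: "?q \<longlonglongrightarrow> z" by simp
    have qi: "?q m $ i \<ge> 0" for m using z s ep(1)[of m] by (simp add: axis_def)
    show ?thesis
    proof (cases "z \<in> ball a r")
      case True
      have zH: "z \<in> H" using True z by (simp add: H_def half_dom_iff)
      have "\<forall>\<^sub>F m in sequentially. ?q m \<in> ball a r" by (rule topological_tendstoD[OF q open_ball True])
      then have ev: "\<forall>\<^sub>F m in sequentially. ?q m \<in> H" by eventually_elim (use qi in \<open>simp add: H_def half_dom_iff\<close>)
      have "(\<lambda>m. u (\<phi> (?q m)) * vd (?q m)) \<longlonglongrightarrow> u (\<phi> z) * vd z"
        by (rule continuous_on_tendsto_compose[OF cH q zH ev])
      moreover have "\<forall>\<^sub>F m in sequentially. u (\<phi> (?q m)) * vd (?q m) = k (?q m)"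
        using ev by eventually_elim (simp add: k_def)
      ultimately have "(\<lambda>m. k (?q m)) \<longlonglongrightarrow> u (\<phi> z) * vd z" by (rule Lim_transform_eventually)
      then show ?thesis using zH by (simp add: k_def)
    next
      case False
      have "open (- K)" using compact_imp_closed[OF Kc] by (simp add: open_Compl)
      then have "\<forall>\<^sub>F m in sequentially. ?q m \<in> - K"
        by (rule topological_tendstoD[OF q]) (use False Kb in blast)
      then have "\<forall>\<^sub>F m in sequentially. k (?q m) = k z"
      proof eventually_elim
        fix m assume "?q m \<in> - K"
        then have "k (?q m) = 0" using offK[of "?q m"] by (cases "?q m \<in> H") (auto simp: k_def)
        moreover have "k z = 0" using False Hb(1)[of z] by (auto simp: k_def indicator_def)
        ultimately show "k (?q m) = k z" by simp
      qed
      then show ?thesis by (rule tendsto_eventually)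
    qed
  qed
  have limJ: "J \<longlonglongrightarrow> (\<integral>\<^sup>+z. ennreal (k z) \<partial>coord_lebesgue (UNIV - {i}))"
  proof -
    let ?in = "\<lambda>m z. \<integral>\<^sup>+s. ennreal (k (z + (ep m * (1 + s)) *\<^sub>R axis i 1)) * ennreal (dramp s) \<partial>lborel"
    obtain R1 where R1: "\<And>z. z \<in> ball a r \<Longrightarrow> norm z \<le> R1" using bounded_ball[of a r] unfolding bounded_iff by blast
    have inner: "(\<lambda>m. ?in m z) \<longlonglongrightarrow> ennreal (k z)" if z: "z $ i = 0" for z
    proof -
      have "(\<lambda>m. ?in m z) \<longlonglongrightarrow> (\<integral>\<^sup>+s. ennreal (k z) * ennreal (dramp s) \<partial>lborel)"
      proof (rule nn_integral_dominated_convergence[where w = "\<lambda>s. ennreal Bk * ennreal (dramp s)"])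
        show "(\<integral>\<^sup>+s. ennreal Bk * ennreal (dramp s) \<partial>lborel) < \<infinity>"
          by (simp add: nn_integral_cmult nn_integral_dramp)
        show "AE s in lborel. (\<lambda>m. ennreal (k (z + (ep m * (1 + s)) *\<^sub>R axis i 1)) * ennreal (dramp s)) \<longlonglongrightarrow> ennreal (k z) * ennreal (dramp s)"
        proof (rule AE_I2)
          fix s :: real
          show "(\<lambda>m. ennreal (k (z + (ep m * (1 + s)) *\<^sub>R axis i 1)) * ennreal (dramp s)) \<longlonglongrightarrow> ennreal (k z) * ennreal (dramp s)"
          proof (cases "s \<ge> 0")
            case True
            have "(\<lambda>m. ennreal (k (z + (ep m * (1 + s)) *\<^sub>R axis i 1) * dramp s)) \<longlonglongrightarrow> ennreal (k z * dramp s)"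
              by (intro tendsto_ennrealI tendsto_mult klim[OF z True] tendsto_const)
            then show ?thesis using k0 ramp_simps(5) by (simp add: ennreal_mult)
          next
            case False
            then show ?thesis by (simp add: ramp_simps)
          qed
        qed
        show "AE s in lborel. ennreal (k (z + (ep m * (1 + s)) *\<^sub>R axis i 1)) * ennreal (dramp s) \<le> ennreal Bk * ennreal (dramp s)" for m
          by (intro AE_I2 mult_right_mono ennreal_leI kB) simp
      qed measurable
      then show ?thesis by (simp add: nn_integral_cmult nn_integral_dramp)
    qed
    have bound: "?in m z \<le> ennreal Bk * indicator (cball 0 (R1 + 2)) z" for m z
    proof (cases "z \<in> cball 0 (R1 + 2)")
      case True
      have "?in m z \<le> (\<integral>\<^sup>+s. ennreal Bk * ennreal (dramp s) \<partial>lborel)"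
        by (intro nn_integral_mono mult_right_mono ennreal_leI kB) simp
      then show ?thesis using True by (simp add: nn_integral_cmult nn_integral_dramp)
    next
      case False
      have z0: "ennreal (k (z + (ep m * (1 + s)) *\<^sub>R axis i 1)) * ennreal (dramp s) = 0" for s
      proof (cases "0 \<le> s \<and> s \<le> 1")
        case True
        let ?q = "z + (ep m * (1 + s)) *\<^sub>R axis i (1::real)"
        have "norm ((ep m * (1 + s)) *\<^sub>R axis i (1::real)) \<le> 2"
        proof -
          have "ep m * (1 + s) \<le> 1 * 2" using True ep[of m] by (intro mult_mono) auto
          then show ?thesis using True ep(1)[of m] by (simp add: abs_of_nonneg)
        qed
        moreover have "norm z \<le> norm ?q + norm ((ep m * (1 + s)) *\<^sub>R axis i (1::real))"
          by (metis add_diff_cancel norm_triangle_ineq4)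
        ultimately have "norm ?q > R1" using False by simp
        then have "?q \<notin> H" using R1 Hb(1) by (meson not_less)
        then show ?thesis by (simp add: k_def)
      next
        case False
        then have "dramp s = 0" using ramp_simps(3,4)[of s] by linarith
        then show ?thesis by simp
      qed
      have "?in m z = 0" by (simp only: z0 nn_integral_const mult_zero_left)
      then show ?thesis by simp
    qed
    have bm: "(\<lambda>z. ennreal Bk * indicator (cball 0 (R1 + 2)) (z :: real ^ 'n)) \<in> borel_measurable borel"
      by (intro borel_measurable_times_ennreal borel_measurable_const borel_measurable_indicator) simp
    show ?thesis unfolding J_def
    proof (rule nn_integral_dominated_convergence[where w = "\<lambda>z. ennreal Bk * indicator (cball 0 (R1 + 2)) z"])
      show "(\<integral>\<^sup>+z. ennreal Bk * indicator (cball 0 (R1 + 2)) z \<partial>coord_lebesgue (UNIV - {i})) < \<infinity>"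
        using emeasure_coord_lebesgue_bounded[OF bounded_cball, of "0::real ^ 'n" "R1 + 2" i]
        by (simp add: nn_integral_cmult_indicator ennreal_mult_less_top)
      show "AE z in coord_lebesgue (UNIV - {i}). (\<lambda>m. ?in m z) \<longlonglongrightarrow> ennreal (k z)"
        using AE_coord_lebesgue[of i] by eventually_elim (rule inner)
      show "?in m \<in> borel_measurable (coord_lebesgue (UNIV - {i}))" for m
      proof -
        have "?in m \<in> borel_measurable borel"
          by (rule lborel.borel_measurable_nn_integral) measurable
        then show ?thesis by simp
      qed
      show "(\<lambda>z. ennreal Bk * indicator (cball 0 (R1 + 2)) z) \<in> borel_measurable (coord_lebesgue (UNIV - {i}))"
        using bm by simp
    qed (use bound in auto)
  qed
  have kint: "(\<integral>\<^sup>+z. ennreal (k z) \<partial>coord_lebesgue (UNIV - {i})) = (\<integral>\<^sup>+x. ennreal (u x) \<partial>\<sigma>)"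
  proof -
    have um: "(\<lambda>x. ennreal (u x)) \<in> borel_measurable \<sigma>" using continuous_measurable_sigma[OF cu] by measurable
    have "(\<integral>\<^sup>+x. ennreal (u x) \<partial>\<sigma>) = (\<integral>\<^sup>+y. ennreal (volume_density (UNIV - {i}) \<phi> y) * ennreal (u (\<phi> y)) * indicator (bdry_dom i (ball a r)) y \<partial>coord_lebesgue (UNIV - {i}))"
    proof (rule nn_integral_sigma_chart[OF lp um])
      fix x assume x: "x \<in> hbdry S" "x \<notin> \<phi> ` half_dom i (ball a r)"
      then have "x \<in> S" "x \<notin> cball p \<rho>" using hbdry_subset sub\<rho> by auto
      then show "ennreal (u x) = 0" using supp by simp
    qed
    also have "\<dots> = (\<integral>\<^sup>+z. ennreal (k z) \<partial>coord_lebesgue (UNIV - {i}))"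
    proof (rule nn_integral_cong_AE)
      show "AE z in coord_lebesgue (UNIV - {i}). ennreal (volume_density (UNIV - {i}) \<phi> z) * ennreal (u (\<phi> z)) * indicator (bdry_dom i (ball a r)) z = ennreal (k z)"
        using AE_coord_lebesgue[of i]
      proof eventually_elim
        fix z :: "real ^ 'n" assume z: "z $ i = 0"
        show "ennreal (volume_density (UNIV - {i}) \<phi> z) * ennreal (u (\<phi> z)) * indicator (bdry_dom i (ball a r)) z = ennreal (k z)"
        proof (cases "z \<in> H")
          case True
          then have "z \<in> bdry_dom i (ball a r)" using z by (simp add: H_def half_dom_iff bdry_dom_iff)
          then show ?thesis
            using True vd0[OF True] u0[OF HS[OF True]] by (simp add: k_def vd_def ennreal_mult mult.commute)
        next
          case False
          then have "z \<notin> bdry_dom i (ball a r)" using z by (auto simp: H_def half_dom_iff bdry_dom_iff)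
          then show ?thesis using False by (simp add: k_def)
        qed
      qed
    qed
    finally show ?thesis by simp
  qed
  have "(\<lambda>m. ennreal (\<tau> * norm e) * J m) \<longlonglongrightarrow> ennreal (\<tau> * norm e) * (\<integral>\<^sup>+x. ennreal (u x) \<partial>\<sigma>)"
    unfolding kint[symmetric] by (intro ennreal_tendsto_cmult limJ) simp
  moreover have "(\<lambda>m. ennreal (\<integral>y. X m y \<partial>lborel)) \<longlonglongrightarrow> ennreal (\<integral>y. P y \<partial>lborel)"
    by (intro tendsto_ennrealI limX)
  moreover have "ennreal (\<integral>y. X m y \<partial>lborel) \<le> ennreal (\<tau> * norm e) * J m" for m
    using XY[of m] YJ[of m] by (rule order_trans)
  ultimately have "ennreal (\<integral>y. P y \<partial>lborel) \<le> ennreal (\<tau> * norm e) * (\<integral>\<^sup>+x. ennreal (u x) \<partial>\<sigma>)"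
    by (intro LIMSEQ_le) auto
  then show ?thesis by (simp add: P_def)
qed

end

lemma ennreal_add_le: "ennreal (a + b) \<le> ennreal a + ennreal b"
proof -
  have "ennreal (a + b) \<le> ennreal (max 0 a + max 0 b)" by (rule ennreal_leI) simp
  also have "\<dots> = ennreal a + ennreal b" by (cases "a \<ge> 0"; cases "b \<ge> 0") (auto simp: max_def ennreal_neg)
  finally show ?thesis .
qed

lemma ennreal_sum_le:
  assumes "finite K"
  shows "ennreal (\<Sum>k\<in>K. a k) \<le> (\<Sum>k\<in>K. ennreal (a k))"
  using assms
proof (induction K)
  case (insert x F)
  have "ennreal (a x + (\<Sum>k\<in>F. a k)) \<le> ennreal (a x) + ennreal (\<Sum>k\<in>F. a k)" by (rule ennreal_add_le)
  also have "\<dots> \<le> ennreal (a x) + (\<Sum>k\<in>F. ennreal (a k))" using insert by (simp add: add_left_mono)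
  finally show ?case using insert by simp
qed simp

lemma sum_powr_le:
  fixes a :: "'k \<Rightarrow> real"
  assumes A: "finite A" and a: "\<And>x. x \<in> A \<Longrightarrow> a x \<ge> 0" and p: "p \<ge> 1"
  shows "(\<Sum>x\<in>A. a x powr p) \<le> (\<Sum>x\<in>A. a x) powr p"
proof -
  let ?s = "\<Sum>x\<in>A. a x"
  have s0: "?s \<ge> 0" by (rule sum_nonneg) (rule a)
  have split: "b powr p = b * b powr (p - 1)" if "b \<ge> 0" for b :: real
    using powr_mult_base[OF that, of "p - 1"] by simp
  have "(\<Sum>x\<in>A. a x powr p) \<le> (\<Sum>x\<in>A. a x * ?s powr (p - 1))"
  proof (rule sum_mono)
    fix x assume x: "x \<in> A"
    have "a x \<le> ?s" by (rule member_le_sum[OF x _ A]) (use a in auto)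
    then have "a x powr (p - 1) \<le> ?s powr (p - 1)" using a[OF x] p by (intro powr_mono2) auto
    then show "a x powr p \<le> a x * ?s powr (p - 1)" unfolding split[OF a[OF x]] by (rule mult_left_mono[OF _ a[OF x]])
  qed
  also have "\<dots> = ?s powr p" unfolding split[OF s0] by (simp only: sum_distrib_right)
  finally show ?thesis .
qed

context spacelike_hypersurface
begin

text \<open>
  The local statement is summed over a partition of unity. The differentials of the summands add up
  to \<open>du\<close>, because those of the partition add up to zero.
\<close>
theorem divergence:
  assumes u: "has_diff u du" and u0: "\<And>x. x \<in> S \<Longrightarrow> u x \<ge> 0"
  shows "ennreal (\<integral>y. push (\<lambda>x. du x \<bullet> e) y \<partial>lborel) \<le> ennreal (\<tau> * norm e) * (\<integral>\<^sup>+x. ennreal (u x) \<partial>\<sigma>)"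
proof -
  obtain K \<rho> \<zeta> d\<zeta> where K: "finite K" "\<And>k. k \<in> K \<Longrightarrow> chart_ball k (\<rho> k)" "\<And>k. k \<in> K \<Longrightarrow> has_diff (\<zeta> k) (d\<zeta> k)"
    "\<And>k x. k \<in> K \<Longrightarrow> x \<in> S \<Longrightarrow> \<zeta> k x \<ge> 0"
    "\<And>k x. k \<in> K \<Longrightarrow> x \<in> S \<Longrightarrow> x \<notin> cball k (\<rho> k) \<Longrightarrow> \<zeta> k x = 0 \<and> d\<zeta> k x = 0"
    "\<And>x. x \<in> S \<Longrightarrow> (\<Sum>k\<in>K. \<zeta> k x) = 1" "\<And>x. x \<in> S \<Longrightarrow> (\<Sum>k\<in>K. d\<zeta> k x) = 0"
    by (rule partition_of_unity) blast
  define w where "w = (\<lambda>k x. \<zeta> k x * u x)"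
  define dw where "dw = (\<lambda>k x. \<zeta> k x *\<^sub>R du x + u x *\<^sub>R d\<zeta> k x)"
  have w: "has_diff (w k) (dw k)" if "k \<in> K" for k
    unfolding w_def dw_def by (rule has_diff_mult[OF K(3)[OF that] u])
  have w0: "w k x \<ge> 0" if "k \<in> K" "x \<in> S" for k x
    using K(4)[OF that] u0[OF that(2)] by (simp add: w_def)
  have each: "ennreal (\<integral>y. push (\<lambda>x. dw k x \<bullet> e) y \<partial>lborel) \<le> ennreal (\<tau> * norm e) * (\<integral>\<^sup>+x. ennreal (w k x) \<partial>\<sigma>)" if k: "k \<in> K" for k
  proof -
    obtain i U \<phi> a r g where fc: "flat_chart i U \<phi> a r g" and sub: "S \<inter> cball k (\<rho> k) \<subseteq> \<phi> ` half_dom i (ball a r)"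
      using K(2)[OF k] unfolding chart_ball_def by blast
    show ?thesis
    proof (rule divergence_chart[OF fc sub w[OF k] w0[OF k]])
      show "w k x = 0 \<and> dw k x = 0" if "x \<in> S" "x \<notin> cball k (\<rho> k)" for x
        using K(5)[OF k that] by (simp add: w_def dw_def)
    qed
  qed
  have cd: "continuous_on S (\<lambda>x. dw k x \<bullet> e)" if "k \<in> K" for k
    by (intro continuous_intros has_diff_continuous(2)[OF w[OF that]])
  have sumd: "(\<Sum>k\<in>K. dw k x \<bullet> e) = du x \<bullet> e" if x: "x \<in> S" for x
  proof -
    have "(\<Sum>k\<in>K. dw k x) = (\<Sum>k\<in>K. \<zeta> k x) *\<^sub>R du x + u x *\<^sub>R (\<Sum>k\<in>K. d\<zeta> k x)"
      by (simp add: dw_def sum.distrib scaleR_sum_left scaleR_sum_right)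
    then show ?thesis using K(6,7)[OF x] by (simp add: inner_sum_left[symmetric])
  qed
  have "push (\<lambda>x. du x \<bullet> e) y = (\<Sum>k\<in>K. push (\<lambda>x. dw k x \<bullet> e) y)" for y
    unfolding push_sum[symmetric] by (rule push_cong) (simp add: sumd)
  then have "(\<integral>y. push (\<lambda>x. du x \<bullet> e) y \<partial>lborel) = (\<integral>y. (\<Sum>k\<in>K. push (\<lambda>x. dw k x \<bullet> e) y) \<partial>lborel)"
    by simp
  also have "\<dots> = (\<Sum>k\<in>K. \<integral>y. push (\<lambda>x. dw k x \<bullet> e) y \<partial>lborel)"
    by (rule Bochner_Integration.integral_sum) (rule push_continuous(2)[OF cd])
  finally have "ennreal (\<integral>y. push (\<lambda>x. du x \<bullet> e) y \<partial>lborel) = ennreal (\<Sum>k\<in>K. \<integral>y. push (\<lambda>x. dw k x \<bullet> e) y \<partial>lborel)"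
    by simp
  also have "\<dots> \<le> (\<Sum>k\<in>K. ennreal (\<integral>y. push (\<lambda>x. dw k x \<bullet> e) y \<partial>lborel))"
    by (rule ennreal_sum_le[OF K(1)])
  also have "\<dots> \<le> (\<Sum>k\<in>K. ennreal (\<tau> * norm e) * (\<integral>\<^sup>+x. ennreal (w k x) \<partial>\<sigma>))"
    by (rule sum_mono) (rule each)
  also have "\<dots> = ennreal (\<tau> * norm e) * (\<Sum>k\<in>K. \<integral>\<^sup>+x. ennreal (w k x) \<partial>\<sigma>)"
    by (simp only: sum_distrib_left)
  also have "(\<Sum>k\<in>K. \<integral>\<^sup>+x. ennreal (w k x) \<partial>\<sigma>) = (\<integral>\<^sup>+x. (\<Sum>k\<in>K. ennreal (w k x)) \<partial>\<sigma>)"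
    by (rule nn_integral_sum[symmetric]) (use continuous_measurable_sigma[OF has_diff_continuous(1)[OF w]] in measurable)
  also have "\<dots> = (\<integral>\<^sup>+x. ennreal (u x) \<partial>\<sigma>)"
  proof (rule nn_integral_cong)
    fix x assume "x \<in> space \<sigma>"
    then have x: "x \<in> S" using hbdry_subset by (auto simp: sigma)
    have "(\<Sum>k\<in>K. ennreal (w k x)) = ennreal (\<Sum>k\<in>K. w k x)" using w0 x by simp
    also have "(\<Sum>k\<in>K. w k x) = u x" by (simp add: w_def sum_distrib_right[symmetric] K(6)[OF x])
    finally show "(\<Sum>k\<in>K. ennreal (w k x)) = ennreal (u x)" .
  qed
  finally show ?thesis .
qed


section \<open>Smooth functions, gradients and continuity of fibre sums\<close>

text \<open>
  A derivative within \<open>S\<close> is not unique, but its composition with the derivative of a chart is.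
\<close>
lemma derivative_tangent_unique:
  fixes f :: "'n minkowski \<Rightarrow> real"
  assumes p: "p \<in> S" and f: "(f has_derivative f') (at p within S)" "(f has_derivative f'') (at p within S)"
    and v: "v \<in> tangent_space S p"
  shows "f' v = f'' v"
proof -
  obtain i U \<phi> a where lp: "local_param S i U \<phi>" and a: "a \<in> half_dom i U" "p = \<phi> a"
    using hyp p unfolding smooth_hypersurface_def by (metis imageE)
  have \<phi>: "(\<phi> has_derivative dd \<phi> a) (at a within half_dom i U)"
    by (rule has_derivative_at_withinI[OF local_paramD(3)[OF lp]]) (use a in \<open>simp add: half_dom_iff\<close>)
  have *: "(f \<circ> \<phi> has_derivative h \<circ> dd \<phi> a) (at a within half_dom i U)" if h: "(f has_derivative h) (at p within S)" for h
    by (rule diff_chain_within[OF \<phi> has_derivative_subset[OF h[unfolded a(2)] local_paramD(7)[OF lp]]])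
  have "f' \<circ> dd \<phi> a = f'' \<circ> dd \<phi> a"
    by (rule derivative_unique_half_dom[OF local_paramD(1)[OF lp] a(1) *[OF f(1)] *[OF f(2)]])
  moreover obtain x where "v = dd \<phi> a x" using v tangent_space_chart[OF lp a(1)] a(2) by auto
  ultimately show ?thesis by (metis comp_apply)
qed

lemma smooth_has_diff:
  assumes f: "smooth_function_on S f"
  obtains df where "has_diff f df"
proof -
  have der: "(f has_derivative dd F q) (at q within S)"
    if F: "smooth_on_open U F" "\<forall>q\<in>S \<inter> U. F q = f q" and q: "q \<in> S" "q \<in> U" for U F q
  proof -
    obtain d where d: "d > 0" "ball q d \<subseteq> U" using smooth_on_openD(1)[OF F(1)] q(2) by (meson open_contains_ball)
    show ?thesis
    proof (rule has_derivative_transform_within[OF has_derivative_at_withinI[OF smooth_on_openD(3)[OF F(1) q(2)]] d(1) q(1)])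
      fix x assume "x \<in> S" "dist x q < d"
      then show "F x = f x" using F(2) d(2) by (auto simp: subset_eq dist_commute)
    qed
  qed
  have loc: "\<exists>U F. p \<in> U \<and> smooth_on_open U F \<and> (\<forall>q\<in>S \<inter> U. F q = f q)" if "p \<in> S" for p
    using f that unfolding smooth_function_on_def by blast
  define f' where "f' = (\<lambda>p. SOME f'. (f has_derivative f') (at p within S))"
  have f': "(f has_derivative f' p) (at p within S)" if p: "p \<in> S" for p
  proof -
    obtain U F where "p \<in> U" "smooth_on_open U F" "\<forall>q\<in>S \<inter> U. F q = f q" using loc[OF p] by blast
    from der[OF this(2,3) p this(1)] show ?thesis unfolding f'_def by (rule someI[where P = "\<lambda>f'. (f has_derivative f') (at p within S)"])
  qed
  have "continuous_on S (\<lambda>p. f' p (lift p e))" for e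
  proof (rule continuous_on_S_local)
    fix p assume p: "p \<in> S"
    obtain U F where U: "p \<in> U" and F: "smooth_on_open U F" "\<forall>q\<in>S \<inter> U. F q = f q" using loc[OF p] by blast
    have "continuous_on (S \<inter> U) (\<lambda>q. \<Sum>b\<in>Basis. (lift q e \<bullet> b) * dd F q b)"
      by (intro continuous_intros continuous_on_subset[OF continuous_lift] continuous_on_subset[OF smooth_on_openD(4)[OF F(1)]]) auto
    moreover have "(\<Sum>b\<in>Basis. (lift q e \<bullet> b) * dd F q b) = f' q (lift q e)" if q: "q \<in> S \<inter> U" for q
    proof -
      have d: "(f has_derivative dd F q) (at q within S)" by (rule der[OF F]) (use q in auto)
      have L: "linear (dd F q)" by (rule has_derivative_linear[OF d])
      have "f' q (lift q e) = dd F q (lift q e)"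
        by (rule derivative_tangent_unique[OF _ f' d lift_in(1)]) (use q in auto)
      also have "\<dots> = dd F q (\<Sum>b\<in>Basis. (lift q e \<bullet> b) *\<^sub>R b)" by (simp only: euclidean_representation)
      also have "\<dots> = (\<Sum>b\<in>Basis. (lift q e \<bullet> b) * dd F q b)" by (simp only: linear_sum[OF L] linear_cmul[OF L] real_scaleR_def)
      finally show ?thesis by (rule sym)
    qed
    ultimately have "continuous_on (S \<inter> U) (\<lambda>q. f' q (lift q e))" by (rule continuous_on_eq)
    then show "\<exists>N. open N \<and> p \<in> N \<and> continuous_on (S \<inter> N) (\<lambda>q. f' q (lift q e))"
      using U smooth_on_openD(1)[OF F(1)] by blast
  qed
  from that[OF has_diff_I[OF f' this]] show ?thesis .
qed

text \<open>
  In projected coordinates the metric on the tangent space is \<open>e \<bullet> e' - (l \<bullet> e) * (l \<bullet> e')\<close> with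
  \<open>l = slope p\<close>; solving for the vector that represents the differential \<open>df p\<close> gives the vector
  \<open>x\<close> of the proof.
\<close>
lemma tnorm_gradient:
  assumes f: "has_diff f df" and p: "p \<in> S"
  shows "tnorm (gradient S f p) = sqrt (df p \<bullet> df p + ((slope p \<bullet> df p) / (1 - slope p \<bullet> slope p))\<^sup>2 * (1 - slope p \<bullet> slope p))"
proof -
  obtain f' where f': "(f has_derivative f') (at p within S)" "\<And>e. f' (lift p e) = df p \<bullet> e" by (rule has_diffE[OF f p]) blast
  define l where "l = slope p"
  define c where "c = (l \<bullet> df p) / (1 - l \<bullet> l)"
  have "l \<bullet> l < 1" using slope(1)[OF p] by (simp add: l_def norm_eq_sqrt_inner)
  then have c: "l \<bullet> df p = c * (1 - l \<bullet> l)" by (simp add: c_def)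
  define x where "x = df p + c *\<^sub>R l"
  have lx: "l \<bullet> x = c" using c by (simp add: x_def inner_add_right algebra_simps)
  have mk: "mink (lift p x) v = x \<bullet> snd v - c * (l \<bullet> snd v)" if "v \<in> tangent_space S p" for v
    using slope(2)[OF p that] slope(2)[OF p lift_in(1)[OF p, of x]] lift_in(2)[OF p, of x] lx by (simp add: mink_def l_def)
  have mf: "mink (lift p x) v = f' v" if v: "v \<in> tangent_space S p" for v
    using f'(2)[of "snd v"] lift_eq[OF p v] mk[OF v] by (simp add: x_def inner_add_left)
  obtain D where D: "spacelike_map D" "tangent_space S p = range D" using tangent_space_map[OF p] .
  interpret spacelike_map D by fact
  have "gradient S f p = lift p x"
    unfolding gradient_def
  proof (rule the_equality)
    show "lift p x \<in> tangent_space S p \<and> (\<exists>f'. (f has_derivative f') (at p within S) \<and> (\<forall>v\<in>tangent_space S p. mink (lift p x) v = f' v))"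
      using lift_in(1)[OF p] f'(1) mf by blast
    fix w assume w: "w \<in> tangent_space S p \<and> (\<exists>f'. (f has_derivative f') (at p within S) \<and> (\<forall>v\<in>tangent_space S p. mink w v = f' v))"
    then obtain f'' where f'': "(f has_derivative f'') (at p within S)" "\<And>v. v \<in> tangent_space S p \<Longrightarrow> mink w v = f'' v" by blast
    obtain a b where a: "w = D a" and b: "lift p x = D b" using w lift_in(1)[OF p, of x] D(2) by blast
    have eq: "mink w v = mink (lift p x) v" if "v \<in> tangent_space S p" for v
      using f''(2)[OF that] mf[OF that] derivative_tangent_unique[OF p f'(1) f''(1) that] by simp
    have "D (a - b) \<in> tangent_space S p" using D(2) by simp
    from eq[OF this] have "mink (D (a - b)) (D (a - b)) = 0"
      unfolding a b by (simp add: mink_def linear_diff[OF lin] algebra_simps)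
    then have "a - b = 0" using pos by fastforce
    then show "w = lift p x" using a b by simp
  qed
  moreover have "mink (lift p x) (lift p x) = df p \<bullet> df p + c\<^sup>2 * (1 - l \<bullet> l)"
  proof -
    have "mink (lift p x) (lift p x) = x \<bullet> x - c * c"
      using mk[OF lift_in(1)[OF p]] lift_in(2)[OF p] lx by simp
    also have "x \<bullet> x = x \<bullet> df p + c * c"
      using inner_add_right[of x "df p" "c *\<^sub>R l"] lx unfolding x_def[symmetric] by (simp add: inner_commute)
    also have "x \<bullet> df p = df p \<bullet> df p + c * (l \<bullet> df p)" by (simp add: x_def inner_add_left)
    finally show ?thesis unfolding c by (simp add: power2_eq_square)
  qed
  ultimately show ?thesis by (simp add: tnorm_def c_def l_def)
qed

text \<open>
  The induced metric is at most the Euclidean metric of the projection, so it assigns the larger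
  norm to covectors.
\<close>
lemma norm_le_tnorm_gradient:
  assumes f: "has_diff f df" and p: "p \<in> S"
  shows "norm (df p) \<le> tnorm (gradient S f p)"
proof -
  have "slope p \<bullet> slope p < 1" using slope(1)[OF p] by (simp add: norm_eq_sqrt_inner)
  then show ?thesis unfolding tnorm_gradient[OF f p] norm_eq_sqrt_inner[of "df p"]
    by (intro real_sqrt_le_mono) simp
qed

lemma continuous_tnorm_gradient:
  assumes f: "has_diff f df"
  shows "continuous_on S (\<lambda>p. tnorm (gradient S f p))"
proof -
  have ne: "1 - slope p \<bullet> slope p \<noteq> 0" if "p \<in> S" for p
    using slope(1)[OF that] by (simp add: norm_eq_sqrt_inner)
  have "continuous_on S (\<lambda>p. sqrt (df p \<bullet> df p + ((slope p \<bullet> df p) / (1 - slope p \<bullet> slope p))\<^sup>2 * (1 - slope p \<bullet> slope p)))"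
    by (intro continuous_intros continuous_slope has_diff_continuous(2)[OF f] ballI ne)
  then show ?thesis by (rule continuous_on_eq) (simp add: tnorm_gradient[OF f])
qed

lemma push_mono: "(\<And>x. x \<in> S \<Longrightarrow> h x \<le> h' x) \<Longrightarrow> push h y \<le> (push h' y :: real)"
  unfolding push_def by (rule sum_mono) auto

lemma push_nonneg: "(\<And>x. x \<in> S \<Longrightarrow> 0 \<le> h x) \<Longrightarrow> 0 \<le> (push h y :: real)"
  unfolding push_def by (rule sum_nonneg) auto

lemma push_powr:
  fixes h :: "'n minkowski \<Rightarrow> real"
  assumes "\<And>x. x \<in> S \<Longrightarrow> 0 \<le> h x" "p \<ge> 1"
  shows "push (\<lambda>x. h x powr p) y \<le> push h y powr p"
  unfolding push_def by (rule sum_powr_le) (use finite_fibre assms in auto)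

text \<open>
  The fibre sum of a function supported in one flat chart can be discontinuous only at projected
  boundary points of the chart, which form a null set.
\<close>
lemma push_AE_isCont:
  fixes h :: "'n minkowski \<Rightarrow> real"
  assumes ch: "continuous_on S h"
  shows "AE y in lborel. isCont (push h) y"
proof -
  obtain K \<rho> \<zeta> d\<zeta> where K: "finite K" "\<And>k. k \<in> K \<Longrightarrow> chart_ball k (\<rho> k)" "\<And>k. k \<in> K \<Longrightarrow> has_diff (\<zeta> k) (d\<zeta> k)"
    "\<And>k x. k \<in> K \<Longrightarrow> x \<in> S \<Longrightarrow> \<zeta> k x \<ge> 0"
    "\<And>k x. k \<in> K \<Longrightarrow> x \<in> S \<Longrightarrow> x \<notin> cball k (\<rho> k) \<Longrightarrow> \<zeta> k x = 0 \<and> d\<zeta> k x = 0"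
    "\<And>x. x \<in> S \<Longrightarrow> (\<Sum>k\<in>K. \<zeta> k x) = 1"
    by (rule partition_of_unity) blast
  let ?h = "\<lambda>k x. \<zeta> k x * h x"
  have eq: "push h y = (\<Sum>k\<in>K. push (?h k) y)" for y
    unfolding push_sum[symmetric] by (rule push_cong) (simp add: sum_distrib_right[symmetric] K(6))
  have "AE y in lborel. isCont (push (?h k)) y" if k: "k \<in> K" for k
  proof -
    obtain i U \<phi> a r g where fc: "flat_chart i U \<phi> a r g" and sub: "S \<inter> cball k (\<rho> k) \<subseteq> \<phi> ` half_dom i (ball a r)"
      using K(2)[OF k] unfolding chart_ball_def by blast
    note lp = flat_chartD(9)[OF fc]
    have ck: "continuous_on S (?h k)" by (intro continuous_intros ch has_diff_continuous(1)[OF K(3)[OF k]])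
    have z: "?h k x = 0" if "x \<in> S" "x \<notin> cball k (\<rho> k)" for x using K(5)[OF k that] by simp
    have z': "?h k x = 0" if "x \<in> S" "x \<notin> \<phi> ` half_dom i (ball a r)" for x using z[OF that(1)] that sub by blast
    define Om where "Om = (snd \<circ> \<phi>) ` ball a r \<inter> g -` {z. 0 < z $ i}"
    have oOm: "open Om" unfolding Om_def
      by (intro continuous_open_preimage continuous_g[OF fc] flat_chartD(5)[OF fc] open_Collect_less continuous_intros)
    have gOm: "g y \<in> half_dom i (ball a r)" "y = (snd \<circ> \<phi>) (g y)" if "y \<in> Om" for y
      using that flat_chartD(11)[OF fc] by (auto simp: Om_def half_dom_iff)
    have cOm: "continuous_on Om (\<lambda>y. ?h k (\<phi> (g y)))"
    proof (rule continuous_on_compose2[OF ck])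
      show "continuous_on Om (\<lambda>y. \<phi> (g y))"
        by (rule continuous_on_compose2[OF local_paramD(2)[OF lp] continuous_on_subset[OF continuous_g[OF fc]]])
          (use gOm(1) in \<open>auto simp: Om_def half_dom_iff\<close>)
      show "(\<lambda>y. \<phi> (g y)) ` Om \<subseteq> S" using gOm(1) local_paramD(7)[OF lp] by blast
    qed
    show ?thesis using flat_bdry_null[OF fc]
    proof eventually_elim
      fix y assume y: "y \<notin> (snd \<circ> \<phi>) ` bdry_dom i (ball a r)"
      let ?C = "snd ` (S \<inter> cball k (\<rho> k))"
      show "isCont (push (?h k)) y"
      proof (cases "y \<in> ?C")
        case True
        then obtain x where x: "x \<in> S \<inter> cball k (\<rho> k)" "y = snd x" by blast
        then obtain z where "z \<in> half_dom i (ball a r)" "x = \<phi> z" using sub by blast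
        with x have zz: "z \<in> half_dom i (ball a r)" "y = (snd \<circ> \<phi>) z" by auto
        then have "g y = z" using flat_chartD(11)[OF fc, of z] by (simp add: half_dom_iff)
        moreover have "z $ i \<noteq> 0" using y zz by (auto simp: half_dom_iff bdry_dom_iff)
        ultimately have yO: "y \<in> Om" using zz by (auto simp: Om_def half_dom_iff)
        have "continuous_on Om (push (?h k))"
        proof (rule continuous_on_eq[OF cOm])
          fix y assume "y \<in> Om"
          from gOm[OF this] have "y \<in> (snd \<circ> \<phi>) ` half_dom i (ball a r)" by (rule image_eqI[rotated])
          then show "?h k (\<phi> (g y)) = push (?h k) y" by (simp add: push_chart[OF fc z'])
        qed
        then show ?thesis using yO oOm by (simp add: continuous_on_eq_continuous_at)
      next
        case False
        have "compact ?C" by (intro compact_continuous_image compact_Int_closed comp closed_cball continuous_intros)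
        then have oC: "open (- ?C)" using compact_imp_closed open_Compl by blast
        have "push (?h k) y' = 0" if "y' \<in> - ?C" for y'
          unfolding push_def by (rule sum.neutral) (use that z in blast)
        then have "continuous_on (- ?C) (push (?h k))"
          by (intro continuous_on_eq[OF continuous_on_const[of _ 0]]) simp
        then show ?thesis using False oC by (simp add: continuous_on_eq_continuous_at)
      qed
    qed
  qed
  then have "AE y in lborel. \<forall>k\<in>K. isCont (push (?h k)) y" using K(1) by (simp add: AE_finite_all)
  then show ?thesis
  proof eventually_elim
    fix y assume "\<forall>k\<in>K. isCont (push (?h k)) y"
    then have "isCont (\<lambda>y. \<Sum>k\<in>K. push (?h k) y) y" by (intro continuous_intros) auto
    then show "isCont (push h) y" by (simp add: eq[abs_def])
  qed
qed

end


section \<open>The Sobolev inequality on the hypersurface\<close>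

context spacelike_hypersurface
begin

lemma integrable_mu: "continuous_on S h \<Longrightarrow> integrable \<mu> (h :: 'n minkowski \<Rightarrow> real)"
proof -
  assume c: "continuous_on S h"
  obtain B where B: "\<And>x. x \<in> S \<Longrightarrow> \<bar>h x\<bar> \<le> B" by (rule continuous_S_bounded[OF c]) blast
  show "integrable \<mu> h"
    by (rule finite_measure.integrable_const_bound[OF finite_measures(1) AE_I2[where P = "\<lambda>x. norm (h x) \<le> B"] continuous_measurable_mu[OF c]])
      (simp add: mu B)
qed

lemma integrable_sigma: "continuous_on S h \<Longrightarrow> integrable \<sigma> (h :: 'n minkowski \<Rightarrow> real)"
proof -
  assume c: "continuous_on S h"
  obtain B where B: "\<And>x. x \<in> S \<Longrightarrow> \<bar>h x\<bar> \<le> B" by (rule continuous_S_bounded[OF c]) blast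
  show "integrable \<sigma> h"
    by (rule finite_measure.integrable_const_bound[OF finite_measures(2) AE_I2[where P = "\<lambda>x. norm (h x) \<le> B"] continuous_measurable_sigma[OF c]])
      (use B hbdry_subset in \<open>auto simp: sigma\<close>)
qed

lemma measurable_snd_sigma: "snd \<in> borel_measurable \<sigma>"
  using borel_measurable_continuous_on_restrict[OF continuous_on_snd[OF continuous_on_id[of "hbdry S"]]]
    measurable_cong_sets[OF sigma(2) refl] by blast

text \<open>
  The derivative of the product of \<open>f\<close> with the kernel, restricted to \<open>S\<close>, has two parts. By
  \<open>divergence\<close>, applied in the direction \<open>- v\<close>, the integral of the whole derivative is at most
  \<open>norm v\<close> times the integral of the kernel with respect to the boundary measure with density
  \<open>\<tau> * f\<close>; the part in which \<open>f\<close> is differentiated is bounded by the fibre sum of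
  \<open>norm (df x)\<close>. The kernel depends on the projected point only, so it can be taken out of the
  fibre sums.
\<close>
lemma push_variation:
  assumes f: "has_diff f df" and f0: "\<And>x. x \<in> S \<Longrightarrow> f x \<ge> 0" and ne: "S \<noteq> {}"
  shows "ennreal (\<integral>w. push f w * dbump \<epsilon> (y - w) v \<partial>lborel) \<le> ennreal (norm v) *
    ((\<integral>\<^sup>+w. ennreal (bump \<epsilon> (y - w)) \<partial>density lborel (\<lambda>w. ennreal (push (\<lambda>x. norm (df x)) w)))
      + (\<integral>\<^sup>+w. ennreal (bump \<epsilon> (y - w)) \<partial>distr (density \<sigma> (\<lambda>x. ennreal (\<tau> * f x))) borel snd))"
proof -
  have cf: "continuous_on S f" and cdf: "continuous_on S df" using has_diff_continuous[OF f] by auto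
  have \<tau>: "\<tau> \<ge> 1" using ne one_le_tau by blast
  obtain dk where dk: "has_diff (\<lambda>x. bump \<epsilon> (y - snd x)) dk" "\<And>x e. x \<in> S \<Longrightarrow> dk x \<bullet> e = - dbump \<epsilon> (y - snd x) e"
    by (rule has_diff_bump_snd) blast
  have ck: "continuous_on S (\<lambda>x. bump \<epsilon> (y - snd x))" by (rule has_diff_continuous(1)[OF dk(1)])
  define u where "u = (\<lambda>x. f x * bump \<epsilon> (y - snd x))"
  define du where "du = (\<lambda>x. f x *\<^sub>R dk x + bump \<epsilon> (y - snd x) *\<^sub>R df x)"
  have u: "has_diff u du" unfolding u_def du_def by (rule has_diff_mult[OF f dk(1)])
  have cdu: "continuous_on S (\<lambda>x. du x \<bullet> (- v))" by (intro continuous_intros has_diff_continuous(2)[OF u])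
  have ckd: "continuous_on S (\<lambda>x. bump \<epsilon> (y - snd x) * (df x \<bullet> v))" by (intro continuous_intros ck cdf)
  have ckn: "continuous_on S (\<lambda>x. bump \<epsilon> (y - snd x) * norm (df x))" by (intro continuous_intros ck cdf)
  have kpush: "push (\<lambda>x. bump \<epsilon> (y - snd x) * h x) w = bump \<epsilon> (y - w) * push h w" for h :: "'n minkowski \<Rightarrow> real" and w
    by (rule push_snd_mult[of "\<lambda>w. bump \<epsilon> (y - w)"])
  have split: "push f w * dbump \<epsilon> (y - w) v = push (\<lambda>x. du x \<bullet> (- v)) w + push (\<lambda>x. bump \<epsilon> (y - snd x) * (df x \<bullet> v)) w" for w
  proof -
    have "push (\<lambda>x. du x \<bullet> (- v)) w + push (\<lambda>x. bump \<epsilon> (y - snd x) * (df x \<bullet> v)) w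
      = push (\<lambda>x. du x \<bullet> (- v) + bump \<epsilon> (y - snd x) * (df x \<bullet> v)) w"
      unfolding push_def by (rule sum.distrib[symmetric])
    also have "\<dots> = push (\<lambda>x. dbump \<epsilon> (y - snd x) v * f x) w"
      by (rule push_cong) (simp add: du_def inner_add_left dk(2) dbump_def)
    also have "\<dots> = dbump \<epsilon> (y - w) v * push f w"
      by (rule push_snd_mult[of "\<lambda>w. dbump \<epsilon> (y - w) v"])
    finally show ?thesis by simp
  qed
  have "(\<integral>w. push f w * dbump \<epsilon> (y - w) v \<partial>lborel)
    = (\<integral>w. push (\<lambda>x. du x \<bullet> (- v)) w \<partial>lborel) + (\<integral>w. push (\<lambda>x. bump \<epsilon> (y - snd x) * (df x \<bullet> v)) w \<partial>lborel)"
    unfolding split by (rule Bochner_Integration.integral_add[OF push_continuous(2)[OF cdu] push_continuous(2)[OF ckd]])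
  also have "ennreal \<dots> \<le> ennreal (\<integral>w. push (\<lambda>x. du x \<bullet> (- v)) w \<partial>lborel) + ennreal (\<integral>w. push (\<lambda>x. bump \<epsilon> (y - snd x) * (df x \<bullet> v)) w \<partial>lborel)"
    by (rule ennreal_add_le)
  also have "\<dots> \<le> ennreal (norm v) * (\<integral>\<^sup>+w. ennreal (bump \<epsilon> (y - w)) \<partial>distr (density \<sigma> (\<lambda>x. ennreal (\<tau> * f x))) borel snd)
    + ennreal (norm v) * (\<integral>\<^sup>+w. ennreal (bump \<epsilon> (y - w)) \<partial>density lborel (\<lambda>w. ennreal (push (\<lambda>x. norm (df x)) w)))"
  proof (rule add_mono)
    have fm: "(\<lambda>x. ennreal (\<tau> * f x)) \<in> borel_measurable \<sigma>"
      using continuous_measurable_sigma[OF cf] by measurable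
    have um: "(\<lambda>x. ennreal (u x)) \<in> borel_measurable \<sigma>"
      using continuous_measurable_sigma[OF has_diff_continuous(1)[OF u]] by measurable
    have km: "(\<lambda>x. ennreal (bump \<epsilon> (y - snd x))) \<in> borel_measurable \<sigma>"
      using continuous_measurable_sigma[OF ck] by measurable
    have "(\<integral>\<^sup>+w. ennreal (bump \<epsilon> (y - w)) \<partial>distr (density \<sigma> (\<lambda>x. ennreal (\<tau> * f x))) borel snd)
      = (\<integral>\<^sup>+x. ennreal (bump \<epsilon> (y - snd x)) \<partial>density \<sigma> (\<lambda>x. ennreal (\<tau> * f x)))"
      by (rule nn_integral_distr) (use measurable_snd_sigma in simp, measurable)
    also have "\<dots> = (\<integral>\<^sup>+x. ennreal (\<tau> * f x) * ennreal (bump \<epsilon> (y - snd x)) \<partial>\<sigma>)"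
      by (rule nn_integral_density[OF fm km])
    also have "\<dots> = (\<integral>\<^sup>+x. ennreal \<tau> * ennreal (u x) \<partial>\<sigma>)"
    proof (rule nn_integral_cong)
      fix x assume "x \<in> space \<sigma>"
      then have "x \<in> S" using hbdry_subset by (auto simp: sigma)
      then have "f x \<ge> 0" by (rule f0)
      moreover have "\<tau> \<ge> 0" using \<tau> by simp
      ultimately show "ennreal (\<tau> * f x) * ennreal (bump \<epsilon> (y - snd x)) = ennreal \<tau> * ennreal (u x)"
        using bump_nonneg[of \<epsilon> "y - snd x"] by (simp add: u_def ennreal_mult mult.assoc)
    qed
    also have "\<dots> = ennreal \<tau> * (\<integral>\<^sup>+x. ennreal (u x) \<partial>\<sigma>)" by (rule nn_integral_cmult[OF um])
    finally have eq: "(\<integral>\<^sup>+w. ennreal (bump \<epsilon> (y - w)) \<partial>distr (density \<sigma> (\<lambda>x. ennreal (\<tau> * f x))) borel snd) = ennreal \<tau> * (\<integral>\<^sup>+x. ennreal (u x) \<partial>\<sigma>)" .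
    have "ennreal (\<integral>w. push (\<lambda>x. du x \<bullet> (- v)) w \<partial>lborel) \<le> ennreal (\<tau> * norm (- v)) * (\<integral>\<^sup>+x. ennreal (u x) \<partial>\<sigma>)"
      by (rule divergence[OF u]) (use f0 in \<open>auto simp: u_def bump_nonneg\<close>)
    also have "ennreal (\<tau> * norm (- v)) = ennreal (norm v) * ennreal \<tau>" using \<tau> by (simp add: ennreal_mult mult.commute)
    finally show "ennreal (\<integral>w. push (\<lambda>x. du x \<bullet> (- v)) w \<partial>lborel) \<le> ennreal (norm v) * (\<integral>\<^sup>+w. ennreal (bump \<epsilon> (y - w)) \<partial>distr (density \<sigma> (\<lambda>x. ennreal (\<tau> * f x))) borel snd)"
      unfolding eq by (simp only: mult.assoc)
  next
    let ?G = "push (\<lambda>x. norm (df x))"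
    have Gm: "?G \<in> borel_measurable borel" by (rule push_continuous(1)) (intro continuous_intros cdf)
    have G0: "?G w \<ge> 0" for w by (rule push_nonneg) simp
    have I: "integrable lborel (\<lambda>w. bump \<epsilon> (y - w) * ?G w)"
    proof -
      have "(\<lambda>w. bump \<epsilon> (y - w) * ?G w) = push (\<lambda>x. bump \<epsilon> (y - snd x) * norm (df x))"
        by (rule ext) (simp only: kpush)
      then show ?thesis using push_continuous(2)[OF ckn] by simp
    qed
    have "(\<integral>w. push (\<lambda>x. bump \<epsilon> (y - snd x) * (df x \<bullet> v)) w \<partial>lborel) \<le> (\<integral>w. norm v * (bump \<epsilon> (y - w) * ?G w) \<partial>lborel)"
    proof (rule integral_mono[OF push_continuous(2)[OF ckd] integrable_mult_right[OF I]])
      fix w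
      have "push (\<lambda>x. df x \<bullet> v) w \<le> push (\<lambda>x. norm v * norm (df x)) w"
        by (rule push_mono) (metis norm_cauchy_schwarz mult.commute)
      also have "\<dots> = norm v * ?G w" by (rule push_snd_mult[of "\<lambda>_. norm v"])
      finally have "bump \<epsilon> (y - w) * push (\<lambda>x. df x \<bullet> v) w \<le> bump \<epsilon> (y - w) * (norm v * ?G w)"
        by (rule mult_left_mono[OF _ bump_nonneg])
      then show "push (\<lambda>x. bump \<epsilon> (y - snd x) * (df x \<bullet> v)) w \<le> norm v * (bump \<epsilon> (y - w) * ?G w)"
        by (simp only: kpush mult.left_commute)
    qed
    also have "\<dots> = norm v * (\<integral>w. bump \<epsilon> (y - w) * ?G w \<partial>lborel)" by simp
    finally have "ennreal (\<integral>w. push (\<lambda>x. bump \<epsilon> (y - snd x) * (df x \<bullet> v)) w \<partial>lborel) \<le> ennreal (norm v * (\<integral>w. bump \<epsilon> (y - w) * ?G w \<partial>lborel))"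
      by (rule ennreal_leI)
    also have "\<dots> = ennreal (norm v) * ennreal (\<integral>w. bump \<epsilon> (y - w) * ?G w \<partial>lborel)"
      by (rule ennreal_mult') simp
    also have "ennreal (\<integral>w. bump \<epsilon> (y - w) * ?G w \<partial>lborel) = (\<integral>\<^sup>+w. ennreal (bump \<epsilon> (y - w) * ?G w) \<partial>lborel)"
      by (rule nn_integral_eq_integral[OF I AE_I2[OF mult_nonneg_nonneg[OF bump_nonneg G0]], symmetric])
    also have "\<dots> = (\<integral>\<^sup>+w. ennreal (?G w) * ennreal (bump \<epsilon> (y - w)) \<partial>lborel)"
      by (rule nn_integral_cong) (subst ennreal_mult[OF bump_nonneg G0], rule mult.commute)
    also have "\<dots> = (\<integral>\<^sup>+w. ennreal (bump \<epsilon> (y - w)) \<partial>density lborel (\<lambda>w. ennreal (?G w)))"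
      by (rule nn_integral_density[symmetric]) (use Gm in measurable)
    finally show "ennreal (\<integral>w. push (\<lambda>x. bump \<epsilon> (y - snd x) * (df x \<bullet> v)) w \<partial>lborel)
       \<le> ennreal (norm v) * (\<integral>\<^sup>+w. ennreal (bump \<epsilon> (y - w)) \<partial>density lborel (\<lambda>w. ennreal (?G w)))" .
  qed
  finally show ?thesis by (simp only: distrib_left add.commute)
qed

text \<open>
  Of the two measures in \<open>push_variation\<close>, the first has mass at most \<open>\<tau>\<close> times the integral of the norm of the gradient, and the
  second has mass \<open>\<tau>\<close> times the boundary integral of \<open>f\<close>. On the left, the exponent
  \<open>N / (N - 1)\<close> is at least 1, so the power of a fibre sum dominates the fibre sum of the powers, and
  the projection does not decrease volume.
\<close>
theorem Sobolev_projection: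
  assumes n: "CARD('n) \<ge> 2" and f: "has_diff f df" and f0: "\<And>x. x \<in> S \<Longrightarrow> f x \<ge> 0" and ne: "S \<noteq> {}"
  defines "N \<equiv> real CARD('n)"
  defines "\<omega> \<equiv> measure lborel (ball (0 :: real ^ 'n) 1)"
  shows "N * \<omega> powr (1 / N) * (LINT p|\<mu>. f p powr (N / (N - 1))) powr ((N - 1) / N)
    \<le> \<tau> * ((LINT p|\<mu>. tnorm (gradient S f p)) + (LINT p|\<sigma>. f p))"
proof -
  have N: "N \<ge> 2" using n by (simp add: N_def)
  define q where "q = N / (N - 1)"
  have q: "q \<ge> 1" using N by (simp add: q_def field_simps)
  have \<tau>: "\<tau> \<ge> 1" using ne one_le_tau by blast
  have cf: "continuous_on S f" and cdf: "continuous_on S df" using has_diff_continuous[OF f] by auto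
  have cn: "continuous_on S (\<lambda>x. norm (df x))" by (intro continuous_intros cdf)
  have cq: "continuous_on S (\<lambda>x. f x powr q)"
    by (rule continuous_on_powr'[OF cf continuous_on_const]) (use f0 q in auto)
  have c\<tau>f: "continuous_on S (\<lambda>x. \<tau> * f x)" by (intro continuous_intros cf)
  define M1 where "M1 = density lborel (\<lambda>w. ennreal (push (\<lambda>x. norm (df x)) w))"
  define M2 where "M2 = distr (density \<sigma> (\<lambda>x. ennreal (\<tau> * f x))) borel (snd :: 'n minkowski \<Rightarrow> real ^ 'n)"
  define a where "a = (\<integral>w. push (\<lambda>x. norm (df x)) w \<partial>lborel)"
  define b where "b = (LINT p|\<sigma>. f p)"
  have gm: "(\<lambda>w. ennreal (push (\<lambda>x. norm (df x)) w)) \<in> borel_measurable borel"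
    using push_continuous(1)[OF cn] by measurable
  have e1: "emeasure M1 UNIV = ennreal a"
  proof -
    have "emeasure M1 UNIV = (\<integral>\<^sup>+w. ennreal (push (\<lambda>x. norm (df x)) w) * indicator UNIV w \<partial>lborel)"
      unfolding M1_def by (rule emeasure_density) (use gm in auto)
    also have "\<dots> = (\<integral>\<^sup>+w. ennreal (push (\<lambda>x. norm (df x)) w) \<partial>lborel)" by simp
    also have "\<dots> = ennreal a"
      unfolding a_def by (rule nn_integral_eq_integral[OF push_continuous(2)[OF cn]]) (simp add: push_nonneg)
    finally show ?thesis .
  qed
  have fm: "(\<lambda>x. ennreal (\<tau> * f x)) \<in> borel_measurable \<sigma>"
    using continuous_measurable_sigma[OF cf] by measurable
  have f\<sigma>: "f x \<ge> 0" if "x \<in> space \<sigma>" for x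
    by (rule f0) (use that hbdry_subset in \<open>auto simp: sigma\<close>)
  have b0: "b \<ge> 0" unfolding b_def by (rule Bochner_Integration.integral_nonneg) (rule f\<sigma>)
  have e2: "emeasure M2 UNIV = ennreal (\<tau> * b)"
  proof -
    have "emeasure M2 UNIV = emeasure (density \<sigma> (\<lambda>x. ennreal (\<tau> * f x))) (space \<sigma>)"
      unfolding M2_def by (subst emeasure_distr) (use measurable_snd_sigma in auto)
    also have "\<dots> = (\<integral>\<^sup>+x. ennreal (\<tau> * f x) * indicator (space \<sigma>) x \<partial>\<sigma>)"
      by (rule emeasure_density[OF fm]) simp
    also have "\<dots> = (\<integral>\<^sup>+x. ennreal (\<tau> * f x) \<partial>\<sigma>)" by (rule nn_integral_cong) simp
    also have "\<dots> = ennreal (LINT x|\<sigma>. \<tau> * f x)"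
      by (rule nn_integral_eq_integral[OF integrable_sigma[OF c\<tau>f]]) (use \<tau> f\<sigma> in auto)
    finally show ?thesis by (simp add: b_def)
  qed
  have a0: "a \<ge> 0" unfolding a_def by (rule Bochner_Integration.integral_nonneg) (simp add: push_nonneg)
  define J where "J = a + \<tau> * b"
  have J0: "J \<ge> 0" using a0 b0 \<tau> by (simp add: J_def)
  have J: "emeasure M1 UNIV + emeasure M2 UNIV = ennreal J"
    unfolding e1 e2 J_def using a0 b0 \<tau> by simp
  have s1: "sets M1 = sets borel" and s2: "sets M2 = sets borel" by (auto simp: M1_def M2_def)
  have fin1: "finite_measure M1" using e1 sets_eq_imp_space_eq[OF s1] by (intro finite_measureI) simp
  have fin2: "finite_measure M2" using e2 sets_eq_imp_space_eq[OF s2] by (intro finite_measureI) simp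
  obtain B where B: "\<And>y. \<bar>push f y\<bar> \<le> B" using push_continuous(3)[OF cf] by blast
  obtain R where R: "\<And>x. x \<in> S \<Longrightarrow> norm (snd x) \<le> R" by (rule S_bounded) blast
  have "(\<integral>\<^sup>+x. ennreal (push f x powr (real DIM(real ^ 'n) / (real DIM(real ^ 'n) - 1))) \<partial>lborel)
    \<le> ennreal ((J / (real DIM(real ^ 'n) * measure lebesgue (ball (0 :: real ^ 'n) 1) powr (1 / real DIM(real ^ 'n)))) powr (real DIM(real ^ 'n) / (real DIM(real ^ 'n) - 1)))"
  proof (rule BV_Sobolev[where R = R and M = B, OF _ push_continuous(1)[OF cf] push_nonneg _ _ push_AE_isCont[OF cf] fin1 s1 fin2 s2 J J0])
    show "2 \<le> DIM(real ^ 'n)" using n by simp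
    show "f x \<ge> 0" if "x \<in> S" for x using f0 that .
    show "push f x \<le> B" for x using B[of x] by simp
    show "push f x = 0" if "R < norm x" for x by (rule push_outside) (use that R in force)
  qed (unfold M1_def M2_def, rule push_variation[OF f f0 ne])
  then have BV: "(\<integral>\<^sup>+x. ennreal (push f x powr q) \<partial>lborel) \<le> ennreal ((J / (N * \<omega> powr (1 / N))) powr q)"
    by (simp add: q_def N_def \<omega>_def)
  define I where "I = (LINT p|\<mu>. f p powr q)"
  have I0: "I \<ge> 0" unfolding I_def by (rule Bochner_Integration.integral_nonneg) simp
  have "ennreal I = (\<integral>\<^sup>+p. ennreal (f p powr q) \<partial>\<mu>)"
    unfolding I_def by (rule nn_integral_eq_integral[OF integrable_mu[OF cq], symmetric]) simp
  also have "\<dots> \<le> (\<integral>\<^sup>+y. ennreal (push (\<lambda>p. f p powr q) y) \<partial>lborel)"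
    by (rule push_mu_compare(1)[OF cq]) simp
  also have "\<dots> \<le> (\<integral>\<^sup>+y. ennreal (push f y powr q) \<partial>lborel)"
    by (intro nn_integral_mono ennreal_leI push_powr f0 q)
  also note BV
  finally have "I \<le> (J / (N * \<omega> powr (1 / N))) powr q" by (subst (asm) ennreal_le_iff) auto
  then have "I powr (1 / q) \<le> ((J / (N * \<omega> powr (1 / N))) powr q) powr (1 / q)"
    using I0 q by (intro powr_mono2) auto
  also have "\<dots> = J / (N * \<omega> powr (1 / N))" using q J0 N by (simp add: powr_powr)
  finally have "I powr ((N - 1) / N) \<le> J / (N * \<omega> powr (1 / N))" by (simp add: q_def)
  moreover have "\<omega> > 0" unfolding \<omega>_def using content_ball_pos[of 1 "0 :: real ^ 'n"] by simp
  ultimately have 1: "N * \<omega> powr (1 / N) * I powr ((N - 1) / N) \<le> J"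
    using N by (simp add: pos_le_divide_eq mult.commute)
  have "a \<le> \<tau> * (LINT p|\<mu>. norm (df p))"
  proof -
    have "ennreal a = (\<integral>\<^sup>+w. ennreal (push (\<lambda>x. norm (df x)) w) \<partial>lborel)"
      unfolding a_def by (rule nn_integral_eq_integral[OF push_continuous(2)[OF cn], symmetric]) (simp add: push_nonneg)
    also have "\<dots> \<le> ennreal \<tau> * (\<integral>\<^sup>+p. ennreal (norm (df p)) \<partial>\<mu>)" by (rule push_mu_compare(2)[OF cn]) simp
    also have "(\<integral>\<^sup>+p. ennreal (norm (df p)) \<partial>\<mu>) = ennreal (LINT p|\<mu>. norm (df p))"
      by (rule nn_integral_eq_integral[OF integrable_mu[OF cn]]) simp
    also have "ennreal \<tau> * \<dots> = ennreal (\<tau> * (LINT p|\<mu>. norm (df p)))" using \<tau> by (simp add: ennreal_mult')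
    finally show ?thesis using \<tau> by (subst (asm) ennreal_le_iff) (auto intro!: mult_nonneg_nonneg)
  qed
  also have "\<dots> \<le> \<tau> * (LINT p|\<mu>. tnorm (gradient S f p))"
    using \<tau> by (intro mult_left_mono integral_mono integrable_mu cn continuous_tnorm_gradient[OF f])
      (auto simp: mu norm_le_tnorm_gradient[OF f])
  finally have "J \<le> \<tau> * ((LINT p|\<mu>. tnorm (gradient S f p)) + b)" by (simp add: J_def distrib_left)
  with 1 show ?thesis by (simp add: I_def q_def b_def)
qed

end

text \<open>
  As \<open>\<tau> \<ge> 1\<close>, the factors with exponent \<open>- 1 / n\<close> are at most 1, and \<open>\<tau> + sqrt (\<tau>\<^sup>2 - 1)\<close> is at
  least \<open>\<tau>\<close>.
\<close>
lemma isop_const_le: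
  assumes "\<tau> \<ge> 1"
  shows "isop_const TYPE('n::finite) \<tau> \<le> real CARD('n) * measure lborel (ball (0 :: real ^ 'n) 1) powr (1 / real CARD('n)) / \<tau>"
proof -
  define N where "N = real CARD('n)"
  define c where "c = N * measure lborel (ball (0 :: real ^ 'n) 1) powr (1 / N)"
  have N: "N \<ge> 1" by (simp add: N_def Suc_le_eq)
  have c: "c \<ge> 0" using N by (simp add: c_def)
  have "x powr (- 1 / N) \<le> 1" if "x \<ge> 1" for x :: real
    using powr_mono[of "- 1 / N" 0 x] N that by simp
  from this[of "N + 1"] this[of \<tau>] have "(N + 1) powr (- 1 / N) \<le> 1" "\<tau> powr (- 1 / N) \<le> 1"
    using N assms by auto
  then have "c * ((N + 1) powr (- 1 / N) * \<tau> powr (- 1 / N)) \<le> c * (1 * 1)"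
    by (intro mult_left_mono mult_mono c) auto
  moreover have "inverse (\<tau> + sqrt (\<tau>\<^sup>2 - 1)) \<le> inverse \<tau>"
    using assms by (intro le_imp_inverse_le) auto
  ultimately have "c * ((N + 1) powr (- 1 / N) * \<tau> powr (- 1 / N)) * inverse (\<tau> + sqrt (\<tau>\<^sup>2 - 1)) \<le> c * inverse \<tau>"
    using assms c by (intro mult_mono) auto
  then show ?thesis
    by (simp add: isop_const_def Let_def c_def N_def divide_inverse mult.assoc)
qed

theorem theorem1p1:
  fixes S :: "'n::finite minkowski set"
    and f :: "'n minkowski \<Rightarrow> real"
  assumes "CARD('n) \<ge> 2"
    and "smooth_hypersurface S"
    and "compact S"
    and "spacelike S"
    and "mean_convex S"
    and "smooth_function_on S f"
    and "\<forall>p\<in>S. f p > 0"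
  shows "(LINT p|hypersurface_measure S. tnorm (gradient S f p)) + (LINT p|boundary_measure S. f p)
    \<ge> isop_const TYPE('n) (max_slope S) *
       (LINT p|hypersurface_measure S. f p powr (real CARD('n) / (real CARD('n) - 1)))
         powr ((real CARD('n) - 1) / real CARD('n))"
proof -
  interpret spacelike_hypersurface S using assms(2-4) by unfold_locales
  show ?thesis
  \<comment> \<open>on the empty hypersurface both sides vanish; otherwise the maximal slope is at least 1\<close>
  proof (cases "S = {}")
    case True
    then have empty: "space \<mu> = {}" "space \<sigma> = {}" unfolding mu sigma using hbdry_subset by blast+
    have "(LINT p|\<mu>. h p) = 0" "(LINT p|\<sigma>. h p) = 0" for h :: "'n minkowski \<Rightarrow> real"
      using Bochner_Integration.integral_cong[of \<mu> \<mu> h "\<lambda>_. 0"] Bochner_Integration.integral_cong[of \<sigma> \<sigma> h "\<lambda>_. 0"] empty by auto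
    then show ?thesis by simp
  next
    case False
    then have \<tau>: "\<tau> \<ge> 1" using one_le_tau by blast
    obtain df where df: "has_diff f df" by (rule smooth_has_diff[OF assms(6)])
    let ?I = "(LINT p|\<mu>. f p powr (real CARD('n) / (real CARD('n) - 1))) powr ((real CARD('n) - 1) / real CARD('n))"
    let ?c = "real CARD('n) * measure lborel (ball (0 :: real ^ 'n) 1) powr (1 / real CARD('n))"
    have "isop_const TYPE('n) \<tau> * ?I \<le> ?c / \<tau> * ?I"
      by (rule mult_right_mono[OF isop_const_le[OF \<tau>]]) simp
    also have "\<dots> \<le> (LINT p|\<mu>. tnorm (gradient S f p)) + (LINT p|\<sigma>. f p)"
      using Sobolev_projection[OF assms(1) df _ False] assms(7) \<tau>
      by (simp add: pos_divide_le_eq mult.commute less_imp_le)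
    finally show ?thesis by (simp add: \<tau>_def)
  qed
qed

end
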